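(* Let $M,N$ be positive integers with $N\ge M$, $\lambda_S,\lambda_R,\mu>0$, and let $f_0$ be a probability density on $\mathbb{R}^{3M}$. Let $F_0(\mathbf v,\mathbf w)=f_0(\mathbf v)e^{-\pi|\mathbf w|^2}$ for $(\mathbf v,\mathbf w)\in\mathbb{R}^{3M}\times\mathbb{R}^{3N}$ and $$f(\mathbf v,t)=\int_{\mathbb{R}^{3N}}\big(e^{\mathcal Lt}F_0\big)(\mathbf v,\mathbf w)\,\mathrm{d}\mathbf w,$$ with $\mathcal L$ as in the context. Then for all $t\ge0$, $$S(f(\cdot,t))\le\left[\frac{M}{N+M}+\frac{N}{N+M}e^{-\frac{\mu}{3}\frac{N+M}{N}t}\right]S(f_0).$$
   Context: Write $\mathbf z=(z_1,\dots,z_{M+N})\in(\mathbb{R}^3)^{M+N}$ with $\mathbf v=(z_1,\dots,z_M)$, $\mathbf w=(z_{M+1},\dots,z_{M+N})$. For $1\le i<j\le M+N$ and $\omega\in\mathbb{S}^2$, $r_{ij}(\omega)$ is the linear map of $(\mathbb{R}^3)^{M+N}$ acting on $(z_i,z_j)$ by $\begin{pmatrix}I_3-\omega\omega^T&\omega\omega^T\\\omega\omega^T&I_3-\omega\omega^T\end{pmatrix}$ and as the identity on the other $z_l$ (a symmetric orthogonal involution). $(R_{ij}F)(\mathbf z)=\int_{\mathbb{S}^2}F(r_{ij}(\omega)^{-1}\mathbf z)\,\mathrm{d}\omega$ with $\mathrm{d}\omega$ the uniform probability measure on $\mathbb{S}^2$. The generator is $$\mathcal L=\frac{\lambda_S}{M-1}\sum_{1\le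 i<j\le M}(R_{ij}-I)+\frac{\lambda_R}{N-1}\sum_{M<i<j\le M+N}(R_{ij}-I)+\frac{\mu}{N}\sum_{i=1}^M\sum_{j=M+1}^{M+N}(R_{ij}-I),$$ a bounded operator on $L^1(\mathbb{R}^{3(M+N)})$ (a term with an empty sum is absent). $S(g)=\int_{\mathbb{R}^{3M}}g(\mathbf v)\log\big(g(\mathbf v)/e^{-\pi|\mathbf v|^2}\big)\mathrm{d}\mathbf v$. *)

theory Defs
  imports "HOL-Probability.Probability"
begin

text \<open>Configurations z = (z_0,...,z_{K-1}) in (R^3)^K are functions nat => real^3,
  extensional on {..<K}; Lebesgue measure on (R^3)^K is the product measure.\<close>

definition config_space :: "nat set \<Rightarrow> (nat \<Rightarrow> real^3) measure" where
  "config_space I = PiM I (\<lambda>_. (lborel :: (real^3) measure))"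

text \<open>Uniform probability measure on the unit sphere S^2: image of the uniform
  probability on the unit ball under radial projection.\<close>

definition sphere_measure :: "(real^3) measure" where
  "sphere_measure = distr (uniform_measure lborel (ball (0::real^3) 1)) borel sgn"

text \<open>The collision map r_ij(omega) (a symmetric orthogonal involution, so its inverse is itself).\<close>

definition rmap :: "nat \<Rightarrow> nat \<Rightarrow> real^3 \<Rightarrow> (nat \<Rightarrow> real^3) \<Rightarrow> (nat \<Rightarrow> real^3)" where
  "rmap i j \<omega> z = (\<lambda>l.
     if l = i then z i - (\<omega> \<bullet> z i) *\<^sub>R \<omega> + (\<omega> \<bullet> z j) *\<^sub>R \<omega>
     else if l = j then (\<omega> \<bullet> z i) *\<^sub>R \<omega> + z j - (\<omega> \<bullet> z j) *\<^sub>R \<omega>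
     else z l)"

definition Rop :: "nat \<Rightarrow> nat \<Rightarrow> ((nat \<Rightarrow> real^3) \<Rightarrow> real) \<Rightarrow> (nat \<Rightarrow> real^3) \<Rightarrow> real" where
  "Rop i j F z = (\<integral>\<omega>. F (rmap i j \<omega> z) \<partial>sphere_measure)"

text \<open>The generator L. Particles 0..M-1 are the system, M..M+N-1 the reservoir.\<close>

definition Lgen :: "nat \<Rightarrow> nat \<Rightarrow> real \<Rightarrow> real \<Rightarrow> real \<Rightarrow>
    ((nat \<Rightarrow> real^3) \<Rightarrow> real) \<Rightarrow> (nat \<Rightarrow> real^3) \<Rightarrow> real" where
  "Lgen M N lS lR mu F z =
     lS / (real M - 1) * (\<Sum>i<M. \<Sum>j\<in>{i<..<M}. Rop i j F z - F z)
   + lR / (real N - 1) * (\<Sum>i\<in>{M..<M+N}. \<Sum>j\<in>{i<..<M+N}. Rop i j F z - F z)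
   + mu / real N * (\<Sum>i<M. \<Sum>j\<in>{M..<M+N}. Rop i j F z - F z)"

definition exp_partial :: "nat \<Rightarrow> nat \<Rightarrow> real \<Rightarrow> real \<Rightarrow> real \<Rightarrow> real \<Rightarrow> nat \<Rightarrow>
    ((nat \<Rightarrow> real^3) \<Rightarrow> real) \<Rightarrow> (nat \<Rightarrow> real^3) \<Rightarrow> real" where
  "exp_partial M N lS lR mu t K F z =
     (\<Sum>n<K. t ^ n / fact n * ((Lgen M N lS lR mu ^^ n) F) z)"

definition is_exp_L :: "nat \<Rightarrow> nat \<Rightarrow> real \<Rightarrow> real \<Rightarrow> real \<Rightarrow> real \<Rightarrow>
    ((nat \<Rightarrow> real^3) \<Rightarrow> real) \<Rightarrow> ((nat \<Rightarrow> real^3) \<Rightarrow> real) \<Rightarrow> bool" where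
  "is_exp_L M N lS lR mu t F G \<longleftrightarrow>
     integrable (config_space {..<M+N}) G \<and>
     ((\<lambda>K. \<integral>\<^sup>+ z. ennreal \<bar>exp_partial M N lS lR mu t K F z - G z\<bar> \<partial>config_space {..<M+N})
        \<longlonglongrightarrow> 0)"

definition gauss :: "nat set \<Rightarrow> (nat \<Rightarrow> real^3) \<Rightarrow> real" where
  "gauss I v = exp (- pi * (\<Sum>i\<in>I. (norm (v i))\<^sup>2))"

text \<open>Relative entropy S(g) = int g log(g / e^{-pi|v|^2}) dv on R^{3M}, valued in
  (-infinity, +infinity] (positive part minus negative part; 0 log 0 = 0).\<close>

definition ent_density :: "nat \<Rightarrow> ((nat \<Rightarrow> real^3) \<Rightarrow> real) \<Rightarrow> (nat \<Rightarrow> real^3) \<Rightarrow> real" where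
  "ent_density M g v = g v * ln (g v / gauss {..<M} v)"

definition entropyS :: "nat \<Rightarrow> ((nat \<Rightarrow> real^3) \<Rightarrow> real) \<Rightarrow> ereal" where
  "entropyS M g =
     enn2ereal (\<integral>\<^sup>+ v. ennreal (ent_density M g v) \<partial>config_space {..<M})
   - enn2ereal (\<integral>\<^sup>+ v. ennreal (- ent_density M g v) \<partial>config_space {..<M})"

end

theory Submission
  imports Defs
begin

text \<open>Relative to the Gaussian, the density \<open>u\<close> of the system evolves by \<open>T u = E (exp (t L) u)\<close>, with \<open>E\<close>
  the average over the reservoir. The operator \<open>T\<close> commutes with the Ornstein--Uhlenbeck semigroup \<open>P\<close>,
  along which the entropy is lost at the rate given by the Fisher information; hence
  \<open>Fisher (T u) \<le> c Fisher u\<close> for all \<open>u\<close> implies \<open>Ent (T u) \<le> c Ent u\<close>. To bound the Fisher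
  information, let \<open>\<Sum> c\<^sub>i |\<nabla>\<^sub>i u|\<^sup>2 / u\<close> carry weights \<open>c\<^sub>i\<close>. By the joint convexity of \<open>|x|\<^sup>2 / u\<close>
  and the second moments of the sphere, a collision of \<open>i\<close> and \<open>j\<close> replaces \<open>c\<^sub>i\<close> by
  \<open>c\<^sub>i + (c\<^sub>j - c\<^sub>i) / 3\<close> and \<open>c\<^sub>j\<close> by \<open>c\<^sub>j + (c\<^sub>i - c\<^sub>j) / 3\<close>. Started from \<open>1\<close> on the system and \<open>0\<close>
  on the reservoir, the weights stay constant on either block, and solving the resulting linear
  system for two numbers gives the factor \<open>c\<close>. Time is discretised for \<open>P\<close> and Poissonised for the
  collisions, so that no differentiation in time is needed.\<close>

section \<open>The Gaussian measure and collisions\<close>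

text \<open>Every collision preserves the Gaussian, so densities are divided by it once and for all
  and \<open>exp (t L)\<close> becomes an averaging operator. All functions live on one space
  \<open>gam\<close> of infinitely many independent Gaussian velocities; a function of the system is
  one that depends on the first \<open>M\<close> coordinates only. The heat flow argument needs
  errors that do not grow with the number of steps. This is the purpose of the class
  \<open>nice I A B C\<close>: two-sided bounds and a quadratic remainder pass, with the same
  constants, to averages and to compositions with affine maps whose linear part is a symmetric
  contraction. Collisions, the reservoir average and the semigroup all have this form. The factor
  1/3 is the mean square of a coordinate on the sphere. If \<alpha> and \<beta> are the weights on
  system and reservoir, then M \<alpha> + N \<beta> is conserved, while \<alpha> - \<beta> decays
  with rate (mu / 3) (N + M) / N; this explains the limit M / (N + M) and the exponent. The
  evolution is given only as an L1 limit of partial sums, so general densities are reached at the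
  end, by L1 approximation and Fatou's lemma.\<close>

lemma distr_orthogonal_lborel:
  fixes T :: "real^3 \<Rightarrow> real^3"
  assumes T: "orthogonal_transformation T"
  shows "distr lborel borel T = lborel"
proof (rule lborel_eqI[symmetric])
  have mT [measurable]: "T \<in> borel_measurable borel"
    using T by (intro borel_measurable_continuous_onI linear_continuous_on
        linear_conv_bounded_linear[THEN iffD1] orthogonal_transformation_linear)
  show "sets (distr lborel borel T) = sets borel" by simp
  fix l u :: "real^3" assume lu: "\<And>b. b \<in> Basis \<Longrightarrow> l \<bullet> b \<le> u \<bullet> b"
  have inv: "orthogonal_transformation (inv T)" and bij: "bij T"
    using T by (auto simp: orthogonal_transformation_inv orthogonal_transformation_bij)
  have vim: "T -` box l u = inv T ` box l u"
    using bij by (simp add: bij_vimage_eq_inv_image)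
  have fm: "box l u \<in> lmeasurable" by simp
  have fm': "inv T ` box l u \<in> lmeasurable"
    by (rule measurable_orthogonal_image[OF inv fm])
  have vs: "T -` box l u \<in> sets borel"
    using measurable_sets[OF mT, of "box l u"] by simp
  have "emeasure (distr lborel borel T) (box l u) = emeasure lborel (T -` box l u)"
    by (subst emeasure_distr) auto
  also have "\<dots> = emeasure lebesgue (inv T ` box l u)"
    using vs by (simp add: vim)
  also have "\<dots> = ennreal (measure lebesgue (inv T ` box l u))"
    using fm' by (simp add: emeasure_eq_measure2)
  also have "\<dots> = ennreal (measure lebesgue (box l u))"
    by (simp only: measure_orthogonal_image[OF inv fm])
  also have "\<dots> = emeasure lborel (box l u)"
    using fm by (simp add: emeasure_eq_measure2)
  also have "\<dots> = ennreal (\<Prod>b\<in>Basis. (u - l) \<bullet> b)"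
    using lu by simp
  finally show "emeasure (distr lborel borel T) (box l u) = ennreal (\<Prod>b\<in>Basis. (u - l) \<bullet> b)" .
qed

text \<open>The weight \<open>exp (- pi * (norm x)\<^sup>2)\<close> of the relative entropy has
  total mass one as it stands, so no normalising constant appears. The coordinates are independent
  with variance 1 / (2 pi).\<close>

definition gamma3 :: "(real^3) measure" where
  "gamma3 = density lborel (\<lambda>x. ennreal (exp (- pi * (norm x)\<^sup>2)))"

lemma sets_gamma3 [simp, measurable_cong]: "sets gamma3 = sets borel"
  and space_gamma3 [simp]: "space gamma3 = UNIV"
  by (simp_all add: gamma3_def)

lemma norm_sq_Basis: "(norm (x::real^3))\<^sup>2 = (\<Sum>b\<in>Basis. (x \<bullet> b)\<^sup>2)"
  unfolding power2_norm_eq_inner by (subst euclidean_inner) (simp add: power2_eq_square)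

lemma card_Basis_real3: "card (Basis :: (real^3) set) = 3"
  by simp

lemma nn_integral_exp_sq_real:
  assumes "c > 0"
  shows "(\<integral>\<^sup>+x. ennreal (exp (- c * x\<^sup>2)) \<partial>lborel) = ennreal (sqrt (pi / c))"
proof -
  define s where "s = sqrt (1 / (2 * c))"
  have s: "s > 0" "s\<^sup>2 = 1 / (2 * c)" using assms by (auto simp: s_def)
  have c: "c = 1 / (2 * s\<^sup>2)" using assms s by simp
  have eq: "exp (- c * x\<^sup>2) = sqrt (pi / c) * normal_density 0 s x" for x
    using assms s(1) unfolding c by (simp add: normal_density_def mult_ac)
  have "(\<integral>\<^sup>+x. ennreal (normal_density 0 s x) \<partial>lborel) = 1"
    using s prob_space.emeasure_space_1[OF prob_space_normal_density[of s 0]]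
    by (simp add: emeasure_density)
  then show ?thesis
    unfolding eq using assms by (subst ennreal_mult') (auto simp: nn_integral_cmult)
qed

text \<open>The exponent is kept general for two uses: \<open>c = pi\<close> gives the normalisation
  of \<open>gamma3\<close>, and \<open>c = pi - 1\<close> the exponential moment behind all
  polynomial moments.\<close>

lemma nn_integral_exp_sq:
  assumes "c > 0"
  shows "(\<integral>\<^sup>+x. ennreal (exp (- c * (norm (x::real^3))\<^sup>2)) \<partial>lborel) = ennreal (sqrt (pi / c) ^ 3)"
proof -
  have "(\<integral>\<^sup>+x. ennreal (exp (- c * (norm (x::real^3))\<^sup>2)) \<partial>lborel)
      = (\<integral>\<^sup>+x. (\<Prod>b\<in>Basis. ennreal (exp (- c * ((x::real^3) \<bullet> b)\<^sup>2))) \<partial>lborel)"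
    unfolding norm_sq_Basis by (simp add: prod_ennreal exp_sum[symmetric] sum_distrib_left sum_negf)
  also have "\<dots> = (\<Prod>b\<in>(Basis::(real^3) set). (\<integral>\<^sup>+x. ennreal (exp (- c * x\<^sup>2)) \<partial>lborel))"
    by (rule nn_integral_lborel_prod) auto
  also have "\<dots> = ennreal (sqrt (pi / c) ^ 3)"
    using assms by (simp only: nn_integral_exp_sq_real prod_constant card_Basis_real3)
      (simp add: ennreal_power)
  finally show ?thesis .
qed

lemma prob_space_gamma3: "prob_space gamma3"
  using nn_integral_exp_sq[of pi] by (intro prob_spaceI) (simp add: gamma3_def emeasure_density)

interpretation G3: prob_space gamma3 by (rule prob_space_gamma3)

lemma distr_orthogonal_gamma3:
  assumes T: "orthogonal_transformation T"
  shows "distr gamma3 borel T = gamma3"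
proof -
  have mT [measurable]: "T \<in> borel_measurable borel"
    using T by (intro borel_measurable_continuous_onI linear_continuous_on
        linear_conv_bounded_linear[THEN iffD1] orthogonal_transformation_linear)
  have "gamma3 = density (distr lborel borel T) (\<lambda>x. ennreal (exp (- pi * (norm x)\<^sup>2)))"
    unfolding gamma3_def distr_orthogonal_lborel[OF T] ..
  also have "\<dots> = distr (density lborel (\<lambda>x. ennreal (exp (- pi * (norm (T x))\<^sup>2)))) borel T"
    by (rule density_distr) auto
  also have "\<dots> = distr gamma3 borel T"
    using T by (simp add: gamma3_def orthogonal_transformation)
  finally show ?thesis by simp
qed

section \<open>Lebesgue-preserving maps of pairs of velocities\<close>

abbreviation L2 :: "((real^3) \<times> (real^3)) measure" where "L2 \<equiv> lborel \<Otimes>\<^sub>M lborel"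

text \<open>Rotations and collisions of a pair are linear maps of R^6 with determinant 1 or -1. They
  are written as compositions of shears and of orthogonal maps of one factor; for these, invariance
  follows from Fubini and from invariance in R^3, so that no determinant has to be computed.\<close>

definition pres2 :: "((real^3) \<times> (real^3) \<Rightarrow> (real^3) \<times> (real^3)) \<Rightarrow> bool" where
  "pres2 \<Phi> \<longleftrightarrow> \<Phi> \<in> measurable L2 L2 \<and> distr L2 L2 \<Phi> = L2"

lemma pres2_comp: "pres2 \<Phi> \<Longrightarrow> pres2 \<Psi> \<Longrightarrow> pres2 (\<Phi> \<circ> \<Psi>)"
  using distr_distr[of \<Phi> L2 L2 \<Psi> L2] measurable_comp[of \<Psi> L2 L2 \<Phi> L2] by (simp add: pres2_def)

lemma pres2_swap: "pres2 (\<lambda>(x, y). (y, x))"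
  using lborel_pair.distr_pair_swap[symmetric] measurable_pair_swap'[of lborel lborel]
  unfolding pres2_def by blast

lemma nn_integral_orthogonal_lborel:
  fixes T :: "real^3 \<Rightarrow> real^3" and f :: "real^3 \<Rightarrow> ennreal"
  assumes "orthogonal_transformation T" and [measurable]: "f \<in> borel_measurable borel"
  shows "(\<integral>\<^sup>+x. f (T (x::real^3)) \<partial>lborel) = (\<integral>\<^sup>+x. f x \<partial>lborel)"
proof -
  have [measurable]: "T \<in> borel_measurable borel"
    using assms by (intro borel_measurable_continuous_onI linear_continuous_on
        linear_conv_bounded_linear[THEN iffD1] orthogonal_transformation_linear)
  have "(\<integral>\<^sup>+x. f x \<partial>lborel) = (\<integral>\<^sup>+x. f x \<partial>distr lborel borel T)"
    by (simp only: distr_orthogonal_lborel[OF assms(1)])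
  also have "\<dots> = (\<integral>\<^sup>+x. f (T x) \<partial>lborel)"
    by (rule nn_integral_distr) auto
  finally show ?thesis by simp
qed

lemma nn_integral_shift_lborel:
  fixes f :: "real^3 \<Rightarrow> ennreal"
  assumes [measurable]: "f \<in> borel_measurable borel"
  shows "(\<integral>\<^sup>+x. f (x + c) \<partial>lborel) = (\<integral>\<^sup>+x. f x \<partial>lborel)"
proof -
  have "(\<integral>\<^sup>+x. f x \<partial>lborel) = (\<integral>\<^sup>+x. f x \<partial>distr lborel borel ((+) c))"
    by (simp only: lborel_distr_plus)
  also have "\<dots> = (\<integral>\<^sup>+x. f (c + x) \<partial>lborel)"
    by (rule nn_integral_distr) auto
  finally show ?thesis by (simp add: add.commute)
qed

lemma pres2I:
  assumes m [measurable]: "\<Phi> \<in> measurable L2 L2"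
    and eq: "\<And>f :: _ \<Rightarrow> ennreal. f \<in> borel_measurable L2 \<Longrightarrow> (\<integral>\<^sup>+p. f (\<Phi> p) \<partial>L2) = (\<integral>\<^sup>+p. f p \<partial>L2)"
  shows "pres2 \<Phi>"
  unfolding pres2_def
proof (intro conjI m measure_eqI)
  fix A assume "A \<in> sets (distr L2 L2 \<Phi>)"
  then have [measurable]: "A \<in> sets L2" by simp
  have "emeasure (distr L2 L2 \<Phi>) A = (\<integral>\<^sup>+p. indicator A p \<partial>distr L2 L2 \<Phi>)"
    by (rule nn_integral_indicator[symmetric]) (simp only: sets_distr \<open>A \<in> sets L2\<close>)
  also have "\<dots> = (\<integral>\<^sup>+p. indicator A (\<Phi> p) \<partial>L2)"
    by (rule nn_integral_distr) auto
  also have "\<dots> = emeasure L2 A"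
    by (simp only: eq borel_measurable_indicator[OF \<open>A \<in> sets L2\<close>] nn_integral_indicator[OF \<open>A \<in> sets L2\<close>])
  finally show "emeasure (distr L2 L2 \<Phi>) A = emeasure L2 A" .
qed simp

lemma pres2_shear:
  assumes [measurable]: "f \<in> borel_measurable (borel :: (real^3) measure)"
  shows "pres2 (\<lambda>(x, y). (x, y + f x))"
proof (rule pres2I)
  fix g :: "_ \<Rightarrow> ennreal" assume [measurable]: "g \<in> borel_measurable L2"
  have "(\<integral>\<^sup>+p. g (case p of (x, y) \<Rightarrow> (x, y + f x)) \<partial>L2)
      = (\<integral>\<^sup>+x. \<integral>\<^sup>+y. g (x, y + f x) \<partial>lborel \<partial>lborel)"
    by (subst lborel.nn_integral_fst[symmetric]) auto
  also have "\<dots> = (\<integral>\<^sup>+x. \<integral>\<^sup>+y. g (x, y) \<partial>lborel \<partial>lborel)"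
    by (intro nn_integral_cong nn_integral_shift_lborel) measurable
  also have "\<dots> = (\<integral>\<^sup>+p. g p \<partial>L2)"
    by (subst lborel.nn_integral_fst[symmetric]) auto
  finally show "(\<integral>\<^sup>+p. g (case p of (x, y) \<Rightarrow> (x, y + f x)) \<partial>L2) = (\<integral>\<^sup>+p. g p \<partial>L2)" .
qed simp

lemma pres2_shear':
  assumes "f \<in> borel_measurable (borel :: (real^3) measure)"
  shows "pres2 (\<lambda>(x, y). (x + f y, y))"
proof -
  have "(\<lambda>(x, y). (x + f y, y)) = (\<lambda>(x, y). (y, x)) \<circ> ((\<lambda>(x, y). (x, y + f x)) \<circ> (\<lambda>(x, y). (y, x)))"
    by auto
  then show ?thesis
    by (simp only: pres2_comp pres2_swap pres2_shear[OF assms])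
qed

lemma pres2_orthogonal:
  assumes T: "orthogonal_transformation T"
  shows "pres2 (\<lambda>(x, y). (T x, y))"
proof (rule pres2I)
  have mT [measurable]: "T \<in> borel_measurable borel"
    using T by (intro borel_measurable_continuous_onI linear_continuous_on
        linear_conv_bounded_linear[THEN iffD1] orthogonal_transformation_linear)
  show "(\<lambda>(x, y). (T x, y)) \<in> measurable L2 L2" by measurable
  fix g :: "_ \<Rightarrow> ennreal" assume [measurable]: "g \<in> borel_measurable L2"
  have "(\<integral>\<^sup>+p. g (case p of (x, y) \<Rightarrow> (T x, y)) \<partial>L2)
      = (\<integral>\<^sup>+y. \<integral>\<^sup>+x. g (T x, y) \<partial>lborel \<partial>lborel)"
    by (subst lborel_pair.nn_integral_snd[symmetric]) auto
  also have "\<dots> = (\<integral>\<^sup>+y. \<integral>\<^sup>+x. g (x, y) \<partial>lborel \<partial>lborel)"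
    by (intro nn_integral_cong nn_integral_orthogonal_lborel[OF T]) measurable
  also have "\<dots> = (\<integral>\<^sup>+p. g p \<partial>L2)"
    by (subst lborel_pair.nn_integral_snd[symmetric]) auto
  finally show "(\<integral>\<^sup>+p. g (case p of (x, y) \<Rightarrow> (T x, y)) \<partial>L2) = (\<integral>\<^sup>+p. g p \<partial>L2)" .
qed

lemma gamma3_pair: "gamma3 \<Otimes>\<^sub>M gamma3 =
    density L2 (\<lambda>(x, y). ennreal (exp (- pi * ((norm x)\<^sup>2 + (norm y)\<^sup>2))))"
proof -
  have "gamma3 \<Otimes>\<^sub>M gamma3 = density L2 (\<lambda>(x, y).
      ennreal (exp (- pi * (norm x)\<^sup>2)) * ennreal (exp (- pi * (norm y)\<^sup>2)))"
    unfolding gamma3_def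
    by (rule pair_measure_density)
       (use G3.sigma_finite_measure_axioms in
         \<open>auto simp: lborel.sigma_finite_measure_axioms gamma3_def\<close>)
  also have "\<dots> = density L2 (\<lambda>(x, y). ennreal (exp (- pi * ((norm x)\<^sup>2 + (norm y)\<^sup>2))))"
    by (intro density_cong)
       (auto simp: ennreal_mult[symmetric] exp_add[symmetric] algebra_simps)
  finally show ?thesis .
qed

text \<open>The Gaussian density on pairs depends on |x|^2 + |y|^2 only, so a map that preserves
  both this quantity and Lebesgue measure preserves the Gaussian.\<close>

lemma distr_gamma3_pair:
  assumes "pres2 \<Phi>"
    and iso: "\<And>x y x' y'. \<Phi> (x, y) = (x', y') \<Longrightarrow> (norm x')\<^sup>2 + (norm y')\<^sup>2 = (norm x)\<^sup>2 + (norm y)\<^sup>2"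
  shows "distr (gamma3 \<Otimes>\<^sub>M gamma3) (gamma3 \<Otimes>\<^sub>M gamma3) \<Phi> = gamma3 \<Otimes>\<^sub>M gamma3"
proof -
  let ?d = "\<lambda>(x, y). ennreal (exp (- pi * ((norm (x::real^3))\<^sup>2 + (norm (y::real^3))\<^sup>2)))"
  have m [measurable]: "\<Phi> \<in> measurable L2 L2" and d: "distr L2 L2 \<Phi> = L2"
    using assms by (auto simp: pres2_def)
  have inv: "?d (\<Phi> p) = ?d p" for p
    using iso by (cases p; cases "\<Phi> p") auto
  have s: "sets (gamma3 \<Otimes>\<^sub>M gamma3) = sets L2" by (intro sets_pair_measure_cong) auto
  have "density L2 ?d = density (distr L2 L2 \<Phi>) ?d" by (simp only: d)
  also have "\<dots> = distr (density L2 (\<lambda>p. ?d (\<Phi> p))) L2 \<Phi>"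
    by (rule density_distr) measurable
  also have "\<dots> = distr (density L2 ?d) L2 \<Phi>" by (simp only: inv)
  finally have e: "density L2 ?d = distr (density L2 ?d) L2 \<Phi>" .
  also have "\<dots> = distr (density L2 ?d) (density L2 ?d) \<Phi>"
    by (rule distr_cong) (simp_all only: sets_density)
  finally show ?thesis unfolding gamma3_pair by (rule sym)
qed

text \<open>Stability of the Gaussian law: a x + b y is the first entry of a rotation of the pair
  (x, y). This is what makes \<open>gam\<close> invariant under the Ornstein--Uhlenbeck
  semigroup.\<close>

lemma distr_gamma3_rotate:
  assumes ab: "a\<^sup>2 + b\<^sup>2 = (1::real)"
  shows "distr (gamma3 \<Otimes>\<^sub>M gamma3) borel (\<lambda>(x, y). a *\<^sub>R x + b *\<^sub>R y) = gamma3"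
proof (cases "b = 0")
  case True
  then have a: "a = 1 \<or> a = -1" using ab by (auto simp: power2_eq_1_iff)
  have T: "orthogonal_transformation (\<lambda>x::real^3. a *\<^sub>R x)"
    using a by (auto simp: orthogonal_transformation_def linear_iff algebra_simps)
  have "distr (gamma3 \<Otimes>\<^sub>M gamma3) borel (\<lambda>(x, y). a *\<^sub>R x + b *\<^sub>R y)
      = distr (distr (gamma3 \<Otimes>\<^sub>M gamma3) gamma3 fst) borel (\<lambda>x. a *\<^sub>R x)"
    using True by (subst distr_distr) (auto simp: comp_def split_beta')
  also have "distr (gamma3 \<Otimes>\<^sub>M gamma3) gamma3 fst = gamma3"
    by (rule G3.distr_pair_fst)
  finally show ?thesis using distr_orthogonal_gamma3[OF T] by simp
next
  case False
  \<comment> \<open>With a = cos \<theta> and b = sin \<theta> this is tan (\<theta> / 2): the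
    rotation is the product of three shears with parameters t, -b and t, which requires b
    nonzero.\<close>
  define t where "t = (1 - a) / b"
  have bt: "b * t = 1 - a" using False by (simp add: t_def)
  define s1 where "s1 = (\<lambda>(x, y::real^3). (x + (\<lambda>y. t *\<^sub>R y) y, y))"
  define s2 where "s2 = (\<lambda>(x, y::real^3). (x, y + (\<lambda>x. (-b) *\<^sub>R x) x))"
  define \<Phi> where "\<Phi> = s1 \<circ> (s2 \<circ> s1)"
  have p: "pres2 \<Phi>"
    unfolding \<Phi>_def s1_def s2_def by (intro pres2_comp pres2_shear pres2_shear') auto
  have t2: "2 * t - t * (b * t) = b"
  proof -
    have "b * (2 * t - t * (b * t)) = b * b"
      using bt ab by (simp add: power2_eq_square algebra_simps) (algebra)
    then show ?thesis using False by simp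
  qed
  have \<Phi>: "\<Phi> (x, y) = (a *\<^sub>R x + b *\<^sub>R y, a *\<^sub>R y - b *\<^sub>R x)" for x y
  proof -
    have "\<Phi> (x, y) = ((1 - b * t) *\<^sub>R x + (2 * t - t * (b * t)) *\<^sub>R y, (1 - b * t) *\<^sub>R y - b *\<^sub>R x)"
      by (simp add: \<Phi>_def s1_def s2_def vec_eq_iff algebra_simps)
    moreover have "1 - b * t = a" using bt by simp
    ultimately show ?thesis by (simp only: t2)
  qed
  have "distr (gamma3 \<Otimes>\<^sub>M gamma3) (gamma3 \<Otimes>\<^sub>M gamma3) \<Phi> = gamma3 \<Otimes>\<^sub>M gamma3"
  proof (rule distr_gamma3_pair[OF p])
    fix x y x' y' assume "\<Phi> (x, y) = (x', y')"
    then have e: "x' = a *\<^sub>R x + b *\<^sub>R y" "y' = a *\<^sub>R y - b *\<^sub>R x" by (auto simp: \<Phi>)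
    have "(norm x')\<^sup>2 + (norm y')\<^sup>2 = (a\<^sup>2 + b\<^sup>2) * ((norm x)\<^sup>2 + (norm y)\<^sup>2)"
      unfolding e power2_norm_eq_inner inner_diff_left inner_diff_right inner_add_left
        inner_add_right inner_scaleR_left inner_scaleR_right inner_commute[of x y]
      by (simp add: power2_eq_square algebra_simps)
    then show "(norm x')\<^sup>2 + (norm y')\<^sup>2 = (norm x)\<^sup>2 + (norm y)\<^sup>2" using ab by simp
  qed
  moreover have "\<Phi> \<in> measurable (gamma3 \<Otimes>\<^sub>M gamma3) (gamma3 \<Otimes>\<^sub>M gamma3)"
    unfolding \<Phi>_def s1_def s2_def by measurable
  moreover have "(\<lambda>(x, y). a *\<^sub>R x + b *\<^sub>R y) = fst \<circ> \<Phi>" using \<Phi> by auto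
  ultimately have "distr (gamma3 \<Otimes>\<^sub>M gamma3) gamma3 (\<lambda>(x, y). a *\<^sub>R x + b *\<^sub>R y)
      = distr (gamma3 \<Otimes>\<^sub>M gamma3) gamma3 fst"
    using distr_distr[OF measurable_fst, of \<Phi> "gamma3 \<Otimes>\<^sub>M gamma3" gamma3 gamma3] by simp
  also have "distr (gamma3 \<Otimes>\<^sub>M gamma3) gamma3 fst = gamma3" by (rule G3.distr_pair_fst)
  finally have "distr (gamma3 \<Otimes>\<^sub>M gamma3) gamma3 (\<lambda>(x, y). a *\<^sub>R x + b *\<^sub>R y) = gamma3" .
  moreover have "distr (gamma3 \<Otimes>\<^sub>M gamma3) gamma3 (\<lambda>(x, y). a *\<^sub>R x + b *\<^sub>R y)
      = distr (gamma3 \<Otimes>\<^sub>M gamma3) borel (\<lambda>(x, y). a *\<^sub>R x + b *\<^sub>R y)"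
    by (rule distr_cong) simp_all
  ultimately show ?thesis by simp
qed

definition coll :: "real^3 \<Rightarrow> (real^3) \<times> (real^3) \<Rightarrow> (real^3) \<times> (real^3)" where
  "coll \<omega> = (\<lambda>(x, y). (x - (\<omega> \<bullet> x) *\<^sub>R \<omega> + (\<omega> \<bullet> y) *\<^sub>R \<omega>, (\<omega> \<bullet> x) *\<^sub>R \<omega> + y - (\<omega> \<bullet> y) *\<^sub>R \<omega>))"

lemma coll_measurable [measurable]: "coll \<omega> \<in> measurable (borel \<Otimes>\<^sub>M borel) (borel \<Otimes>\<^sub>M borel)"
  unfolding coll_def by measurable

text \<open>In the coordinates \<open>(x - y, y)\<close> a collision is a reflection of the first entry
  followed by a shear.\<close>

lemma distr_coll_gamma3:
  assumes w: "norm \<omega> = 1"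
  shows "distr (gamma3 \<Otimes>\<^sub>M gamma3) (gamma3 \<Otimes>\<^sub>M gamma3) (coll \<omega>) = gamma3 \<Otimes>\<^sub>M gamma3"
proof (rule distr_gamma3_pair)
  have w1: "\<omega> \<bullet> \<omega> = 1" using w by (simp add: norm_eq_1)
  define T where "T = (\<lambda>p::real^3. p - (2 * (\<omega> \<bullet> p)) *\<^sub>R \<omega>)"
  have T: "orthogonal_transformation T"
    unfolding orthogonal_transformation_def
  proof (intro conjI allI)
    show "linear T" unfolding T_def
      by (rule linearI) (simp_all add: inner_add_right scaleR_diff_right scaleR_add_left distrib_left)
    fix u v
    show "T u \<bullet> T v = u \<bullet> v"
      unfolding T_def inner_diff_left inner_diff_right inner_scaleR_left inner_scaleR_right
        w1 inner_commute[of u \<omega>] by (simp add: algebra_simps)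
  qed
  define A where "A = (\<lambda>(x, y::real^3). (x + y, y))"
  define A' where "A' = (\<lambda>(x, y::real^3). (x + - y, y))"
  define B where "B = (\<lambda>(x, y::real^3). (x, y + (\<omega> \<bullet> x) *\<^sub>R \<omega>))"
  have eq: "coll \<omega> = A \<circ> ((\<lambda>(x, y). (T x, y)) \<circ> (B \<circ> A'))"
  proof (rule ext, clarify)
    fix x y
    define p where "p = \<omega> \<bullet> (x - y)"
    have "coll \<omega> (x, y) = (x - p *\<^sub>R \<omega>, y + p *\<^sub>R \<omega>)"
      by (simp add: coll_def p_def inner_diff_right scaleR_diff_left)
    moreover have "(2 * p) *\<^sub>R \<omega> = p *\<^sub>R \<omega> + p *\<^sub>R \<omega>"
      by (simp only: mult_2 scaleR_add_left)
    then have "(A \<circ> ((\<lambda>(x, y). (T x, y)) \<circ> (B \<circ> A'))) (x, y) = (x - p *\<^sub>R \<omega>, y + p *\<^sub>R \<omega>)"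
      by (simp add: A_def A'_def B_def T_def p_def)
    ultimately show "coll \<omega> (x, y) = (A \<circ> ((\<lambda>(x, y). (T x, y)) \<circ> (B \<circ> A'))) (x, y)" by simp
  qed
  show "pres2 (coll \<omega>)"
    unfolding eq A_def A'_def B_def
    by (intro pres2_comp pres2_orthogonal T pres2_shear pres2_shear') auto
  fix x y x' y' assume "coll \<omega> (x, y) = (x', y')"
  then have e: "x' = x - (\<omega> \<bullet> x) *\<^sub>R \<omega> + (\<omega> \<bullet> y) *\<^sub>R \<omega>" "y' = (\<omega> \<bullet> x) *\<^sub>R \<omega> + y - (\<omega> \<bullet> y) *\<^sub>R \<omega>"
    by (auto simp: coll_def)
  show "(norm x')\<^sup>2 + (norm y')\<^sup>2 = (norm x)\<^sup>2 + (norm y)\<^sup>2"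
  proof -
    define p where "p = \<omega> \<bullet> (x - y)"
    have e': "x' = x - p *\<^sub>R \<omega>" "y' = y + p *\<^sub>R \<omega>"
      by (simp_all add: e p_def inner_diff_right scaleR_diff_left)
    have n: "(norm (u + s *\<^sub>R \<omega>))\<^sup>2 = (norm u)\<^sup>2 + 2 * s * (\<omega> \<bullet> u) + s * s" for u s
      unfolding power2_norm_eq_inner inner_add_left inner_add_right inner_scaleR_left inner_scaleR_right
        w1 inner_commute[of u \<omega>] by (simp add: distrib_left)
    have p: "\<omega> \<bullet> y = \<omega> \<bullet> x - p" by (simp add: p_def inner_diff_right)
    have z: "2 * (-p) * A + (-p) * (-p) + (2 * p * (A - p) + p * p) = 0" for A
      by algebra
    have "(norm x')\<^sup>2 = (norm x)\<^sup>2 + 2 * (-p) * (\<omega> \<bullet> x) + (-p) * (-p)"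
      using n[of x "-p"] by (simp only: e' diff_conv_add_uminus scaleR_minus_left)
    moreover have "(norm y')\<^sup>2 = (norm y)\<^sup>2 + 2 * p * (\<omega> \<bullet> x - p) + p * p"
      using n[of y p] by (simp only: e' p)
    ultimately show ?thesis
      using z[of "\<omega> \<bullet> x"] by linarith
  qed
qed

section \<open>Infinitely many independent Gaussian velocities\<close>

abbreviation gam :: "(nat \<Rightarrow> real^3) measure" where "gam \<equiv> PiM UNIV (\<lambda>_::nat. gamma3)"

interpretation GP: product_prob_space "\<lambda>_::nat. gamma3" UNIV
  by unfold_locales

lemma prob_space_gam: "prob_space gam"
  by (rule GP.P.prob_space_axioms)

lemma space_gam [simp]: "space gam = UNIV"
  by (simp add: space_PiM PiE_def extensional_def)

lemma nn_integral_gam_prod: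
  fixes f :: "nat \<Rightarrow> real^3 \<Rightarrow> ennreal"
  assumes J: "finite J" and f [measurable]: "\<And>j. f j \<in> borel_measurable borel"
  shows "(\<integral>\<^sup>+z. (\<Prod>j\<in>J. f j (z j)) \<partial>gam) = (\<Prod>j\<in>J. \<integral>\<^sup>+x. f j x \<partial>gamma3)"
proof -
  have "(\<Prod>j\<in>J. \<integral>\<^sup>+x. f j x \<partial>gamma3) = (\<integral>\<^sup>+z. (\<Prod>j\<in>J. f j (z j)) \<partial>PiM J (\<lambda>_. gamma3))"
    using J by (intro GP.product_nn_integral_prod[symmetric]) auto
  also have "\<dots> = (\<integral>\<^sup>+z. (\<Prod>j\<in>J. f j (z j)) \<partial>distr gam (PiM J (\<lambda>_. gamma3)) (\<lambda>z. restrict z J))"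
    using J by (simp add: GP.distr_PiM_restrict_finite)
  also have "\<dots> = (\<integral>\<^sup>+z. (\<Prod>j\<in>J. f j (restrict z J j)) \<partial>gam)"
    by (rule nn_integral_distr) (auto intro!: measurable_restrict borel_measurable_prod_ennreal)
  finally show ?thesis by simp
qed

lemma gam_eqI:
  assumes s: "sets M = sets gam"
    and eq: "\<And>J F. finite J \<Longrightarrow> (\<And>j. F j \<in> sets borel) \<Longrightarrow>
      (\<integral>\<^sup>+z. (\<Prod>j\<in>J. indicator (F j) (z j)) \<partial>M) = (\<Prod>j\<in>J. emeasure gamma3 (F j))"
  shows "M = gam"
proof (rule GP.PiM_eq[OF s])
  fix J :: "nat set" and F :: "nat \<Rightarrow> (real^3) set"
  assume J: "finite J" and F: "\<And>j. j \<in> J \<Longrightarrow> F j \<in> sets gamma3"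
  define F' where "F' j = (if j \<in> J then F j else UNIV)" for j
  have F': "F' j \<in> sets borel" for j using F by (auto simp: F'_def)
  let ?E = "prod_emb UNIV (\<lambda>_. gamma3) J (\<Pi>\<^sub>E j\<in>J. F j)"
  have "?E \<in> sets gam" using J F by (intro sets_PiM_I) auto
  then have E: "?E \<in> sets M" by (simp only: s)
  have ind: "indicator ?E z = (\<Prod>j\<in>J. indicator (F' j) (z j) :: ennreal)" for z
  proof -
    have "z \<in> ?E \<longleftrightarrow> (\<forall>j\<in>J. z j \<in> F j)"
      by (auto simp: prod_emb_def PiE_def extensional_def Pi_def)
    then show ?thesis using J
      by (auto simp: F'_def indicator_def prod_zero_iff)
  qed
  have "emeasure M ?E = (\<integral>\<^sup>+z. indicator ?E z \<partial>M)"
    using E by (rule nn_integral_indicator[symmetric])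
  also have "\<dots> = (\<Prod>j\<in>J. emeasure gamma3 (F' j))"
    unfolding ind by (rule eq[OF J F'])
  also have "\<dots> = (\<Prod>j\<in>J. emeasure gamma3 (F j))"
    by (intro prod.cong) (auto simp: F'_def)
  finally show "emeasure M ?E = (\<Prod>j\<in>J. emeasure gamma3 (F j))" .
qed

lemma measurable_gamI:
  "(\<And>n. (\<lambda>x. f x n) \<in> borel_measurable M) \<Longrightarrow> f \<in> measurable M gam"
  by (rule measurable_abs_UNIV[of "\<lambda>n x. f x n", simplified]) auto

text \<open>Different coordinates of the result involve disjoint families of independent variables,
  so they stay independent, and it suffices that each of them has law \<open>gamma3\<close>. Both
  the splicing of system and reservoir and the rotation of two configurations into each other are of
  this kind.\<close>

lemma distr_coordwise:
  assumes [measurable]: "\<And>i. \<phi> i \<in> measurable (gamma3 \<Otimes>\<^sub>M gamma3) borel"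
    and d: "\<And>i. distr (gamma3 \<Otimes>\<^sub>M gamma3) borel (\<phi> i) = gamma3"
  shows "distr (gam \<Otimes>\<^sub>M gam) gam (\<lambda>(z, w) i. \<phi> i (z i, w i)) = gam"
proof (rule gam_eqI)
  show "sets (distr (gam \<Otimes>\<^sub>M gam) gam (\<lambda>(z, w) i. \<phi> i (z i, w i))) = sets gam" by simp
  have m: "(\<lambda>(z, w) i. \<phi> i (z i, w i)) \<in> measurable (gam \<Otimes>\<^sub>M gam) gam"
    by (rule measurable_gamI) (auto simp: split_beta')
  fix J :: "nat set" and F :: "nat \<Rightarrow> (real^3) set"
  assume J: "finite J" and [measurable]: "\<And>j. F j \<in> sets borel"
  have "(\<integral>\<^sup>+z. (\<Prod>j\<in>J. indicator (F j) (z j)) \<partial>distr (gam \<Otimes>\<^sub>M gam) gam (\<lambda>(z, w) i. \<phi> i (z i, w i)))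
      = (\<integral>\<^sup>+p. (\<Prod>j\<in>J. indicator (F j) (\<phi> j (fst p j, snd p j))) \<partial>(gam \<Otimes>\<^sub>M gam))"
    by (subst nn_integral_distr[OF m]) (auto simp: split_beta' intro!: borel_measurable_prod_ennreal)
  also have "\<dots> = (\<integral>\<^sup>+z. \<integral>\<^sup>+w. (\<Prod>j\<in>J. indicator (F j) (\<phi> j (z j, w j))) \<partial>gam \<partial>gam)"
    by (subst GP.P.nn_integral_fst[symmetric]) (auto intro!: borel_measurable_prod_ennreal)
  also have "\<dots> = (\<integral>\<^sup>+z. (\<Prod>j\<in>J. \<integral>\<^sup>+y. indicator (F j) (\<phi> j (z j, y)) \<partial>gamma3) \<partial>gam)"
    using J by (intro nn_integral_cong nn_integral_gam_prod) auto
  also have "\<dots> = (\<Prod>j\<in>J. \<integral>\<^sup>+x. \<integral>\<^sup>+y. indicator (F j) (\<phi> j (x, y)) \<partial>gamma3 \<partial>gamma3)"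
    using J by (intro nn_integral_gam_prod) auto
  also have "\<dots> = (\<Prod>j\<in>J. emeasure gamma3 (F j))"
  proof (intro prod.cong refl)
    fix j
    have "(\<integral>\<^sup>+x. \<integral>\<^sup>+y. indicator (F j) (\<phi> j (x, y)) \<partial>gamma3 \<partial>gamma3)
        = (\<integral>\<^sup>+p. indicator (F j) (\<phi> j p) \<partial>(gamma3 \<Otimes>\<^sub>M gamma3))"
      by (subst G3.nn_integral_fst[symmetric]) auto
    also have "\<dots> = (\<integral>\<^sup>+x. indicator (F j) x \<partial>distr (gamma3 \<Otimes>\<^sub>M gamma3) borel (\<phi> j))"
      by (subst nn_integral_distr) auto
    finally show "(\<integral>\<^sup>+x. \<integral>\<^sup>+y. indicator (F j) (\<phi> j (x, y)) \<partial>gamma3 \<partial>gamma3) = emeasure gamma3 (F j)"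
      by (simp add: d)
  qed
  finally show "(\<integral>\<^sup>+z. (\<Prod>j\<in>J. indicator (F j) (z j))
      \<partial>distr (gam \<Otimes>\<^sub>M gam) gam (\<lambda>(z, w) i. \<phi> i (z i, w i))) = (\<Prod>j\<in>J. emeasure gamma3 (F j))" .
qed

text \<open>Replacing one coordinate by a fresh independent sample does not change the law. Done
  twice, this isolates the pair of velocities on which a collision acts.\<close>

lemma nn_integral_gam_upd:
  fixes f :: "(nat \<Rightarrow> real^3) \<Rightarrow> ennreal"
  assumes [measurable]: "f \<in> borel_measurable gam"
  shows "(\<integral>\<^sup>+z. f z \<partial>gam) = (\<integral>\<^sup>+x. \<integral>\<^sup>+z. f (z(i := x)) \<partial>gam \<partial>gamma3)"
proof -
  have m: "(\<lambda>(x, z). z(i := x)) \<in> measurable (gamma3 \<Otimes>\<^sub>M gam) gam"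
    by (rule measurable_gamI) (auto simp: split_beta' fun_upd_def)
  have "gam = distr (gamma3 \<Otimes>\<^sub>M gam) gam (\<lambda>(x, z). z(i := x))"
    using distr_pair_PiM_eq_PiM[of UNIV "\<lambda>_. gamma3" i] prob_space_gamma3 by simp
  then have "(\<integral>\<^sup>+z. f z \<partial>gam) = (\<integral>\<^sup>+z. f z \<partial>distr (gamma3 \<Otimes>\<^sub>M gam) gam (\<lambda>(x, z). z(i := x)))"
    by (rule arg_cong[where f="\<lambda>M. \<integral>\<^sup>+z. f z \<partial>M"])
  also have "\<dots> = (\<integral>\<^sup>+p. f ((\<lambda>(x, z). z(i := x)) p) \<partial>(gamma3 \<Otimes>\<^sub>M gam))"
    by (rule nn_integral_distr[OF m]) auto
  also have "\<dots> = (\<integral>\<^sup>+x. \<integral>\<^sup>+z. f (z(i := x)) \<partial>gam \<partial>gamma3)"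
    using measurable_compose[OF m \<open>f \<in> borel_measurable gam\<close>]
    by (subst GP.P.nn_integral_fst[symmetric]) (auto simp: split_beta')
  finally show ?thesis .
qed

lemma rmap_joint_measurable:
  "(\<lambda>(\<omega>, z). rmap i j \<omega> z) \<in> measurable (borel \<Otimes>\<^sub>M gam) gam"
  unfolding rmap_def by (rule measurable_gamI) (auto simp: split_beta')

lemma rmap_measurable [measurable (raw)]:
  assumes [measurable]: "f \<in> borel_measurable M" "g \<in> measurable M gam"
  shows "(\<lambda>x. rmap i j (f x) (g x)) \<in> measurable M gam"
  using measurable_compose[OF _ rmap_joint_measurable, of "\<lambda>x. (f x, g x)" M i j] by simp

text \<open>The coordinates i and j are resampled as an independent pair p. On this pair the
  collision acts as \<open>coll\<close>, whose invariance is known, while all other coordinates of z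
  are frozen.\<close>

lemma nn_integral_rmap:
  fixes f :: "(nat \<Rightarrow> real^3) \<Rightarrow> ennreal"
  assumes ij: "i \<noteq> j" and w: "norm \<omega> = 1" and [measurable]: "f \<in> borel_measurable gam"
  shows "(\<integral>\<^sup>+z. f (rmap i j \<omega> z) \<partial>gam) = (\<integral>\<^sup>+z. f z \<partial>gam)"
proof -
  have upd: "(\<integral>\<^sup>+z. g z \<partial>gam) = (\<integral>\<^sup>+z. \<integral>\<^sup>+p. g (z(j := snd p, i := fst p)) \<partial>(gamma3 \<Otimes>\<^sub>M gamma3) \<partial>gam)"
    if g [measurable]: "g \<in> borel_measurable gam" for g :: "(nat \<Rightarrow> real^3) \<Rightarrow> ennreal"
  proof -
    have PP: "pair_sigma_finite (gamma3 \<Otimes>\<^sub>M gamma3) gam"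
      by (intro pair_sigma_finite.intro prob_space_imp_sigma_finite prob_space_pair
          prob_space_gamma3 prob_space_gam)
    have mm: "(\<lambda>t. g ((snd t)(j := snd (fst t), i := fst (fst t)))) \<in> borel_measurable ((gamma3 \<Otimes>\<^sub>M gamma3) \<Otimes>\<^sub>M gam)"
      by (rule measurable_compose[OF _ g], rule measurable_gamI) (auto simp: fun_upd_def)
    have m1: "(\<lambda>z. z(i := x)) \<in> measurable gam gam" for x
      by (rule measurable_gamI) (auto simp: fun_upd_def)
    have "(\<integral>\<^sup>+z. g z \<partial>gam) = (\<integral>\<^sup>+x. \<integral>\<^sup>+z. g (z(i := x)) \<partial>gam \<partial>gamma3)"
      by (rule nn_integral_gam_upd[OF g])
    also have "\<dots> = (\<integral>\<^sup>+x. \<integral>\<^sup>+y. \<integral>\<^sup>+z. g (z(j := y, i := x)) \<partial>gam \<partial>gamma3 \<partial>gamma3)"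
      by (rule nn_integral_cong, rule nn_integral_gam_upd[OF measurable_compose[OF m1 g]])
    also have "\<dots> = (\<integral>\<^sup>+p. \<integral>\<^sup>+z. g (z(j := snd p, i := fst p)) \<partial>gam \<partial>(gamma3 \<Otimes>\<^sub>M gamma3))"
      using GP.P.borel_measurable_nn_integral_fst[OF mm]
      by (subst G3.nn_integral_fst[symmetric]) auto
    also have "\<dots> = (\<integral>\<^sup>+z. \<integral>\<^sup>+p. g (z(j := snd p, i := fst p)) \<partial>(gamma3 \<Otimes>\<^sub>M gamma3) \<partial>gam)"
      using pair_sigma_finite.Fubini[OF PP mm] by simp
    finally show ?thesis .
  qed
  have cm: "coll \<omega> \<in> measurable (gamma3 \<Otimes>\<^sub>M gamma3) (gamma3 \<Otimes>\<^sub>M gamma3)" by measurable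
  have "(\<integral>\<^sup>+z. f (rmap i j \<omega> z) \<partial>gam)
      = (\<integral>\<^sup>+z. \<integral>\<^sup>+p. f (rmap i j \<omega> (z(j := snd p, i := fst p))) \<partial>(gamma3 \<Otimes>\<^sub>M gamma3) \<partial>gam)"
    by (rule upd[of "\<lambda>z. f (rmap i j \<omega> z)"]) measurable
  also have "\<dots> = (\<integral>\<^sup>+z. \<integral>\<^sup>+p. f (z(j := snd (coll \<omega> p), i := fst (coll \<omega> p))) \<partial>(gamma3 \<Otimes>\<^sub>M gamma3) \<partial>gam)"
  proof -
    have "rmap i j \<omega> (z(j := snd p, i := fst p)) = z(j := snd (coll \<omega> p), i := fst (coll \<omega> p))" for z p
      using ij by (auto simp: rmap_def coll_def fun_eq_iff split_beta')
    then show ?thesis by simp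
  qed
  also have "\<dots> = (\<integral>\<^sup>+z. \<integral>\<^sup>+p. f (z(j := snd p, i := fst p)) \<partial>(gamma3 \<Otimes>\<^sub>M gamma3) \<partial>gam)"
  proof (rule nn_integral_cong)
    fix z
    have m4 [measurable]: "(\<lambda>p. f (z(j := snd p, i := fst p))) \<in> borel_measurable (gamma3 \<Otimes>\<^sub>M gamma3)"
      by (rule measurable_compose[OF _ \<open>f \<in> borel_measurable gam\<close>], rule measurable_gamI)
         (auto simp: fun_upd_def)
    have "(\<integral>\<^sup>+p. f (z(j := snd p, i := fst p)) \<partial>(gamma3 \<Otimes>\<^sub>M gamma3))
      = (\<integral>\<^sup>+p. f (z(j := snd p, i := fst p)) \<partial>distr (gamma3 \<Otimes>\<^sub>M gamma3) (gamma3 \<Otimes>\<^sub>M gamma3) (coll \<omega>))"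
      by (simp only: distr_coll_gamma3[OF w])
    also have "\<dots> = (\<integral>\<^sup>+p. f (z(j := snd (coll \<omega> p), i := fst (coll \<omega> p))) \<partial>(gamma3 \<Otimes>\<^sub>M gamma3))"
      by (rule nn_integral_distr[OF cm]) (simp add: m4)
    finally show "(\<integral>\<^sup>+p. f (z(j := snd (coll \<omega> p), i := fst (coll \<omega> p))) \<partial>(gamma3 \<Otimes>\<^sub>M gamma3)) =
      (\<integral>\<^sup>+p. f (z(j := snd p, i := fst p)) \<partial>(gamma3 \<Otimes>\<^sub>M gamma3))" by simp
  qed
  also have "\<dots> = (\<integral>\<^sup>+z. f z \<partial>gam)" by (rule upd[OF \<open>f \<in> borel_measurable gam\<close>, symmetric])
  finally show ?thesis .
qed

lemma distr_rmap:
  assumes ij: "i \<noteq> j" and w: "norm \<omega> = 1"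
  shows "distr gam gam (rmap i j \<omega>) = gam"
proof (rule measure_eqI)
  have m: "rmap i j \<omega> \<in> measurable gam gam" by measurable
  fix A assume A: "A \<in> sets (distr gam gam (rmap i j \<omega>))"
  then have [measurable]: "A \<in> sets gam" by simp
  have "emeasure (distr gam gam (rmap i j \<omega>)) A = (\<integral>\<^sup>+z. indicator A z \<partial>distr gam gam (rmap i j \<omega>))"
    by (rule nn_integral_indicator[symmetric, OF A])
  also have "\<dots> = (\<integral>\<^sup>+z. indicator A (rmap i j \<omega> z) \<partial>gam)"
    by (rule nn_integral_distr[OF m]) auto
  also have "\<dots> = (\<integral>\<^sup>+z. indicator A z \<partial>gam)"
    by (rule nn_integral_rmap[OF ij w]) measurable
  also have "\<dots> = emeasure gam A" by simp
  finally show "emeasure (distr gam gam (rmap i j \<omega>)) A = emeasure gam A" .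
qed simp

text \<open>Rotation invariance makes the integral depend on |x| alone, so it equals the average
  over the three vectors |x| b with b in an orthonormal basis, and the three integrands add up to
  |x|^2 |w|^2. It is used for the sphere, where it produces the factor 1/3 of the collisions, and
  for \<open>gamma3\<close>.\<close>

lemma isotropic_second_moment:
  fixes \<mu> :: "(real^3) measure"
  assumes s [measurable_cong]: "sets \<mu> = sets borel"
    and inv: "\<And>T. orthogonal_transformation T \<Longrightarrow> distr \<mu> borel T = \<mu>"
    and int: "integrable \<mu> (\<lambda>w. (norm w)\<^sup>2)"
  shows "(\<integral>w. (x \<bullet> w)\<^sup>2 \<partial>\<mu>) = (norm x)\<^sup>2 * ((\<integral>w. (norm w)\<^sup>2 \<partial>\<mu>) / 3)"
proof -
  have ib: "integrable \<mu> (\<lambda>w. (x \<bullet> w)\<^sup>2)" for x :: "real^3"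
  proof (rule Bochner_Integration.integrable_bound[OF integrable_mult_right[OF int, of "(norm x)\<^sup>2"]])
    show "AE w in \<mu>. norm ((x \<bullet> w)\<^sup>2) \<le> norm ((norm x)\<^sup>2 * (norm w)\<^sup>2)"
      using power_mono[OF Cauchy_Schwarz_ineq2 abs_ge_zero, of x _ 2] by (simp add: power_mult_distrib)
  qed measurable
  have rot: "(\<integral>w. (x \<bullet> w)\<^sup>2 \<partial>\<mu>) = (\<integral>w. (y \<bullet> w)\<^sup>2 \<partial>\<mu>)" if xy: "norm x = norm y" for y
  proof -
    obtain T where T: "orthogonal_transformation T" "T x = y"
      using orthogonal_transformation_exists[OF xy] by blast
    have mT [measurable]: "T \<in> borel_measurable borel"
      using T by (intro borel_measurable_continuous_onI linear_continuous_on
          linear_conv_bounded_linear[THEN iffD1] orthogonal_transformation_linear)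
    have "(\<integral>w. (y \<bullet> w)\<^sup>2 \<partial>\<mu>) = (\<integral>w. (y \<bullet> w)\<^sup>2 \<partial>distr \<mu> borel T)"
      by (simp only: inv[OF T(1)])
    also have "\<dots> = (\<integral>w. (T x \<bullet> T w)\<^sup>2 \<partial>\<mu>)"
      unfolding T(2)[symmetric] by (rule integral_distr) auto
    also have "\<dots> = (\<integral>w. (x \<bullet> w)\<^sup>2 \<partial>\<mu>)"
      using T(1) unfolding orthogonal_transformation_def by simp
    finally show ?thesis by simp
  qed
  have "(\<integral>w. (x \<bullet> w)\<^sup>2 \<partial>\<mu>) = (\<integral>w. ((norm x *\<^sub>R b) \<bullet> w)\<^sup>2 \<partial>\<mu>)" if "b \<in> Basis" for b
    by (rule rot) (use that in simp)
  then have "(\<Sum>b\<in>(Basis :: (real^3) set). (\<integral>w. (x \<bullet> w)\<^sup>2 \<partial>\<mu>)) = (\<Sum>b\<in>Basis. (\<integral>w. ((norm x *\<^sub>R b) \<bullet> w)\<^sup>2 \<partial>\<mu>))"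
    by (rule sum.cong[OF refl])
  also have "\<dots> = (\<integral>w. (\<Sum>b\<in>Basis. ((norm x *\<^sub>R b) \<bullet> w)\<^sup>2) \<partial>\<mu>)"
    by (rule Bochner_Integration.integral_sum[symmetric]) (rule ib)
  also have "\<dots> = (\<integral>w. (norm x)\<^sup>2 * (norm w)\<^sup>2 \<partial>\<mu>)"
    proof (rule Bochner_Integration.integral_cong[OF refl])
    fix w :: "real^3"
    have "(\<Sum>b\<in>Basis. ((norm x *\<^sub>R b) \<bullet> w)\<^sup>2) = (norm x)\<^sup>2 * (\<Sum>b\<in>Basis. (w \<bullet> b)\<^sup>2)"
      unfolding sum_distrib_left
      by (rule sum.cong) (auto simp: power_mult_distrib inner_commute[of w])
    then show "(\<Sum>b\<in>Basis. ((norm x *\<^sub>R b) \<bullet> w)\<^sup>2) = (norm x)\<^sup>2 * (norm w)\<^sup>2"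
      by (simp only: norm_sq_Basis[of w])
  qed
  finally show ?thesis by simp
qed

section \<open>The uniform measure on the sphere\<close>

lemma prob_space_sphere: "prob_space sphere_measure"
proof -
  have "prob_space (uniform_measure lborel (ball (0::real^3) 1))"
  proof (rule prob_space_uniform_measure)
    show "emeasure lborel (ball (0::real^3) 1) \<noteq> 0"
      using unit_ball_vol_pos[of 3] by (simp add: emeasure_ball del: unit_ball_vol_pos)
    show "emeasure lborel (ball (0::real^3) 1) \<noteq> \<infinity>"
      using emeasure_lborel_ball_finite[of "0::real^3" 1] by simp
  qed
  then show ?thesis unfolding sphere_measure_def
    by (rule prob_space.prob_space_distr) simp
qed

interpretation SP: prob_space sphere_measure by (rule prob_space_sphere)

lemma sets_sphere [simp, measurable_cong]: "sets sphere_measure = sets borel"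
  and space_sphere [simp]: "space sphere_measure = UNIV"
  by (simp_all add: sphere_measure_def)

lemma AE_sphere: "AE \<omega> in sphere_measure. norm \<omega> = 1"
proof -
  have "AE x in uniform_measure lborel (ball (0::real^3) 1). norm (sgn x) = 1"
    \<comment> \<open>The only point that \<open>sgn\<close> does not send to the sphere is the
      origin, a null set.\<close>
    by (rule AE_uniform_measureI) (use AE_lborel_singleton[of "0::real^3"] in \<open>auto simp: norm_sgn\<close>)
  then show ?thesis unfolding sphere_measure_def
    by (subst AE_distr_iff) auto
qed

text \<open>An orthogonal map commutes with the radial projection \<open>sgn\<close> and preserves
  the ball together with its Lebesgue measure.\<close>

lemma distr_orthogonal_sphere:
  assumes T: "orthogonal_transformation T"
  shows "distr sphere_measure borel T = sphere_measure"
proof -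
  have mT [measurable]: "T \<in> borel_measurable borel"
    using T by (intro borel_measurable_continuous_onI linear_continuous_on
        linear_conv_bounded_linear[THEN iffD1] orthogonal_transformation_linear)
  let ?B = "ball (0::real^3) 1" and ?d = "\<lambda>x::real^3. indicator (ball 0 1) x / emeasure lborel (ball (0::real^3) 1)"
  have n: "norm (T x) = norm x" for x using T by (simp add: orthogonal_transformation)
  have lin: "linear T" using T by (rule orthogonal_transformation_linear)
  have s: "T (sgn x) = sgn (T x)" for x
    by (simp add: sgn_div_norm n linear_cmul[OF lin])
  have "uniform_measure lborel ?B = density (distr lborel borel T) ?d"
    unfolding uniform_measure_def distr_orthogonal_lborel[OF T] ..
  also have "\<dots> = distr (density lborel (\<lambda>x. ?d (T x))) borel T"
    by (rule density_distr) (auto intro!: borel_measurable_divide_ennreal borel_measurable_indicator)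
  also have "(\<lambda>x. ?d (T x)) = ?d"
    by (auto simp: n indicator_def fun_eq_iff)
  finally have u: "uniform_measure lborel ?B = distr (uniform_measure lborel ?B) borel T"
    unfolding uniform_measure_def .
  have "distr sphere_measure borel T = distr (uniform_measure lborel ?B) borel (T \<circ> sgn)"
    unfolding sphere_measure_def by (rule distr_distr) auto
  also have "\<dots> = distr (distr (uniform_measure lborel ?B) borel T) borel sgn"
    by (subst distr_distr) (auto simp: comp_def s)
  also have "\<dots> = sphere_measure"
    unfolding sphere_measure_def by (simp only: u[symmetric])
  finally show ?thesis .
qed

lemma sphere_second_moment: "(\<integral>\<omega>. (\<omega> \<bullet> x)\<^sup>2 \<partial>sphere_measure) = (norm x)\<^sup>2 / 3"
proof -
  have i: "integrable sphere_measure (\<lambda>\<omega>. (norm \<omega>)\<^sup>2)"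
    by (rule SP.integrable_const_bound[of _ 1]) (use AE_sphere in auto)
  have "(\<integral>\<omega>. (norm \<omega>)\<^sup>2 \<partial>sphere_measure) = (\<integral>\<omega>. 1 \<partial>sphere_measure)"
    by (rule integral_cong_AE) (use AE_sphere in auto)
  then show ?thesis
    using isotropic_second_moment[OF sets_sphere distr_orthogonal_sphere i, of x]
    using SP.prob_space by (simp add: inner_commute)
qed

section \<open>Gaussian moments\<close>

definition nsq :: "nat set \<Rightarrow> (nat \<Rightarrow> real^3) \<Rightarrow> real" where
  "nsq I z = (\<Sum>i\<in>I. (norm (z i))\<^sup>2)"

lemma nsq_nonneg [simp]: "nsq I z \<ge> 0" by (simp add: nsq_def sum_nonneg)

lemma nsq_measurable [measurable]: "nsq I \<in> borel_measurable gam"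
  unfolding nsq_def by measurable

text \<open>The factor exp (|x|^2) leaves the exponent pi - 1 > 0 in every coordinate, and
  independence gives a finite product of Gaussian integrals.\<close>

lemma nn_integral_exp_nsq:
  assumes "finite I" shows "(\<integral>\<^sup>+z. ennreal (exp (nsq I z)) \<partial>gam) < \<infinity>"
proof -
  have "(\<integral>\<^sup>+z. ennreal (exp (nsq I z)) \<partial>gam) = (\<integral>\<^sup>+z. (\<Prod>i\<in>I. ennreal (exp ((norm (z i))\<^sup>2))) \<partial>gam)"
    by (simp add: nsq_def exp_sum[OF assms] prod_ennreal)
  also have "\<dots> = (\<Prod>i\<in>I. \<integral>\<^sup>+x. ennreal (exp ((norm x)\<^sup>2)) \<partial>gamma3)"
    using assms by (rule nn_integral_gam_prod) auto
  also have "(\<integral>\<^sup>+x. ennreal (exp ((norm x)\<^sup>2)) \<partial>gamma3)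
      = (\<integral>\<^sup>+x. ennreal (exp (- (pi - 1) * (norm (x::real^3))\<^sup>2)) \<partial>lborel)"
    unfolding gamma3_def
    by (subst nn_integral_density)
       (auto simp: ennreal_mult[symmetric] exp_add[symmetric] algebra_simps)
  also have "\<dots> = ennreal (sqrt (pi / (pi - 1)) ^ 3)"
    using pi_gt3 by (intro nn_integral_exp_sq) auto
  finally show ?thesis by (simp add: ennreal_power power_less_top_ennreal)
qed

text \<open>All error terms below grow at most cubically in the displacement, hence are dominated by
  this cube. It is dominated in turn by the exponential moment, through x / 3 \<le> exp (x /
  3).\<close>

lemma integrable_nsq_power:
  assumes "finite I" shows "integrable gam (\<lambda>z. (1 + nsq I z) ^ 3)"
proof (rule Bochner_Integration.integrable_bound)
  show "integrable gam (\<lambda>z. 27 * exp 1 * exp (nsq I z))"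
    using nn_integral_exp_nsq[OF assms] by (intro integrable_mult_right integrableI_nonneg) auto
  have "x ^ 3 \<le> 27 * exp x" if "x \<ge> 0" for x :: real
  proof -
    have "(x / 3) ^ 3 \<le> exp (x / 3) ^ 3"
    proof (rule power_mono)
      show "x / 3 \<le> exp (x / 3)" using exp_ge_add_one_self[of "x/3"] by linarith
    qed (use that in simp)
    also have "\<dots> = exp x" by (simp add: exp_of_nat_mult[symmetric])
    finally show ?thesis by (simp add: power_divide)
  qed
  from this[of "1 + nsq I z" for z]
  show "AE z in gam. norm ((1 + nsq I z) ^ 3) \<le> norm (27 * exp 1 * exp (nsq I z))"
    by (auto simp: exp_add mult_ac)
qed measurable

section \<open>Fisher information under mixing and collisions\<close>

definition ip :: "nat set \<Rightarrow> (nat \<Rightarrow> real^3) \<Rightarrow> (nat \<Rightarrow> real^3) \<Rightarrow> real" where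
  "ip I x y = (\<Sum>i\<in>I. x i \<bullet> y i)"

lemma ip_bound: "\<bar>ip I x y\<bar> \<le> sqrt (nsq I x) * sqrt (nsq I y)"
proof -
  have "\<bar>ip I x y\<bar> \<le> (\<Sum>i\<in>I. \<bar>norm (x i)\<bar> * \<bar>norm (y i)\<bar>)"
    unfolding ip_def
    by (rule order_trans[OF sum_abs], rule sum_mono) (simp add: Cauchy_Schwarz_ineq2)
  also have "\<dots> \<le> L2_set (\<lambda>i. norm (x i)) I * L2_set (\<lambda>i. norm (y i)) I"
    by (rule L2_set_mult_ineq)
  finally show ?thesis by (simp add: L2_set_def nsq_def)
qed

lemma ip_add_right: "ip I x (\<lambda>i. y i + z i) = ip I x y + ip I x z"
  by (simp add: ip_def inner_add_right sum.distrib)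
lemma ip_diff_left: "ip I (\<lambda>i. x i - y i) z = ip I x z - ip I y z"
  by (simp add: ip_def inner_diff_left sum_subtractf)
lemma ip_scale_right: "ip I x (\<lambda>i. s *\<^sub>R y i) = s * ip I x y"
  by (simp add: ip_def sum_distrib_left)
lemma ip_self: "ip I x x = nsq I x"
  by (simp add: ip_def nsq_def power2_norm_eq_inner)
lemma nsq_scale: "nsq I (\<lambda>i. s *\<^sub>R y i) = s\<^sup>2 * nsq I y"
  by (simp add: nsq_def sum_distrib_left power_mult_distrib)
lemma nsq_add_le: "nsq I (\<lambda>i. x i + y i) \<le> 2 * nsq I x + 2 * nsq I y"
proof -
  have "(norm (u + v))\<^sup>2 \<le> 2 * (norm u)\<^sup>2 + 2 * (norm v)\<^sup>2" for u v :: "real^3"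
  proof -
    have "(norm (u + v))\<^sup>2 + (norm (u - v))\<^sup>2 = 2 * (norm u)\<^sup>2 + 2 * (norm v)\<^sup>2"
      unfolding power2_norm_eq_inner by (simp add: inner_simps)
    moreover have "0 \<le> (norm (u - v))\<^sup>2" by simp
    ultimately show ?thesis by linarith
  qed
  then show ?thesis
    unfolding nsq_def sum_distrib_left sum.distrib[symmetric] by (intro sum_mono) auto
qed
lemma nsq_ge: "finite I \<Longrightarrow> i \<in> I \<Longrightarrow> (norm (x i))\<^sup>2 \<le> nsq I x"
  unfolding nsq_def by (rule member_le_sum) auto

text \<open>\<open>X\<close> is the gradient of \<open>u\<close> on the coordinates in \<open>I\<close>; the uniform quadratic remainder also
  forces \<open>u\<close> to depend on these coordinates only.\<close>

definition nice :: "nat set \<Rightarrow> real \<Rightarrow> real \<Rightarrow> real \<Rightarrow> ((nat \<Rightarrow> real^3) \<Rightarrow> real) \<Rightarrow>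
    ((nat \<Rightarrow> real^3) \<Rightarrow> nat \<Rightarrow> real^3) \<Rightarrow> bool" where
  "nice I A B C u X \<longleftrightarrow> finite I \<and> 0 \<le> C \<and> u \<in> borel_measurable gam \<and>
     (\<forall>i. (\<lambda>z. X z i) \<in> borel_measurable gam) \<and> (\<forall>z. A \<le> u z \<and> u z \<le> B) \<and>
     (\<forall>z e. \<bar>u (\<lambda>i. z i + e i) - u z - ip I (X z) e\<bar> \<le> C * nsq I e)"

lemma niceD:
  assumes "nice I A B C u X"
  shows "finite I" "0 \<le> C" "u \<in> borel_measurable gam" "\<And>i. (\<lambda>z. X z i) \<in> borel_measurable gam"
    "\<And>z. A \<le> u z" "\<And>z. u z \<le> B" "A \<le> B"
    "\<And>z e. \<bar>u (\<lambda>i. z i + e i) - u z - ip I (X z) e\<bar> \<le> C * nsq I e"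
  using assms unfolding nice_def by (auto intro: order_trans)

text \<open>A step of length one in the direction of the gradient changes u by |X| up to the
  remainder C, while u cannot vary by more than B - A.\<close>

lemma nice_grad_bound:
  assumes n: "nice I A B C u X"
  shows "sqrt (nsq I (X z)) \<le> B - A + C"
proof (cases "nsq I (X z) = 0")
  case True then show ?thesis using niceD(2,7)[OF n] by simp
next
  case False
  define r where "r = sqrt (nsq I (X z))"
  have r: "r > 0" "nsq I (X z) = r\<^sup>2" using False by (auto simp: r_def less_le)
  define e where "e = (\<lambda>i. (1 / r) *\<^sub>R X z i)"
  have e: "nsq I e = 1" "ip I (X z) e = r"
    using r unfolding e_def by (auto simp: nsq_scale ip_scale_right ip_self power2_eq_square)
  have "\<bar>u (\<lambda>i. z i + e i) - u z - r\<bar> \<le> C"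
    using niceD(8)[OF n, of z e] by (simp add: e)
  then show ?thesis
    using niceD(6)[OF n, of "\<lambda>i. z i + e i"] niceD(5)[OF n, of z] by (simp add: r_def[symmetric])
qed

text \<open>Steps of length at most one are controlled by the gradient bound and the remainder,
  longer ones by the oscillation B - A.\<close>

lemma nice_lipschitz:
  assumes n: "nice I A B C u X"
  shows "\<bar>u (\<lambda>i. z i + e i) - u z\<bar> \<le> (B - A + 2 * C) * sqrt (nsq I e)"
proof (cases "nsq I e \<le> 1")
  case True
  have C: "C \<ge> 0" and AB: "A \<le> B" using niceD[OF n] by auto
  have "\<bar>u (\<lambda>i. z i + e i) - u z\<bar> \<le> \<bar>ip I (X z) e\<bar> + C * nsq I e"
    using niceD(8)[OF n, of z e] by linarith
  also have "\<bar>ip I (X z) e\<bar> \<le> (B - A + C) * sqrt (nsq I e)"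
    using ip_bound[of I "X z" e] mult_right_mono[OF nice_grad_bound[OF n, of z], of "sqrt (nsq I e)"]
    by simp
  also have "C * nsq I e \<le> C * sqrt (nsq I e)"
    using True C real_le_rsqrt[of "nsq I e" "nsq I e"] power2_eq_square[of "nsq I e"]
      mult_left_le[of "nsq I e" "nsq I e"]
    by (intro mult_left_mono) auto
  finally show ?thesis by (simp add: algebra_simps)
next
  case False
  have C: "C \<ge> 0" and AB: "A \<le> B" using niceD[OF n] by auto
  have "\<bar>u (\<lambda>i. z i + e i) - u z\<bar> \<le> B - A"
    using niceD(5,6)[OF n, of "\<lambda>i. z i + e i"] niceD(5,6)[OF n, of z] by auto
  also have "\<dots> \<le> (B - A + 2 * C) * 1" using C by simp
  also have "\<dots> \<le> (B - A + 2 * C) * sqrt (nsq I e)"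
    using False C AB by (intro mult_left_mono) auto
  finally show ?thesis .
qed

text \<open>The quadratic remainder alone forces a Lipschitz gradient. The expansions at z + d along
  e, at z along d + e and at z along d combine to bound the inner product of X (z + d) - X z with e
  by 3 C (|e|^2 + |d|^2); then e is chosen parallel to this difference, with length |d|.\<close>

lemma nice_grad_lipschitz:
  assumes n: "nice I A B C u X"
  shows "sqrt (nsq I (\<lambda>i. X (\<lambda>i. z i + d i) i - X z i)) \<le> 6 * C * sqrt (nsq I d)"
proof -
  define Y where "Y = (\<lambda>i. X (\<lambda>i. z i + d i) i - X z i)"
  define r where "r = sqrt (nsq I Y)"
  define s where "s = sqrt (nsq I d)"
  have C: "C \<ge> 0" using niceD[OF n] by auto
  have r0: "r \<ge> 0" "s \<ge> 0" by (simp_all add: r_def s_def)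
  have rr: "nsq I Y = r\<^sup>2" "nsq I d = s\<^sup>2" by (simp_all add: r_def s_def)
  have est: "ip I Y e \<le> 3 * C * nsq I e + 3 * C * s\<^sup>2" for e
  proof -
    have 1: "\<bar>u (\<lambda>i. (z i + d i) + e i) - u (\<lambda>i. z i + d i) - ip I (X (\<lambda>i. z i + d i)) e\<bar> \<le> C * nsq I e"
      by (rule niceD(8)[OF n])
    have 2: "\<bar>u (\<lambda>i. z i + (d i + e i)) - u z - (ip I (X z) d + ip I (X z) e)\<bar> \<le> C * nsq I (\<lambda>i. d i + e i)"
      using niceD(8)[OF n, of z "\<lambda>i. d i + e i"] by (simp add: ip_add_right)
    have 3: "\<bar>u (\<lambda>i. z i + d i) - u z - ip I (X z) d\<bar> \<le> C * nsq I d"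
      by (rule niceD(8)[OF n])
    have 4: "C * nsq I (\<lambda>i. d i + e i) \<le> C * (2 * s\<^sup>2 + 2 * nsq I e)"
      using nsq_add_le[of I d e] C by (intro mult_left_mono) (auto simp: rr)
    have "ip I Y e = ip I (X (\<lambda>i. z i + d i)) e - ip I (X z) e"
      unfolding Y_def by (rule ip_diff_left)
    then show ?thesis using 1 2 3 4 by (simp add: rr add.assoc algebra_simps abs_le_iff)
  qed
  have "r \<le> 6 * C * s"
  proof (cases "r = 0")
    case True then show ?thesis using C r0 by simp
  next
    case False
    then have r: "r > 0" using r0 by simp
    define e where "e = (\<lambda>i. (s / r) *\<^sub>R Y i)"
    have "s * r = (s / r) * r\<^sup>2" using r by (simp add: power2_eq_square)
    also have "\<dots> = ip I Y e" unfolding e_def by (simp add: ip_scale_right ip_self rr)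
    also have "\<dots> \<le> 3 * C * nsq I e + 3 * C * s\<^sup>2" by (rule est)
    also have "nsq I e = s\<^sup>2" using r unfolding e_def by (simp add: nsq_scale rr power_divide)
    finally have *: "s * r \<le> s * (6 * C * s)" by (simp add: power2_eq_square algebra_simps)
    show ?thesis
    proof (cases "s = 0")
      \<comment> \<open>Here d vanishes on \<open>I\<close> but may be nonzero elsewhere, so the
        gradient must be shown not to change at all. The right side is quadratic in t and the left
        side linear, and t = 1 / (3 C + 1) contradicts r > 0.\<close>
      case True
      have "t * r\<^sup>2 \<le> 3 * C * (t\<^sup>2 * r\<^sup>2)" for t
        using est[of "\<lambda>i. t *\<^sub>R Y i"] True by (simp add: ip_scale_right ip_self rr nsq_scale)
      then have "1 / (3 * C + 1) * r\<^sup>2 * 1 \<le> 1 / (3 * C + 1) * r\<^sup>2 * (3 * C * (1 / (3 * C + 1)))"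
        by (metis (no_types, opaque_lifting) mult.assoc mult.commute mult.right_neutral power2_eq_square)
      moreover have "1 / (3 * C + 1) * r\<^sup>2 > 0" using r C by simp
      ultimately have "1 \<le> 3 * C * (1 / (3 * C + 1))" by (metis mult_le_cancel_left_pos)
      then have "(3 * C + 1) \<le> 3 * C" using C by (simp add: field_simps)
      then show ?thesis by simp
    next
      case False
      then show ?thesis using * r0 by (simp add: mult_le_cancel_left)
    qed
  qed
  then show ?thesis by (simp add: r_def s_def Y_def)
qed

text \<open>The chain rule for an affine map with linear part \<open>\<l>\<close>: symmetry lets
  \<open>\<l>\<close> stand for its own adjoint in the gradient, and contraction keeps all three
  constants. Collisions, the splicing with a frozen reservoir and the scaling by \<open>a\<close>
  are the instances.\<close>

lemma nice_pullback:
  assumes n: "nice I A B C u X"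
    and m: "\<phi> \<in> measurable gam gam" "\<And>i. (\<lambda>z. \<l> (X (\<phi> z)) i) \<in> borel_measurable gam"
    and aff: "\<And>z e. \<phi> (\<lambda>i. z i + e i) = (\<lambda>i. \<phi> z i + \<l> e i)"
    and con: "\<And>e. nsq I (\<l> e) \<le> nsq I e"
    and sym: "\<And>x e. ip I x (\<l> e) = ip I (\<l> x) e"
  shows "nice I A B C (\<lambda>z. u (\<phi> z)) (\<lambda>z. \<l> (X (\<phi> z)))"
proof -
  have "\<bar>u (\<phi> (\<lambda>i. z i + e i)) - u (\<phi> z) - ip I (\<l> (X (\<phi> z))) e\<bar> \<le> C * nsq I e" for z e
  proof -
    have "\<bar>u (\<phi> (\<lambda>i. z i + e i)) - u (\<phi> z) - ip I (\<l> (X (\<phi> z))) e\<bar> \<le> C * nsq I (\<l> e)"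
      using niceD(8)[OF n, of "\<phi> z" "\<l> e"] by (simp only: aff sym)
    also have "\<dots> \<le> C * nsq I e" using niceD(2)[OF n] con by (intro mult_left_mono) auto
    finally show ?thesis .
  qed
  then show ?thesis
    unfolding nice_def using niceD[OF n] m(2) measurable_compose[OF m(1) niceD(3)[OF n]] by auto
qed

section \<open>Weighted Fisher information and mixtures\<close>

definition wsq :: "nat set \<Rightarrow> (nat \<Rightarrow> real) \<Rightarrow> (nat \<Rightarrow> real^3) \<Rightarrow> real" where
  "wsq I c x = (\<Sum>i\<in>I. c i * (norm (x i))\<^sup>2)"

text \<open>The gradient is passed as an argument, so that for an average of functions the average
  of the gradients can be supplied and no derivative has to be taken under an integral.\<close>

definition fisher :: "nat set \<Rightarrow> (nat \<Rightarrow> real) \<Rightarrow> ((nat \<Rightarrow> real^3) \<Rightarrow> real) \<Rightarrow>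
    ((nat \<Rightarrow> real^3) \<Rightarrow> nat \<Rightarrow> real^3) \<Rightarrow> real" where
  "fisher I c u X = (\<integral>z. wsq I c (X z) / u z \<partial>gam)"

lemma nice_component_bound:
  assumes n: "nice I A B C u X" and i: "i \<in> I"
  shows "norm (X z i) \<le> B - A + C"
proof -
  have "norm (X z i) = sqrt ((norm (X z i))\<^sup>2)" by simp
  also have "\<dots> \<le> sqrt (nsq I (X z))" by (intro real_sqrt_le_mono nsq_ge[OF niceD(1)[OF n] i])
  also have "\<dots> \<le> B - A + C" by (rule nice_grad_bound[OF n])
  finally show ?thesis .
qed

lemma wsq_quotient_bound:
  assumes n: "nice I A B C u X" and A: "A > 0"
  shows "\<bar>wsq I c (X z) / u z\<bar> \<le> (\<Sum>i\<in>I. \<bar>c i\<bar> * (B - A + C)\<^sup>2) / A"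
proof -
  have u: "u z \<ge> A" using niceD[OF n] by auto
  have "\<bar>wsq I c (X z)\<bar> \<le> (\<Sum>i\<in>I. \<bar>c i * (norm (X z i))\<^sup>2\<bar>)"
    unfolding wsq_def by (rule sum_abs)
  also have "\<dots> \<le> (\<Sum>i\<in>I. \<bar>c i\<bar> * (B - A + C)\<^sup>2)"
    unfolding abs_mult using nice_component_bound[OF n]
    by (intro sum_mono mult_left_mono) (auto intro: power_mono)
  finally have "\<bar>wsq I c (X z)\<bar> / u z \<le> (\<Sum>i\<in>I. \<bar>c i\<bar> * (B - A + C)\<^sup>2) / A"
    using u A by (intro frac_le) (auto intro!: sum_nonneg mult_nonneg_nonneg)
  then show ?thesis using u A by simp
qed

lemma wsq_quotient_measurable:
  assumes n: "nice I A B C u X"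
  shows "(\<lambda>z. wsq I c (X z) / u z) \<in> borel_measurable gam"
proof -
  note [measurable] = niceD(3,4)[OF n]
  show ?thesis unfolding wsq_def by measurable
qed

lemma wsq_quotient_integrable:
  assumes n: "nice I A B C u X" and A: "A > 0"
  shows "integrable gam (\<lambda>z. wsq I c (X z) / u z)"
  using wsq_quotient_bound[OF n A] wsq_quotient_measurable[OF n]
  by (intro GP.P.integrable_const_bound) auto

text \<open>Every bound in \<open>nice\<close> is linear in the function and its gradient or convex
  in both, so it passes to averages over any probability space with the same A, B, C. This
  uniformity keeps the errors of the heat flow argument under control over any number of
  steps.\<close>

lemma nice_mix:
  fixes U :: "'a \<Rightarrow> (nat \<Rightarrow> real^3) \<Rightarrow> real"
  assumes K: "prob_space K"
    and mU [measurable]: "(\<lambda>(\<xi>, z). U \<xi> z) \<in> borel_measurable (K \<Otimes>\<^sub>M gam)"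
    and mX [measurable]: "\<And>i. (\<lambda>(\<xi>, z). X \<xi> z i) \<in> borel_measurable (K \<Otimes>\<^sub>M gam)"
    and n: "\<And>\<xi>. nice I A B C (U \<xi>) (X \<xi>)"
  shows "nice I A B C (\<lambda>z. \<integral>\<xi>. U \<xi> z \<partial>K) (\<lambda>z i. \<integral>\<xi>. X \<xi> z i \<partial>K)"
proof -
  interpret K: prob_space K by fact
  interpret P: pair_sigma_finite K gam
    by (intro pair_sigma_finite.intro prob_space_imp_sigma_finite K prob_space_gam)
  have mU': "(\<lambda>(z, \<xi>). U \<xi> z) \<in> borel_measurable (gam \<Otimes>\<^sub>M K)"
    and mX': "\<And>i. (\<lambda>(z, \<xi>). X \<xi> z i) \<in> borel_measurable (gam \<Otimes>\<^sub>M K)"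
    by measurable
  have mU1: "(\<lambda>\<xi>. U \<xi> z) \<in> borel_measurable K" and mX1: "(\<lambda>\<xi>. X \<xi> z i) \<in> borel_measurable K" for z i
    using measurable_Pair2[OF mU', of z] measurable_Pair2[OF mX', of z] by auto
  have iU: "integrable K (\<lambda>\<xi>. U \<xi> z)" for z
    using niceD(5,6)[OF n] mU1 by (intro K.integrable_const_bound[of _ "max \<bar>A\<bar> \<bar>B\<bar>"] AE_I2)
      (auto simp: abs_le_iff le_max_iff_disj, (smt (verit, best))+)
  have iX: "integrable K (\<lambda>\<xi>. X \<xi> z i)" if "i \<in> I" for z i
    using nice_component_bound[OF n that] mX1 by (intro K.integrable_const_bound AE_I2) auto
  show ?thesis
    unfolding nice_def
  proof (intro conjI allI)
    show "finite I" "0 \<le> C" using niceD[OF n] by auto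
    show "(\<lambda>z. \<integral>\<xi>. U \<xi> z \<partial>K) \<in> borel_measurable gam"
      by (rule K.borel_measurable_lebesgue_integral) (rule mU')
    show "(\<lambda>z. \<integral>\<xi>. X \<xi> z i \<partial>K) \<in> borel_measurable gam" for i
      by (rule K.borel_measurable_lebesgue_integral) (rule mX')
    fix z
    show "A \<le> (\<integral>\<xi>. U \<xi> z \<partial>K)" by (rule K.integral_ge_const[OF iU]) (use niceD[OF n] in auto)
    show "(\<integral>\<xi>. U \<xi> z \<partial>K) \<le> B" by (rule K.integral_le_const[OF iU]) (use niceD[OF n] in auto)
    fix e
    have ip: "ip I (\<lambda>i. \<integral>\<xi>. X \<xi> z i \<partial>K) e = (\<integral>\<xi>. ip I (X \<xi> z) e \<partial>K)"
      unfolding ip_def using iX by (subst Bochner_Integration.integral_sum) auto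
    have iip: "integrable K (\<lambda>\<xi>. ip I (X \<xi> z) e)"
      unfolding ip_def using iX by (intro Bochner_Integration.integrable_sum) auto
    have "(\<integral>\<xi>. U \<xi> (\<lambda>i. z i + e i) \<partial>K) - (\<integral>\<xi>. U \<xi> z \<partial>K) - ip I (\<lambda>i. \<integral>\<xi>. X \<xi> z i \<partial>K) e
       = (\<integral>\<xi>. U \<xi> (\<lambda>i. z i + e i) - U \<xi> z - ip I (X \<xi> z) e \<partial>K)"
      unfolding ip using iU iip by simp
    also have "\<bar>\<dots>\<bar> \<le> (\<integral>\<xi>. \<bar>U \<xi> (\<lambda>i. z i + e i) - U \<xi> z - ip I (X \<xi> z) e\<bar> \<partial>K)"
      by (rule integral_abs_bound)
    also have "\<dots> \<le> C * nsq I e"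
      using iU iip niceD(8)[OF n] by (intro K.integral_le_const) auto
    finally show "\<bar>(\<integral>\<xi>. U \<xi> (\<lambda>i. z i + e i) \<partial>K) - (\<integral>\<xi>. U \<xi> z \<partial>K) - ip I (\<lambda>i. \<integral>\<xi>. X \<xi> z i \<partial>K) e\<bar> \<le> C * nsq I e" .
  qed
qed

text \<open>Joint convexity of \<open>|x|^2 / u\<close>: integrate \<open>|X|^2 / U \<ge> 2 y \<bullet> X - |y|^2 U\<close>
  with \<open>y\<close> the quotient of the means.\<close>

lemma fisher_mix:
  fixes U :: "'a \<Rightarrow> (nat \<Rightarrow> real^3) \<Rightarrow> real"
  assumes K: "prob_space K"
    and mU [measurable]: "(\<lambda>(\<xi>, z). U \<xi> z) \<in> borel_measurable (K \<Otimes>\<^sub>M gam)"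
    and mX [measurable]: "\<And>i. (\<lambda>(\<xi>, z). X \<xi> z i) \<in> borel_measurable (K \<Otimes>\<^sub>M gam)"
    and n: "\<And>\<xi>. nice I A B C (U \<xi>) (X \<xi>)" and A: "A > 0" and c: "\<And>i. c i \<ge> 0"
  shows "fisher I c (\<lambda>z. \<integral>\<xi>. U \<xi> z \<partial>K) (\<lambda>z i. \<integral>\<xi>. X \<xi> z i \<partial>K) \<le> (\<integral>\<xi>. fisher I c (U \<xi>) (X \<xi>) \<partial>K)"
    and "integrable K (\<lambda>\<xi>. fisher I c (U \<xi>) (X \<xi>))"
    and "(\<integral>\<xi>. fisher I c (U \<xi>) (X \<xi>) \<partial>K) = (\<integral>z. (\<integral>\<xi>. wsq I c (X \<xi> z) / U \<xi> z \<partial>K) \<partial>gam)"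
    and "integrable gam (\<lambda>z. \<integral>\<xi>. wsq I c (X \<xi> z) / U \<xi> z \<partial>K)"
proof -
  interpret K: prob_space K by fact
  interpret P: pair_sigma_finite K gam
    by (intro pair_sigma_finite.intro prob_space_imp_sigma_finite K prob_space_gam)
  have KP: "prob_space (K \<Otimes>\<^sub>M gam)" by (intro prob_space_pair K prob_space_gam)
  have mU': "(\<lambda>(z, \<xi>). U \<xi> z) \<in> borel_measurable (gam \<Otimes>\<^sub>M K)"
    and mX': "\<And>i. (\<lambda>(z, \<xi>). X \<xi> z i) \<in> borel_measurable (gam \<Otimes>\<^sub>M K)"
    by measurable
  have mU1: "(\<lambda>\<xi>. U \<xi> z) \<in> borel_measurable K" and mX1: "(\<lambda>\<xi>. X \<xi> z i) \<in> borel_measurable K" for z i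
    using measurable_Pair2[OF mU', of z] measurable_Pair2[OF mX', of z] by auto
  have iU: "integrable K (\<lambda>\<xi>. U \<xi> z)" for z
    using niceD(5,6)[OF n] mU1 by (intro K.integrable_const_bound[of _ "max \<bar>A\<bar> \<bar>B\<bar>"] AE_I2)
      (auto simp: abs_le_iff le_max_iff_disj, (smt (verit, best))+)
  have iX: "integrable K (\<lambda>\<xi>. X \<xi> z i)" if "i \<in> I" for z i
    using nice_component_bound[OF n that] mX1 by (intro K.integrable_const_bound AE_I2) auto
  let ?D = "(\<Sum>i\<in>I. \<bar>c i\<bar> * (B - A + C)\<^sup>2) / A"
  have mq: "(\<lambda>(\<xi>, z). wsq I c (X \<xi> z) / U \<xi> z) \<in> borel_measurable (K \<Otimes>\<^sub>M gam)"
    unfolding wsq_def split_beta' using mU mX by (auto simp: split_beta')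
  have iq: "integrable (K \<Otimes>\<^sub>M gam) (\<lambda>(\<xi>, z). wsq I c (X \<xi> z) / U \<xi> z)"
    using wsq_quotient_bound[OF n A, where c=c] mq
    by (intro finite_measure.integrable_const_bound[of _ _ ?D] prob_space.finite_measure[OF KP] AE_I2) auto
  have iq1: "integrable K (\<lambda>\<xi>. wsq I c (X \<xi> z) / U \<xi> z)" for z
    using wsq_quotient_bound[OF n A, where c=c] mU1 mX1 unfolding wsq_def
    by (intro K.integrable_const_bound[of _ ?D] AE_I2) auto
  show "integrable K (\<lambda>\<xi>. fisher I c (U \<xi>) (X \<xi>))"
    unfolding fisher_def using P.integrable_fst[OF iq] by simp
  show eq: "(\<integral>\<xi>. fisher I c (U \<xi>) (X \<xi>) \<partial>K) = (\<integral>z. (\<integral>\<xi>. wsq I c (X \<xi> z) / U \<xi> z \<partial>K) \<partial>gam)"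
    unfolding fisher_def using P.Fubini_integral[OF iq] by simp
  show i2: "integrable gam (\<lambda>z. \<integral>\<xi>. wsq I c (X \<xi> z) / U \<xi> z \<partial>K)"
    using P.integrable_snd[OF iq] by simp
  note nm = nice_mix[OF K mU mX n]
  show "fisher I c (\<lambda>z. \<integral>\<xi>. U \<xi> z \<partial>K) (\<lambda>z i. \<integral>\<xi>. X \<xi> z i \<partial>K) \<le> (\<integral>\<xi>. fisher I c (U \<xi>) (X \<xi>) \<partial>K)"
    unfolding eq unfolding fisher_def
  proof (rule integral_mono[OF wsq_quotient_integrable[OF nm A] i2])
    fix z
    define u where "u = (\<integral>\<xi>. U \<xi> z \<partial>K)"
    define x where "x = (\<lambda>i. \<integral>\<xi>. X \<xi> z i \<partial>K)"
    have u: "u \<ge> A" using niceD(5)[OF nm] by (simp add: u_def)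
    define y where "y i = (1 / u) *\<^sub>R x i" for i
    have pt: "(\<Sum>i\<in>I. c i * (2 * (y i \<bullet> X \<xi> z i) - (norm (y i))\<^sup>2 * U \<xi> z)) \<le> wsq I c (X \<xi> z) / U \<xi> z" for \<xi>
    proof -
      have U: "U \<xi> z > 0" using niceD(5)[OF n[of \<xi>], of z] A by linarith
      have "2 * (y i \<bullet> X \<xi> z i) - (norm (y i))\<^sup>2 * U \<xi> z \<le> (norm (X \<xi> z i))\<^sup>2 / U \<xi> z" for i
      proof -
        have "0 \<le> (norm (X \<xi> z i - U \<xi> z *\<^sub>R y i))\<^sup>2" by simp
        also have "\<dots> = (norm (X \<xi> z i))\<^sup>2 - 2 * U \<xi> z * (y i \<bullet> X \<xi> z i) + (U \<xi> z)\<^sup>2 * (norm (y i))\<^sup>2"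
          unfolding power2_norm_eq_inner
          by (simp add: inner_diff_left inner_diff_right inner_commute[of "X \<xi> z i" "y i"] power2_eq_square
              right_diff_distrib)
        finally show ?thesis using U by (simp add: field_simps power2_eq_square)
      qed
      then show ?thesis unfolding wsq_def sum_divide_distrib times_divide_eq_right[symmetric]
        using c by (intro sum_mono mult_left_mono) auto
    qed
    have "wsq I c x / u = (\<Sum>i\<in>I. c i * (2 * (y i \<bullet> x i) - (norm (y i))\<^sup>2 * u))"
      unfolding wsq_def sum_divide_distrib
    proof (rule sum.cong[OF refl])
      fix i
      have u0: "u > 0" using u A by simp
      have "y i \<bullet> x i = (norm (x i))\<^sup>2 / u" "(norm (y i))\<^sup>2 = (norm (x i))\<^sup>2 / u\<^sup>2"
        using u0 by (simp_all add: y_def power2_norm_eq_inner power_divide)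
      then show "c i * (norm (x i))\<^sup>2 / u = c i * (2 * (y i \<bullet> x i) - (norm (y i))\<^sup>2 * u)"
        using u0 by (simp only:) (simp add: field_simps power2_eq_square)
    qed
    also have "\<dots> = (\<integral>\<xi>. (\<Sum>i\<in>I. c i * (2 * (y i \<bullet> X \<xi> z i) - (norm (y i))\<^sup>2 * U \<xi> z)) \<partial>K)"
      using iX iU by (subst Bochner_Integration.integral_sum) (auto simp: x_def u_def)
    also have "\<dots> \<le> (\<integral>\<xi>. wsq I c (X \<xi> z) / U \<xi> z \<partial>K)"
      using iX iU pt iq1
      by (intro integral_mono Bochner_Integration.integrable_sum integrable_mult_right
          Bochner_Integration.integrable_diff) auto
    finally show "wsq I c (\<lambda>i. \<integral>\<xi>. X \<xi> z i \<partial>K) / (\<integral>\<xi>. U \<xi> z \<partial>K) \<le> (\<integral>\<xi>. wsq I c (X \<xi> z) / U \<xi> z \<partial>K)"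
      by (simp add: u_def x_def)
  qed
qed

section \<open>Collisions acting on gradients and weights\<close>

lemma sum_split2:
  assumes "finite I" "i \<in> I" "j \<in> I" "i \<noteq> j"
  shows "(\<Sum>l\<in>I. f l) = f i + f j + (\<Sum>l\<in>I - {i, j}. f l :: real)"
proof -
  have "(\<Sum>l\<in>I. f l) = f i + (\<Sum>l\<in>I - {i}. f l)"
    using assms by (simp add: sum.remove)
  also have "(\<Sum>l\<in>I - {i}. f l) = f j + (\<Sum>l\<in>I - {i} - {j}. f l)"
    using assms by (intro sum.remove) auto
  also have "I - {i} - {j} = I - {i, j}" by auto
  finally show ?thesis by simp
qed

lemma rmap_add: "rmap i j \<omega> (\<lambda>l. z l + e l) = (\<lambda>l. rmap i j \<omega> z l + rmap i j \<omega> e l)"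
  by (rule ext) (simp add: rmap_def inner_add_right scaleR_add_left)

lemma rmap_measurable1: "rmap i j \<omega> \<in> measurable gam gam"
  unfolding rmap_def by (rule measurable_gamI) simp

lemma gam_component:
  assumes "f \<in> measurable M gam" shows "(\<lambda>x. f x l) \<in> borel_measurable M"
proof -
  have "(\<lambda>z. z l) \<in> borel_measurable gam" by measurable
  from measurable_compose[OF assms this] show ?thesis .
qed

lemma rmap_zero: "rmap i j 0 z = z"
  by (rule ext) (simp add: rmap_def)

text \<open>The vector is x + s \<omega> with s = \<omega> . y - \<omega> . x: only the component
  along the unit vector \<omega> changes, from \<omega> . x to \<omega> . y.\<close>

lemma norm_reflect:
  fixes x y \<omega> :: "real^3"
  assumes "norm \<omega> = 1"
  shows "(norm (x - (\<omega> \<bullet> x) *\<^sub>R \<omega> + (\<omega> \<bullet> y) *\<^sub>R \<omega>))\<^sup>2 = (norm x)\<^sup>2 - (\<omega> \<bullet> x)\<^sup>2 + (\<omega> \<bullet> y)\<^sup>2"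
proof -
  have w1: "\<omega> \<bullet> \<omega> = 1" using assms by (simp add: norm_eq_1)
  define s where "s = \<omega> \<bullet> y - \<omega> \<bullet> x"
  have e: "x - (\<omega> \<bullet> x) *\<^sub>R \<omega> + (\<omega> \<bullet> y) *\<^sub>R \<omega> = x + s *\<^sub>R \<omega>"
    by (simp add: s_def scaleR_diff_left)
  have "(norm (x + s *\<^sub>R \<omega>))\<^sup>2 = (norm x)\<^sup>2 + 2 * s * (\<omega> \<bullet> x) + s * s"
    unfolding power2_norm_eq_inner inner_add_left inner_add_right inner_scaleR_left inner_scaleR_right
      w1 inner_commute[of x \<omega>] by (simp add: distrib_left)
  also have "\<dots> = (norm x)\<^sup>2 - (\<omega> \<bullet> x)\<^sup>2 + (\<omega> \<bullet> y)\<^sup>2"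
    unfolding s_def power2_eq_square[of "_ \<bullet> _"] by (simp add: left_diff_distrib right_diff_distrib)
  finally show ?thesis by (simp only: e)
qed

text \<open>The two particles exchange their components along \<omega>, so the change is the
  transferred square times the difference of the two weights. Equal weights give conservation of the
  norm.\<close>

lemma wsq_rmap:
  assumes I: "finite I" "i \<in> I" "j \<in> I" "i \<noteq> j" and w: "norm \<omega> = 1"
  shows "wsq I c (rmap i j \<omega> x) = wsq I c x + (c i - c j) * ((\<omega> \<bullet> x j)\<^sup>2 - (\<omega> \<bullet> x i)\<^sup>2)"
proof -
  have r: "(norm (rmap i j \<omega> x i))\<^sup>2 = (norm (x i))\<^sup>2 - (\<omega> \<bullet> x i)\<^sup>2 + (\<omega> \<bullet> x j)\<^sup>2"
    "(norm (rmap i j \<omega> x j))\<^sup>2 = (norm (x j))\<^sup>2 - (\<omega> \<bullet> x j)\<^sup>2 + (\<omega> \<bullet> x i)\<^sup>2"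
    using norm_reflect[OF w, of "x i" "x j"] norm_reflect[OF w, of "x j" "x i"] I
    by (simp_all add: rmap_def add.commute add_diff_eq)
  have "(\<Sum>l\<in>I - {i, j}. c l * (norm (rmap i j \<omega> x l))\<^sup>2) = (\<Sum>l\<in>I - {i, j}. c l * (norm (x l))\<^sup>2)"
    by (intro sum.cong) (auto simp: rmap_def)
  then show ?thesis
    unfolding wsq_def sum_split2[OF I] r by (simp add: left_diff_distrib right_diff_distrib distrib_left)
qed

text \<open>The sphere measure is a measure on the whole space; \<open>rw\<close> replaces the null set of non-unit
  vectors, on which \<open>rmap\<close> is not a reflection, by \<open>0\<close>.\<close>

definition rw :: "real^3 \<Rightarrow> real^3" where "rw \<omega> = (if norm \<omega> = 1 then \<omega> else 0)"

lemma rw_cases: "norm (rw \<omega>) = 1 \<or> rw \<omega> = 0" by (simp add: rw_def)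

lemma rw_measurable [measurable]: "rw \<in> borel_measurable borel"
  unfolding rw_def by measurable

lemma nsq_rmap:
  assumes I: "finite I" "i \<in> I" "j \<in> I" "i \<noteq> j"
  shows "nsq I (rmap i j (rw \<omega>) x) = nsq I x"
  using rw_cases[of \<omega>] wsq_rmap[OF I, of "rw \<omega>" "\<lambda>_. 1" x]
  by (auto simp: rmap_zero nsq_def wsq_def)

lemma ip_rmap:
  assumes I: "finite I" "i \<in> I" "j \<in> I" "i \<noteq> j"
  shows "ip I x (rmap i j \<omega> y) = ip I (rmap i j \<omega> x) y"
proof -
  have "(\<Sum>l\<in>I - {i, j}. x l \<bullet> rmap i j \<omega> y l) = (\<Sum>l\<in>I - {i, j}. rmap i j \<omega> x l \<bullet> y l)"
    by (intro sum.cong) (auto simp: rmap_def)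
  then show ?thesis
    unfolding ip_def sum_split2[OF I] using I
    by (simp add: rmap_def inner_add_left inner_add_right inner_diff_left inner_diff_right
        inner_commute[of "x i" \<omega>] inner_commute[of "x j" \<omega>] mult.commute)
qed

lemma integral_rmap:
  fixes f :: "(nat \<Rightarrow> real^3) \<Rightarrow> real"
  assumes "i \<noteq> j" and [measurable]: "f \<in> borel_measurable gam"
  shows "(\<integral>z. f (rmap i j (rw \<omega>) z) \<partial>gam) = (\<integral>z. f z \<partial>gam)"
proof (cases "norm \<omega> = 1")
  case True
  have "(\<integral>z. f z \<partial>gam) = (\<integral>z. f z \<partial>distr gam gam (rmap i j \<omega>))"
    by (simp only: distr_rmap[OF assms(1) True])
  also have "\<dots> = (\<integral>z. f (rmap i j \<omega> z) \<partial>gam)" by (rule integral_distr) auto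
  finally show ?thesis using True by (simp add: rw_def)
qed (simp add: rw_def rmap_zero)

lemma wsq_bound: "finite I \<Longrightarrow> \<bar>wsq I c x\<bar> \<le> (\<Sum>i\<in>I. \<bar>c i\<bar>) * nsq I x"
  unfolding wsq_def sum_distrib_right
  by (rule order_trans[OF sum_abs], intro sum_mono) (auto simp: abs_mult intro!: mult_left_mono nsq_ge)

definition Rc :: "nat \<Rightarrow> nat \<Rightarrow> (nat \<Rightarrow> real) \<Rightarrow> nat \<Rightarrow> real" where
  "Rc i j c = (\<lambda>l. if l = i then c i + (c j - c i) / 3 else if l = j then c j + (c i - c j) / 3 else c l)"

text \<open>By \<open>sphere_second_moment\<close> the mean change is (c_i - c_j) (|x_j|^2 -
  |x_i|^2) / 3. Sorted by particle, this moves each of the two weights towards the other by a third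
  of their difference.\<close>

lemma integral_wsq_rmap:
  assumes I: "finite I" "i \<in> I" "j \<in> I" "i \<noteq> j"
  shows "(\<integral>\<omega>. wsq I c (rmap i j (rw \<omega>) x) \<partial>sphere_measure) = wsq I (Rc i j c) x"
proof -
  have ii: "integrable sphere_measure (\<lambda>\<omega>. (\<omega> \<bullet> y)\<^sup>2)" for y
  proof (rule SP.integrable_const_bound)
    show "AE \<omega> in sphere_measure. norm ((\<omega> \<bullet> y)\<^sup>2) \<le> (norm y)\<^sup>2"
      using AE_sphere
    proof eventually_elim
      fix \<omega> :: "real^3" assume "norm \<omega> = 1"
      then show "norm ((\<omega> \<bullet> y)\<^sup>2) \<le> (norm y)\<^sup>2"
        using power_mono[OF Cauchy_Schwarz_ineq2 abs_ge_zero, of \<omega> y 2] by simp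
    qed
  qed measurable
  have [measurable]: "(\<lambda>\<omega>. rmap i j (rw \<omega>) x l) \<in> borel_measurable borel" for l
    unfolding rmap_def by measurable
  have m: "(\<lambda>\<omega>. wsq I c (rmap i j (rw \<omega>) x)) \<in> borel_measurable sphere_measure"
    unfolding wsq_def by measurable
  have "(\<integral>\<omega>. wsq I c (rmap i j (rw \<omega>) x) \<partial>sphere_measure)
     = (\<integral>\<omega>. wsq I c x + (c i - c j) * ((\<omega> \<bullet> x j)\<^sup>2 - (\<omega> \<bullet> x i)\<^sup>2) \<partial>sphere_measure)"
  proof (rule integral_cong_AE[OF m])
    show "AE \<omega> in sphere_measure. wsq I c (rmap i j (rw \<omega>) x)
        = wsq I c x + (c i - c j) * ((\<omega> \<bullet> x j)\<^sup>2 - (\<omega> \<bullet> x i)\<^sup>2)"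
      using AE_sphere by eventually_elim (simp add: wsq_rmap[OF I] rw_def)
  qed measurable
  also have "\<dots> = wsq I c x + (c i - c j) * ((norm (x j))\<^sup>2 / 3 - (norm (x i))\<^sup>2 / 3)"
    using ii SP.prob_space by (simp add: sphere_second_moment)
  also have "\<dots> = wsq I (Rc i j c) x"
  proof -
    have "(\<Sum>l\<in>I - {i, j}. Rc i j c l * (norm (x l))\<^sup>2) = (\<Sum>l\<in>I - {i, j}. c l * (norm (x l))\<^sup>2)"
      by (intro sum.cong) (auto simp: Rc_def)
    then show ?thesis
      unfolding wsq_def sum_split2[OF I] using I by (simp add: Rc_def field_simps)
  qed
  finally show ?thesis .
qed

lemma Rop_rw:
  assumes u: "u \<in> borel_measurable gam"
  shows "Rop i j u z = (\<integral>\<omega>. u (rmap i j (rw \<omega>) z) \<partial>sphere_measure)"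
proof -
  note [measurable] = u
  have 1: "(\<lambda>\<omega>. rmap i j \<omega> z) \<in> measurable sphere_measure gam"
    "(\<lambda>\<omega>. rmap i j (rw \<omega>) z) \<in> measurable sphere_measure gam"
    unfolding rmap_def by (rule measurable_gamI; simp)+
  show ?thesis
    unfolding Rop_def using AE_sphere measurable_compose[OF 1(1) u] measurable_compose[OF 1(2) u]
    by (intro integral_cong_AE) (auto simp: rw_def)
qed

text \<open>The gradient of u composed with a reflection is the reflection applied to the gradient
  at the reflected point. Convexity takes the average over \<omega> out of the Fisher information,
  invariance of \<open>gam\<close> removes the reflection of the point, and the reflection left on
  the gradient is averaged by \<open>integral_wsq_rmap\<close>. One gradient \<open>X'\<close> has
  to serve all weights c, because iteration changes the weights while the function stays the
  same.\<close>

lemma Rop_nice: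
  assumes n: "nice I A B C u X" and ij: "i \<in> I" "j \<in> I" "i \<noteq> j" and A: "A > 0"
  shows "\<exists>X'. nice I A B C (Rop i j u) X' \<and>
    (\<forall>c. (\<forall>l. 0 \<le> c l) \<longrightarrow> fisher I c (Rop i j u) X' \<le> fisher I (Rc i j c) u X)"
proof -
  note I = niceD(1)[OF n] ij
  note [measurable] = niceD(3,4)[OF n]
  define U where "U \<omega> z = u (rmap i j (rw \<omega>) z)" for \<omega> z
  define Y where "Y \<omega> z = rmap i j (rw \<omega>) (X (rmap i j (rw \<omega>) z))" for \<omega> z
  have R: "Rop i j u = (\<lambda>z. \<integral>\<omega>. U \<omega> z \<partial>sphere_measure)"
    unfolding U_def by (rule ext) (rule Rop_rw[OF niceD(3)[OF n]])
  have mX: "X \<in> measurable gam gam" by (rule measurable_gamI) (rule niceD(4)[OF n])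
  have mf: "(\<lambda>p. rw (fst p)) \<in> borel_measurable (sphere_measure \<Otimes>\<^sub>M gam)"
    by (rule measurable_compose[OF measurable_fst]) simp
  have mr: "(\<lambda>p. rmap i j (rw (fst p)) (snd p)) \<in> measurable (sphere_measure \<Otimes>\<^sub>M gam) gam"
    by (rule rmap_measurable[OF mf measurable_snd])
  have mU: "(\<lambda>(\<omega>, z). U \<omega> z) \<in> borel_measurable (sphere_measure \<Otimes>\<^sub>M gam)"
    unfolding U_def split_beta' by (rule measurable_compose[OF mr niceD(3)[OF n]])
  have mY0: "(\<lambda>p. Y (fst p) (snd p)) \<in> measurable (sphere_measure \<Otimes>\<^sub>M gam) gam"
    unfolding Y_def by (rule rmap_measurable[OF mf measurable_compose[OF mr mX]])
  have mY: "(\<lambda>(\<omega>, z). Y \<omega> z l) \<in> borel_measurable (sphere_measure \<Otimes>\<^sub>M gam)" for l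
    unfolding split_beta' by (rule gam_component[OF mY0])
  have nn: "nice I A B C (U \<omega>) (Y \<omega>)" for \<omega>
    unfolding U_def Y_def
  proof (rule nice_pullback[OF n])
    show m: "rmap i j (rw \<omega>) \<in> measurable gam gam"
      by (rule rmap_measurable1)
    have "(\<lambda>z. rmap i j (rw \<omega>) (X (rmap i j (rw \<omega>) z))) \<in> measurable gam gam"
      using measurable_compose[OF measurable_compose[OF m mX] m] .
    then show "(\<lambda>z. rmap i j (rw \<omega>) (X (rmap i j (rw \<omega>) z)) l) \<in> borel_measurable gam" for l
      by (rule gam_component)
    show "nsq I (rmap i j (rw \<omega>) e) \<le> nsq I e" for e by (simp add: nsq_rmap[OF I])
  qed (rule rmap_add, rule ip_rmap[OF I])
  let ?X' = "\<lambda>z l. \<integral>\<omega>. Y \<omega> z l \<partial>sphere_measure"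
  have "fisher I c (Rop i j u) ?X' \<le> fisher I (Rc i j c) u X" if c: "\<forall>l. 0 \<le> c l" for c
  proof -
    interpret P: pair_sigma_finite sphere_measure gam
      by (intro pair_sigma_finite.intro prob_space_imp_sigma_finite prob_space_sphere prob_space_gam)
    have SG: "prob_space (sphere_measure \<Otimes>\<^sub>M gam)"
      by (intro prob_space_pair prob_space_sphere prob_space_gam)
    have "fisher I c (Rop i j u) ?X' \<le> (\<integral>\<omega>. fisher I c (U \<omega>) (Y \<omega>) \<partial>sphere_measure)"
      unfolding R by (rule fisher_mix(1)[OF prob_space_sphere mU mY nn A]) (use c in auto)
    also have "\<dots> = (\<integral>\<omega>. (\<integral>z. wsq I c (rmap i j (rw \<omega>) (X z)) / u z \<partial>gam) \<partial>sphere_measure)"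
    proof (rule Bochner_Integration.integral_cong[OF refl])
      fix \<omega>
      have m: "rmap i j (rw \<omega>) \<in> measurable gam gam"
        by (rule rmap_measurable1)
      have "(\<lambda>z. rmap i j (rw \<omega>) (X z)) \<in> measurable gam gam"
        using measurable_compose[OF mX m] .
      then have [measurable]: "(\<lambda>z. rmap i j (rw \<omega>) (X z) l) \<in> borel_measurable gam" for l
        by (rule gam_component)
      have "(\<lambda>z. wsq I c (rmap i j (rw \<omega>) (X z)) / u z) \<in> borel_measurable gam"
        unfolding wsq_def by measurable
      from integral_rmap[OF \<open>i \<noteq> j\<close> this, of \<omega>]
      show "fisher I c (U \<omega>) (Y \<omega>) = (\<integral>z. wsq I c (rmap i j (rw \<omega>) (X z)) / u z \<partial>gam)"
        unfolding fisher_def U_def Y_def .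
    qed
    also have "\<dots> = (\<integral>z. (\<integral>\<omega>. wsq I c (rmap i j (rw \<omega>) (X z)) / u z \<partial>sphere_measure) \<partial>gam)"
    proof (rule P.Fubini_integral[symmetric])
      let ?D = "(\<Sum>i\<in>I. \<bar>c i\<bar>) * (B - A + C)\<^sup>2 / A"
      have "(\<lambda>p. rmap i j (rw (fst p)) (X (snd p))) \<in> measurable (sphere_measure \<Otimes>\<^sub>M gam) gam"
        by (rule rmap_measurable[OF mf measurable_compose[OF measurable_snd mX]])
      then have [measurable]: "(\<lambda>p. rmap i j (rw (fst p)) (X (snd p)) l) \<in> borel_measurable (sphere_measure \<Otimes>\<^sub>M gam)" for l
        by (rule gam_component)
      have bd: "\<bar>wsq I c (rmap i j (rw \<omega>) (X z)) / u z\<bar> \<le> ?D" for \<omega> z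
      proof -
        have u: "u z \<ge> A" using niceD[OF n] by auto
        have "\<bar>wsq I c (rmap i j (rw \<omega>) (X z))\<bar> \<le> (\<Sum>i\<in>I. \<bar>c i\<bar>) * nsq I (rmap i j (rw \<omega>) (X z))"
          by (rule wsq_bound[OF I(1)])
        also have "\<dots> = (\<Sum>i\<in>I. \<bar>c i\<bar>) * (sqrt (nsq I (X z)))\<^sup>2" by (simp add: nsq_rmap[OF I])
        also have "\<dots> \<le> (\<Sum>i\<in>I. \<bar>c i\<bar>) * (B - A + C)\<^sup>2"
          using nice_grad_bound[OF n] by (intro mult_left_mono power_mono sum_nonneg) auto
        finally have "\<bar>wsq I c (rmap i j (rw \<omega>) (X z))\<bar> / u z \<le> ?D"
          using u A by (intro frac_le) (auto intro!: sum_nonneg mult_nonneg_nonneg)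
        then show ?thesis using u A by simp
      qed
      show "integrable (sphere_measure \<Otimes>\<^sub>M gam) (\<lambda>(\<omega>, z). wsq I c (rmap i j (rw \<omega>) (X z)) / u z)"
        unfolding split_beta'
      proof (rule finite_measure.integrable_const_bound[OF prob_space.finite_measure[OF SG]])
        show "AE p in sphere_measure \<Otimes>\<^sub>M gam. norm (wsq I c (rmap i j (rw (fst p)) (X (snd p))) / u (snd p)) \<le> ?D"
          using bd by simp
        show "(\<lambda>p. wsq I c (rmap i j (rw (fst p)) (X (snd p))) / u (snd p)) \<in> borel_measurable (sphere_measure \<Otimes>\<^sub>M gam)"
          unfolding wsq_def by measurable
      qed
    qed
    also have "\<dots> = fisher I (Rc i j c) u X"
      unfolding fisher_def by (simp add: integral_wsq_rmap[OF I])
    finally show ?thesis .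
  qed
  moreover have "nice I A B C (Rop i j u) ?X'"
    unfolding R by (rule nice_mix[OF prob_space_sphere mU mY nn])
  ultimately show ?thesis by blast
qed

section \<open>Averaging over the reservoir\<close>

definition Eop :: "nat \<Rightarrow> ((nat \<Rightarrow> real^3) \<Rightarrow> real) \<Rightarrow> (nat \<Rightarrow> real^3) \<Rightarrow> real" where
  "Eop M u z = (\<integral>w. u (\<lambda>i. if i < M then z i else w i) \<partial>gam)"

lemma distr_splice: "distr (gam \<Otimes>\<^sub>M gam) gam (\<lambda>(z, w) i. if i < M then z i else w i) = gam"
proof -
  have "distr (gam \<Otimes>\<^sub>M gam) gam (\<lambda>(z, w) i. (if i < M then fst else snd) (z i, w i)) = gam"
  proof (rule distr_coordwise)
    fix i :: nat
    have "(\<lambda>(x, y). 1 *\<^sub>R x + 0 *\<^sub>R y) = (fst :: (real^3) \<times> (real^3) \<Rightarrow> _)"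
      "(\<lambda>(x, y). 0 *\<^sub>R x + 1 *\<^sub>R y) = (snd :: (real^3) \<times> (real^3) \<Rightarrow> _)" by auto
    then show "distr (gamma3 \<Otimes>\<^sub>M gamma3) borel (if i < M then fst else snd) = gamma3"
      using distr_gamma3_rotate[of 1 0] distr_gamma3_rotate[of 0 1] by simp
  qed auto
  then show ?thesis by (simp add: if_distribR split_beta' cong: if_cong)
qed

lemma wsq_quotient_Fubini:
  assumes n: "nice I A B C u X" and A: "A > 0" and K: "prob_space K"
    and m: "(\<lambda>(w, z). \<Phi> w z) \<in> measurable (K \<Otimes>\<^sub>M gam) gam"
    and d: "distr (K \<Otimes>\<^sub>M gam) gam (\<lambda>(w, z). \<Phi> w z) = gam"
  shows "(\<integral>w. (\<integral>z. wsq I c (X (\<Phi> w z)) / u (\<Phi> w z) \<partial>gam) \<partial>K) = fisher I c u X"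
proof -
  interpret P: pair_sigma_finite K gam
    by (intro pair_sigma_finite.intro prob_space_imp_sigma_finite K prob_space_gam)
  have KG: "prob_space (K \<Otimes>\<^sub>M gam)" by (intro prob_space_pair K prob_space_gam)
  let ?h = "\<lambda>z. wsq I c (X z) / u z"
  have mh: "?h \<in> borel_measurable gam" by (rule wsq_quotient_measurable[OF n])
  have i: "integrable (K \<Otimes>\<^sub>M gam) (\<lambda>(w, z). ?h (\<Phi> w z))"
    using wsq_quotient_bound[OF n A, where c=c] measurable_compose[OF m mh]
    by (intro finite_measure.integrable_const_bound[OF prob_space.finite_measure[OF KG]] AE_I2)
       (auto simp: split_beta')
  have "(\<integral>w. (\<integral>z. ?h (\<Phi> w z) \<partial>gam) \<partial>K) = (\<integral>p. ?h ((\<lambda>(w, z). \<Phi> w z) p) \<partial>(K \<Otimes>\<^sub>M gam))"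
    using P.integral_fst[OF i] by (simp add: split_beta')
  also have "\<dots> = (\<integral>z. ?h z \<partial>distr (K \<Otimes>\<^sub>M gam) gam (\<lambda>(w, z). \<Phi> w z))"
    by (rule integral_distr[OF m mh, symmetric])
  finally show ?thesis unfolding fisher_def d .
qed

lemma splice_measurable:
  "(\<lambda>(w, z) i. if i < M then z i else w i) \<in> measurable (gam \<Otimes>\<^sub>M gam) gam"
  by (rule measurable_gamI) (auto simp: split_beta')

lemma distr_splice':
  "distr (gam \<Otimes>\<^sub>M gam) gam (\<lambda>(w, z) i. if i < M then z i else w i) = gam"
proof -
  have PP: "pair_sigma_finite gam gam"
    by (intro pair_sigma_finite.intro prob_space_imp_sigma_finite prob_space_gam)
  have m: "(\<lambda>(z, w) i. if i < M then z i else w i) \<in> measurable (gam \<Otimes>\<^sub>M gam) gam"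
    by (rule measurable_gamI) (auto simp: split_beta')
  have "distr (gam \<Otimes>\<^sub>M gam) gam (\<lambda>(z, w) i. if i < M then z i else w i)
     = distr (distr (gam \<Otimes>\<^sub>M gam) (gam \<Otimes>\<^sub>M gam) (\<lambda>(x, y). (y, x))) gam (\<lambda>(z, w) i. if i < M then z i else w i)"
    by (subst pair_sigma_finite.distr_pair_swap[OF PP]) (rule refl)
  also have "\<dots> = distr (gam \<Otimes>\<^sub>M gam) gam ((\<lambda>(z, w) i. if i < M then z i else w i) \<circ> (\<lambda>(x, y). (y, x)))"
    by (rule distr_distr[OF m measurable_pair_swap'])
  also have "(\<lambda>(z, w) i. if i < M then z i else w i) \<circ> (\<lambda>(x, y). (y, x)) = (\<lambda>(w, z) i. if i < M then z i else w i)"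
    by auto
  finally show ?thesis by (simp add: distr_splice)
qed

text \<open>For a frozen reservoir the splicing has the projection onto the system as its linear
  part. It deletes the reservoir components of the gradient, so that weights there count as 0;
  convexity and the invariance of the spliced law do the rest.\<close>

lemma Eop_nice:
  assumes n: "nice I A B C u X" and A: "A > 0"
  shows "\<exists>X'. nice I A B C (Eop M u) X' \<and>
    (\<forall>c. (\<forall>l. 0 \<le> c l) \<longrightarrow> fisher I c (Eop M u) X' \<le> fisher I (\<lambda>i. if i < M then c i else 0) u X)"
proof -
  define \<phi> where "\<phi> w z = (\<lambda>i. if i < M then z i else w i)" for w z :: "nat \<Rightarrow> real^3"
  define \<l> where "\<l> e = (\<lambda>i. if i < M then e i else 0)" for e :: "nat \<Rightarrow> real^3"
  define U where "U w z = u (\<phi> w z)" for w z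
  define Y where "Y w z = \<l> (X (\<phi> w z))" for w z
  note [measurable] = niceD(3,4)[OF n]
  have m: "(\<lambda>(w, z). \<phi> w z) \<in> measurable (gam \<Otimes>\<^sub>M gam) gam"
    unfolding \<phi>_def by (rule splice_measurable)
  have m1: "\<phi> w \<in> measurable gam gam" for w
    unfolding \<phi>_def by (rule measurable_gamI) simp
  have mX: "X \<in> measurable gam gam" by (rule measurable_gamI) (rule niceD(4)[OF n])
  have mU: "(\<lambda>(w, z). U w z) \<in> borel_measurable (gam \<Otimes>\<^sub>M gam)"
    using measurable_compose[OF m niceD(3)[OF n]] by (simp add: U_def split_beta')
  have mY: "(\<lambda>(w, z). Y w z l) \<in> borel_measurable (gam \<Otimes>\<^sub>M gam)" for l
    using measurable_compose[OF m niceD(4)[OF n, of l]] by (simp add: Y_def \<l>_def split_beta')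
  have nn: "nice I A B C (U w) (Y w)" for w
    unfolding U_def Y_def
  proof (rule nice_pullback[OF n m1])
    show "(\<lambda>z. \<l> (X (\<phi> w z)) i) \<in> borel_measurable gam" for i
      using measurable_compose[OF m1 niceD(4)[OF n, of i], of w] by (simp add: \<l>_def)
    show "\<phi> w (\<lambda>i. z i + e i) = (\<lambda>i. \<phi> w z i + \<l> e i)" for z e
      by (auto simp: \<phi>_def \<l>_def)
    show "nsq I (\<l> e) \<le> nsq I e" for e unfolding nsq_def by (rule sum_mono) (auto simp: \<l>_def)
    show "ip I x (\<l> e) = ip I (\<l> x) e" for x e unfolding ip_def by (rule sum.cong) (auto simp: \<l>_def)
  qed
  have E: "Eop M u = (\<lambda>z. \<integral>w. U w z \<partial>gam)" by (simp add: Eop_def U_def \<phi>_def fun_eq_iff)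
  let ?X' = "\<lambda>z l. \<integral>w. Y w z l \<partial>gam"
  have "fisher I c (Eop M u) ?X' \<le> fisher I (\<lambda>i. if i < M then c i else 0) u X" if c: "\<forall>l. 0 \<le> c l" for c
  proof -
    have w: "wsq I c (\<l> x) = wsq I (\<lambda>i. if i < M then c i else 0) x" for x
      unfolding wsq_def by (rule sum.cong) (auto simp: \<l>_def)
    have "fisher I c (Eop M u) ?X' \<le> (\<integral>w. fisher I c (U w) (Y w) \<partial>gam)"
      unfolding E by (rule fisher_mix(1)[OF prob_space_gam mU mY nn A]) (use c in auto)
    also have "\<dots> = (\<integral>w. (\<integral>z. wsq I (\<lambda>i. if i < M then c i else 0) (X (\<phi> w z)) / u (\<phi> w z) \<partial>gam) \<partial>gam)"
      unfolding fisher_def U_def Y_def w ..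
    also have "\<dots> = fisher I (\<lambda>i. if i < M then c i else 0) u X"
      by (rule wsq_quotient_Fubini[OF n A prob_space_gam m]) (simp add: \<phi>_def distr_splice')
    finally show ?thesis .
  qed
  moreover have "nice I A B C (Eop M u) ?X'"
    unfolding E by (rule nice_mix[OF prob_space_gam mU mY nn])
  ultimately show ?thesis by blast
qed

text \<open>Mehler's formula: for a = exp (- s) and a^2 + b^2 = 1 this is the Ornstein--Uhlenbeck
  semigroup at time s, with \<open>gam\<close> as invariant law.\<close>

definition Pop :: "real \<Rightarrow> real \<Rightarrow> ((nat \<Rightarrow> real^3) \<Rightarrow> real) \<Rightarrow> (nat \<Rightarrow> real^3) \<Rightarrow> real" where
  "Pop a b u z = (\<integral>g. u (\<lambda>i. a *\<^sub>R z i + b *\<^sub>R g i) \<partial>gam)"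

lemma lin_measurable:
  "(\<lambda>(g, z) i. a *\<^sub>R z i + b *\<^sub>R g i) \<in> measurable (gam \<Otimes>\<^sub>M gam) gam"
  by (rule measurable_gamI) (auto simp: split_beta')

lemma distr_lin:
  assumes "a\<^sup>2 + b\<^sup>2 = 1"
  shows "distr (gam \<Otimes>\<^sub>M gam) gam (\<lambda>(g, z) i. a *\<^sub>R z i + b *\<^sub>R g i) = gam"
proof -
  have "distr (gam \<Otimes>\<^sub>M gam) gam (\<lambda>(g, z) i. (\<lambda>i (g, z). b *\<^sub>R g + a *\<^sub>R z) i (g i, z i)) = gam"
    using distr_gamma3_rotate[of b a] assms by (intro distr_coordwise) (auto simp: add.commute)
  then show ?thesis by (simp add: add.commute)
qed

lemma Pop_nice:
  assumes n: "nice I A B C u X" and a: "\<bar>a\<bar> \<le> 1"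
  shows "\<exists>X'. nice I A B C (Pop a b u) X'"
proof -
  define \<phi> where "\<phi> g z = (\<lambda>i. a *\<^sub>R z i + b *\<^sub>R g i)" for g z :: "nat \<Rightarrow> real^3"
  define \<l> where "\<l> e = (\<lambda>i. a *\<^sub>R e i)" for e :: "nat \<Rightarrow> real^3"
  define U where "U w z = u (\<phi> w z)" for w z
  define Y where "Y w z = \<l> (X (\<phi> w z))" for w z
  note [measurable] = niceD(3,4)[OF n]
  have m: "(\<lambda>(w, z). \<phi> w z) \<in> measurable (gam \<Otimes>\<^sub>M gam) gam"
    unfolding \<phi>_def by (rule lin_measurable)
  have m1: "\<phi> w \<in> measurable gam gam" for w
    unfolding \<phi>_def by (rule measurable_gamI) simp
  have mU: "(\<lambda>(w, z). U w z) \<in> borel_measurable (gam \<Otimes>\<^sub>M gam)"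
    using measurable_compose[OF m niceD(3)[OF n]] by (simp add: U_def split_beta')
  have mY: "(\<lambda>(w, z). Y w z l) \<in> borel_measurable (gam \<Otimes>\<^sub>M gam)" for l
    using measurable_compose[OF m niceD(4)[OF n, of l]] by (simp add: Y_def \<l>_def split_beta')
  have nn: "nice I A B C (U w) (Y w)" for w
    unfolding U_def Y_def
  proof (rule nice_pullback[OF n m1])
    show "(\<lambda>z. \<l> (X (\<phi> w z)) i) \<in> borel_measurable gam" for i
      using measurable_compose[OF m1 niceD(4)[OF n, of i], of w] by (simp add: \<l>_def)
    show "\<phi> w (\<lambda>i. z i + e i) = (\<lambda>i. \<phi> w z i + \<l> e i)" for z e
      by (auto simp: \<phi>_def \<l>_def scaleR_add_right)
    show "nsq I (\<l> e) \<le> nsq I e" for e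
      using a mult_right_mono[of "a\<^sup>2" 1 "nsq I e"] by (simp add: \<l>_def nsq_scale abs_square_le_1)
    show "ip I x (\<l> e) = ip I (\<l> x) e" for x e unfolding ip_def by (rule sum.cong) (auto simp: \<l>_def)
  qed
  have E: "Pop a b u = (\<lambda>z. \<integral>w. U w z \<partial>gam)" by (simp add: Pop_def U_def \<phi>_def fun_eq_iff)
  show ?thesis
    unfolding E by (rule exI, rule nice_mix[OF prob_space_gam mU mY nn])
qed

lemma nice_integrable:
  assumes "nice I A B C u X" shows "integrable gam u"
proof (rule GP.P.integrable_const_bound)
  show "AE z in gam. norm (u z) \<le> max \<bar>A\<bar> \<bar>B\<bar>"
  proof (rule AE_I2)
    fix z show "norm (u z) \<le> max \<bar>A\<bar> \<bar>B\<bar>"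
      using niceD(5,6)[OF assms, of z] by (auto simp: abs_le_iff le_max_iff_disj)
  qed
qed (rule niceD(3)[OF assms])

lemma Pop_integrable:
  assumes "nice I A B C u X" shows "integrable gam (\<lambda>g. u (\<lambda>i. a *\<^sub>R z i + b *\<^sub>R g i))"
proof (rule GP.P.integrable_const_bound)
  show "AE g in gam. norm (u (\<lambda>i. a *\<^sub>R z i + b *\<^sub>R g i)) \<le> max \<bar>A\<bar> \<bar>B\<bar>"
  proof (rule AE_I2)
    fix g show "norm (u (\<lambda>i. a *\<^sub>R z i + b *\<^sub>R g i)) \<le> max \<bar>A\<bar> \<bar>B\<bar>"
      using niceD(5,6)[OF assms, of "\<lambda>i. a *\<^sub>R z i + b *\<^sub>R g i"] by (auto simp: abs_le_iff le_max_iff_disj)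
  qed
  have "(\<lambda>g i. a *\<^sub>R z i + b *\<^sub>R g i) \<in> measurable gam gam" by (rule measurable_gamI) simp
  from measurable_compose[OF this niceD(3)[OF assms]]
  show "(\<lambda>g. u (\<lambda>i. a *\<^sub>R z i + b *\<^sub>R g i)) \<in> borel_measurable gam" .
qed

text \<open>Displacements are scaled by a before u sees them. The factor |a| gained in each step is
  what finally drives the iterates to a constant.\<close>

lemma Pop_lipschitz:
  assumes n: "nice I A B C u X"
    and L: "\<And>z e. \<bar>u (\<lambda>i. z i + e i) - u z\<bar> \<le> L * sqrt (nsq I e)"
  shows "\<bar>Pop a b u (\<lambda>i. z i + e i) - Pop a b u z\<bar> \<le> (\<bar>a\<bar> * L) * sqrt (nsq I e)"
proof -
  let ?f = "\<lambda>z g. u (\<lambda>i. a *\<^sub>R z i + b *\<^sub>R g i)"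
  have i: "integrable gam (?f z)" for z by (rule Pop_integrable[OF n])
  have "\<bar>?f (\<lambda>i. z i + e i) g - ?f z g\<bar> \<le> \<bar>a\<bar> * L * sqrt (nsq I e)" for g
  proof -
    have "?f (\<lambda>i. z i + e i) g = u (\<lambda>i. (a *\<^sub>R z i + b *\<^sub>R g i) + a *\<^sub>R e i)"
      by (simp add: scaleR_add_right add_ac)
    then show ?thesis
      using L[of "\<lambda>i. a *\<^sub>R z i + b *\<^sub>R g i" "\<lambda>i. a *\<^sub>R e i"]
      by (simp add: nsq_scale real_sqrt_mult mult_ac)
  qed
  then have le: "(\<integral>g. \<bar>?f (\<lambda>i. z i + e i) g - ?f z g\<bar> \<partial>gam) \<le> \<bar>a\<bar> * L * sqrt (nsq I e)"
    using i by (intro GP.P.integral_le_const) auto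
  have d: "Pop a b u (\<lambda>i. z i + e i) - Pop a b u z = (\<integral>g. ?f (\<lambda>i. z i + e i) g - ?f z g \<partial>gam)"
    unfolding Pop_def by (rule Bochner_Integration.integral_diff[OF i i, symmetric])
  show ?thesis unfolding d by (rule order_trans[OF integral_abs_bound le])
qed

lemma Pop_mean:
  assumes m: "h \<in> borel_measurable gam" and h: "\<And>z. \<bar>h z\<bar> \<le> D" and ab: "a\<^sup>2 + b\<^sup>2 = 1"
  shows "(\<integral>z. Pop a b h z \<partial>gam) = (\<integral>z. h z \<partial>gam)" and "integrable gam (Pop a b h)"
proof -
  interpret P: pair_sigma_finite gam gam
    by (intro pair_sigma_finite.intro prob_space_imp_sigma_finite prob_space_gam)
  have GG: "prob_space (gam \<Otimes>\<^sub>M gam)" by (intro prob_space_pair prob_space_gam)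
  have i: "integrable (gam \<Otimes>\<^sub>M gam) (\<lambda>(g, z). h (\<lambda>i. a *\<^sub>R z i + b *\<^sub>R g i))"
  proof (rule finite_measure.integrable_const_bound[OF prob_space.finite_measure[OF GG]])
    show "AE p in gam \<Otimes>\<^sub>M gam. norm (case p of (g, z) \<Rightarrow> h (\<lambda>i. a *\<^sub>R z i + b *\<^sub>R g i)) \<le> D"
      using h by (intro AE_I2) (auto simp: split_beta')
    show "(\<lambda>(g, z). h (\<lambda>i. a *\<^sub>R z i + b *\<^sub>R g i)) \<in> borel_measurable (gam \<Otimes>\<^sub>M gam)"
      using measurable_compose[OF lin_measurable m] by (simp add: split_beta')
  qed
  have "(\<integral>z. Pop a b h z \<partial>gam) = (\<integral>p. (case p of (g, z) \<Rightarrow> h (\<lambda>i. a *\<^sub>R z i + b *\<^sub>R g i)) \<partial>(gam \<Otimes>\<^sub>M gam))"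
    unfolding Pop_def using P.integral_snd[OF i] by simp
  also have "\<dots> = (\<integral>z. h z \<partial>distr (gam \<Otimes>\<^sub>M gam) gam (\<lambda>(g, z) i. a *\<^sub>R z i + b *\<^sub>R g i))"
    by (subst integral_distr[OF lin_measurable m]) (simp add: split_beta')
  finally show "(\<integral>z. Pop a b h z \<partial>gam) = (\<integral>z. h z \<partial>gam)" by (simp only: distr_lin[OF ab])
  show "integrable gam (Pop a b h)"
    unfolding Pop_def[abs_def] using P.integrable_snd[OF i] by simp
qed

section \<open>Entropy loss under the Ornstein--Uhlenbeck semigroup\<close>

definition Psi :: "real \<Rightarrow> real" where "Psi x = x * ln x"

lemma Psi_measurable [measurable]: "Psi \<in> borel_measurable borel"
  unfolding Psi_def by measurable

text \<open>The difference of \<open>Psi\<close> and its tangent at q is p ln (p / q) - (p - q). The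
  inequality ln s \<le> s - 1 is used at s = q / p for the lower bound and at s = p / q for the
  upper one.\<close>

lemma Psi_tangent:
  assumes "p > 0" "q > 0"
  shows "0 \<le> Psi p - Psi q - (ln q + 1) * (p - q)" "Psi p - Psi q - (ln q + 1) * (p - q) \<le> (p - q)\<^sup>2 / q"
proof -
  have e: "Psi p - Psi q - (ln q + 1) * (p - q) = p * ln (p / q) - (p - q)"
    using assms by (simp add: Psi_def ln_div algebra_simps)
  have "ln (q / p) \<le> q / p - 1" using assms by (intro ln_le_minus_one) auto
  then have "p * ln (q / p) \<le> p * (q / p - 1)" using assms by (intro mult_left_mono) auto
  then have "p * ln (q / p) \<le> q - p" using assms by (simp add: right_diff_distrib)
  moreover have "ln (q / p) = - ln (p / q)" using assms by (simp add: ln_div)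
  ultimately show "0 \<le> Psi p - Psi q - (ln q + 1) * (p - q)" unfolding e by simp
  have "ln (p / q) \<le> p / q - 1" using assms by (intro ln_le_minus_one) auto
  then have "p * ln (p / q) \<le> p * (p / q - 1)" using assms by (intro mult_left_mono) auto
  also have "\<dots> = (p - q)\<^sup>2 / q + (p - q)" using assms by (simp add: power2_eq_square field_simps)
  finally show "Psi p - Psi q - (ln q + 1) * (p - q) \<le> (p - q)\<^sup>2 / q" unfolding e by simp
qed

text \<open>The derivative of the remainder is ln (x / q) - (x / q - 1), which ln s \<le> s - 1, at
  x / q and at q / x, bounds by (x - q)^2 / (x q). The mean value theorem adds one more factor |p -
  q|.\<close>

lemma Psi_taylor:
  assumes A: "0 < A" "A \<le> p" "A \<le> q"
  shows "\<bar>Psi p - Psi q - (ln q + 1) * (p - q) - (p - q)\<^sup>2 / (2 * q)\<bar> \<le> \<bar>p - q\<bar> ^ 3 / A\<^sup>2"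
proof -
  define f where "f x = Psi x - Psi q - (ln q + 1) * (x - q) - (x - q)\<^sup>2 / (2 * q)" for x
  define f' where "f' x = ln x + 1 - (ln q + 1) - (x - q) / q" for x
  have d: "(f has_real_derivative f' x) (at x)" if "x \<ge> A" for x
    unfolding f_def Psi_def f'_def using that A
    by (auto intro!: derivative_eq_intros simp: field_simps)
  have f'b: "\<bar>f' x\<bar> \<le> (x - q)\<^sup>2 / A\<^sup>2" if "x \<ge> A" for x
  proof -
    have x: "x > 0" "q > 0" using that A by auto
    have e: "f' x = ln (x / q) - (x / q - 1)" using x by (simp add: f'_def ln_div diff_divide_distrib)
    have "ln (x / q) \<le> x / q - 1" using x by (intro ln_le_minus_one) auto
    moreover have "ln (q / x) \<le> q / x - 1" using x by (intro ln_le_minus_one) auto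
    then have "- ln (x / q) \<le> q / x - 1" using x by (simp add: ln_div)
    ultimately have "\<bar>f' x\<bar> \<le> q / x - 1 + (x / q - 1)" unfolding e by linarith
    also have "\<dots> = (x - q)\<^sup>2 / (x * q)" using x by (simp add: field_simps power2_eq_square)
    also have "\<dots> \<le> (x - q)\<^sup>2 / A\<^sup>2"
      unfolding power2_eq_square[of A] using that A by (intro divide_left_mono mult_mono) auto
    finally show ?thesis .
  qed
  have f0: "f q = 0" by (simp add: f_def)
  have mvt: "\<exists>\<xi>. \<xi> \<ge> A \<and> \<bar>\<xi> - q\<bar> \<le> \<bar>p - q\<bar> \<and> f p = f' \<xi> * (p - q)"
  proof (cases p q rule: linorder_cases)
    case less
    obtain \<xi> where "\<xi> > p" "\<xi> < q" "f q - f p = (q - p) * f' \<xi>"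
      using MVT2[OF less, of f f'] d order_trans[OF A(2)] by blast
    moreover from this f0 have "f p = f' \<xi> * (p - q)" by (simp add: algebra_simps)
    ultimately show ?thesis using A by (intro exI[of _ \<xi>]) auto
  next
    case equal then show ?thesis using A f0 by auto
  next
    case greater
    obtain \<xi> where "\<xi> > q" "\<xi> < p" "f p - f q = (p - q) * f' \<xi>"
      using MVT2[OF greater, of f f'] d order_trans[OF A(3)] by blast
    moreover from this f0 have "f p = f' \<xi> * (p - q)" by (simp add: algebra_simps)
    ultimately show ?thesis using A by (intro exI[of _ \<xi>]) auto
  qed
  then obtain \<xi> where x: "\<xi> \<ge> A" "\<bar>\<xi> - q\<bar> \<le> \<bar>p - q\<bar>" "f p = f' \<xi> * (p - q)" by blast
  have "\<bar>f' \<xi>\<bar> \<le> (\<xi> - q)\<^sup>2 / A\<^sup>2" by (rule f'b[OF x(1)])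
  also have "\<dots> \<le> (p - q)\<^sup>2 / A\<^sup>2"
    using x(2) by (intro divide_right_mono) (auto simp: abs_le_square_iff)
  finally have "\<bar>f p\<bar> \<le> (p - q)\<^sup>2 / A\<^sup>2 * \<bar>p - q\<bar>"
    unfolding x(3) abs_mult by (rule mult_right_mono) auto
  moreover have "\<bar>p - q\<bar> ^ 3 = (p - q)\<^sup>2 * \<bar>p - q\<bar>"
    unfolding power3_eq_cube power2_eq_square by simp
  ultimately show ?thesis unfolding f_def by simp
qed

lemma nsq_triangle: "\<bar>sqrt (nsq I x) - sqrt (nsq I y)\<bar> \<le> sqrt (nsq I (\<lambda>i. x i - y i))"
proof -
  have t: "sqrt (nsq I (\<lambda>i. u i + v i)) \<le> sqrt (nsq I u) + sqrt (nsq I v)" for u v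
  proof -
    have "sqrt (nsq I (\<lambda>i. u i + v i)) \<le> L2_set (\<lambda>i. norm (u i) + norm (v i)) I"
      unfolding L2_set_def nsq_def
      by (intro real_sqrt_le_mono sum_mono power_mono norm_triangle_ineq) auto
    also have "\<dots> \<le> L2_set (\<lambda>i. norm (u i)) I + L2_set (\<lambda>i. norm (v i)) I"
      by (rule L2_set_triangle_ineq)
    finally show ?thesis by (simp add: L2_set_def nsq_def)
  qed
  have "nsq I (\<lambda>i. y i - x i) = nsq I (\<lambda>i. x i - y i)"
    by (simp add: nsq_def norm_minus_commute)
  then show ?thesis using t[of "\<lambda>i. x i - y i" y] t[of "\<lambda>i. y i - x i" x] by simp
qed

section \<open>Moments of Gaussian displacements\<close>

lemma integrable_poly:
  assumes I: "finite I" and m: "f \<in> borel_measurable gam"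
    and b: "\<And>g. \<bar>f g\<bar> \<le> K * (1 + nsq I g) ^ 3"
  shows "integrable gam f"
proof (rule Bochner_Integration.integrable_bound[OF integrable_mult_right[OF integrable_nsq_power[OF I], of K] m])
  show "AE g in gam. norm (f g) \<le> norm (K * (1 + nsq I g) ^ 3)"
    using b by (intro AE_I2) (auto intro: order_trans[OF _ abs_ge_self])
qed

lemma nsq_powers:
  shows "nsq I g \<le> (1 + nsq I g) ^ 3" "sqrt (nsq I g) \<le> 1 + nsq I g" "1 + nsq I g \<le> (1 + nsq I g) ^ 3"
    "(1 + nsq I g)\<^sup>2 \<le> (1 + nsq I g) ^ 3"
proof -
  let ?t = "1 + nsq I g"
  have t: "?t \<ge> 1" by simp
  show 3: "?t \<le> ?t ^ 3" using power_increasing[of 1 3 ?t] t by simp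
  then show "nsq I g \<le> ?t ^ 3" by linarith
  show "?t\<^sup>2 \<le> ?t ^ 3" using t by (intro power_increasing) auto
  have "nsq I g \<le> ?t\<^sup>2" using power_increasing[of 1 2 ?t] t by simp
  then show "sqrt (nsq I g) \<le> 1 + nsq I g" by (intro real_le_lsqrt) auto
qed

lemma integral_gam_component:
  fixes f :: "real^3 \<Rightarrow> real"
  assumes [measurable]: "f \<in> borel_measurable borel"
  shows "(\<integral>g. f (g i) \<partial>gam) = (\<integral>x. f x \<partial>gamma3)"
proof -
  have "(\<integral>x. f x \<partial>gamma3) = (\<integral>x. f x \<partial>distr gam gamma3 (\<lambda>g. g i))"
    by (simp only: GP.PiM_component[OF UNIV_I])
  also have "\<dots> = (\<integral>g. f (g i) \<partial>gam)" by (rule integral_distr) auto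
  finally show ?thesis by simp
qed

lemma integrable_gam_component:
  fixes f :: "real^3 \<Rightarrow> real"
  assumes [measurable]: "f \<in> borel_measurable borel"
  shows "integrable gam (\<lambda>g. f (g i)) \<longleftrightarrow> integrable gamma3 f"
proof -
  have "integrable gamma3 f \<longleftrightarrow> integrable (distr gam gamma3 (\<lambda>g. g i)) f"
    by (simp only: GP.PiM_component[OF UNIV_I])
  also have "\<dots> \<longleftrightarrow> integrable gam (\<lambda>g. f (g i))" by (rule integrable_distr_eq) auto
  finally show ?thesis by simp
qed

text \<open>The variance of one coordinate of \<open>gamma3\<close>. It multiplies the Fisher
  information on both sides of the comparison, so only its sign matters there.\<close>

definition kap :: real where "kap = (\<integral>w. (norm w)\<^sup>2 \<partial>gamma3) / 3"

lemma kap_nonneg: "kap \<ge> 0" by (simp add: kap_def)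

lemma gamma3_mean: "(\<integral>w. x \<bullet> w \<partial>gamma3) = 0"
proof -
  have T: "orthogonal_transformation (\<lambda>w::real^3. - w)"
    by (simp add: orthogonal_transformation_def linear_iff)
  have "(\<integral>w. x \<bullet> w \<partial>gamma3) = (\<integral>w. x \<bullet> w \<partial>distr gamma3 borel (\<lambda>w. - w))"
    by (simp only: distr_orthogonal_gamma3[OF T])
  also have "\<dots> = (\<integral>w. x \<bullet> - w \<partial>gamma3)" by (rule integral_distr) auto
  finally show ?thesis by simp
qed

lemma integrable_gamma3_sq: "integrable gamma3 (\<lambda>w. (norm w)\<^sup>2)"
proof -
  have "integrable gam (\<lambda>g. (norm (g 0))\<^sup>2)"
  proof (rule integrable_poly[of "{0}" _ 1])
    show "\<bar>(norm (g 0))\<^sup>2\<bar> \<le> 1 * (1 + nsq {0} g) ^ 3" for g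
      using nsq_powers(1)[of "{0}" g] by (simp add: nsq_def)
  qed auto
  then show ?thesis by (subst (asm) integrable_gam_component) auto
qed

lemma ip_measurable [measurable]: "(\<lambda>g. ip I x g) \<in> borel_measurable gam"
  unfolding ip_def by measurable

lemma ip_sq_le: "(ip I x g)\<^sup>2 \<le> nsq I x * nsq I g"
  using power_mono[OF ip_bound abs_ge_zero, of I x g 2] by (simp add: power_mult_distrib)

lemma integrable_ip: "finite I \<Longrightarrow> integrable gam (\<lambda>g. ip I x g)"
proof (rule integrable_poly)
  fix g
  have "\<bar>ip I x g\<bar> \<le> sqrt (nsq I x) * sqrt (nsq I g)" by (rule ip_bound)
  also have "\<dots> \<le> sqrt (nsq I x) * (1 + nsq I g) ^ 3"
    using order_trans[OF nsq_powers(2,3)] by (intro mult_left_mono) auto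
  finally show "\<bar>ip I x g\<bar> \<le> sqrt (nsq I x) * (1 + nsq I g) ^ 3" .
qed auto

lemma integrable_ip_sq: "finite I \<Longrightarrow> integrable gam (\<lambda>g. (ip I x g)\<^sup>2)"
proof (rule integrable_poly)
  fix g
  show "\<bar>(ip I x g)\<^sup>2\<bar> \<le> nsq I x * (1 + nsq I g) ^ 3"
    using ip_sq_le[of I x g] mult_left_mono[OF nsq_powers(1), of "nsq I x" I g] by simp
qed auto

lemma integral_ip:
  assumes "finite I" shows "(\<integral>g. ip I x g \<partial>gam) = 0"
proof -
  have i: "integrable gam (\<lambda>g. x i \<bullet> g i)" for i
    using integrable_ip[of "{i}" x] by (simp add: ip_def)
  have "(\<integral>g. ip I x g \<partial>gam) = (\<Sum>i\<in>I. \<integral>g. x i \<bullet> g i \<partial>gam)"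
    unfolding ip_def by (rule Bochner_Integration.integral_sum) (rule i)
  also have "\<dots> = (\<Sum>i\<in>I. 0)"
  proof (rule sum.cong[OF refl])
    fix i show "(\<integral>g. x i \<bullet> g i \<partial>gam) = 0"
      using integral_gam_component[of "\<lambda>w. x i \<bullet> w" i] by (simp add: gamma3_mean)
  qed
  finally show ?thesis by simp
qed

lemma gam_eq_upd: "distr (gamma3 \<Otimes>\<^sub>M gam) gam (\<lambda>(x, z). z(i := x)) = gam"
  using distr_pair_PiM_eq_PiM[of UNIV "\<lambda>_. gamma3" i] prob_space_gamma3 by simp

text \<open>Coordinate i is resampled independently of those in \<open>I\<close>, and its mean
  vanishes by symmetry. The integrability needed for Fubini comes from |s t| \<le> s^2 +
  t^2.\<close>

lemma integral_ip_cross: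
  assumes I: "finite I" and i: "i \<notin> I"
  shows "(\<integral>g. (y \<bullet> g i) * ip I x g \<partial>gam) = 0"
proof -
  interpret P: pair_sigma_finite gamma3 gam
    by (intro pair_sigma_finite.intro prob_space_imp_sigma_finite prob_space_gamma3 prob_space_gam)
  have m: "(\<lambda>(x, z). z(i := x)) \<in> measurable (gamma3 \<Otimes>\<^sub>M gam) gam"
    by (rule measurable_gamI) (auto simp: split_beta' fun_upd_def)
  have mf: "(\<lambda>g. (y \<bullet> g i) * ip I x g) \<in> borel_measurable gam" by measurable
  have u: "ip I x (z(i := w)) = ip I x z" for z w
    unfolding ip_def using i by (intro sum.cong) auto
  have int: "integrable gam (\<lambda>g. (y \<bullet> g i) * ip I x g)"
  proof (rule Bochner_Integration.integrable_bound)
    show "integrable gam (\<lambda>g. (ip {i} (\<lambda>_. y) g)\<^sup>2 + (ip I x g)\<^sup>2)"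
      using I by (intro Bochner_Integration.integrable_add integrable_ip_sq) auto
    show "AE g in gam. norm ((y \<bullet> g i) * ip I x g) \<le> norm ((ip {i} (\<lambda>_. y) g)\<^sup>2 + (ip I x g)\<^sup>2)"
    proof (rule AE_I2)
      fix g
      have "\<bar>s * t\<bar> \<le> s\<^sup>2 + t\<^sup>2" for s t :: real
      proof -
        have "2 * (\<bar>s\<bar> * \<bar>t\<bar>) \<le> s\<^sup>2 + t\<^sup>2"
          using sum_squares_bound[of "\<bar>s\<bar>" "\<bar>t\<bar>"] by (simp only: power2_abs mult.assoc)
        moreover have "0 \<le> \<bar>s\<bar> * \<bar>t\<bar>" by simp
        ultimately show ?thesis unfolding abs_mult by linarith
      qed
      from this[of "y \<bullet> g i" "ip I x g"]
      show "norm ((y \<bullet> g i) * ip I x g) \<le> norm ((ip {i} (\<lambda>_. y) g)\<^sup>2 + (ip I x g)\<^sup>2)"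
        by (simp add: ip_def)
    qed
  qed (rule mf)
  then have "integrable (distr (gamma3 \<Otimes>\<^sub>M gam) gam (\<lambda>(x, z). z(i := x))) (\<lambda>g. (y \<bullet> g i) * ip I x g)"
    by (simp only: gam_eq_upd)
  then have int2: "integrable (gamma3 \<Otimes>\<^sub>M gam) (\<lambda>(w, z). (y \<bullet> w) * ip I x z)"
    by (subst (asm) integrable_distr_eq[OF m mf]) (simp add: split_beta' u)
  have "(\<integral>g. (y \<bullet> g i) * ip I x g \<partial>gam)
      = (\<integral>g. (y \<bullet> g i) * ip I x g \<partial>distr (gamma3 \<Otimes>\<^sub>M gam) gam (\<lambda>(x, z). z(i := x)))"
    by (simp only: gam_eq_upd)
  also have "\<dots> = (\<integral>p. (case p of (w, z) \<Rightarrow> (y \<bullet> w) * ip I x z) \<partial>(gamma3 \<Otimes>\<^sub>M gam))"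
    by (subst integral_distr[OF m mf]) (simp add: split_beta' u)
  also have "\<dots> = (\<integral>z. (\<integral>w. (y \<bullet> w) * ip I x z \<partial>gamma3) \<partial>gam)"
    using P.integral_snd[OF int2] by simp
  also have "\<dots> = 0" by (simp add: gamma3_mean)
  finally show ?thesis .
qed

text \<open>Induction over the coordinates: the squares add up by isotropy of each coordinate, and
  the cross terms vanish by independence.\<close>

lemma integral_ip_sq:
  assumes "finite I" shows "(\<integral>g. (ip I x g)\<^sup>2 \<partial>gam) = kap * nsq I x"
  using assms
proof (induction I rule: finite_induct)
  case empty then show ?case by (simp add: ip_def nsq_def)
next
  case (insert i I)
  have e: "(ip (insert i I) x g)\<^sup>2 = (x i \<bullet> g i)\<^sup>2 + (ip I x g)\<^sup>2 + 2 * ((x i \<bullet> g i) * ip I x g)" for g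
    using insert by (simp add: ip_def power2_sum)
  have 1: "integrable gam (\<lambda>g. (x i \<bullet> g i)\<^sup>2)" using integrable_ip_sq[of "{i}" x] by (simp add: ip_def)
  have 2: "integrable gam (\<lambda>g. (ip I x g)\<^sup>2)" using insert integrable_ip_sq by auto
  have "integrable gam (\<lambda>g. (ip (insert i I) x g)\<^sup>2)" using insert integrable_ip_sq by auto
  from Bochner_Integration.integrable_diff[OF this Bochner_Integration.integrable_add[OF 1 2]]
  have 3: "integrable gam (\<lambda>g. 2 * ((x i \<bullet> g i) * ip I x g))" by (simp add: e)
  have m: "(\<integral>w. (x i \<bullet> w)\<^sup>2 \<partial>gamma3) = kap * (norm (x i))\<^sup>2"
    using isotropic_second_moment[OF sets_gamma3 distr_orthogonal_gamma3 integrable_gamma3_sq, of "x i"]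
    by (simp add: kap_def)
  have "(\<integral>g. (ip (insert i I) x g)\<^sup>2 \<partial>gam) = (\<integral>g. (x i \<bullet> g i)\<^sup>2 \<partial>gam) + (\<integral>g. (ip I x g)\<^sup>2 \<partial>gam)
      + (\<integral>g. 2 * ((x i \<bullet> g i) * ip I x g) \<partial>gam)"
    unfolding e using 1 2 3 by simp
  also have "(\<integral>g. 2 * ((x i \<bullet> g i) * ip I x g) \<partial>gam) = 0"
    using integral_ip_cross[OF insert(1,2), of "x i" x] by simp
  also have "(\<integral>g. (x i \<bullet> g i)\<^sup>2 \<partial>gam) = kap * (norm (x i))\<^sup>2"
    using integral_gam_component[of "\<lambda>w. (x i \<bullet> w)\<^sup>2" i] by (simp add: m)
  finally show ?case using insert by (simp add: nsq_def distrib_left)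
qed

lemma abs_Psi_le:
  assumes "0 < A" "A \<le> x" "x \<le> B"
  shows "\<bar>Psi x\<bar> \<le> B * (\<bar>ln A\<bar> + \<bar>ln B\<bar>)"
proof -
  have "ln A \<le> ln x" "ln x \<le> ln B" using assms by auto
  then have "\<bar>ln x\<bar> \<le> \<bar>ln A\<bar> + \<bar>ln B\<bar>" by linarith
  then show ?thesis unfolding Psi_def abs_mult using assms by (intro mult_mono) auto
qed

definition mom :: "nat set \<Rightarrow> real" where "mom I = (\<integral>g. (1 + nsq I g) ^ 3 \<partial>gam)"

lemma integral_le_mom:
  assumes I: "finite I" and m: "f \<in> borel_measurable gam"
    and b: "\<And>g. \<bar>f g\<bar> \<le> K * (1 + nsq I g) ^ 3"
  shows "integrable gam f" "\<bar>\<integral>g. f g \<partial>gam\<bar> \<le> K * mom I" "(\<integral>g. \<bar>f g\<bar> \<partial>gam) \<le> K * mom I"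
proof -
  show i: "integrable gam f" by (rule integrable_poly[OF I m b])
  have "(\<integral>g. \<bar>f g\<bar> \<partial>gam) \<le> (\<integral>g. K * (1 + nsq I g) ^ 3 \<partial>gam)"
    using i b integrable_mult_right[OF integrable_nsq_power[OF I], of K] by (intro integral_mono) auto
  then show 1: "(\<integral>g. \<bar>f g\<bar> \<partial>gam) \<le> K * mom I" by (simp add: mom_def)
  show "\<bar>\<integral>g. f g \<partial>gam\<bar> \<le> K * mom I" using order_trans[OF integral_abs_bound 1] .
qed

lemma mom_ge_0: "0 \<le> mom I"
  unfolding mom_def by (rule Bochner_Integration.integral_nonneg) simp

context
  fixes I A B C u X and a b :: real and z :: "nat \<Rightarrow> real^3"
  assumes n: "nice I A B C u X" and A: "A > 0" and b: "0 < b" "b \<le> (1::real)"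
begin

text \<open>Put y = a z, q = u y and d = u (y + b g) - q. The entropy gap is the mean of Psi (q + d)
  over g minus \<open>Psi\<close> at q plus the mean of d. The terms linear in the mean of d cancel,
  and what remains to second order is the mean of d^2 / (2 q), where d is b times the inner product
  of X y and g, up to O(b^2). This inner product has mean zero, so the mean of d is O(b^2) and its
  square is negligible. The constants involve A, B, C and the moments, but neither u nor z.\<close>

lemma gap_pointwise:
  defines "L \<equiv> B - A + 2 * C" and "y \<equiv> \<lambda>i. a *\<^sub>R z i"
  shows "\<bar>(\<integral>g. Psi (u (\<lambda>i. a *\<^sub>R z i + b *\<^sub>R g i)) \<partial>gam) - Psi (Pop a b u z)
      - b\<^sup>2 * (kap / 2) * (nsq I (X y) / u y)\<bar>
    \<le> (L ^ 3 * mom I / A\<^sup>2 + C\<^sup>2 * (mom I)\<^sup>2 / A + L * C * mom I / A) * b ^ 3"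
proof -
  note I = niceD(1)[OF n]
  have C0: "C \<ge> 0" and AB: "A \<le> B" using niceD[OF n] by auto
  have L0: "L \<ge> 0" using C0 AB by (simp add: L_def)
  define q where "q = u y"
  have q: "A \<le> q" "q > 0" using niceD(5)[OF n, of y] A by (auto simp: q_def)
  define d where "d g = u (\<lambda>i. y i + b *\<^sub>R g i) - q" for g
  have uq: "u (\<lambda>i. a *\<^sub>R z i + b *\<^sub>R g i) = q + d g" for g by (simp add: d_def y_def)
  have uA: "A \<le> q + d g" for g using niceD(5)[OF n] by (simp add: d_def)
  have md [measurable]: "d \<in> borel_measurable gam"
  proof -
    have "(\<lambda>g i. y i + b *\<^sub>R g i) \<in> measurable gam gam" by (rule measurable_gamI) simp
    from measurable_compose[OF this niceD(3)[OF n]] show ?thesis unfolding d_def by simp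
  qed
  define t where "t g = 1 + nsq I g" for g
  have t: "t g \<ge> 1" "sqrt (nsq I g) \<le> t g" "nsq I g \<le> t g" for g
    using nsq_powers(2)[of I g] by (auto simp: t_def)
  have d1: "\<bar>d g\<bar> \<le> L * b * sqrt (nsq I g)" for g
    using nice_lipschitz[OF n, of y "\<lambda>i. b *\<^sub>R g i"] b
    by (simp add: d_def q_def L_def nsq_scale real_sqrt_mult mult_ac)
  have d2: "\<bar>d g - b * ip I (X y) g\<bar> \<le> C * b\<^sup>2 * nsq I g" for g
    using niceD(8)[OF n, of y "\<lambda>i. b *\<^sub>R g i"]
    by (simp add: d_def q_def nsq_scale ip_scale_right mult_ac)
  have d3: "\<bar>d g\<bar> ^ 3 \<le> (L ^ 3 * b ^ 3) * (1 + nsq I g) ^ 3" for g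
  proof -
    have "\<bar>d g\<bar> \<le> L * b * t g"
      using d1[of g] mult_left_mono[OF t(2)[of g], of "L * b"] L0 b by simp
    then have "\<bar>d g\<bar> ^ 3 \<le> (L * b * t g) ^ 3" by (rule power_mono) simp
    then show ?thesis by (simp add: power_mult_distrib t_def)
  qed
  have id: "integrable gam d" and id2: "integrable gam (\<lambda>g. (d g)\<^sup>2)"
  proof -
    have bd: "\<bar>d g\<bar> \<le> B - A" for g
      using niceD(5,6)[OF n] unfolding d_def q_def abs_le_iff by (smt (verit, best))
    show "integrable gam d" using bd by (intro GP.P.integrable_const_bound AE_I2) auto
    show "integrable gam (\<lambda>g. (d g)\<^sup>2)"
      using power_mono[OF bd abs_ge_zero, where n=2] by (intro GP.P.integrable_const_bound AE_I2) auto
  qed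
  have iPsi: "integrable gam (\<lambda>g. Psi (q + d g))"
  proof (rule GP.P.integrable_const_bound)
    show "AE g in gam. norm (Psi (q + d g)) \<le> B * (\<bar>ln A\<bar> + \<bar>ln B\<bar>)"
      using abs_Psi_le[OF A uA] niceD(6)[OF n] by (intro AE_I2) (simp add: d_def)
  qed measurable
  \<comment> \<open>Second-order expansion of \<open>Psi\<close> at q; the cubic remainder is
    integrated against the moments.\<close>
  have r1: "\<bar>(\<integral>g. Psi (q + d g) \<partial>gam) - (Psi q + (ln q + 1) * (\<integral>g. d g \<partial>gam) + (\<integral>g. (d g)\<^sup>2 \<partial>gam) / (2 * q))\<bar>
      \<le> L ^ 3 * b ^ 3 / A\<^sup>2 * mom I"
  proof -
    let ?f = "\<lambda>g. Psi (q + d g) - Psi q - (ln q + 1) * d g - (d g)\<^sup>2 / (2 * q)"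
    have "(\<integral>g. ?f g \<partial>gam) = (\<integral>g. Psi (q + d g) \<partial>gam) - Psi q - (ln q + 1) * (\<integral>g. d g \<partial>gam) - (\<integral>g. (d g)\<^sup>2 \<partial>gam) / (2 * q)"
      using iPsi id id2 GP.P.prob_space by simp
    moreover have "\<bar>\<integral>g. ?f g \<partial>gam\<bar> \<le> L ^ 3 * b ^ 3 / A\<^sup>2 * mom I"
    proof (rule integral_le_mom(2)[OF I])
      fix g
      have "\<bar>?f g\<bar> \<le> \<bar>d g\<bar> ^ 3 / A\<^sup>2"
        using Psi_taylor[OF A uA q(1), of g] by simp
      also have "\<dots> \<le> (L ^ 3 * b ^ 3) * (1 + nsq I g) ^ 3 / A\<^sup>2"
        by (rule divide_right_mono[OF d3]) simp
      finally show "\<bar>?f g\<bar> \<le> L ^ 3 * b ^ 3 / A\<^sup>2 * (1 + nsq I g) ^ 3" by simp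
    qed measurable
    ultimately show ?thesis by (simp add: algebra_simps)
  qed
  have iip: "integrable gam (\<lambda>g. ip I (X y) g)" by (rule integrable_ip[OF I])
  have md1: "\<bar>\<integral>g. d g \<partial>gam\<bar> \<le> C * b\<^sup>2 * mom I"
  proof -
    have "(\<integral>g. d g - b * ip I (X y) g \<partial>gam) = (\<integral>g. d g \<partial>gam)"
      using id iip by (simp add: integral_ip[OF I])
    moreover have "\<bar>\<integral>g. d g - b * ip I (X y) g \<partial>gam\<bar> \<le> C * b\<^sup>2 * mom I"
    proof (rule integral_le_mom(2)[OF I])
      fix g show "\<bar>d g - b * ip I (X y) g\<bar> \<le> C * b\<^sup>2 * (1 + nsq I g) ^ 3"
        using order_trans[OF d2 mult_left_mono[OF nsq_powers(1)[of I g], of "C * b\<^sup>2"]] C0 by simp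
    qed measurable
    ultimately show ?thesis by simp
  qed
  have P: "Pop a b u z = q + (\<integral>g. d g \<partial>gam)"
    unfolding Pop_def uq using id GP.P.prob_space by simp
  \<comment> \<open>The mean value is expanded at the same point q. Its deviation m is O(b^2), so
    the tangent suffices, with error m^2 / q of order b^4.\<close>
  have r2: "\<bar>Psi (Pop a b u z) - (Psi q + (ln q + 1) * (\<integral>g. d g \<partial>gam))\<bar> \<le> C\<^sup>2 * (mom I)\<^sup>2 / A * b ^ 3"
  proof -
    define m where "m = (\<integral>g. d g \<partial>gam)"
    have pos: "q + m > 0"
    proof -
      have "A \<le> (\<integral>g. q + d g \<partial>gam)" by (rule GP.P.integral_ge_const) (use id uA in auto)
      then show ?thesis using id A GP.P.prob_space by (simp add: m_def)
    qed
    have "\<bar>Psi (q + m) - (Psi q + (ln q + 1) * m)\<bar> \<le> m\<^sup>2 / q"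
      using Psi_tangent[OF pos q(2)] by simp
    also have "\<dots> \<le> (C * b\<^sup>2 * mom I)\<^sup>2 / A"
      using md1 power_mono[OF md1 abs_ge_zero, of 2] q A by (intro frac_le) (auto simp: m_def)
    also have "\<dots> = C\<^sup>2 * (mom I)\<^sup>2 / A * b ^ 4"
      by (simp add: power_mult_distrib)
    also have "\<dots> \<le> C\<^sup>2 * (mom I)\<^sup>2 / A * b ^ 3"
      using b A by (intro mult_left_mono power_decreasing) auto
    finally show ?thesis by (simp add: P m_def)
  qed
  have r3: "\<bar>(\<integral>g. (d g)\<^sup>2 \<partial>gam) - b\<^sup>2 * (kap * nsq I (X y))\<bar> \<le> 2 * L * C * b ^ 3 * mom I"
  proof -
    let ?f = "\<lambda>g. (d g)\<^sup>2 - b\<^sup>2 * (ip I (X y) g)\<^sup>2"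
    have "(\<integral>g. ?f g \<partial>gam) = (\<integral>g. (d g)\<^sup>2 \<partial>gam) - b\<^sup>2 * (kap * nsq I (X y))"
      using id2 integrable_ip_sq[OF I] by (simp add: integral_ip_sq[OF I])
    moreover have "\<bar>\<integral>g. ?f g \<partial>gam\<bar> \<le> 2 * L * C * b ^ 3 * mom I"
    proof (rule integral_le_mom(2)[OF I])
      fix g
      have s: "sqrt (nsq I (X y)) \<le> L" using nice_grad_bound[OF n, of y] C0 by (simp add: L_def)
      have "\<bar>b * ip I (X y) g\<bar> \<le> b * (sqrt (nsq I (X y)) * sqrt (nsq I g))"
        using ip_bound[of I "X y" g] b by (simp add: abs_mult)
      also have "\<dots> \<le> b * (L * sqrt (nsq I g))" using s b by (intro mult_left_mono mult_right_mono) auto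
      finally have "\<bar>d g + b * ip I (X y) g\<bar> \<le> 2 * L * b * sqrt (nsq I g)"
        using d1[of g] by (simp add: mult_ac)
      also have "\<dots> \<le> 2 * L * b * t g" using t(2)[of g] L0 b by (intro mult_left_mono) auto
      finally have p: "\<bar>d g + b * ip I (X y) g\<bar> \<le> 2 * L * b * t g" .
      have m: "\<bar>d g - b * ip I (X y) g\<bar> \<le> C * b\<^sup>2 * t g"
        using d2[of g] mult_left_mono[OF t(3)[of g], of "C * b\<^sup>2"] C0 by simp
      \<comment> \<open>Of the two factors of this difference of squares, the first is the remainder
        of order b^2, the second is of order b only.\<close>
      have "?f g = (d g - b * ip I (X y) g) * (d g + b * ip I (X y) g)"
        by (simp add: power2_eq_square algebra_simps)
      then have "\<bar>?f g\<bar> \<le> (C * b\<^sup>2 * t g) * (2 * L * b * t g)"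
        unfolding abs_mult using mult_mono[OF m p] C0 t(1)[of g] by (simp add: abs_mult)
      also have "\<dots> = 2 * L * C * b ^ 3 * (t g)\<^sup>2" by (simp add: power2_eq_square power3_eq_cube)
      also have "\<dots> \<le> 2 * L * C * b ^ 3 * (1 + nsq I g) ^ 3"
        using nsq_powers(4)[of I g] L0 C0 b unfolding t_def by (intro mult_left_mono) auto
      finally show "\<bar>?f g\<bar> \<le> 2 * L * C * b ^ 3 * (1 + nsq I g) ^ 3" .
    qed measurable
    ultimately show ?thesis by simp
  qed
  have r4: "\<bar>(\<integral>g. (d g)\<^sup>2 \<partial>gam) / (2 * q) - b\<^sup>2 * (kap / 2) * (nsq I (X y) / q)\<bar> \<le> L * C * mom I / A * b ^ 3"
  proof -
    have "(\<integral>g. (d g)\<^sup>2 \<partial>gam) / (2 * q) - b\<^sup>2 * (kap / 2) * (nsq I (X y) / q)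
        = ((\<integral>g. (d g)\<^sup>2 \<partial>gam) - b\<^sup>2 * (kap * nsq I (X y))) / (2 * q)"
      using q by (simp add: field_simps)
    also have "\<bar>\<dots>\<bar> \<le> 2 * L * C * b ^ 3 * mom I / (2 * A)"
      unfolding abs_divide using r3 q A C0 L0 b mom_ge_0[of I] by (intro frac_le) auto
    finally show ?thesis by (simp add: mult_ac)
  qed
  have "L ^ 3 * b ^ 3 / A\<^sup>2 * mom I = L ^ 3 * mom I / A\<^sup>2 * b ^ 3" by simp
  then show ?thesis
    unfolding uq q_def[symmetric] using r1 r2 r4 unfolding distrib_right by linarith
qed

text \<open>\<open>gap_pointwise\<close> produces the Fisher integrand at a z, whereas invariance
  under the semigroup concerns the point a z + b g. Moving between them costs one power of b, hence
  b^3 after multiplication by b^2.\<close>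

lemma quotient_lipschitz:
  fixes g
  defines "L \<equiv> B - A + 2 * C" and "y \<equiv> \<lambda>i. a *\<^sub>R z i" and "y' \<equiv> \<lambda>i. a *\<^sub>R z i + b *\<^sub>R g i"
  shows "\<bar>nsq I (X y') / u y' - nsq I (X y) / u y\<bar> \<le> (12 * C * L / A + L ^ 3 / A\<^sup>2) * b * (1 + nsq I g) ^ 3"
proof -
  have C0: "C \<ge> 0" and AB: "A \<le> B" using niceD[OF n] by auto
  have L0: "L \<ge> 0" using C0 AB by (simp add: L_def)
  define r where "r = sqrt (nsq I (X y))"
  define r' where "r' = sqrt (nsq I (X y'))"
  define s where "s = b * sqrt (nsq I g)"
  have s0: "s \<ge> 0" using b by (simp add: s_def)
  have sn: "sqrt (nsq I (\<lambda>i. b *\<^sub>R g i)) = s" using b by (simp add: s_def nsq_scale real_sqrt_mult)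
  have y': "y' = (\<lambda>i. y i + b *\<^sub>R g i)" by (simp add: y_def y'_def)
  have rr: "0 \<le> r" "0 \<le> r'" "r \<le> L" "r' \<le> L"
    using nice_grad_bound[OF n, of y] nice_grad_bound[OF n, of y'] C0 by (auto simp: r_def r'_def L_def)
  have "\<bar>r' - r\<bar> \<le> sqrt (nsq I (\<lambda>i. X y' i - X y i))" unfolding r_def r'_def by (rule nsq_triangle)
  also have "\<dots> \<le> 6 * C * s"
    using nice_grad_lipschitz[OF n, of y "\<lambda>i. b *\<^sub>R g i"] unfolding y' sn .
  finally have dr: "\<bar>r' - r\<bar> \<le> 6 * C * s" .
  have du: "\<bar>u y' - u y\<bar> \<le> L * s"
    using nice_lipschitz[OF n, of y "\<lambda>i. b *\<^sub>R g i"] unfolding y' sn L_def .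
  have u: "u y \<ge> A" "u y' \<ge> A" using niceD(5)[OF n] by auto
  \<comment> \<open>The numerator is changed first and the denominator afterwards; r'^2 - r^2 is
    factored so that the Lipschitz bound on the norm of the gradient applies.\<close>
  have "nsq I (X y') / u y' - nsq I (X y) / u y = (r' - r) * (r' + r) / u y' + r\<^sup>2 * (u y - u y') / (u y' * u y)"
  proof -
    have "nsq I (X y') = r'\<^sup>2" "nsq I (X y) = r\<^sup>2" by (simp_all add: r_def r'_def)
    then show ?thesis using u A by (simp add: field_simps power2_eq_square)
  qed
  also have "\<bar>\<dots>\<bar> \<le> \<bar>(r' - r) * (r' + r) / u y'\<bar> + \<bar>r\<^sup>2 * (u y - u y') / (u y' * u y)\<bar>"
    by (rule abs_triangle_ineq)
  also have "\<bar>(r' - r) * (r' + r) / u y'\<bar> \<le> (6 * C * s) * (2 * L) / A"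
    unfolding abs_divide abs_mult using dr rr u A C0 s0 by (intro frac_le mult_mono) auto
  also have "\<bar>r\<^sup>2 * (u y - u y') / (u y' * u y)\<bar> \<le> L\<^sup>2 * (L * s) / (A * A)"
    unfolding abs_divide abs_mult using du rr u A L0 s0
    by (intro frac_le mult_mono) (auto simp: abs_minus_commute intro: power_mono)
  finally have "\<bar>nsq I (X y') / u y' - nsq I (X y) / u y\<bar> \<le> (12 * C * L / A + L ^ 3 / A\<^sup>2) * s"
    by (simp add: distrib_left power2_eq_square power3_eq_cube mult_ac)
  also have "\<dots> \<le> (12 * C * L / A + L ^ 3 / A\<^sup>2) * (b * (1 + nsq I g) ^ 3)"
    unfolding s_def using order_trans[OF nsq_powers(2,3), of I g] b C0 L0 A
    by (intro mult_left_mono) auto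
  finally show ?thesis by (simp add: mult.assoc)
qed

end

definition Ent :: "((nat \<Rightarrow> real^3) \<Rightarrow> real) \<Rightarrow> real" where
  "Ent u = (\<integral>z. Psi (u z) \<partial>gam)"

text \<open>The entropy of u and its Fisher information are both rewritten as means of semigroup
  averages, so that the pointwise estimate can be integrated. The order of quantifiers matters: K is
  chosen before u, X, a and b, hence is the same along all iterates.\<close>

lemma gap_bound:
  assumes A: "A > 0"
  shows "\<exists>K\<ge>0. \<forall>u X a b. nice I A B C u X \<longrightarrow> 0 < b \<longrightarrow> b \<le> 1 \<longrightarrow> a\<^sup>2 + b\<^sup>2 = 1 \<longrightarrow>
    \<bar>Ent u - Ent (Pop a b u) - b\<^sup>2 * (kap / 2) * fisher I (\<lambda>_. 1) u X\<bar> \<le> K * b ^ 3"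
proof -
  define L where "L = B - A + 2 * C"
  define K1 where "K1 = L ^ 3 * mom I / A\<^sup>2 + C\<^sup>2 * (mom I)\<^sup>2 / A + L * C * mom I / A"
  define K2 where "K2 = 12 * C * L / A + L ^ 3 / A\<^sup>2"
  define K where "K = K1 + kap / 2 * (K2 * mom I)"
  have main: "\<bar>Ent u - Ent (Pop a b u) - b\<^sup>2 * (kap / 2) * fisher I (\<lambda>_. 1) u X\<bar> \<le> K * b ^ 3"
    if n: "nice I A B C u X" and b: "0 < b" "b \<le> 1" and ab: "a\<^sup>2 + b\<^sup>2 = 1" for u X a b
  proof -
    note I = niceD(1)[OF n]
    let ?y = "\<lambda>z g i. a *\<^sub>R z i + b *\<^sub>R g i"
    let ?Q = "\<lambda>z. nsq I (X z) / u z"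
    have w: "wsq I (\<lambda>_. 1) x = nsq I x" for x by (simp add: wsq_def nsq_def)
    have mQ: "?Q \<in> borel_measurable gam" using wsq_quotient_measurable[OF n, of "\<lambda>_. 1"] by (simp add: w)
    have bQ: "\<bar>?Q z\<bar> \<le> (\<Sum>i\<in>I. \<bar>1\<bar> * (B - A + C)\<^sup>2) / A" for z
      using wsq_quotient_bound[OF n A, of "\<lambda>_. 1" z] by (simp add: w)
    have mP: "(\<lambda>z. Psi (u z)) \<in> borel_measurable gam"
      using measurable_compose[OF niceD(3)[OF n] Psi_measurable] .
    have bP: "\<bar>Psi (u z)\<bar> \<le> B * (\<bar>ln A\<bar> + \<bar>ln B\<bar>)" for z
      by (rule abs_Psi_le[OF A niceD(5)[OF n] niceD(6)[OF n]])
    have a1: "\<bar>a\<bar> \<le> 1" 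
    proof -
      have "a\<^sup>2 \<le> 1" using ab zero_le_power2[of b] by linarith
      then show ?thesis by (simp add: abs_square_le_1)
    qed
    obtain X' where n': "nice I A B C (Pop a b u) X'" using Pop_nice[OF n a1] by blast
    have iPP: "integrable gam (\<lambda>z. Psi (Pop a b u z))"
      by (rule GP.P.integrable_const_bound[OF AE_I2])
         (use abs_Psi_le[OF A niceD(5)[OF n'] niceD(6)[OF n']]
              measurable_compose[OF niceD(3)[OF n'] Psi_measurable] in auto)
    note iP = Pop_mean(2)[OF mP bP ab] and iQ = Pop_mean(2)[OF mQ bQ ab]
    have iC: "integrable gam (\<lambda>z. b\<^sup>2 * (kap / 2) * Pop a b ?Q z)"
      using iQ by (rule integrable_mult_right)
    have E1: "Ent u = (\<integral>z. Pop a b (\<lambda>z. Psi (u z)) z \<partial>gam)"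
      unfolding Ent_def by (rule Pop_mean(1)[OF mP bP ab, symmetric])
    have E2: "fisher I (\<lambda>_. 1) u X = (\<integral>z. Pop a b ?Q z \<partial>gam)"
      unfolding fisher_def w by (rule Pop_mean(1)[OF mQ bQ ab, symmetric])
    have pt: "\<bar>Pop a b (\<lambda>z. Psi (u z)) z - Psi (Pop a b u z) - b\<^sup>2 * (kap / 2) * Pop a b ?Q z\<bar> \<le> K * b ^ 3" for z
    proof -
      let ?q = "?Q (\<lambda>i. a *\<^sub>R z i)"
      have my: "?y z \<in> measurable gam gam" by (rule measurable_gamI) simp
      have iq: "integrable gam (\<lambda>g. ?Q (?y z g))"
        using bQ measurable_compose[OF my mQ] by (intro GP.P.integrable_const_bound AE_I2) auto
      have "Pop a b ?Q z - ?q = (\<integral>g. ?Q (?y z g) - ?q \<partial>gam)"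
        unfolding Pop_def using iq GP.P.prob_space by simp
      also have "\<bar>\<dots>\<bar> \<le> (K2 * b) * mom I"
        using quotient_lipschitz[OF n A b, of a z] measurable_compose[OF my mQ]
        by (intro integral_le_mom(2)[OF I]) (auto simp: K2_def L_def)
      finally have 2: "\<bar>Pop a b ?Q z - ?q\<bar> \<le> K2 * b * mom I" .
      have "\<bar>b\<^sup>2 * (kap / 2) * Pop a b ?Q z - b\<^sup>2 * (kap / 2) * ?q\<bar> = b\<^sup>2 * (kap / 2) * \<bar>Pop a b ?Q z - ?q\<bar>"
        unfolding right_diff_distrib[symmetric] abs_mult using kap_nonneg by simp
      also have "\<dots> \<le> b\<^sup>2 * (kap / 2) * (K2 * b * mom I)"
        using 2 kap_nonneg by (intro mult_left_mono) auto
      also have "\<dots> = kap / 2 * (K2 * mom I) * b ^ 3" by (simp add: power2_eq_square power3_eq_cube)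
      finally have 3: "\<bar>b\<^sup>2 * (kap / 2) * Pop a b ?Q z - b\<^sup>2 * (kap / 2) * ?q\<bar> \<le> kap / 2 * (K2 * mom I) * b ^ 3" .
      have 1: "\<bar>Pop a b (\<lambda>z. Psi (u z)) z - Psi (Pop a b u z) - b\<^sup>2 * (kap / 2) * ?q\<bar> \<le> K1 * b ^ 3"
        using gap_pointwise[OF n A b, of a z] unfolding K1_def L_def Pop_def[of a b "\<lambda>z. Psi (u z)"] .
      show ?thesis using 1 3 unfolding K_def distrib_right by linarith
    qed
    have e: "Ent u - Ent (Pop a b u) - b\<^sup>2 * (kap / 2) * fisher I (\<lambda>_. 1) u X
      = (\<integral>z. Pop a b (\<lambda>z. Psi (u z)) z - Psi (Pop a b u z) - b\<^sup>2 * (kap / 2) * Pop a b ?Q z \<partial>gam)"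
      unfolding E1 E2 Ent_def[of "Pop a b u"]
        Bochner_Integration.integral_diff[OF Bochner_Integration.integrable_diff[OF iP iPP] iC]
        Bochner_Integration.integral_diff[OF iP iPP] by (simp only: integral_mult_right_zero)
    show ?thesis
      unfolding e
      by (rule order_trans[OF integral_abs_bound],
          rule GP.P.integral_le_const[OF integrable_abs[OF Bochner_Integration.integrable_diff[OF
            Bochner_Integration.integrable_diff[OF iP iPP] iC]] AE_I2[OF pt]])
  qed
  show ?thesis
  \<comment> \<open>If A, B, C admit no nice function at all, the expression K may be negative;
    hence the absolute value.\<close>
  proof (intro exI[of _ "\<bar>K\<bar>"] conjI allI impI)
    fix u X and a b :: real
    assume h: "nice I A B C u X" "0 < b" "b \<le> 1" "a\<^sup>2 + b\<^sup>2 = 1"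
    have "K * b ^ 3 \<le> \<bar>K\<bar> * b ^ 3" using h by (intro mult_right_mono) auto
    then show "\<bar>Ent u - Ent (Pop a b u) - b\<^sup>2 * (kap / 2) * fisher I (\<lambda>_. 1) u X\<bar> \<le> \<bar>K\<bar> * b ^ 3"
      using main[OF h] by linarith
  qed simp
qed

section \<open>Entropy along the iterated semigroup\<close>

lemma Pop_funpow_nice:
  assumes "nice I A B C u X" "\<bar>a\<bar> \<le> 1"
  shows "\<exists>X'. nice I A B C ((Pop a b ^^ k) u) X'"
proof (induction k)
  case 0 then show ?case using assms(1) by auto
next
  case (Suc k) then show ?case using Pop_nice[OF _ assms(2)] by auto
qed

lemma nice_bounded: "nice I A B C u X \<Longrightarrow> \<bar>u z\<bar> \<le> max \<bar>A\<bar> \<bar>B\<bar>"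
  using niceD(5,6)[of I A B C u X z] by (auto simp: abs_le_iff le_max_iff_disj)

text \<open>\<open>Psi\<close> lies above its tangent x - 1 at x = 1, and u - 1 has mean
  zero.\<close>

lemma Ent_nonneg:
  assumes n: "nice I A B C u X" and A: "A > 0" and m: "(\<integral>z. u z \<partial>gam) = 1"
  shows "Ent u \<ge> 0"
proof -
  have i: "integrable gam u" by (rule nice_integrable[OF n])
  have iP: "integrable gam (\<lambda>z. Psi (u z))"
    by (rule GP.P.integrable_const_bound[OF AE_I2])
       (use abs_Psi_le[OF A niceD(5)[OF n] niceD(6)[OF n]]
            measurable_compose[OF niceD(3)[OF n] Psi_measurable] in auto)
  have "0 = (\<integral>z. u z - 1 \<partial>gam)" using i m GP.P.prob_space by simp
  also have "\<dots> \<le> Ent u" unfolding Ent_def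
  proof (rule integral_mono)
    fix z
    have "u z > 0" using niceD(5)[OF n, of z] A by linarith
    from Psi_tangent(1)[OF this, of 1] show "u z - 1 \<le> Psi (u z)" by (simp add: Psi_def)
  qed (use i iP in auto)
  finally show ?thesis .
qed

text \<open>A function of mean one with a small Lipschitz constant is close to 1, since u z - 1 is
  the mean of u z - u g over g; and Psi (u) \<le> u (u - 1) turns this into a small entropy. It
  takes the place of convergence to equilibrium for the semigroup.\<close>

lemma Ent_le_lipschitz:
  assumes n: "nice I A B C u X" and A: "A > 0" and m: "(\<integral>z. u z \<partial>gam) = 1"
    and L: "\<And>z e. \<bar>u (\<lambda>i. z i + e i) - u z\<bar> \<le> L * sqrt (nsq I e)" and L0: "L \<ge> 0"
  shows "Ent u \<le> B * (4 * L * mom I)"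
proof -
  note I = niceD(1)[OF n]
  have B: "B > 0" using niceD(7)[OF n] A by linarith
  have i: "integrable gam u" by (rule nice_integrable[OF n])
  have ip: "integrable gam (\<lambda>g. (1 + nsq I g) ^ 3)" by (rule integrable_nsq_power[OF I])
  have iP: "integrable gam (\<lambda>z. Psi (u z))"
    by (rule GP.P.integrable_const_bound[OF AE_I2])
       (use abs_Psi_le[OF A niceD(5)[OF n] niceD(6)[OF n]]
            measurable_compose[OF niceD(3)[OF n] Psi_measurable] in auto)
  have b: "\<bar>u z - 1\<bar> \<le> L * (2 * (1 + nsq I z) ^ 3 + 2 * mom I)" for z
  proof -
    have "u z - 1 = (\<integral>g. u z - u g \<partial>gam)" using i m GP.P.prob_space by simp
    also have "\<bar>\<dots>\<bar> \<le> (\<integral>g. \<bar>u z - u g\<bar> \<partial>gam)" by (rule integral_abs_bound)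
    also have "\<dots> \<le> (\<integral>g. L * (2 * (1 + nsq I z) ^ 3 + 2 * (1 + nsq I g) ^ 3) \<partial>gam)"
    proof (rule integral_mono)
      show "integrable gam (\<lambda>g. \<bar>u z - u g\<bar>)" using i by simp
      show "integrable gam (\<lambda>g. L * (2 * (1 + nsq I z) ^ 3 + 2 * (1 + nsq I g) ^ 3))" using ip by simp
      fix g
      have "\<bar>u z - u g\<bar> \<le> L * sqrt (nsq I (\<lambda>i. z i + - g i))"
        using L[of g "\<lambda>i. z i + - g i"] by (simp add: abs_minus_commute)
      also have "\<dots> \<le> L * (1 + nsq I (\<lambda>i. z i + - g i))"
        using L0 nsq_powers(2) by (intro mult_left_mono) auto
      also have "\<dots> \<le> L * (2 * (1 + nsq I z) ^ 3 + 2 * (1 + nsq I g) ^ 3)"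
      proof (rule mult_left_mono[OF _ L0])
        have "nsq I (\<lambda>i. - g i) = nsq I g" by (simp add: nsq_def)
        then have "1 + nsq I (\<lambda>i. z i + - g i) \<le> 2 * (1 + nsq I z) + 2 * (1 + nsq I g)"
          using nsq_add_le[of I z "\<lambda>i. - g i"] by simp
        then show "1 + nsq I (\<lambda>i. z i + - g i) \<le> 2 * (1 + nsq I z) ^ 3 + 2 * (1 + nsq I g) ^ 3"
          by (rule order_trans) (intro add_mono mult_left_mono nsq_powers(3); simp)
      qed
      finally show "\<bar>u z - u g\<bar> \<le> L * (2 * (1 + nsq I z) ^ 3 + 2 * (1 + nsq I g) ^ 3)" .
    qed
    also have "\<dots> = L * (2 * (1 + nsq I z) ^ 3 + 2 * mom I)"
      using ip GP.P.prob_space by (simp add: mom_def)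
    finally show ?thesis .
  qed
  have "Ent u \<le> (\<integral>z. B * (L * (2 * (1 + nsq I z) ^ 3 + 2 * mom I)) \<partial>gam)"
    unfolding Ent_def
  proof (rule integral_mono[OF iP])
    show "integrable gam (\<lambda>z. B * (L * (2 * (1 + nsq I z) ^ 3 + 2 * mom I)))" using ip by simp
    fix z
    have u: "u z > 0" "u z \<le> B" using niceD(5,6)[OF n, of z] A by auto
    have "Psi (u z) \<le> u z * (u z - 1)"
      unfolding Psi_def using u ln_le_minus_one[of "u z"] by (intro mult_left_mono) auto
    also have "\<dots> \<le> u z * \<bar>u z - 1\<bar>" using u by (intro mult_left_mono) auto
    also have "\<dots> \<le> B * \<bar>u z - 1\<bar>" using u by (intro mult_right_mono) auto
    also have "\<dots> \<le> B * (L * (2 * (1 + nsq I z) ^ 3 + 2 * mom I))"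
      using b B by (intro mult_left_mono) auto
    finally show "Psi (u z) \<le> B * (L * (2 * (1 + nsq I z) ^ 3 + 2 * mom I))" .
  qed
  also have "\<dots> = B * (4 * L * mom I)" using ip GP.P.prob_space by (simp add: mom_def algebra_simps)
  finally show ?thesis .
qed

text \<open>The heat flow argument. Along \<open>u\<^sub>k = P\<^sup>k u\<close> and \<open>T u\<^sub>k = P\<^sup>k (T u)\<close> the entropy losses
  per step are, up to \<open>O(b\<^sup>3)\<close>, multiples of the Fisher informations, which compare with factor
  \<open>c\<close>; with \<open>b = m\<^sup>-\<^sup>2\<close> and \<open>m\<^sup>5\<close> steps the accumulated error and the final entropy vanish.\<close>

lemma entropy_contraction:
  fixes T :: "((nat \<Rightarrow> real^3) \<Rightarrow> real) \<Rightarrow> (nat \<Rightarrow> real^3) \<Rightarrow> real"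
  assumes TJ: "\<And>u X. nice V A B C u X \<Longrightarrow>
      \<exists>Y. nice I A B C (T u) Y \<and> fisher I (\<lambda>_. 1) (T u) Y \<le> c * fisher V (\<lambda>_. 1) u X"
    and TP: "\<And>u X a b. nice V A B C u X \<Longrightarrow> a\<^sup>2 + b\<^sup>2 = 1 \<Longrightarrow> T (Pop a b u) = Pop a b (T u)"
    and Tm: "\<And>u X. nice V A B C u X \<Longrightarrow> (\<integral>z. T u z \<partial>gam) = (\<integral>z. u z \<partial>gam)"
    and n: "nice V A B C u X" and A: "A > 0" and mean: "(\<integral>z. u z \<partial>gam) = 1" and c: "c \<ge> 0"
  shows "Ent (T u) \<le> c * Ent u"
proof -
  obtain KV where KV: "KV \<ge> 0" "\<And>u X a b. nice V A B C u X \<Longrightarrow> 0 < b \<Longrightarrow> b \<le> 1 \<Longrightarrow> a\<^sup>2 + b\<^sup>2 = 1 \<Longrightarrow>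
      \<bar>Ent u - Ent (Pop a b u) - b\<^sup>2 * (kap / 2) * fisher V (\<lambda>_. 1) u X\<bar> \<le> KV * b ^ 3"
    using gap_bound[OF A, of V B C] by blast
  obtain KI where KI: "KI \<ge> 0" "\<And>u X a b. nice I A B C u X \<Longrightarrow> 0 < b \<Longrightarrow> b \<le> 1 \<Longrightarrow> a\<^sup>2 + b\<^sup>2 = 1 \<Longrightarrow>
      \<bar>Ent u - Ent (Pop a b u) - b\<^sup>2 * (kap / 2) * fisher I (\<lambda>_. 1) u X\<bar> \<le> KI * b ^ 3"
    using gap_bound[OF A, of I B C] by blast
  define L where "L = B - A + 2 * C"
  have L0: "L \<ge> 0" and B0: "B > 0" using niceD(2,7)[OF n] A by (auto simp: L_def)
  \<comment> \<open>The two discretisation errors and the bound on the final entropy; the factor 2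
    in front of L comes from the bound 2 / m for \<open>a ^ N\<close>.\<close>
  define K where "K = KI + c * KV + B * (4 * (2 * L) * mom I)"
  have est: "Ent (T u) \<le> c * Ent u + K / real m" if m: "m \<ge> 1" for m :: nat
  proof -
    define b where "b = 1 / (real m)\<^sup>2"
    define a where "a = sqrt (1 - b\<^sup>2)"
    define N where "N = m ^ 5"
    have b: "0 < b" "b \<le> 1" using m by (auto simp: b_def)
    have b2: "b\<^sup>2 \<le> 1" using b by (simp add: power_le_one)
    have ab: "a\<^sup>2 + b\<^sup>2 = 1" using b2 by (simp add: a_def)
    have a: "0 \<le> a" "\<bar>a\<bar> \<le> 1" using b2 by (auto simp: a_def)
    define uu where "uu k = (Pop a b ^^ k) u" for k
    have nu: "\<exists>X. nice V A B C (uu k) X" for k unfolding uu_def by (rule Pop_funpow_nice[OF n a(2)])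
    have nv: "\<exists>Y. nice I A B C (T (uu k)) Y" for k using nu[of k] TJ by blast
    have uS: "uu (Suc k) = Pop a b (uu k)" for k by (simp add: uu_def)
    have vS: "T (uu (Suc k)) = Pop a b (T (uu k))" for k using nu[of k] TP[OF _ ab] uS by auto
    have step: "Ent (T (uu k)) - Ent (T (uu (Suc k))) \<le> c * (Ent (uu k) - Ent (uu (Suc k))) + (KI + c * KV) * b ^ 3" for k
    proof -
      obtain X where X: "nice V A B C (uu k) X" using nu by blast
      obtain Y where Y: "nice I A B C (T (uu k)) Y" "fisher I (\<lambda>_. 1) (T (uu k)) Y \<le> c * fisher V (\<lambda>_. 1) (uu k) X"
        using TJ[OF X] by blast
      have 1: "Ent (T (uu k)) - Ent (T (uu (Suc k))) \<le> b\<^sup>2 * (kap / 2) * fisher I (\<lambda>_. 1) (T (uu k)) Y + KI * b ^ 3"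
        using KI(2)[OF Y(1) b ab] unfolding vS abs_le_iff by linarith
      have 2: "b\<^sup>2 * (kap / 2) * fisher V (\<lambda>_. 1) (uu k) X \<le> Ent (uu k) - Ent (uu (Suc k)) + KV * b ^ 3"
        using KV(2)[OF X b ab] unfolding uS abs_le_iff by linarith
      have "b\<^sup>2 * (kap / 2) * fisher I (\<lambda>_. 1) (T (uu k)) Y \<le> b\<^sup>2 * (kap / 2) * (c * fisher V (\<lambda>_. 1) (uu k) X)"
        using Y(2) kap_nonneg by (intro mult_left_mono) auto
      also have "\<dots> = c * (b\<^sup>2 * (kap / 2) * fisher V (\<lambda>_. 1) (uu k) X)" by simp
      also have "\<dots> \<le> c * (Ent (uu k) - Ent (uu (Suc k)) + KV * b ^ 3)" using 2 c by (rule mult_left_mono)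
      finally show ?thesis using 1 by (simp add: algebra_simps)
    qed
    have tel: "Ent (T (uu 0)) - Ent (T (uu k)) \<le> c * (Ent (uu 0) - Ent (uu k)) + real k * ((KI + c * KV) * b ^ 3)" for k
    proof (induction k)
      case (Suc k) then show ?case using step[of k] by (simp add: algebra_simps)
    qed simp
    have mu: "(\<integral>z. uu k z \<partial>gam) = 1" for k
    proof (induction k)
      case 0 then show ?case using mean by (simp add: uu_def)
    next
      case (Suc k)
      obtain X where X: "nice V A B C (uu k) X" using nu by blast
      show ?case unfolding uS using Pop_mean(1)[OF niceD(3)[OF X] nice_bounded[OF X] ab] Suc by simp
    qed
    have mv: "(\<integral>z. T (uu k) z \<partial>gam) = 1" for k using nu[of k] Tm mu[of k] by metis
    have lip: "\<bar>T (uu k) (\<lambda>i. z i + e i) - T (uu k) z\<bar> \<le> (a ^ k * L) * sqrt (nsq I e)" for k z e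
    proof (induction k arbitrary: z e)
      case 0
      then show ?case using nv[of 0] nice_lipschitz[of I A B C] by (auto simp: L_def)
    next
      case (Suc k)
      obtain Y where Y: "nice I A B C (T (uu k)) Y" using nv by blast
      show ?case unfolding vS using Pop_lipschitz[OF Y Suc.IH, of a b z e] a by (simp add: mult_ac)
    qed
    obtain XN where XN: "nice V A B C (uu N) XN" using nu by blast
    obtain YN where YN: "nice I A B C (T (uu N)) YN" using nv by blast
    have e0: "0 \<le> Ent (uu N)" by (rule Ent_nonneg[OF XN A mu])
    have "0 \<le> a ^ N * L" using a L0 by simp
    from Ent_le_lipschitz[OF YN A mv lip this]
    have eN: "Ent (T (uu N)) \<le> B * (4 * (a ^ N * L) * mom I)" .
    \<comment> \<open>Here a^2 = 1 - b^2 \<le> exp (- b^2) and N b^2 = m^5 / m^4 = m, so that a^N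
      \<le> exp (- m / 2).\<close>
    have aN: "a ^ N \<le> 2 / real m"
    proof -
      have "a\<^sup>2 \<le> exp (- b\<^sup>2)" using ab exp_ge_add_one_self[of "- b\<^sup>2"] by linarith
      also have "\<dots> = (exp (- b\<^sup>2 / 2))\<^sup>2" by (simp add: exp_double[symmetric])
      finally have "a \<le> exp (- b\<^sup>2 / 2)" using a by (simp add: power2_le_iff_abs_le)
      then have "a ^ N \<le> exp (- b\<^sup>2 / 2) ^ N" using a by (intro power_mono)
      also have "\<dots> = exp (- (real N * b\<^sup>2) / 2)" by (simp add: exp_of_nat_mult[symmetric])
      also have "real N * b\<^sup>2 = real m" using m by (simp add: N_def b_def eval_nat_numeral)
      also have "exp (- real m / 2) \<le> 2 / real m"
        using m exp_ge_add_one_self[of "real m / 2"] by (simp add: exp_minus field_simps)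
      finally show ?thesis .
    qed
    have "4 * (a ^ N * L) * mom I \<le> 4 * (2 / real m * L) * mom I"
      using aN L0 mom_ge_0 by (intro mult_right_mono mult_left_mono) auto
    then have eN': "Ent (T (uu N)) \<le> B * (4 * (2 / real m * L) * mom I)"
      using eN B0 mult_left_mono[of _ _ B] by (meson less_imp_le order_trans)
    \<comment> \<open>The N errors of size b^3 add up to m^5 / m^6 = 1 / m.\<close>
    have "real N * ((KI + c * KV) * b ^ 3) = (KI + c * KV) / real m"
      using m by (simp add: N_def b_def eval_nat_numeral)
    then have "Ent (T (uu 0)) \<le> c * Ent (uu 0) + (KI + c * KV) / real m + B * (4 * (2 / real m * L) * mom I)"
      \<comment> \<open>The entropy of \<open>uu N\<close> enters with a negative sign and is
        dropped, being nonnegative.\<close>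
      using tel[of N] eN' mult_nonneg_nonneg[OF c e0] unfolding right_diff_distrib by linarith
    then show ?thesis by (simp add: uu_def K_def add_divide_distrib mult_ac)
  qed
  show ?thesis
  proof (rule LIMSEQ_le_const)
    show "(\<lambda>m. c * Ent u + K / real m) \<longlonglongrightarrow> c * Ent u"
      using tendsto_add[OF tendsto_const lim_const_over_n[of K], of "c * Ent u"] by simp
    show "\<exists>N. \<forall>m\<ge>N. Ent (T u) \<le> c * Ent u + K / real m" using est by blast
  qed
qed

section \<open>The collision semigroup\<close>

lemma Fubini_bounded:
  fixes f :: "'a \<Rightarrow> 'b \<Rightarrow> real"
  assumes K: "prob_space K" and K': "prob_space K'"
    and m: "(\<lambda>(x, y). f x y) \<in> borel_measurable (K \<Otimes>\<^sub>M K')" and b: "\<And>x y. \<bar>f x y\<bar> \<le> D"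
  shows "(\<integral>x. (\<integral>y. f x y \<partial>K') \<partial>K) = (\<integral>y. (\<integral>x. f x y \<partial>K) \<partial>K')"
    and "integrable K (\<lambda>x. \<integral>y. f x y \<partial>K')" and "integrable K' (\<lambda>y. \<integral>x. f x y \<partial>K)"
    and "(\<integral>x. (\<integral>y. f x y \<partial>K') \<partial>K) = (\<integral>p. f (fst p) (snd p) \<partial>(K \<Otimes>\<^sub>M K'))"
proof -
  interpret P: pair_sigma_finite K K'
    by (intro pair_sigma_finite.intro prob_space_imp_sigma_finite K K')
  have KK: "prob_space (K \<Otimes>\<^sub>M K')" by (intro prob_space_pair K K')
  have i: "integrable (K \<Otimes>\<^sub>M K') (\<lambda>(x, y). f x y)"
    using b m by (intro finite_measure.integrable_const_bound[OF prob_space.finite_measure[OF KK], of _ D] AE_I2)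
      (auto simp: split_beta')
  show "(\<integral>x. (\<integral>y. f x y \<partial>K') \<partial>K) = (\<integral>y. (\<integral>x. f x y \<partial>K) \<partial>K')"
    using P.Fubini_integral[OF i] by simp
  show "integrable K (\<lambda>x. \<integral>y. f x y \<partial>K')" using P.integrable_fst[OF i] by simp
  show "integrable K' (\<lambda>y. \<integral>x. f x y \<partial>K)" using P.integrable_snd[OF i] by simp
  show "(\<integral>x. (\<integral>y. f x y \<partial>K') \<partial>K) = (\<integral>p. f (fst p) (snd p) \<partial>(K \<Otimes>\<^sub>M K'))"
    using P.integral_fst[OF i] by (simp add: split_beta')
qed

lemma integral_coordwise:
  fixes h :: "(nat \<Rightarrow> real^3) \<Rightarrow> real"
  assumes \<phi>: "\<And>i. \<phi> i \<in> measurable (gamma3 \<Otimes>\<^sub>M gamma3) borel"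
    and d: "\<And>i. distr (gamma3 \<Otimes>\<^sub>M gamma3) borel (\<phi> i) = gamma3"
    and m: "h \<in> borel_measurable gam" and b: "\<And>z. \<bar>h z\<bar> \<le> D"
  shows "(\<integral>z. (\<integral>w. h (\<lambda>i. \<phi> i (z i, w i)) \<partial>gam) \<partial>gam) = (\<integral>z. h z \<partial>gam)"
proof -
  note [measurable] = \<phi>
  have mm: "(\<lambda>(z, w) i. \<phi> i (z i, w i)) \<in> measurable (gam \<Otimes>\<^sub>M gam) gam"
    by (rule measurable_gamI) (auto simp: split_beta')
  have "(\<integral>z. h z \<partial>gam) = (\<integral>z. h z \<partial>distr (gam \<Otimes>\<^sub>M gam) gam (\<lambda>(z, w) i. \<phi> i (z i, w i)))"
    by (simp only: distr_coordwise[OF \<phi> d])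
  also have "\<dots> = (\<integral>p. h (\<lambda>i. \<phi> i (fst p i, snd p i)) \<partial>(gam \<Otimes>\<^sub>M gam))"
    by (subst integral_distr[OF mm m]) (simp add: split_beta')
  also have "\<dots> = (\<integral>z. (\<integral>w. h (\<lambda>i. \<phi> i (z i, w i)) \<partial>gam) \<partial>gam)"
    using measurable_compose[OF mm m] b
    by (intro Fubini_bounded(4)[OF prob_space_gam prob_space_gam, where D=D, symmetric]) (auto simp: split_beta')
  finally show ?thesis by simp
qed

lemma distr_gamma3_fst: "distr (gamma3 \<Otimes>\<^sub>M gamma3) borel fst = gamma3"
  and distr_gamma3_snd: "distr (gamma3 \<Otimes>\<^sub>M gamma3) borel snd = gamma3"
proof -
  have "(\<lambda>(x, y). 1 *\<^sub>R x + 0 *\<^sub>R y) = (fst :: (real^3) \<times> (real^3) \<Rightarrow> _)"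
    "(\<lambda>(x, y). 0 *\<^sub>R x + 1 *\<^sub>R y) = (snd :: (real^3) \<times> (real^3) \<Rightarrow> _)" by auto
  then show "distr (gamma3 \<Otimes>\<^sub>M gamma3) borel fst = gamma3" "distr (gamma3 \<Otimes>\<^sub>M gamma3) borel snd = gamma3"
    using distr_gamma3_rotate[of 1 0] distr_gamma3_rotate[of 0 1] by simp_all
qed

section \<open>Commutation with the semigroup and conservation of the mean\<close>

lemma Pop_mix:
  assumes K: "prob_space K" and m: "(\<lambda>(\<xi>, z). U \<xi> z) \<in> borel_measurable (K \<Otimes>\<^sub>M gam)"
    and b: "\<And>\<xi> z. \<bar>U \<xi> z\<bar> \<le> D"
  shows "Pop a b (\<lambda>z. \<integral>\<xi>. U \<xi> z \<partial>K) z = (\<integral>\<xi>. Pop a b (U \<xi>) z \<partial>K)"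
proof -
  have "(\<lambda>g i. a *\<^sub>R z i + b *\<^sub>R g i) \<in> measurable gam gam" by (rule measurable_gamI) simp
  then have "(\<lambda>p. (fst p, \<lambda>i. a *\<^sub>R z i + b *\<^sub>R snd p i)) \<in> measurable (K \<Otimes>\<^sub>M gam) (K \<Otimes>\<^sub>M gam)"
    by (intro measurable_Pair measurable_fst measurable_compose[OF measurable_snd])
  from measurable_compose[OF this m]
  have "(\<lambda>(\<xi>, g). U \<xi> (\<lambda>i. a *\<^sub>R z i + b *\<^sub>R g i)) \<in> borel_measurable (K \<Otimes>\<^sub>M gam)"
    by (simp add: split_beta')
  from Fubini_bounded(1)[OF K prob_space_gam this, of D] b show ?thesis
    unfolding Pop_def by simp
qed

lemma mean_mix:
  fixes U :: "'a \<Rightarrow> (nat \<Rightarrow> real^3) \<Rightarrow> real"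
  assumes K: "prob_space K" and m: "(\<lambda>(\<xi>, z). U \<xi> z) \<in> borel_measurable (K \<Otimes>\<^sub>M gam)"
    and b: "\<And>\<xi> z. \<bar>U \<xi> z\<bar> \<le> D"
  shows "(\<integral>z. (\<integral>\<xi>. U \<xi> z \<partial>K) \<partial>gam) = (\<integral>\<xi>. (\<integral>z. U \<xi> z \<partial>gam) \<partial>K)"
  using Fubini_bounded(1)[OF K prob_space_gam m, of D] b by simp

lemma rmap_scale: "rmap i j \<omega> (\<lambda>l. a *\<^sub>R z l) = (\<lambda>l. a *\<^sub>R rmap i j \<omega> z l)"
  by (rule ext) (simp add: rmap_def scaleR_add_right scaleR_diff_right)

lemma U_rw_measurable:
  assumes u: "u \<in> borel_measurable gam"
  shows "(\<lambda>(\<omega>, z). u (rmap i j (rw \<omega>) z)) \<in> borel_measurable (sphere_measure \<Otimes>\<^sub>M gam)"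
proof -
  have "(\<lambda>p. rw (fst p)) \<in> borel_measurable (sphere_measure \<Otimes>\<^sub>M gam)"
    by (rule measurable_compose[OF measurable_fst]) simp
  from measurable_compose[OF rmap_measurable[OF this measurable_snd] u]
  show ?thesis by (simp add: split_beta')
qed

lemma Rop_bounded_measurable:
  assumes u: "u \<in> borel_measurable gam" and b: "\<And>z. \<bar>u z\<bar> \<le> D"
  shows "Rop i j u \<in> borel_measurable gam" "\<bar>Rop i j u z\<bar> \<le> D"
proof -
  have "(\<lambda>(z, \<omega>). u (rmap i j (rw \<omega>) z)) \<in> borel_measurable (gam \<Otimes>\<^sub>M sphere_measure)"
    using measurable_compose[OF measurable_pair_swap' U_rw_measurable[OF u, of i j]] by (simp add: split_beta')
  from SP.borel_measurable_lebesgue_integral[OF this]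
  show "Rop i j u \<in> borel_measurable gam" unfolding Rop_rw[OF u, abs_def] by simp
  have "(\<lambda>\<omega>. rmap i j (rw \<omega>) z) \<in> measurable sphere_measure gam"
    unfolding rmap_def by (rule measurable_gamI) simp
  from measurable_compose[OF this u]
  have m: "(\<lambda>\<omega>. u (rmap i j (rw \<omega>) z)) \<in> borel_measurable sphere_measure" .
  have i: "integrable sphere_measure (\<lambda>\<omega>. u (rmap i j (rw \<omega>) z))"
    using b m by (intro SP.integrable_const_bound AE_I2) auto
  show "\<bar>Rop i j u z\<bar> \<le> D" unfolding Rop_rw[OF u]
    by (rule order_trans[OF integral_abs_bound], rule SP.integral_le_const) (use i b in auto)
qed

text \<open>A collision is linear, so it acts on a z and on the noise b g separately; the reflected
  noise has the same law as the noise and can be replaced by it.\<close>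

lemma Rop_Pop:
  assumes u: "u \<in> borel_measurable gam" and b: "\<And>z. \<bar>u z\<bar> \<le> D" and ij: "i \<noteq> j"
    and Pm: "Pop a b' u \<in> borel_measurable gam"
  shows "Rop i j (Pop a b' u) = Pop a b' (Rop i j u)"
proof (rule ext)
  fix z
  have e: "Pop a b' (\<lambda>z. u (rmap i j (rw \<omega>) z)) z = Pop a b' u (rmap i j (rw \<omega>) z)" for \<omega>
  proof -
    have "(\<lambda>g i. a *\<^sub>R z' i + b' *\<^sub>R g i) \<in> measurable gam gam" for z' by (rule measurable_gamI) simp
    then have m: "(\<lambda>g. u (\<lambda>l. a *\<^sub>R z' l + b' *\<^sub>R g l)) \<in> borel_measurable gam" for z'
      using measurable_compose[OF _ u] by blast
    have "Pop a b' (\<lambda>z. u (rmap i j (rw \<omega>) z)) z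
        = (\<integral>g. u (\<lambda>l. a *\<^sub>R rmap i j (rw \<omega>) z l + b' *\<^sub>R rmap i j (rw \<omega>) g l) \<partial>gam)"
      unfolding Pop_def rmap_add rmap_scale ..
    also have "\<dots> = Pop a b' u (rmap i j (rw \<omega>) z)"
      unfolding Pop_def by (rule integral_rmap[OF ij m])
    finally show ?thesis .
  qed
  have "Pop a b' (Rop i j u) z = (\<integral>\<omega>. Pop a b' (\<lambda>z. u (rmap i j (rw \<omega>) z)) z \<partial>sphere_measure)"
    unfolding Rop_rw[OF u, abs_def] by (rule Pop_mix[OF prob_space_sphere U_rw_measurable[OF u] b])
  also have "\<dots> = Rop i j (Pop a b' u) z" unfolding e Rop_rw[OF Pm] ..
  finally show "Rop i j (Pop a b' u) z = Pop a b' (Rop i j u) z" by simp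
qed

lemma Rop_mean:
  assumes u: "u \<in> borel_measurable gam" and b: "\<And>z. \<bar>u z\<bar> \<le> D" and ij: "i \<noteq> j"
  shows "(\<integral>z. Rop i j u z \<partial>gam) = (\<integral>z. u z \<partial>gam)"
proof -
  have "(\<integral>z. Rop i j u z \<partial>gam) = (\<integral>\<omega>. (\<integral>z. u (rmap i j (rw \<omega>) z) \<partial>gam) \<partial>sphere_measure)"
    unfolding Rop_rw[OF u] by (rule mean_mix[OF prob_space_sphere U_rw_measurable[OF u] b])
  also have "\<dots> = (\<integral>z. u z \<partial>gam)"
    unfolding integral_rmap[OF ij u] using SP.prob_space by simp
  finally show ?thesis .
qed

text \<open>Both orders give the system the velocities a z + b g. The reservoir gets a w + b g in
  one order and w in the other, and these have the same law because the squares of the coefficients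
  add up to 1.\<close>

lemma Eop_Pop:
  assumes n: "u \<in> borel_measurable gam" and b: "\<And>z. \<bar>u z\<bar> \<le> D" and ab: "a\<^sup>2 + b'\<^sup>2 = 1"
  shows "Eop M (Pop a b' u) = Pop a b' (Eop M u)"
proof (rule ext)
  fix z
  define \<Psi> where "\<Psi> = (\<lambda>y. u (\<lambda>i. if i < M then a *\<^sub>R z i + b' *\<^sub>R y i else y i))"
  have "(\<lambda>y i. if i < M then a *\<^sub>R z i + b' *\<^sub>R y i else y i) \<in> measurable gam gam"
    by (rule measurable_gamI) simp
  from measurable_compose[OF this n] have m: "\<Psi> \<in> borel_measurable gam" by (simp add: \<Psi>_def)
  have bb: "\<bar>\<Psi> y\<bar> \<le> D" for y using b by (simp add: \<Psi>_def)
  have "Eop M (Pop a b' u) z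
      = (\<integral>w. (\<integral>g. \<Psi> (\<lambda>i. (if i < M then snd else (\<lambda>(w, g). a *\<^sub>R w + b' *\<^sub>R g)) (w i, g i)) \<partial>gam) \<partial>gam)"
    unfolding Eop_def Pop_def \<Psi>_def
    by (intro Bochner_Integration.integral_cong refl arg_cong[where f=u]) auto
  also have "\<dots> = (\<integral>y. \<Psi> y \<partial>gam)"
    using distr_gamma3_rotate[OF ab] distr_gamma3_snd
    by (intro integral_coordwise[OF _ _ m bb]) auto
  also have "\<dots> = (\<integral>g. (\<integral>w. \<Psi> (\<lambda>i. (if i < M then fst else snd) (g i, w i)) \<partial>gam) \<partial>gam)"
    using distr_gamma3_fst distr_gamma3_snd
    by (intro integral_coordwise[OF _ _ m bb, symmetric]) auto
  also have "\<dots> = Pop a b' (Eop M u) z"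
    unfolding Eop_def Pop_def \<Psi>_def
    by (intro Bochner_Integration.integral_cong refl arg_cong[where f=u]) auto
  finally show "Eop M (Pop a b' u) z = Pop a b' (Eop M u) z" .
qed

lemma Eop_mean:
  assumes n: "u \<in> borel_measurable gam" and b: "\<And>z. \<bar>u z\<bar> \<le> D"
  shows "(\<integral>z. Eop M u z \<partial>gam) = (\<integral>z. u z \<partial>gam)"
proof -
  have "(\<integral>z. Eop M u z \<partial>gam) = (\<integral>z. (\<integral>w. u (\<lambda>i. (if i < M then fst else snd) (z i, w i)) \<partial>gam) \<partial>gam)"
    unfolding Eop_def by (intro Bochner_Integration.integral_cong refl arg_cong[where f=u]) auto
  also have "\<dots> = (\<integral>z. u z \<partial>gam)"
    using distr_gamma3_fst distr_gamma3_snd by (intro integral_coordwise[OF _ _ n b]) auto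
  finally show ?thesis .
qed

text \<open>Finite convex combinations and Poisson series become integrals against such a measure,
  so that \<open>nice_mix\<close> and \<open>fisher_mix\<close> cover them exactly as they cover the
  averages over the sphere and over \<open>gam\<close>.\<close>

definition dmeas :: "('a \<Rightarrow> real) \<Rightarrow> 'a measure" where
  "dmeas f = density (count_space UNIV) (\<lambda>x. ennreal (f x))"

lemma sets_dmeas [simp]: "sets (dmeas f) = UNIV" and space_dmeas [simp]: "space (dmeas f) = UNIV"
  by (simp_all add: dmeas_def)

lemma integral_dmeas:
  assumes "\<And>x. 0 \<le> f x"
  shows "(\<integral>x. g x \<partial>dmeas f) = (\<integral>x. f x * (g x :: real) \<partial>count_space UNIV)"
  unfolding dmeas_def using assms by (subst integral_density) auto

lemma prob_space_dmeas:
  assumes "\<And>x. 0 \<le> f x" "integrable (count_space UNIV) f" "(\<integral>x. f x \<partial>count_space UNIV) = 1"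
  shows "prob_space (dmeas f)"
proof (rule prob_spaceI)
  have "(\<integral>\<^sup>+x. ennreal (f x) \<partial>count_space UNIV) = 1"
    using nn_integral_eq_integral[OF assms(2)] assms by simp
  then show "emeasure (dmeas f) (space (dmeas f)) = 1"
    by (simp add: dmeas_def emeasure_density)
qed

text \<open>The index space is countable with all subsets measurable, so measurability of each
  section is enough. Gradients picked by choice, one for each index, are therefore
  admissible.\<close>

lemma dmeas_joint_measurable:
  fixes F :: "'a::countable \<Rightarrow> (nat \<Rightarrow> real^3) \<Rightarrow> 'b::topological_space"
  assumes "\<And>\<xi>. F \<xi> \<in> borel_measurable gam"
  shows "(\<lambda>(\<xi>, z). F \<xi> z) \<in> borel_measurable (dmeas f \<Otimes>\<^sub>M gam)"
proof -
  have "(\<lambda>(\<xi>, z). F \<xi> z) \<in> borel_measurable (count_space UNIV \<Otimes>\<^sub>M gam)"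
    by (rule measurable_pair_measure_countable1) (use assms in auto)
  moreover have "sets (dmeas f \<Otimes>\<^sub>M gam) = sets (count_space UNIV \<Otimes>\<^sub>M gam)"
    by (rule sets_pair_measure_cong) auto
  ultimately show ?thesis by (simp cong: measurable_cong_sets)
qed

text \<open>\<open>Qop\<close> performs one random collision and \<open>Sop r\<close> a Poisson number, of mean \<open>r\<close>, of them,
  so that \<open>exp (t L)\<close> is \<open>Sop\<close> at \<open>r = \<Lambda> t\<close>, where \<open>\<Lambda>\<close> is the total rate. \<open>Rc\<close> and \<open>Qc\<close> are the
  corresponding maps on the weights of the Fisher information.\<close>

definition Qop :: "(nat \<times> nat) set \<Rightarrow> (nat \<times> nat \<Rightarrow> real) \<Rightarrow> ((nat \<Rightarrow> real^3) \<Rightarrow> real) \<Rightarrow> (nat \<Rightarrow> real^3) \<Rightarrow> real" where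
  "Qop PS w u z = (\<Sum>p\<in>PS. w p / sum w PS * Rop (fst p) (snd p) u z)"

definition Qc :: "(nat \<times> nat) set \<Rightarrow> (nat \<times> nat \<Rightarrow> real) \<Rightarrow> (nat \<Rightarrow> real) \<Rightarrow> nat \<Rightarrow> real" where
  "Qc PS w c l = (\<Sum>p\<in>PS. w p / sum w PS * Rc (fst p) (snd p) c l)"

definition pois :: "real \<Rightarrow> nat \<Rightarrow> real" where
  "pois r k = r ^ k / fact k * exp (- r)"

definition Sop :: "(nat \<times> nat) set \<Rightarrow> (nat \<times> nat \<Rightarrow> real) \<Rightarrow> real \<Rightarrow> ((nat \<Rightarrow> real^3) \<Rightarrow> real) \<Rightarrow> (nat \<Rightarrow> real^3) \<Rightarrow> real" where
  "Sop PS w r u z = (\<integral>k. (Qop PS w ^^ k) u z \<partial>dmeas (pois r))"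

lemma pois_nonneg: "r \<ge> 0 \<Longrightarrow> pois r k \<ge> 0" by (simp add: pois_def)

lemma pois_mgf_sums: "(\<lambda>k. pois r k * x ^ k) sums exp (r * x - r)"
proof -
  have "(\<lambda>k. exp (- r) * ((r * x) ^ k /\<^sub>R fact k)) sums (exp (- r) * exp (r * x))"
    by (intro sums_mult exp_converges)
  then show ?thesis
    by (simp add: pois_def power_mult_distrib divide_inverse mult_ac exp_add[symmetric] exp_diff exp_minus)
qed

text \<open>This generating function averages \<open>rho ^ k\<close> over the random number k of
  collisions and thus produces the exponential in time. For |x| \<le> 1 the series is dominated by
  the one for x = 1.\<close>

lemma integral_pois_mgf:
  assumes "r \<ge> 0" and x: "\<bar>x\<bar> \<le> 1"
  shows "integrable (dmeas (pois r)) (\<lambda>k. x ^ k)" "(\<integral>k. x ^ k \<partial>dmeas (pois r)) = exp (r * x - r)"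
proof -
  have s: "summable (\<lambda>k. norm (pois r k * x ^ k))"
  proof (rule summable_comparison_test'[of "\<lambda>k. pois r k * 1 ^ k" 0])
    show "summable (\<lambda>k. pois r k * 1 ^ k)" using pois_mgf_sums[of r 1] by (rule sums_summable)
    show "norm (norm (pois r k * x ^ k)) \<le> pois r k * 1 ^ k" for k
      using pois_nonneg[OF assms(1), of k] power_le_one[of "\<bar>x\<bar>" k] x
      by (simp add: abs_mult power_abs mult_left_le)
  qed
  then have i: "integrable (count_space UNIV) (\<lambda>k. pois r k * x ^ k)"
    by (simp add: integrable_count_space_nat_iff)
  show "integrable (dmeas (pois r)) (\<lambda>k. x ^ k)"
    unfolding dmeas_def using i pois_nonneg[OF assms(1)] by (subst integrable_density) auto
  show "(\<integral>k. x ^ k \<partial>dmeas (pois r)) = exp (r * x - r)"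
    using sums_unique2[OF sums_integral_count_space_nat[OF i] pois_mgf_sums]
    by (simp add: integral_dmeas pois_nonneg[OF assms(1)])
qed

lemma prob_space_pois: "r \<ge> 0 \<Longrightarrow> prob_space (dmeas (pois r))"
proof (rule prob_space_dmeas)
  assume r: "r \<ge> 0"
  show "0 \<le> pois r k" for k by (rule pois_nonneg[OF r])
  have "summable (\<lambda>k. norm (pois r k))"
    using sums_summable[OF pois_mgf_sums[of r 1]] pois_nonneg[OF r] by simp
  then show i: "integrable (count_space UNIV) (pois r)" by (simp add: integrable_count_space_nat_iff)
  show "(\<integral>k. pois r k \<partial>count_space UNIV) = 1"
    using sums_unique2[OF sums_integral_count_space_nat[OF i], of 1] pois_mgf_sums[of r 1] by simp
qed

lemma integral_pois_sums:
  assumes r: "r \<ge> 0" and b: "\<And>k. \<bar>g k\<bar> \<le> D"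
  shows "(\<lambda>k. pois r k * g k) sums (\<integral>k. g k \<partial>dmeas (pois r))"
proof -
  have "summable (\<lambda>k. norm (pois r k * g k))"
  proof (rule summable_comparison_test'[of "\<lambda>k. pois r k * D" 0])
    show "summable (\<lambda>k. pois r k * D)"
      using sums_summable[OF pois_mgf_sums[of r 1]] by (intro summable_mult2) simp
    show "norm (norm (pois r k * g k)) \<le> pois r k * D" for k
      using pois_nonneg[OF r, of k] b[of k] by (simp add: abs_mult mult_left_mono)
  qed
  then have i: "integrable (count_space UNIV) (\<lambda>k. pois r k * g k)"
    by (simp add: integrable_count_space_nat_iff)
  show ?thesis using sums_integral_count_space_nat[OF i] by (simp add: integral_dmeas pois_nonneg[OF r])
qed

lemma Rc_nonneg: "\<forall>l. 0 \<le> c l \<Longrightarrow> 0 \<le> Rc i j c l"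
proof -
  assume c: "\<forall>l. 0 \<le> c l"
  have "c i + (c j - c i) / 3 = 2 / 3 * c i + c j / 3" "c j + (c i - c j) / 3 = 2 / 3 * c j + c i / 3"
    by (simp_all add: field_simps)
  then show ?thesis using c by (simp add: Rc_def)
qed

lemma integral_lin_comb:
  fixes f :: "'b \<Rightarrow> 'a \<Rightarrow> real"
  assumes "\<And>p. p \<in> P \<Longrightarrow> integrable K (f p)"
  shows "(\<integral>x. (\<Sum>p\<in>P. a p * f p x) \<partial>K) = (\<Sum>p\<in>P. a p * (\<integral>x. f p x \<partial>K))"
proof -
  have "(\<integral>x. (\<Sum>p\<in>P. a p * f p x) \<partial>K) = (\<Sum>p\<in>P. (\<integral>x. a p * f p x \<partial>K))"
    by (rule Bochner_Integration.integral_sum) (rule integrable_mult_right[OF assms])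
  then show ?thesis by (simp only: integral_mult_right_zero)
qed

text \<open>Linearity in the weights is what allows a mixture of collisions to be moved from the
  function to the weights.\<close>

lemma fisher_sum:
  assumes n: "nice I A B C u X" and A: "A > 0" and P: "finite P"
  shows "fisher I (\<lambda>l. \<Sum>p\<in>P. a p * c p l) u X = (\<Sum>p\<in>P. a p * fisher I (c p) u X)"
proof -
  have "wsq I (\<lambda>l. \<Sum>p\<in>P. a p * c p l) x = (\<Sum>p\<in>P. a p * wsq I (c p) x)" for x
    unfolding wsq_def sum_distrib_right sum_distrib_left
    by (subst sum.swap) (simp add: mult.assoc)
  then have "fisher I (\<lambda>l. \<Sum>p\<in>P. a p * c p l) u X = (\<integral>z. (\<Sum>p\<in>P. a p * (wsq I (c p) (X z) / u z)) \<partial>gam)"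
    unfolding fisher_def by (simp only: sum_divide_distrib times_divide_eq_right)
  also have "\<dots> = (\<Sum>p\<in>P. a p * fisher I (c p) u X)"
    unfolding fisher_def by (rule integral_lin_comb) (rule wsq_quotient_integrable[OF n A])
  finally show ?thesis .
qed

section \<open>One random collision and a Poisson number of them\<close>

locale collisions =
  fixes PS :: "(nat \<times> nat) set" and w :: "nat \<times> nat \<Rightarrow> real" and I :: "nat set"
  assumes PS: "finite PS" "\<And>p. p \<in> PS \<Longrightarrow> fst p \<in> I \<and> snd p \<in> I \<and> fst p \<noteq> snd p"
    and w: "\<And>p. p \<in> PS \<Longrightarrow> 0 \<le> w p" and wpos: "sum w PS > 0"
begin

definition qw :: "nat \<times> nat \<Rightarrow> real" where "qw p = (if p \<in> PS then w p / sum w PS else 0)"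

lemma qw_nonneg: "qw p \<ge> 0" using w wpos by (simp add: qw_def)

lemma qw_integrable: "integrable (count_space UNIV) (\<lambda>p. qw p * g p :: real)"
  and integral_qw: "(\<integral>p. qw p * g p \<partial>count_space UNIV) = (\<Sum>p\<in>PS. w p / sum w PS * g p)"
proof -
  have f: "finite {p. qw p * g p \<noteq> 0}"
    by (rule finite_subset[OF _ PS(1)]) (auto simp: qw_def)
  show "integrable (count_space UNIV) (\<lambda>p. qw p * g p :: real)"
  proof (rule integrableI_bounded)
    have "(\<integral>\<^sup>+p. ennreal (norm (qw p * g p)) \<partial>count_space UNIV) = (\<Sum>p\<in>PS. ennreal (norm (qw p * g p)))"
      by (rule nn_integral_count_space'[OF PS(1)]) (auto simp: qw_def)
    then show "(\<integral>\<^sup>+p. ennreal (norm (qw p * g p)) \<partial>count_space UNIV) < \<infinity>"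
      using PS(1) by (simp add: less_top[symmetric])
  qed simp
  have "(\<integral>p. qw p * g p \<partial>count_space UNIV) = (\<Sum>p | qw p * g p \<noteq> 0. qw p * g p)"
    using f by (subst lebesgue_integral_count_space_finite_support) auto
  also have "\<dots> = (\<Sum>p\<in>PS. qw p * g p)"
    by (rule sum.mono_neutral_left[OF PS(1)]) (auto simp: qw_def)
  also have "\<dots> = (\<Sum>p\<in>PS. w p / sum w PS * g p)"
    by (rule sum.cong) (auto simp: qw_def)
  finally show "(\<integral>p. qw p * g p \<partial>count_space UNIV) = (\<Sum>p\<in>PS. w p / sum w PS * g p)" .
qed

lemma sum_qw: "(\<Sum>p\<in>PS. w p / sum w PS) = 1"
  using wpos by (simp add: sum_divide_distrib[symmetric])

lemma prob_space_qw: "prob_space (dmeas qw)"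
  by (rule prob_space_dmeas[OF qw_nonneg])
     (use qw_integrable[of "\<lambda>_. 1"] integral_qw[of "\<lambda>_. 1"] sum_qw in auto)

lemma integral_dmeas_qw: "(\<integral>p. g p \<partial>dmeas qw) = (\<Sum>p\<in>PS. w p / sum w PS * (g p :: real))"
  by (simp add: integral_dmeas qw_nonneg integral_qw)

abbreviation "Q \<equiv> Qop PS w"
abbreviation "S \<equiv> Sop PS w"

lemma Q_nice:
  assumes n: "nice I A B C u X" and A: "A > 0"
  shows "\<exists>X'. nice I A B C (Q u) X' \<and>
    (\<forall>c. (\<forall>l. 0 \<le> c l) \<longrightarrow> fisher I c (Q u) X' \<le> fisher I (Qc PS w c) u X)"
proof -
  \<comment> \<open>The measure \<open>dmeas qw\<close> lives on all pairs, so a nice function is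
    needed for each of them; outside \<open>PS\<close>, where there is no mass, u itself is
    taken.\<close>
  define U where "U p = (if p \<in> PS then Rop (fst p) (snd p) u else u)" for p
  have "\<forall>p. \<exists>Y. nice I A B C (U p) Y \<and>
      (p \<in> PS \<longrightarrow> (\<forall>c. (\<forall>l. 0 \<le> c l) \<longrightarrow> fisher I c (U p) Y \<le> fisher I (Rc (fst p) (snd p) c) u X))"
  proof
    fix p
    show "\<exists>Y. nice I A B C (U p) Y \<and>
      (p \<in> PS \<longrightarrow> (\<forall>c. (\<forall>l. 0 \<le> c l) \<longrightarrow> fisher I c (U p) Y \<le> fisher I (Rc (fst p) (snd p) c) u X))"
      using Rop_nice[OF n _ _ _ A, of "fst p" "snd p"] PS(2)[of p] n by (cases "p \<in> PS") (auto simp: U_def)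
  qed
  then obtain Y where Y: "\<And>p. nice I A B C (U p) (Y p)"
    "\<And>p c. p \<in> PS \<Longrightarrow> \<forall>l. 0 \<le> c l \<Longrightarrow> fisher I c (U p) (Y p) \<le> fisher I (Rc (fst p) (snd p) c) u X"
    by metis
  have mU: "(\<lambda>(p, z). U p z) \<in> borel_measurable (dmeas qw \<Otimes>\<^sub>M gam)"
    by (rule dmeas_joint_measurable) (rule niceD(3)[OF Y(1)])
  have mY: "(\<lambda>(p, z). Y p z i) \<in> borel_measurable (dmeas qw \<Otimes>\<^sub>M gam)" for i
    by (rule dmeas_joint_measurable) (rule niceD(4)[OF Y(1)])
  have Q: "Q u = (\<lambda>z. \<integral>p. U p z \<partial>dmeas qw)"
    unfolding integral_dmeas_qw Qop_def by (rule ext, rule sum.cong) (auto simp: U_def)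
  let ?X' = "\<lambda>z i. \<integral>p. Y p z i \<partial>dmeas qw"
  have "fisher I c (Q u) ?X' \<le> fisher I (Qc PS w c) u X" if c: "\<forall>l. 0 \<le> c l" for c
  proof -
    have "fisher I c (Q u) ?X' \<le> (\<integral>p. fisher I c (U p) (Y p) \<partial>dmeas qw)"
      unfolding Q by (rule fisher_mix(1)[OF prob_space_qw mU mY Y(1) A]) (use c in auto)
    also have "\<dots> = (\<Sum>p\<in>PS. w p / sum w PS * fisher I c (U p) (Y p))" by (rule integral_dmeas_qw)
    also have "\<dots> \<le> (\<Sum>p\<in>PS. w p / sum w PS * fisher I (Rc (fst p) (snd p) c) u X)"
      using Y(2) c w wpos by (intro sum_mono mult_left_mono) auto
    also have "\<dots> = fisher I (Qc PS w c) u X"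
      unfolding Qc_def[abs_def] by (rule fisher_sum[OF n A PS(1), symmetric])
    finally show ?thesis .
  qed
  moreover have "nice I A B C (Q u) ?X'"
    unfolding Q by (rule nice_mix[OF prob_space_qw mU mY Y(1)])
  ultimately show ?thesis by blast
qed

lemma Qc_nonneg: "\<forall>l. 0 \<le> c l \<Longrightarrow> 0 \<le> Qc PS w c l"
  unfolding Qc_def using w wpos by (intro sum_nonneg mult_nonneg_nonneg Rc_nonneg) auto

text \<open>The weights travel backwards: the last collision acts on c first, and its result is
  handed to the earlier ones. Hence the induction hypothesis has to hold for all nonnegative c with
  one and the same gradient.\<close>

lemma Q_funpow_nice:
  assumes n: "nice I A B C u X" and A: "A > 0"
  shows "\<exists>X'. nice I A B C ((Q ^^ k) u) X' \<and>
    (\<forall>c. (\<forall>l. 0 \<le> c l) \<longrightarrow> fisher I c ((Q ^^ k) u) X' \<le> fisher I ((Qc PS w ^^ k) c) u X)"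
proof (induction k)
  case 0 then show ?case using n by auto
next
  case (Suc k)
  then obtain X1 where X1: "nice I A B C ((Q ^^ k) u) X1"
    "\<And>c. \<forall>l. 0 \<le> c l \<Longrightarrow> fisher I c ((Q ^^ k) u) X1 \<le> fisher I ((Qc PS w ^^ k) c) u X" by blast
  obtain X2 where X2: "nice I A B C (Q ((Q ^^ k) u)) X2"
    "\<And>c. \<forall>l. 0 \<le> c l \<Longrightarrow> fisher I c (Q ((Q ^^ k) u)) X2 \<le> fisher I (Qc PS w c) ((Q ^^ k) u) X1"
    using Q_nice[OF X1(1) A] by blast
  have "fisher I c ((Q ^^ Suc k) u) X2 \<le> fisher I ((Qc PS w ^^ Suc k) c) u X" if c: "\<forall>l. 0 \<le> c l" for c
    using order_trans[OF X2(2)[OF c] X1(2)[of "Qc PS w c"]] Qc_nonneg[OF c]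
    by (simp add: funpow_swap1)
  then show ?case using X2(1) by auto
qed

text \<open>By convexity the Fisher information is at most the Poisson average of that of the
  iterates. The bound \<open>jj\<close> is left as a parameter, to be filled in where the iterated
  weights are known explicitly.\<close>

lemma S_nice:
  assumes n: "nice I A B C u X" and A: "A > 0" and r: "r \<ge> 0" and c: "\<forall>l. 0 \<le> c l"
    and j: "\<And>k. fisher I ((Qc PS w ^^ k) c) u X \<le> jj k" "integrable (dmeas (pois r)) jj"
  shows "\<exists>X'. nice I A B C (S r u) X' \<and> fisher I c (S r u) X' \<le> (\<integral>k. jj k \<partial>dmeas (pois r))"
proof -
  have "\<forall>k. \<exists>Y. nice I A B C ((Q ^^ k) u) Y \<and> fisher I c ((Q ^^ k) u) Y \<le> jj k"
    using Q_funpow_nice[OF n A] c j(1) by (meson order_trans)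
  then obtain Y where Y: "\<And>k. nice I A B C ((Q ^^ k) u) (Y k)" "\<And>k. fisher I c ((Q ^^ k) u) (Y k) \<le> jj k"
    by metis
  note K = prob_space_pois[OF r]
  have mU: "(\<lambda>(k, z). (Q ^^ k) u z) \<in> borel_measurable (dmeas (pois r) \<Otimes>\<^sub>M gam)"
    by (rule dmeas_joint_measurable) (rule niceD(3)[OF Y(1)])
  have mY: "(\<lambda>(k, z). Y k z i) \<in> borel_measurable (dmeas (pois r) \<Otimes>\<^sub>M gam)" for i
    by (rule dmeas_joint_measurable) (rule niceD(4)[OF Y(1)])
  have S: "S r u = (\<lambda>z. \<integral>k. (Q ^^ k) u z \<partial>dmeas (pois r))" by (simp add: Sop_def fun_eq_iff)
  let ?X' = "\<lambda>z i. \<integral>k. Y k z i \<partial>dmeas (pois r)"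
  have c': "\<And>l. 0 \<le> c l" using c by blast
  have "fisher I c (S r u) ?X' \<le> (\<integral>k. fisher I c ((Q ^^ k) u) (Y k) \<partial>dmeas (pois r))"
    unfolding S by (rule fisher_mix(1)[OF K mU mY Y(1) A c'])
  also have "\<dots> \<le> (\<integral>k. jj k \<partial>dmeas (pois r))"
    by (rule integral_mono[OF fisher_mix(2)[OF K mU mY Y(1) A c'] j(2) Y(2)])
  finally have "fisher I c (S r u) ?X' \<le> (\<integral>k. jj k \<partial>dmeas (pois r))" .
  moreover have "nice I A B C (S r u) ?X'"
    unfolding S by (rule nice_mix[OF K mU mY Y(1)])
  ultimately show ?thesis by blast
qed

lemma Q_bounded_measurable:
  assumes u: "u \<in> borel_measurable gam" and b: "\<And>z. \<bar>u z\<bar> \<le> D"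
  shows "Q u \<in> borel_measurable gam" "\<bar>Q u z\<bar> \<le> D"
proof -
  note [measurable] = Rop_bounded_measurable(1)[OF u b]
  show "Q u \<in> borel_measurable gam" unfolding Qop_def[abs_def] by measurable
  have "\<bar>Q u z\<bar> \<le> (\<Sum>p\<in>PS. \<bar>w p / sum w PS * Rop (fst p) (snd p) u z\<bar>)"
    unfolding Qop_def by (rule sum_abs)
  also have "\<dots> \<le> (\<Sum>p\<in>PS. w p / sum w PS * D)"
    unfolding abs_mult using Rop_bounded_measurable(2)[OF u b] w wpos
    by (intro sum_mono mult_mono) auto
  also have "\<dots> = D" unfolding sum_distrib_right[symmetric] by (simp add: sum_qw)
  finally show "\<bar>Q u z\<bar> \<le> D" .
qed

lemma Qk_bounded_measurable:
  assumes u: "u \<in> borel_measurable gam" and b: "\<And>z. \<bar>u z\<bar> \<le> D"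
  shows "(Q ^^ k) u \<in> borel_measurable gam \<and> (\<forall>z. \<bar>(Q ^^ k) u z\<bar> \<le> D)"
  by (induction k) (use u b Q_bounded_measurable in auto)

lemma Pop_linear_sum:
  assumes "finite P" "\<And>p. p \<in> P \<Longrightarrow> U p \<in> borel_measurable gam" "\<And>p z. p \<in> P \<Longrightarrow> \<bar>U p z\<bar> \<le> D"
  shows "Pop a b (\<lambda>z. \<Sum>p\<in>P. k p * U p z) z = (\<Sum>p\<in>P. k p * Pop a b (U p) z)"
proof -
  have my: "(\<lambda>g i. a *\<^sub>R z i + b *\<^sub>R g i) \<in> measurable gam gam" by (rule measurable_gamI) simp
  have "integrable gam (\<lambda>g. U p (\<lambda>i. a *\<^sub>R z i + b *\<^sub>R g i))" if "p \<in> P" for p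
    using assms(3)[OF that] measurable_compose[OF my assms(2)[OF that]]
    by (intro GP.P.integrable_const_bound AE_I2) auto
  then show ?thesis unfolding Pop_def by (rule integral_lin_comb)
qed

lemma Pop_bounded_measurable:
  assumes u: "u \<in> borel_measurable gam" and b: "\<And>z. \<bar>u z\<bar> \<le> D"
  shows "Pop a b u \<in> borel_measurable gam" "\<bar>Pop a b u z\<bar> \<le> D"
proof -
  have "(\<lambda>(z, g) i. a *\<^sub>R z i + b *\<^sub>R g i) \<in> measurable (gam \<Otimes>\<^sub>M gam) gam"
    by (rule measurable_gamI) (auto simp: split_beta')
  from measurable_compose[OF this u]
  have "(\<lambda>(z, g). u (\<lambda>i. a *\<^sub>R z i + b *\<^sub>R g i)) \<in> borel_measurable (gam \<Otimes>\<^sub>M gam)"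
    by (simp add: split_beta')
  from GP.P.borel_measurable_lebesgue_integral[OF this]
  show "Pop a b u \<in> borel_measurable gam" unfolding Pop_def[abs_def] by simp
  have my: "(\<lambda>g i. a *\<^sub>R z i + b *\<^sub>R g i) \<in> measurable gam gam" by (rule measurable_gamI) simp
  have i: "integrable gam (\<lambda>g. u (\<lambda>i. a *\<^sub>R z i + b *\<^sub>R g i))"
    using b measurable_compose[OF my u] by (intro GP.P.integrable_const_bound AE_I2) auto
  show "\<bar>Pop a b u z\<bar> \<le> D" unfolding Pop_def
    by (rule order_trans[OF integral_abs_bound], rule GP.P.integral_le_const) (use i b in auto)
qed

lemma Q_Pop:
  assumes u: "u \<in> borel_measurable gam" and b: "\<And>z. \<bar>u z\<bar> \<le> D"
  shows "Q (Pop a b' u) = Pop a b' (Q u)"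
proof (rule ext)
  fix z
  have "Pop a b' (Q u) z = (\<Sum>p\<in>PS. w p / sum w PS * Pop a b' (Rop (fst p) (snd p) u) z)"
    unfolding Qop_def[abs_def]
    by (rule Pop_linear_sum[OF PS(1)]) (use Rop_bounded_measurable[OF u b] in auto)
  also have "\<dots> = Q (Pop a b' u) z"
    unfolding Qop_def
    by (rule sum.cong[OF refl]) (use Rop_Pop[OF u b _ Pop_bounded_measurable(1)[OF u b]] PS(2) in auto)
  finally show "Q (Pop a b' u) z = Pop a b' (Q u) z" by simp
qed

lemma Qk_Pop:
  assumes u: "u \<in> borel_measurable gam" and b: "\<And>z. \<bar>u z\<bar> \<le> D"
  shows "(Q ^^ k) (Pop a b' u) = Pop a b' ((Q ^^ k) u)"
proof (induction k)
  case (Suc k)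
  show ?case
    using Suc Q_Pop[of "(Q ^^ k) u" D a b'] Qk_bounded_measurable[OF u b, of k] by auto
qed simp

lemma S_Pop:
  assumes u: "u \<in> borel_measurable gam" and b: "\<And>z. \<bar>u z\<bar> \<le> D" and r: "r \<ge> 0"
  shows "S r (Pop a b' u) = Pop a b' (S r u)"
proof (rule ext)
  fix z
  have mU: "(\<lambda>(k, z). (Q ^^ k) u z) \<in> borel_measurable (dmeas (pois r) \<Otimes>\<^sub>M gam)"
    by (rule dmeas_joint_measurable) (use Qk_bounded_measurable[OF u b] in blast)
  have bb: "\<bar>(Q ^^ k) u z\<bar> \<le> D" for k z using Qk_bounded_measurable[OF u b] by blast
  show "S r (Pop a b' u) z = Pop a b' (S r u) z"
    unfolding Sop_def[abs_def] Pop_mix[OF prob_space_pois[OF r] mU bb] Qk_Pop[OF u b] ..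
qed

lemma Qk_mean:
  assumes u: "u \<in> borel_measurable gam" and b: "\<And>z. \<bar>u z\<bar> \<le> D"
  shows "(\<integral>z. (Q ^^ k) u z \<partial>gam) = (\<integral>z. u z \<partial>gam)"
proof (induction k)
  case (Suc k)
  let ?v = "(Q ^^ k) u"
  have v: "?v \<in> borel_measurable gam" "\<And>z. \<bar>?v z\<bar> \<le> D" using Qk_bounded_measurable[OF u b, of k] by auto
  have i: "integrable gam (Rop i j ?v)" for i j
    using Rop_bounded_measurable[OF v] by (intro GP.P.integrable_const_bound AE_I2) auto
  have "(\<integral>z. Q ?v z \<partial>gam) = (\<Sum>p\<in>PS. w p / sum w PS * (\<integral>z. Rop (fst p) (snd p) ?v z \<partial>gam))"
    unfolding Qop_def[of PS w ?v] by (rule integral_lin_comb) (rule i)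
  also have "\<dots> = (\<Sum>p\<in>PS. w p / sum w PS * (\<integral>z. ?v z \<partial>gam))"
    by (rule sum.cong[OF refl]) (use Rop_mean[OF v] PS(2) in auto)
  also have "\<dots> = (\<integral>z. ?v z \<partial>gam)" unfolding sum_distrib_right[symmetric] by (simp add: sum_qw)
  finally show ?case using Suc by simp
qed simp

lemma S_mean:
  assumes u: "u \<in> borel_measurable gam" and b: "\<And>z. \<bar>u z\<bar> \<le> D" and r: "r \<ge> 0"
  shows "(\<integral>z. S r u z \<partial>gam) = (\<integral>z. u z \<partial>gam)"
proof -
  have mU: "(\<lambda>(k, z). (Q ^^ k) u z) \<in> borel_measurable (dmeas (pois r) \<Otimes>\<^sub>M gam)"
    by (rule dmeas_joint_measurable) (use Qk_bounded_measurable[OF u b] in blast)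
  have bb: "\<bar>(Q ^^ k) u z\<bar> \<le> D" for k z using Qk_bounded_measurable[OF u b] by blast
  interpret K: prob_space "dmeas (pois r)" by (rule prob_space_pois[OF r])
  show ?thesis
    unfolding Sop_def mean_mix[OF prob_space_pois[OF r] mU bb] Qk_mean[OF u b]
    using K.prob_space by simp
qed

lemma S_bounded_measurable:
  assumes u: "u \<in> borel_measurable gam" and b: "\<And>z. \<bar>u z\<bar> \<le> D" and r: "r \<ge> 0"
  shows "S r u \<in> borel_measurable gam" "\<bar>S r u z\<bar> \<le> D"
proof -
  interpret K: prob_space "dmeas (pois r)" by (rule prob_space_pois[OF r])
  have mU: "(\<lambda>(k, z). (Q ^^ k) u z) \<in> borel_measurable (dmeas (pois r) \<Otimes>\<^sub>M gam)"
    by (rule dmeas_joint_measurable) (use Qk_bounded_measurable[OF u b] in blast)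
  have "(\<lambda>(z, k). (Q ^^ k) u z) \<in> borel_measurable (gam \<Otimes>\<^sub>M dmeas (pois r))"
    using measurable_compose[OF measurable_pair_swap' mU] by (simp add: split_beta')
  from K.borel_measurable_lebesgue_integral[OF this]
  show "S r u \<in> borel_measurable gam" unfolding Sop_def[abs_def] by simp
  have bb: "\<bar>(Q ^^ k) u z\<bar> \<le> D" for k z using Qk_bounded_measurable[OF u b] by blast
  have i: "integrable (dmeas (pois r)) (\<lambda>k. (Q ^^ k) u z)"
    using bb by (intro K.integrable_const_bound AE_I2) (auto simp: measurable_def)
  show "\<bar>S r u z\<bar> \<le> D" unfolding Sop_def
    by (rule order_trans[OF integral_abs_bound], rule K.integral_le_const) (use i bb in auto)
qed

end

section \<open>Rates and weights for system and reservoir\<close>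

locale kac =
  fixes M N :: nat and lS lR mu :: real
  assumes M: "M \<ge> 1" and N: "N \<ge> 1" and lS: "lS > 0" and lR: "lR > 0" and mu: "mu > 0"
begin

definition PS :: "(nat \<times> nat) set" where "PS = {p. fst p < snd p \<and> snd p < M + N}"

text \<open>The junk value \<open>lS / 0 = 0\<close> for \<open>M = 1\<close> (\<open>lR / 0\<close> for \<open>N = 1\<close>) is harmless, as there are no such
  pairs.\<close>

definition rate :: "nat \<times> nat \<Rightarrow> real" where
  "rate p = (if snd p < M then lS / (real M - 1) else if M \<le> fst p then lR / (real N - 1) else mu / real N)"

lemma PS_eq: "PS = (SIGMA i:{..<M}. {i<..<M}) \<union> (SIGMA i:{M..<M+N}. {i<..<M+N}) \<union> {..<M} \<times> {M..<M+N}"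
  unfolding PS_def by auto

lemma rate_nonneg: "rate p \<ge> 0"
  using M N lS lR mu by (simp add: rate_def)

lemma finite_PS: "finite PS"
  unfolding PS_eq by auto

lemma sum_PS:
  fixes f :: "nat \<times> nat \<Rightarrow> real"
  shows "(\<Sum>p\<in>PS. rate p * f p) = lS / (real M - 1) * (\<Sum>i<M. \<Sum>j\<in>{i<..<M}. f (i, j))
    + lR / (real N - 1) * (\<Sum>i\<in>{M..<M+N}. \<Sum>j\<in>{i<..<M+N}. f (i, j))
    + mu / real N * (\<Sum>i<M. \<Sum>j\<in>{M..<M+N}. f (i, j))"
proof -
  let ?A = "SIGMA i:{..<M}. {i<..<M}" and ?B = "SIGMA i:{M..<M+N}. {i<..<M+N}" and ?C = "{..<M} \<times> {M..<M+N}"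
  have "(\<Sum>p\<in>PS. rate p * f p) = (\<Sum>p\<in>?A \<union> ?B. rate p * f p) + (\<Sum>p\<in>?C. rate p * f p)"
    unfolding PS_eq by (rule sum.union_disjoint) auto
  also have "(\<Sum>p\<in>?A \<union> ?B. rate p * f p) = (\<Sum>p\<in>?A. rate p * f p) + (\<Sum>p\<in>?B. rate p * f p)"
    by (rule sum.union_disjoint) auto
  also have "(\<Sum>p\<in>?A. rate p * f p) = (\<Sum>p\<in>?A. lS / (real M - 1) * f p)"
    by (rule sum.cong) (auto simp: rate_def)
  also have "(\<Sum>p\<in>?B. rate p * f p) = (\<Sum>p\<in>?B. lR / (real N - 1) * f p)"
    by (rule sum.cong) (auto simp: rate_def)
  also have "(\<Sum>p\<in>?C. rate p * f p) = (\<Sum>p\<in>?C. mu / real N * f p)"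
    by (rule sum.cong) (auto simp: rate_def)
  finally show ?thesis
    unfolding sum_distrib_left[symmetric]
    using sum.Sigma[of "{..<M}" "\<lambda>i. {i<..<M}" "\<lambda>i j. f (i, j)"]
      sum.Sigma[of "{M..<M+N}" "\<lambda>i. {i<..<M+N}" "\<lambda>i j. f (i, j)"]
      sum.Sigma[of "{..<M}" "\<lambda>i. {M..<M+N}" "\<lambda>i j. f (i, j)"] by simp
qed

lemma sum_rate_pos: "sum rate PS > 0"
proof (rule sum_pos2[OF finite_PS, of "(0, M)"])
  show "(0, M) \<in> PS" using M N by (auto simp: PS_def)
  show "0 < rate (0, M)" using M N mu by (simp add: rate_def)
qed (rule rate_nonneg)

sublocale collisions PS rate "{..<M+N}"
proof
  show "fst p \<in> {..<M+N} \<and> snd p \<in> {..<M+N} \<and> fst p \<noteq> snd p" if "p \<in> PS" for p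
    using that by (auto simp: PS_def)
qed (use finite_PS rate_nonneg sum_rate_pos in auto)

abbreviation "Lam \<equiv> sum rate PS"

text \<open>Only finite sums are rearranged, so the identity holds at every point and for every F.
  It exhibits the generator as a total rate times one random collision minus the identity.\<close>

lemma Lgen_eq: "Lgen M N lS lR mu F z = Lam * (Q F z - F z)"
proof -
  have "Lgen M N lS lR mu F z = (\<Sum>p\<in>PS. rate p * (Rop (fst p) (snd p) F z - F z))"
    unfolding sum_PS Lgen_def by simp
  also have "\<dots> = (\<Sum>p\<in>PS. rate p * Rop (fst p) (snd p) F z) - Lam * F z"
    by (simp add: right_diff_distrib sum_subtractf sum_distrib_right)
  also have "(\<Sum>p\<in>PS. rate p * Rop (fst p) (snd p) F z) = Lam * Q F z"
    unfolding Qop_def sum_distrib_left using sum_rate_pos by (intro sum.cong) auto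
  finally show ?thesis by (simp add: right_diff_distrib)
qed

definition step :: "real \<Rightarrow> real \<Rightarrow> nat \<Rightarrow> real" where
  "step \<alpha> \<beta> l = (if l < M then \<alpha> else \<beta>)"

text \<open>Within a block the two weights are equal and a collision does nothing; only a mixed pair
  moves them, by a third of the difference.\<close>

lemma Rc_step:
  assumes "p \<in> PS"
  shows "Rc (fst p) (snd p) (step \<alpha> \<beta>) l = step \<alpha> \<beta> l +
    (if fst p < M \<and> M \<le> snd p then (if l = fst p then (\<beta> - \<alpha>) / 3 else if l = snd p then (\<alpha> - \<beta>) / 3 else 0) else 0)"
  using assms by (auto simp: Rc_def step_def PS_def)

text \<open>A system particle meets N reservoir particles at rate mu / N each, in total mu; a
  reservoir particle meets M system particles, in total mu M / N. Division by \<open>Lam\<close>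
  turns rates into probabilities, and each meeting moves the weight by a third of the
  difference.\<close>

lemma Qc_step:
  assumes l: "l < M + N"
  shows "Qc PS rate (step \<alpha> \<beta>) l =
    step (\<alpha> + mu / (3 * Lam) * (\<beta> - \<alpha>)) (\<beta> + mu * real M / (3 * real N * Lam) * (\<alpha> - \<beta>)) l"
proof -
  let ?g = "\<lambda>p. if fst p < M \<and> M \<le> snd p then (if l = fst p then (\<beta> - \<alpha>) / 3 else if l = snd p then (\<alpha> - \<beta>) / 3 else 0) else 0"
  have "Qc PS rate (step \<alpha> \<beta>) l = (\<Sum>p\<in>PS. rate p / Lam * (step \<alpha> \<beta> l + ?g p))"
    unfolding Qc_def using Rc_step by (intro sum.cong) auto
  also have "\<dots> = (\<Sum>p\<in>PS. rate p / Lam) * step \<alpha> \<beta> l + (\<Sum>p\<in>PS. rate p * ?g p) / Lam"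
    by (simp add: distrib_left sum.distrib sum_distrib_right sum_divide_distrib)
  also have "(\<Sum>p\<in>PS. rate p / Lam) = 1" by (rule sum_qw)
  also have "(\<Sum>p\<in>PS. rate p * ?g p) = mu / real N * (\<Sum>i<M. \<Sum>j\<in>{M..<M+N}. ?g (i, j))"
  proof -
    have "(\<Sum>i<M. \<Sum>j\<in>{i<..<M}. ?g (i, j)) = 0" by (intro sum.neutral ballI) auto
    moreover have "(\<Sum>i\<in>{M..<M+N}. \<Sum>j\<in>{i<..<M+N}. ?g (i, j)) = 0" by (intro sum.neutral ballI) auto
    ultimately show ?thesis unfolding sum_PS by simp
  qed
  also have "(\<Sum>i<M. \<Sum>j\<in>{M..<M+N}. ?g (i, j)) =
     (if l < M then real N * ((\<beta> - \<alpha>) / 3) else real M * ((\<alpha> - \<beta>) / 3))"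
  proof (cases "l < M")
    case True
    have "(\<Sum>i<M. \<Sum>j\<in>{M..<M+N}. ?g (i, j)) = (\<Sum>i<M. if i = l then real N * ((\<beta> - \<alpha>) / 3) else 0)"
    proof (rule sum.cong[OF refl])
      fix i assume i: "i \<in> {..<M}"
      have "(\<Sum>j\<in>{M..<M+N}. ?g (i, j)) = (\<Sum>j\<in>{M..<M+N}. if i = l then (\<beta> - \<alpha>) / 3 else 0)"
        using True i by (intro sum.cong) auto
      then show "(\<Sum>j\<in>{M..<M+N}. ?g (i, j)) = (if i = l then real N * ((\<beta> - \<alpha>) / 3) else 0)" by simp
    qed
    then show ?thesis using True by simp
  next
    case False
    have "(\<Sum>i<M. \<Sum>j\<in>{M..<M+N}. ?g (i, j)) = (\<Sum>i<M. (\<alpha> - \<beta>) / 3)"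
    proof (rule sum.cong[OF refl])
      fix i assume that: "i \<in> {..<M}"
      have "(\<Sum>j\<in>{M..<M+N}. ?g (i, j)) = (\<Sum>j\<in>{M..<M+N}. if j = l then (\<alpha> - \<beta>) / 3 else 0)"
        using False that by (intro sum.cong) auto
      then show "(\<Sum>j\<in>{M..<M+N}. ?g (i, j)) = (\<alpha> - \<beta>) / 3" using False l by simp
    qed
    then show ?thesis using False by simp
  qed
  finally have e: "Qc PS rate (step \<alpha> \<beta>) l = 1 * step \<alpha> \<beta> l
     + mu / real N * (if l < M then real N * ((\<beta> - \<alpha>) / 3) else real M * ((\<alpha> - \<beta>) / 3)) / Lam" .
  show ?thesis
    unfolding e using N by (simp add: step_def)
qed

text \<open>\<open>al k\<close> and \<open>be k\<close> are the weights on the system and on the reservoir after \<open>k\<close> averaged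
  collisions, started from \<open>1\<close> and \<open>0\<close>.\<close>

definition rho :: real where "rho = 1 - mu / (3 * Lam) * ((real N + real M) / real N)"

definition al :: "nat \<Rightarrow> real" where "al k = (real M + real N * rho ^ k) / (real N + real M)"
definition be :: "nat \<Rightarrow> real" where "be k = (real M - real M * rho ^ k) / (real N + real M)"

text \<open>The difference is the mode of the linear system that is multiplied by \<open>rho\<close>
  in each step, while M \<open>al\<close> + N \<open>be\<close> = M stays constant. These two facts
  determine both sequences and explain their form.\<close>

lemma al_be_diff: "al k - be k = rho ^ k"
  using M N by (simp add: al_def be_def diff_divide_distrib[symmetric] field_simps)

lemma al_Suc: "al (Suc k) = al k + mu / (3 * Lam) * (be k - al k)"
proof -
  have "al (Suc k) = al k - real N * (1 - rho) / (real N + real M) * rho ^ k"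
    unfolding al_def by (simp add: diff_divide_distrib[symmetric] algebra_simps)
  also have "real N * (1 - rho) / (real N + real M) = mu / (3 * Lam)"
  proof -
    have "n * (x * (s / n)) / s = x" if "n > 0" "s > 0" for n s x :: real
      using that by simp
    from this[of "real N" "real N + real M"] show ?thesis using M N by (simp add: rho_def)
  qed
  finally show ?thesis using al_be_diff[of k] by (simp add: algebra_simps)
qed

lemma be_Suc: "be (Suc k) = be k + mu * real M / (3 * real N * Lam) * (al k - be k)"
proof -
  have "be (Suc k) = be k + real M * (1 - rho) / (real N + real M) * rho ^ k"
    unfolding be_def by (simp add: add_divide_distrib[symmetric] diff_divide_distrib[symmetric] algebra_simps)
  also have "real M * (1 - rho) / (real N + real M) = mu * real M / (3 * real N * Lam)"
  proof -
    have "m * (x * (s / n)) / s = x * m / n" if "n > 0" "s > 0" for n m s x :: real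
      using that by simp
    from this[of "real N" "real N + real M" "real M" "mu / (3 * Lam)"] show ?thesis using M N by (simp add: rho_def mult_ac)
  qed
  finally show ?thesis using al_be_diff[of k] by simp
qed

text \<open>\<open>Qc_step\<close> describes the weights only at indices below M + N. All pairs lie
  there, so this knowledge is enough to apply \<open>Qc\<close> once more.\<close>

lemma Qc_cong:
  assumes "\<And>l. l < M + N \<Longrightarrow> c l = c' l" "l < M + N"
  shows "Qc PS rate c l = Qc PS rate c' l"
  unfolding Qc_def
proof (rule sum.cong[OF refl])
  fix p assume "p \<in> PS"
  then have "c (fst p) = c' (fst p)" "c (snd p) = c' (snd p)" "c l = c' l"
    using assms by (auto simp: PS_def)
  then show "rate p / Lam * Rc (fst p) (snd p) c l = rate p / Lam * Rc (fst p) (snd p) c' l"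
    by (simp add: Rc_def)
qed

lemma Qc_funpow_step:
  "l < M + N \<Longrightarrow> (Qc PS rate ^^ k) (step 1 0) l = step (al k) (be k) l"
proof (induction k arbitrary: l)
  case 0 then show ?case using M N by (simp add: al_def be_def step_def)
next
  case (Suc k)
  have "(Qc PS rate ^^ Suc k) (step 1 0) l = Qc PS rate (step (al k) (be k)) l"
    using Qc_cong[OF Suc.IH Suc.prems] by simp
  then show ?case using Qc_step[OF Suc.prems] by (simp add: al_Suc be_Suc)
qed

definition decay :: "real \<Rightarrow> real" where
  "decay t = real M / real (N + M) + real N / real (N + M) * exp (- mu / 3 * (real (N + M) / real N) * t)"

lemma decay_pos: "decay t > 0"
  unfolding decay_def using M N by (intro add_pos_pos) auto

text \<open>The mixed pairs alone contribute mu M to \<open>Lam\<close>, and N + M \<le> 3 N M gives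
  mu (N + M) / (3 N) \<le> mu M. So \<open>rho\<close> lies in the unit interval, where the Poisson
  generating function is available.\<close>

lemma rho_abs: "\<bar>rho\<bar> \<le> 1"
proof -
  have "mu * (real N + real M) / (3 * real N) \<le> Lam"
  proof -
    have c: "card ({..<M} \<times> {M..<M+N}) = M * N" by simp
    have "(\<Sum>p\<in>{..<M} \<times> {M..<M+N}. rate p) \<le> Lam"
      by (rule sum_mono2[OF finite_PS]) (auto simp: PS_def rate_nonneg)
    moreover have "(\<Sum>p\<in>{..<M} \<times> {M..<M+N}. rate p) = (\<Sum>p\<in>{..<M} \<times> {M..<M+N}. mu / real N)"
      by (rule sum.cong) (auto simp: rate_def)
    ultimately have 1: "mu * real M \<le> Lam" using N c by (simp add: mult.commute)
    have "real N + real M \<le> 3 * real N * real M"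
    proof -
      have "real N * 1 \<le> real N * real M" "1 * real M \<le> real N * real M"
        using M N by (intro mult_left_mono mult_right_mono; simp)+
      moreover have "0 \<le> real N * real M" by simp
      ultimately show ?thesis by linarith
    qed
    then have "mu * (real N + real M) \<le> mu * (3 * real N * real M)" using mu by simp
    then have "mu * (real N + real M) / (3 * real N) \<le> mu * real M" using N by (simp add: field_simps)
    then show ?thesis using 1 by linarith
  qed
  then have "mu * (real N + real M) / (3 * real N) / Lam \<le> 1"
    using divide_le_eq_1_pos[OF sum_rate_pos] by blast
  moreover have "mu * (real N + real M) / (3 * real N) / Lam = mu / (3 * Lam) * ((real N + real M) / real N)"
    by simp
  moreover have "0 \<le> mu / (3 * Lam) * ((real N + real M) / real N)"
    using mu sum_rate_pos by (intro mult_nonneg_nonneg divide_nonneg_nonneg) auto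
  ultimately show ?thesis unfolding rho_def by linarith
qed

text \<open>The generating function at \<open>rho\<close> has the exponent Lam t (rho - 1), which
  equals - (mu / 3) ((N + M) / N) t: the total rate \<open>Lam\<close> cancels.\<close>

lemma integral_al:
  assumes t: "t \<ge> 0"
  shows "integrable (dmeas (pois (Lam * t))) al" "(\<integral>k. al k \<partial>dmeas (pois (Lam * t))) = decay t"
proof -
  have r: "Lam * t \<ge> 0" using t sum_rate_pos by simp
  interpret K: prob_space "dmeas (pois (Lam * t))" by (rule prob_space_pois[OF r])
  note i = integral_pois_mgf[OF r rho_abs]
  have e: "al k = real M / (real N + real M) + real N / (real N + real M) * rho ^ k" for k
    by (simp add: al_def add_divide_distrib)
  show "integrable (dmeas (pois (Lam * t))) al"
    unfolding e[abs_def] using i(1) by simp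
  have "(\<integral>k. al k \<partial>dmeas (pois (Lam * t))) = real M / (real N + real M) + real N / (real N + real M) * exp (Lam * t * rho - Lam * t)"
    unfolding e using i K.prob_space by simp
  also have "Lam * t * rho - Lam * t = - mu / 3 * (real (N + M) / real N) * t"
    using sum_rate_pos N by (simp add: rho_def field_simps)
  finally show "(\<integral>k. al k \<partial>dmeas (pois (Lam * t))) = decay t" by (simp add: decay_def)
qed

section \<open>The reduced evolution of the system\<close>

definition Top :: "real \<Rightarrow> ((nat \<Rightarrow> real^3) \<Rightarrow> real) \<Rightarrow> (nat \<Rightarrow> real^3) \<Rightarrow> real" where
  "Top t u = Eop M (S (Lam * t) u)"

text \<open>Weights are pulled back through the operators in reverse order. The reservoir average
  turns weight 1 everywhere into 1 on the system and 0 on the reservoir; k collisions turn these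
  into \<open>al k\<close> and \<open>be k\<close>; and u has no gradient in the reservoir
  directions, so that only \<open>al k\<close> survives. Its Poisson mean is
  \<open>decay t\<close>.\<close>

lemma Top_fisher:
  assumes n: "nice {..<M} A B C u X" and A: "A > 0" and t: "t \<ge> 0"
  shows "\<exists>Y. nice {..<M+N} A B C (Top t u) Y \<and>
    fisher {..<M+N} (\<lambda>_. 1) (Top t u) Y \<le> decay t * fisher {..<M} (\<lambda>_. 1) u X"
proof -
  define Xe where "Xe z i = (if i < M then X z i else 0)" for z i
  have r: "Lam * t \<ge> 0" using t sum_rate_pos by simp
  have sub: "{..<M} \<subseteq> {..<M+N}" by auto
  have nsub: "nsq {..<M} e \<le> nsq {..<M+N} e" for e
    unfolding nsq_def by (rule sum_mono2) auto
  have ipe: "ip {..<M+N} (Xe z) e = ip {..<M} (X z) e" for z e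
  proof -
    have "ip {..<M+N} (Xe z) e = (\<Sum>i\<in>{..<M}. Xe z i \<bullet> e i)"
      unfolding ip_def by (rule sum.mono_neutral_right) (auto simp: Xe_def)
    also have "\<dots> = ip {..<M} (X z) e" unfolding ip_def by (rule sum.cong) (auto simp: Xe_def)
    finally show ?thesis .
  qed
  have ne: "nice {..<M+N} A B C u Xe"
    unfolding nice_def
  proof (intro conjI allI)
    show "(\<lambda>z. Xe z i) \<in> borel_measurable gam" for i
      using niceD(4)[OF n] by (cases "i < M") (auto simp: Xe_def)
    show "\<bar>u (\<lambda>i. z i + e i) - u z - ip {..<M+N} (Xe z) e\<bar> \<le> C * nsq {..<M+N} e" for z e
      unfolding ipe by (rule order_trans[OF niceD(8)[OF n] mult_left_mono[OF nsub niceD(2)[OF n]]])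
  qed (use niceD[OF n] in auto)
  have Je: "fisher {..<M+N} ((Qc PS rate ^^ k) (step 1 0)) u Xe = al k * fisher {..<M} (\<lambda>_. 1) u X" for k
  proof -
    have "wsq {..<M+N} ((Qc PS rate ^^ k) (step 1 0)) (Xe z) = al k * wsq {..<M} (\<lambda>_. 1) (X z)" for z
    proof -
      have "wsq {..<M+N} ((Qc PS rate ^^ k) (step 1 0)) (Xe z)
          = (\<Sum>i\<in>{..<M}. (Qc PS rate ^^ k) (step 1 0) i * (norm (Xe z i))\<^sup>2)"
        unfolding wsq_def by (rule sum.mono_neutral_right) (auto simp: Xe_def)
      also have "\<dots> = (\<Sum>i\<in>{..<M}. al k * (1 * (norm (X z i))\<^sup>2))"
        by (rule sum.cong) (auto simp: Xe_def Qc_funpow_step step_def)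
      finally show ?thesis unfolding wsq_def sum_distrib_left .
    qed
    then show ?thesis
      unfolding fisher_def by (simp only: times_divide_eq_right[symmetric] integral_mult_right_zero)
  qed
  have "\<exists>Y. nice {..<M+N} A B C (S (Lam * t) u) Y \<and> fisher {..<M+N} (step 1 0) (S (Lam * t) u) Y
      \<le> (\<integral>k. al k * fisher {..<M} (\<lambda>_. 1) u X \<partial>dmeas (pois (Lam * t)))"
  proof (rule S_nice[OF ne A r])
    show "\<forall>l. 0 \<le> step 1 0 l" by (simp add: step_def)
    show "fisher {..<M+N} ((Qc PS rate ^^ k) (step 1 0)) u Xe \<le> al k * fisher {..<M} (\<lambda>_. 1) u X" for k by (simp add: Je)
    show "integrable (dmeas (pois (Lam * t))) (\<lambda>k. al k * fisher {..<M} (\<lambda>_. 1) u X)"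
      using integral_al(1)[OF t] by simp
  qed
  then obtain Y where Y: "nice {..<M+N} A B C (S (Lam * t) u) Y"
    "fisher {..<M+N} (step 1 0) (S (Lam * t) u) Y \<le> decay t * fisher {..<M} (\<lambda>_. 1) u X"
    using integral_al[OF t] by auto
  obtain Z where Z: "nice {..<M+N} A B C (Eop M (S (Lam * t) u)) Z"
    "\<And>c. (\<forall>l. 0 \<le> c l) \<Longrightarrow> fisher {..<M+N} c (Eop M (S (Lam * t) u)) Z
       \<le> fisher {..<M+N} (\<lambda>i. if i < M then c i else 0) (S (Lam * t) u) Y"
    using Eop_nice[OF Y(1) A, of M] by blast
  have "fisher {..<M+N} (\<lambda>_. 1) (Eop M (S (Lam * t) u)) Z \<le> decay t * fisher {..<M} (\<lambda>_. 1) u X"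
    using order_trans[OF Z(2)[of "\<lambda>_. 1"] ] Y(2) by (simp add: step_def[abs_def])
  then show ?thesis using Z(1) unfolding Top_def by blast
qed

lemma Top_entropy:
  assumes n: "nice {..<M} A B C u X" and A: "A > 0" and t: "t \<ge> 0" and mean: "(\<integral>z. u z \<partial>gam) = 1"
  shows "Ent (Top t u) \<le> decay t * Ent u"
proof (rule entropy_contraction[OF _ _ _ n A mean])
  have r: "Lam * t \<ge> 0" using t sum_rate_pos by simp
  show "\<exists>Y. nice {..<M+N} A B C (Top t u) Y \<and>
    fisher {..<M+N} (\<lambda>_. 1) (Top t u) Y \<le> decay t * fisher {..<M} (\<lambda>_. 1) u X" if "nice {..<M} A B C u X" for u X
    by (rule Top_fisher[OF that A t])
  fix u X assume n: "nice {..<M} A B C u X"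
  note u = niceD(3)[OF n] nice_bounded[OF n]
  note Su = S_bounded_measurable[OF u r]
  show "Top t (Pop a b u) = Pop a b (Top t u)" if ab: "a\<^sup>2 + b\<^sup>2 = 1" for a b
    unfolding Top_def S_Pop[OF u r] by (rule Eop_Pop[OF Su ab])
  show "(\<integral>z. Top t u z \<partial>gam) = (\<integral>z. u z \<partial>gam)"
    unfolding Top_def by (simp add: Eop_mean[OF Su] S_mean[OF u r])
qed (use decay_pos in \<open>auto intro: less_imp_le\<close>)

end

section \<open>Approximation by nice functions\<close>

lemma Psi_nonneg_lower: "0 \<le> x \<Longrightarrow> x - 1 \<le> Psi x"
proof (cases "x = 0")
  case False
  assume "0 \<le> x"
  then show ?thesis using False Psi_tangent(1)[of x 1] by (simp add: Psi_def)
qed (simp add: Psi_def)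

text \<open>Only the limit 0 needs an argument, since ln is not continuous there: |Psi y| \<le> 2
  sqrt y on the unit interval follows from ln s \<le> s - 1 at s = 1 / sqrt y.\<close>

lemma Psi_tendsto:
  assumes f: "(f \<longlongrightarrow> x) F" and f0: "eventually (\<lambda>k. 0 \<le> f k) F" and x: "0 \<le> x"
  shows "((\<lambda>k. Psi (f k)) \<longlongrightarrow> Psi x) F"
proof (cases "x = 0")
  case False
  then show ?thesis unfolding Psi_def using x by (intro tendsto_mult f tendsto_ln) auto
next
  case True
  have b: "\<bar>Psi y\<bar> \<le> 2 * sqrt y" if y: "0 \<le> y" "y \<le> 1" for y
  proof (cases "y = 0")
    case False
    then have y0: "y > 0" using y by simp
    then have s: "sqrt y > 0" by simp
    have "ln (1 / sqrt y) \<le> 1 / sqrt y - 1" using s by (intro ln_le_minus_one) auto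
    then have "- ln y / 2 \<le> 1 / sqrt y" using y0 by (simp add: ln_div ln_sqrt)
    then have "- ln y \<le> 2 / sqrt y" by simp
    then have "y * (- ln y) \<le> y * (2 / sqrt y)" using y0 by (intro mult_left_mono) auto
    also have "y * (2 / sqrt y) = 2 * (y / sqrt y)" by simp
    also have "\<dots> = 2 * sqrt y" using y0 by (simp only: real_div_sqrt less_imp_le)
    finally have "- Psi y \<le> 2 * sqrt y" by (simp add: Psi_def)
    moreover have "Psi y \<le> 0" unfolding Psi_def using y y0 by (simp add: mult_nonneg_nonpos)
    ultimately show ?thesis by simp
  qed (simp add: Psi_def)
  have "((\<lambda>k. 2 * sqrt (f k)) \<longlongrightarrow> 2 * sqrt 0) F"
    using f True by (intro tendsto_mult tendsto_const tendsto_real_sqrt) simp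
  then have lim: "((\<lambda>k. 2 * sqrt (f k)) \<longlongrightarrow> 0) F" by simp
  have "eventually (\<lambda>k. f k < 1) F" using order_tendstoD(2)[OF f, of 1] True by simp
  then have "eventually (\<lambda>k. norm (Psi (f k)) \<le> 2 * sqrt (f k)) F"
    using f0 by eventually_elim (use b in auto)
  from Lim_null_comparison[OF this lim] show ?thesis using True by (simp add: Psi_def)
qed

text \<open>By convexity Psi s - Psi t is at most the slope ln s + 1 times s - t, and this slope is
  bounded on the interval; exchanging s and t gives the absolute value.\<close>

lemma Psi_lipschitz:
  assumes A: "0 < A" and x: "A \<le> x" "x \<le> B" and y: "A \<le> y" "y \<le> B"
  shows "\<bar>Psi x - Psi y\<bar> \<le> (1 + \<bar>ln A\<bar> + \<bar>ln B\<bar>) * \<bar>x - y\<bar>"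
proof -
  have *: "Psi s - Psi t \<le> (1 + \<bar>ln A\<bar> + \<bar>ln B\<bar>) * \<bar>s - t\<bar>" if s: "A \<le> s" "s \<le> B" and t: "A \<le> t" "t \<le> B" for s t
  proof -
    have "0 \<le> Psi t - Psi s - (ln s + 1) * (t - s)" using A s t by (intro Psi_tangent) auto
    then have "Psi s - Psi t \<le> (ln s + 1) * (s - t)" by (simp add: algebra_simps)
    also have "\<dots> \<le> \<bar>ln s + 1\<bar> * \<bar>s - t\<bar>" unfolding abs_mult[symmetric] by (rule abs_ge_self)
    also have "\<dots> \<le> (1 + \<bar>ln A\<bar> + \<bar>ln B\<bar>) * \<bar>s - t\<bar>"
    proof (rule mult_right_mono)
      have "ln A \<le> ln s" "ln s \<le> ln B" using A s by auto
      then show "\<bar>ln s + 1\<bar> \<le> 1 + \<bar>ln A\<bar> + \<bar>ln B\<bar>" by linarith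
    qed simp
    finally show ?thesis .
  qed
  show ?thesis using *[OF x y] *[OF y x] by (simp add: abs_minus_commute abs_le_iff)
qed

section \<open>Algebra of nice functions\<close>

lemma nice_affine:
  assumes P: "finite P" and I: "finite I" and n: "\<And>j. j \<in> P \<Longrightarrow> nice I 0 1 (C j) (\<phi> j) (X j)" and a: "\<And>j. j \<in> P \<Longrightarrow> 0 \<le> a j"
  shows "nice I c (c + (\<Sum>j\<in>P. a j)) (\<Sum>j\<in>P. a j * C j) (\<lambda>z. c + (\<Sum>j\<in>P. a j * \<phi> j z)) (\<lambda>z i. \<Sum>j\<in>P. a j *\<^sub>R X j z i)"
  unfolding nice_def
proof (intro conjI allI)
  note [measurable] = niceD(3,4)[OF n]
  show "finite I" by fact
  show "0 \<le> (\<Sum>j\<in>P. a j * C j)" using a niceD(2)[OF n] by (intro sum_nonneg mult_nonneg_nonneg)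
  show "(\<lambda>z. c + (\<Sum>j\<in>P. a j * \<phi> j z)) \<in> borel_measurable gam" by measurable
  show "(\<lambda>z. \<Sum>j\<in>P. a j *\<^sub>R X j z i) \<in> borel_measurable gam" for i by measurable
  fix z
  show "c \<le> c + (\<Sum>j\<in>P. a j * \<phi> j z)" using a niceD(5)[OF n] by (simp add: sum_nonneg)
  have "(\<Sum>j\<in>P. a j * \<phi> j z) \<le> (\<Sum>j\<in>P. a j * 1)" using a niceD(6)[OF n] by (intro sum_mono mult_left_mono)
  then show "c + (\<Sum>j\<in>P. a j * \<phi> j z) \<le> c + (\<Sum>j\<in>P. a j)" by simp
  fix e
  have ip: "ip I (\<lambda>i. \<Sum>j\<in>P. a j *\<^sub>R X j z i) e = (\<Sum>j\<in>P. a j * ip I (X j z) e)"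
    unfolding ip_def sum_distrib_left inner_sum_left by (subst sum.swap) simp
  have "c + (\<Sum>j\<in>P. a j * \<phi> j (\<lambda>i. z i + e i)) - (c + (\<Sum>j\<in>P. a j * \<phi> j z)) - ip I (\<lambda>i. \<Sum>j\<in>P. a j *\<^sub>R X j z i) e
      = (\<Sum>j\<in>P. a j * (\<phi> j (\<lambda>i. z i + e i) - \<phi> j z - ip I (X j z) e))"
    unfolding ip by (simp add: right_diff_distrib sum_subtractf)
  also have "\<bar>\<dots>\<bar> \<le> (\<Sum>j\<in>P. a j * (C j * nsq I e))"
  proof (rule order_trans[OF sum_abs], rule sum_mono)
    fix j assume j: "j \<in> P"
    show "\<bar>a j * (\<phi> j (\<lambda>i. z i + e i) - \<phi> j z - ip I (X j z) e)\<bar> \<le> a j * (C j * nsq I e)"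
      unfolding abs_mult using a[OF j] niceD(8)[OF n[OF j], of z e] by (intro mult_mono) auto
  qed
  finally show "\<bar>c + (\<Sum>j\<in>P. a j * \<phi> j (\<lambda>i. z i + e i)) - (c + (\<Sum>j\<in>P. a j * \<phi> j z)) - ip I (\<lambda>i. \<Sum>j\<in>P. a j *\<^sub>R X j z i) e\<bar>
      \<le> (\<Sum>j\<in>P. a j * C j) * nsq I e" by (simp add: sum_distrib_right mult.assoc)
qed

lemma nice_one_minus:
  assumes n: "nice I 0 1 C \<phi> X"
  shows "nice I 0 1 C (\<lambda>z. 1 - \<phi> z) (\<lambda>z i. - X z i)"
  unfolding nice_def
proof (intro conjI allI)
  note [measurable] = niceD(3,4)[OF n]
  show "(\<lambda>z. 1 - \<phi> z) \<in> borel_measurable gam" "(\<lambda>z. - X z i) \<in> borel_measurable gam" for i by measurable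
  fix z e
  have "ip I (\<lambda>i. - X z i) e = - ip I (X z) e" by (simp add: ip_def sum_negf)
  then show "\<bar>1 - \<phi> (\<lambda>i. z i + e i) - (1 - \<phi> z) - ip I (\<lambda>i. - X z i) e\<bar> \<le> C * nsq I e"
    using niceD(8)[OF n, of z e] by (simp add: abs_le_iff)
qed (use niceD[OF n] in auto)

text \<open>Beyond the linear part, the increment of a product consists of two remainders weighted
  by values in the unit interval and of a product of increments. The latter is quadratic by the
  Lipschitz bounds 1 + 2 C and 1 + 2 C' of the factors.\<close>

lemma nice_mult:
  assumes n: "nice I 0 1 C \<phi> X" and n': "nice I 0 1 C' \<phi>' X'"
  shows "nice I 0 1 (C + C' + (1 + 2 * C) * (1 + 2 * C')) (\<lambda>z. \<phi> z * \<phi>' z) (\<lambda>z i. \<phi>' z *\<^sub>R X z i + \<phi> z *\<^sub>R X' z i)"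
  unfolding nice_def
proof (intro conjI allI)
  note [measurable] = niceD(3,4)[OF n] niceD(3,4)[OF n']
  have C: "C \<ge> 0" "C' \<ge> 0" using niceD(2)[OF n] niceD(2)[OF n'] .
  show "finite I" by (rule niceD(1)[OF n])
  show "0 \<le> C + C' + (1 + 2 * C) * (1 + 2 * C')" using C by simp
  show "(\<lambda>z. \<phi> z * \<phi>' z) \<in> borel_measurable gam" "(\<lambda>z. \<phi>' z *\<^sub>R X z i + \<phi> z *\<^sub>R X' z i) \<in> borel_measurable gam" for i
    by measurable
  fix z
  note r = niceD(5,6)[OF n, of z] niceD(5,6)[OF n', of z]
  show "0 \<le> \<phi> z * \<phi>' z" "\<phi> z * \<phi>' z \<le> 1" using r by (auto intro: mult_le_one)
  fix e
  define p where "p = \<phi> (\<lambda>i. z i + e i) - \<phi> z"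
  define q where "q = \<phi>' (\<lambda>i. z i + e i) - \<phi>' z"
  have ip: "ip I (\<lambda>i. \<phi>' z *\<^sub>R X z i + \<phi> z *\<^sub>R X' z i) e = \<phi>' z * ip I (X z) e + \<phi> z * ip I (X' z) e"
    by (simp add: ip_def inner_add_left sum.distrib sum_distrib_left)
  have "\<phi> (\<lambda>i. z i + e i) * \<phi>' (\<lambda>i. z i + e i) - \<phi> z * \<phi>' z - ip I (\<lambda>i. \<phi>' z *\<^sub>R X z i + \<phi> z *\<^sub>R X' z i) e
     = \<phi>' z * (p - ip I (X z) e) + \<phi> z * (q - ip I (X' z) e) + p * q"
    unfolding ip p_def q_def by (simp add: algebra_simps)
  also have "\<bar>\<dots>\<bar> \<le> \<bar>\<phi>' z * (p - ip I (X z) e)\<bar> + \<bar>\<phi> z * (q - ip I (X' z) e)\<bar> + \<bar>p * q\<bar>" by linarith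
  also have "\<bar>\<phi>' z * (p - ip I (X z) e)\<bar> \<le> 1 * (C * nsq I e)"
    unfolding abs_mult using r niceD(8)[OF n, of z e] by (intro mult_mono) (auto simp: p_def)
  also have "\<bar>\<phi> z * (q - ip I (X' z) e)\<bar> \<le> 1 * (C' * nsq I e)"
    unfolding abs_mult using r niceD(8)[OF n', of z e] by (intro mult_mono) (auto simp: q_def)
  also have "\<bar>p * q\<bar> \<le> ((1 + 2 * C) * sqrt (nsq I e)) * ((1 + 2 * C') * sqrt (nsq I e))"
    unfolding abs_mult using nice_lipschitz[OF n, of z e] nice_lipschitz[OF n', of z e] C
    by (intro mult_mono) (auto simp: p_def q_def)
  also have "\<dots> = (1 + 2 * C) * (1 + 2 * C') * nsq I e" by (simp add: mult.assoc mult.left_commute)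
  finally show "\<bar>\<phi> (\<lambda>i. z i + e i) * \<phi>' (\<lambda>i. z i + e i) - \<phi> z * \<phi>' z - ip I (\<lambda>i. \<phi>' z *\<^sub>R X z i + \<phi> z *\<^sub>R X' z i) e\<bar>
      \<le> (C + C' + (1 + 2 * C) * (1 + 2 * C')) * nsq I e" by (simp add: distrib_right)
qed

text \<open>A smooth monotone step from 0 to 1 whose derivatives are polynomials in itself, hence
  bounded; steepened, it approximates the indicator of a half-line.\<close>

definition logistic :: "real \<Rightarrow> real" where "logistic x = 1 / (1 + exp (- x))"

lemma logistic_bounds: "0 < logistic x" "logistic x < 1"
  using exp_gt_zero[of "- x"] by (auto simp: logistic_def field_simps add_pos_pos)

lemma logistic_deriv: "(logistic has_real_derivative logistic x * (1 - logistic x)) (at x)"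
proof -
  have p: "1 + exp (- x) \<noteq> 0" using exp_gt_zero[of "- x"] by linarith
  have "(logistic has_real_derivative exp (- x) / (1 + exp (- x))\<^sup>2) (at x)"
    unfolding logistic_def[abs_def] using p
    by (auto intro!: derivative_eq_intros simp: power2_eq_square)
  moreover have "exp (- x) / (1 + exp (- x))\<^sup>2 = logistic x * (1 - logistic x)"
    unfolding logistic_def using p by (simp add: field_simps power2_eq_square)
  ultimately show ?thesis by simp
qed

lemma mvt_abs:
  fixes f f' :: "real \<Rightarrow> real"
  assumes "\<And>x. (f has_real_derivative f' x) (at x)"
  shows "\<exists>\<xi>. \<bar>\<xi> - x\<bar> \<le> \<bar>y - x\<bar> \<and> f y - f x = f' \<xi> * (y - x)"
proof (cases x y rule: linorder_cases)
  case less
  obtain \<xi> where "\<xi> > x" "\<xi> < y" "f y - f x = (y - x) * f' \<xi>"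
    using MVT2[OF less, of f f'] assms by blast
  then show ?thesis by (intro exI[of _ \<xi>]) (auto simp: mult.commute)
next
  case greater
  obtain \<xi> where x: "\<xi> > y" "\<xi> < x" "f x - f y = (x - y) * f' \<xi>"
    using MVT2[OF greater, of f f'] assms by blast
  then have "f y - f x = f' \<xi> * (y - x)" by (simp add: algebra_simps)
  then show ?thesis using x(1,2) by (intro exI[of _ \<xi>]) auto
qed auto

text \<open>The mean value theorem is applied twice; the second derivative is l (1 - l) (1 - 2 l)
  with l the value of \<open>logistic\<close>, hence bounded by 1.\<close>

lemma logistic_taylor: "\<bar>logistic y - logistic x - logistic x * (1 - logistic x) * (y - x)\<bar> \<le> (y - x)\<^sup>2"
proof -
  let ?d = "\<lambda>x. logistic x * (1 - logistic x)"
  let ?dd = "\<lambda>x. ?d x * (1 - logistic x) + logistic x * (0 - ?d x)"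
  have dd: "(?d has_real_derivative ?dd x) (at x)" for x
    by (rule derivative_eq_intros logistic_deriv refl | simp)+
  have ddb: "\<bar>?dd x\<bar> \<le> 1" for x
  proof -
    have l: "0 \<le> logistic x" "logistic x \<le> 1" using logistic_bounds[of x] by auto
    have d: "0 \<le> ?d x" "?d x \<le> 1" using l by (auto intro: mult_le_one)
    have "?dd x = ?d x * (1 - 2 * logistic x)" by (simp add: algebra_simps)
    then have "\<bar>?dd x\<bar> = \<bar>?d x\<bar> * \<bar>1 - 2 * logistic x\<bar>" by (simp only: abs_mult)
    also have "\<dots> \<le> 1 * 1" using l d by (intro mult_mono) (auto simp: abs_le_iff)
    finally show ?thesis by simp
  qed
  obtain \<xi> where x: "\<bar>\<xi> - x\<bar> \<le> \<bar>y - x\<bar>" "logistic y - logistic x = ?d \<xi> * (y - x)"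
    using mvt_abs[OF logistic_deriv] by blast
  obtain \<eta> where e: "?d \<xi> - ?d x = ?dd \<eta> * (\<xi> - x)" using mvt_abs[OF dd] by blast
  have "logistic y - logistic x - ?d x * (y - x) = (?d \<xi> - ?d x) * (y - x)"
    using x(2) by (simp add: algebra_simps)
  then have "\<bar>logistic y - logistic x - ?d x * (y - x)\<bar> = \<bar>?dd \<eta>\<bar> * \<bar>\<xi> - x\<bar> * \<bar>y - x\<bar>"
    unfolding e by (simp only: abs_mult)
  also have "\<dots> \<le> 1 * \<bar>y - x\<bar> * \<bar>y - x\<bar>"
    using ddb x(1) by (intro mult_mono) auto
  finally show ?thesis by (simp add: power2_eq_square)
qed

lemma nice_logistic:
  assumes I: "finite I" "i \<in> I"
  shows "nice I 0 1 (s\<^sup>2 * (norm v)\<^sup>2) (\<lambda>z. logistic (c + s * (z i \<bullet> v)))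
    (\<lambda>z l. if l = i then (logistic (c + s * (z i \<bullet> v)) * (1 - logistic (c + s * (z i \<bullet> v))) * s) *\<^sub>R v else 0)"
  unfolding nice_def
proof (intro conjI allI)
  have [measurable]: "logistic \<in> borel_measurable borel" unfolding logistic_def[abs_def] by measurable
  show "(\<lambda>z. logistic (c + s * (z i \<bullet> v))) \<in> borel_measurable gam" by measurable
  show "(\<lambda>z. if l = i then (logistic (c + s * (z i \<bullet> v)) * (1 - logistic (c + s * (z i \<bullet> v))) * s) *\<^sub>R v else 0)
      \<in> borel_measurable gam" for l by measurable
  fix z e
  show "0 \<le> logistic (c + s * (z i \<bullet> v))" "logistic (c + s * (z i \<bullet> v)) \<le> 1"
    using logistic_bounds by (auto intro: less_imp_le)
  let ?x = "c + s * (z i \<bullet> v)" and ?y = "c + s * ((z i + e i) \<bullet> v)"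
  have ip: "ip I (\<lambda>l. if l = i then (logistic ?x * (1 - logistic ?x) * s) *\<^sub>R v else 0) e
      = logistic ?x * (1 - logistic ?x) * (?y - ?x)"
  proof -
    have "ip I (\<lambda>l. if l = i then (logistic ?x * (1 - logistic ?x) * s) *\<^sub>R v else 0) e
      = (\<Sum>l\<in>I. if l = i then logistic ?x * (1 - logistic ?x) * s * (v \<bullet> e i) else 0)"
      unfolding ip_def by (rule sum.cong) auto
    also have "\<dots> = logistic ?x * (1 - logistic ?x) * (s * (v \<bullet> e i))" using I by simp
    also have "s * (v \<bullet> e i) = ?y - ?x"
      by (simp add: inner_add_left inner_commute[of "e i" v] distrib_left)
    finally show ?thesis .
  qed
  have "?y - ?x = s * (v \<bullet> e i)"
    by (simp add: inner_add_left inner_commute[of "e i" v] distrib_left)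
  then have "(?y - ?x)\<^sup>2 = s\<^sup>2 * (v \<bullet> e i)\<^sup>2"
    by (simp only: power_mult_distrib)
  also have "\<dots> \<le> s\<^sup>2 * ((norm v)\<^sup>2 * (norm (e i))\<^sup>2)"
    using power_mono[OF Cauchy_Schwarz_ineq2 abs_ge_zero, of v "e i" 2]
    by (intro mult_left_mono) (auto simp: power_mult_distrib)
  also have "\<dots> \<le> s\<^sup>2 * ((norm v)\<^sup>2 * nsq I e)" using nsq_ge[OF I] by (intro mult_left_mono) auto
  finally show "\<bar>logistic (c + s * ((z i + e i) \<bullet> v)) - logistic (c + s * (z i \<bullet> v))
      - ip I (\<lambda>l. if l = i then (logistic ?x * (1 - logistic ?x) * s) *\<^sub>R v else 0) e\<bar> \<le> s\<^sup>2 * (norm v)\<^sup>2 * nsq I e"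
    unfolding ip using logistic_taylor[of ?y ?x] by simp
qed (use I in auto)

text \<open>Complements correspond to 1 - \<phi>, intersections to products, and countable unions to
  limits in L1. So these sets form a sigma-algebra, and it is enough to find the half-spaces among
  them.\<close>

definition approx :: "nat set \<Rightarrow> (nat \<Rightarrow> real^3) set \<Rightarrow> bool" where
  "approx I S \<longleftrightarrow> S \<in> sets gam \<and> (\<forall>\<epsilon>>0. \<exists>\<phi> C X. nice I 0 1 C \<phi> X \<and> (\<integral>z. \<bar>\<phi> z - indicator S z\<bar> \<partial>gam) < \<epsilon>)"

lemma nice_ind_integrable:
  "nice I A B C \<phi> X \<Longrightarrow> S \<in> sets gam \<Longrightarrow> integrable gam (\<lambda>z. \<bar>\<phi> z - indicator S z\<bar>)"
  by (intro integrable_abs Bochner_Integration.integrable_diff nice_integrable GP.P.integrable_const_bound[of "indicator S" 1 for S] AE_I2)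
     (auto simp: indicator_def)

lemma approx_compl: "approx I S \<Longrightarrow> approx I (- S)"
  unfolding approx_def
proof (intro conjI allI impI; elim conjE)
  assume S: "S \<in> sets gam" and *: "\<forall>\<epsilon>>0. \<exists>\<phi> C X. nice I 0 1 C \<phi> X \<and> (\<integral>z. \<bar>\<phi> z - indicator S z\<bar> \<partial>gam) < \<epsilon>"
  show "- S \<in> sets gam" using sets.compl_sets[OF S] by (simp add: Compl_eq_Diff_UNIV)
  fix \<epsilon> :: real assume "\<epsilon> > 0"
  then obtain \<phi> C X where n: "nice I 0 1 C \<phi> X" "(\<integral>z. \<bar>\<phi> z - indicator S z\<bar> \<partial>gam) < \<epsilon>" using * by blast
  have "(\<lambda>z. \<bar>1 - \<phi> z - indicator (- S) z\<bar>) = (\<lambda>z. \<bar>\<phi> z - indicator S z\<bar>)"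
    by (rule ext) (auto simp: indicator_def)
  then show "\<exists>\<phi> C X. nice I 0 1 C \<phi> X \<and> (\<integral>z. \<bar>\<phi> z - indicator (- S) z\<bar> \<partial>gam) < \<epsilon>"
    using nice_one_minus[OF n(1)] n(2) by (intro exI[of _ "\<lambda>z. 1 - \<phi> z"]) auto
qed

lemma approx_inter: "approx I S \<Longrightarrow> approx I T \<Longrightarrow> approx I (S \<inter> T)"
proof -
  assume S: "approx I S" and T: "approx I T"
  have m: "S \<in> sets gam" "T \<in> sets gam" using S T by (auto simp: approx_def)
  show "approx I (S \<inter> T)" unfolding approx_def
  proof (intro conjI allI impI)
    show "S \<inter> T \<in> sets gam" using m by blast
    fix \<epsilon> :: real assume e: "\<epsilon> > 0"
    then have e2: "\<epsilon> / 2 > 0" by simp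
    obtain \<phi> C X where n: "nice I 0 1 C \<phi> X" "(\<integral>z. \<bar>\<phi> z - indicator S z\<bar> \<partial>gam) < \<epsilon> / 2"
      using S e2 unfolding approx_def by blast
    obtain \<phi>' C' X' where n': "nice I 0 1 C' \<phi>' X'" "(\<integral>z. \<bar>\<phi>' z - indicator T z\<bar> \<partial>gam) < \<epsilon> / 2"
      using T e2 unfolding approx_def by blast
    note nm = nice_mult[OF n(1) n'(1)]
    have "(\<integral>z. \<bar>\<phi> z * \<phi>' z - indicator (S \<inter> T) z\<bar> \<partial>gam) \<le> (\<integral>z. \<bar>\<phi> z - indicator S z\<bar> + \<bar>\<phi>' z - indicator T z\<bar> \<partial>gam)"
    proof (rule integral_mono)
      show "integrable gam (\<lambda>z. \<bar>\<phi> z * \<phi>' z - indicator (S \<inter> T) z\<bar>)"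
        using nice_ind_integrable[OF nm] m by blast
      show "integrable gam (\<lambda>z. \<bar>\<phi> z - indicator S z\<bar> + \<bar>\<phi>' z - indicator T z\<bar>)"
        by (intro Bochner_Integration.integrable_add nice_ind_integrable[OF n(1)] nice_ind_integrable[OF n'(1)] m)
      fix z
      have r: "0 \<le> \<phi> z" "\<phi> z \<le> 1" "0 \<le> \<phi>' z" "\<phi>' z \<le> 1" using niceD(5,6)[OF n(1)] niceD(5,6)[OF n'(1)] by auto
      have e: "\<phi> z * \<phi>' z - indicator (S \<inter> T) z = (\<phi> z - indicator S z) * \<phi>' z + indicator S z * (\<phi>' z - indicator T z)"
        by (simp add: indicator_def algebra_simps)
      have "\<bar>(\<phi> z - indicator S z) * \<phi>' z\<bar> \<le> \<bar>\<phi> z - indicator S z\<bar>"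
        unfolding abs_mult using r by (intro mult_right_le_one_le) auto
      moreover have "\<bar>indicator S z * (\<phi>' z - indicator T z)\<bar> \<le> \<bar>\<phi>' z - indicator T z\<bar>"
        by (simp add: indicator_def)
      ultimately show "\<bar>\<phi> z * \<phi>' z - indicator (S \<inter> T) z\<bar> \<le> \<bar>\<phi> z - indicator S z\<bar> + \<bar>\<phi>' z - indicator T z\<bar>"
        unfolding e by linarith
    qed
    also have "\<dots> = (\<integral>z. \<bar>\<phi> z - indicator S z\<bar> \<partial>gam) + (\<integral>z. \<bar>\<phi>' z - indicator T z\<bar> \<partial>gam)"
      by (rule Bochner_Integration.integral_add[OF nice_ind_integrable[OF n(1) m(1)] nice_ind_integrable[OF n'(1) m(2)]])
    finally show "\<exists>\<phi> C X. nice I 0 1 C \<phi> X \<and> (\<integral>z. \<bar>\<phi> z - indicator (S \<inter> T) z\<bar> \<partial>gam) < \<epsilon>"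
      using nm n(2) n'(2) by (intro exI[of _ "\<lambda>z. \<phi> z * \<phi>' z"] exI conjI) (assumption, linarith)
  qed
qed

lemma approx_limit:
  assumes S: "S \<in> sets gam" and T: "\<And>k. approx I (T k)"
    and lim: "(\<lambda>k. \<integral>z. \<bar>indicator (T k) z - indicator S z :: real\<bar> \<partial>gam) \<longlonglongrightarrow> 0"
  shows "approx I S"
  unfolding approx_def
proof (intro conjI allI impI S)
  fix \<epsilon> :: real assume e: "\<epsilon> > 0"
  then obtain k where k: "(\<integral>z. \<bar>indicator (T k) z - indicator S z :: real\<bar> \<partial>gam) < \<epsilon> / 2"
    using order_tendstoD(2)[OF lim, of "\<epsilon> / 2"] by (auto simp: eventually_sequentially)
  have m: "T k \<in> sets gam" using T by (auto simp: approx_def)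
  obtain \<phi> C X where n: "nice I 0 1 C \<phi> X" "(\<integral>z. \<bar>\<phi> z - indicator (T k) z\<bar> \<partial>gam) < \<epsilon> / 2"
    using T[of k] e unfolding approx_def by (meson half_gt_zero)
  have i: "integrable gam (\<lambda>z. \<bar>indicator (T k) z - indicator S z :: real\<bar>)"
    using m S by (intro GP.P.integrable_const_bound[of _ 1] AE_I2) (auto simp: indicator_def)
  have "(\<integral>z. \<bar>\<phi> z - indicator S z\<bar> \<partial>gam) \<le> (\<integral>z. \<bar>\<phi> z - indicator (T k) z\<bar> + \<bar>indicator (T k) z - indicator S z\<bar> \<partial>gam)"
    by (rule integral_mono[OF nice_ind_integrable[OF n(1) S]
          Bochner_Integration.integrable_add[OF nice_ind_integrable[OF n(1) m] i]]) linarith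
  also have "\<dots> < \<epsilon>"
    unfolding Bochner_Integration.integral_add[OF nice_ind_integrable[OF n(1) m] i] using n(2) k by linarith
  finally show "\<exists>\<phi> C X. nice I 0 1 C \<phi> X \<and> (\<integral>z. \<bar>\<phi> z - indicator S z\<bar> \<partial>gam) < \<epsilon>" using n(1) by blast
qed

lemma approx_empty: "finite I \<Longrightarrow> approx I {}"
  unfolding approx_def
proof (intro conjI allI impI)
  fix \<epsilon> :: real assume "finite I" "\<epsilon> > 0"
  then show "\<exists>\<phi> C X. nice I 0 1 C \<phi> X \<and> (\<integral>z. \<bar>\<phi> z - indicator {} z\<bar> \<partial>gam) < \<epsilon>"
    by (intro exI[of _ "\<lambda>_. 0"] exI[of _ 0] exI[of _ "\<lambda>_ _. 0"]) (auto simp: nice_def ip_def)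
qed simp

text \<open>Finite unions come from complements and intersections. The indicators of the partial
  unions are eventually constant at each point, and dominated convergence gives the limit in
  L1.\<close>

lemma approx_UN:
  assumes I: "finite I" and S: "\<And>k::nat. approx I (S k)"
  shows "approx I (\<Union>k. S k)"
proof (rule approx_limit)
  have m [measurable]: "S k \<in> sets gam" for k using S by (auto simp: approx_def)
  show "(\<Union>k. S k) \<in> sets gam" using m by blast
  define T where "T k = (\<Union>i<k. S i)" for k
  show "approx I (T k)" for k
  proof (induction k)
    case 0 then show ?case using approx_empty[OF I] by (simp add: T_def)
  next
    case (Suc k)
    have "T (Suc k) = - (- T k \<inter> - S k)" by (auto simp: T_def less_Suc_eq)
    then show ?case using Suc S by (simp only: approx_compl approx_inter)
  qed
  have mT [measurable]: "T k \<in> sets gam" for k unfolding T_def by measurable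
  have "(\<lambda>k. \<integral>z. \<bar>indicator (T k) z - indicator (\<Union>k. S k) z :: real\<bar> \<partial>gam) \<longlonglongrightarrow> (\<integral>z. 0 \<partial>gam)"
  proof (rule integral_dominated_convergence[where w = "\<lambda>_. 1"])
    show "AE z in gam. (\<lambda>k. \<bar>indicator (T k) z - indicator (\<Union>k. S k) z :: real\<bar>) \<longlonglongrightarrow> 0"
    proof (rule AE_I2)
      fix z
      have "\<exists>k0. \<forall>k\<ge>k0. \<bar>indicator (T k) z - indicator (\<Union>k. S k) z :: real\<bar> = 0"
      proof (cases "z \<in> (\<Union>k. S k)")
        case True
        then obtain k0 where "z \<in> S k0" by blast
        then show ?thesis using True by (intro exI[of _ "Suc k0"]) (auto simp: T_def indicator_def intro!: bexI[of _ k0])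
      qed (auto simp: T_def indicator_def)
      then show "(\<lambda>k. \<bar>indicator (T k) z - indicator (\<Union>k. S k) z :: real\<bar>) \<longlonglongrightarrow> 0"
        by (intro tendsto_eventually) (simp add: eventually_sequentially)
    qed
  qed (auto simp: indicator_def)
  then show "(\<lambda>k. \<integral>z. \<bar>indicator (T k) z - indicator (\<Union>k. S k) z :: real\<bar> \<partial>gam) \<longlonglongrightarrow> 0" by simp
qed

lemma logistic_at_top: "(logistic \<longlongrightarrow> 1) at_top" and logistic_at_bot: "(logistic \<longlongrightarrow> 0) at_bot"
proof -
  have "((\<lambda>x. 1 / (1 + exp (- x))) \<longlongrightarrow> 1 / (1 + 0)) (at_top :: real filter)"
    by (intro tendsto_intros filterlim_compose[OF exp_at_bot filterlim_uminus_at_bot_at_top]) auto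
  then show "(logistic \<longlongrightarrow> 1) at_top" by (simp add: logistic_def[abs_def])
  have "filterlim (\<lambda>x::real. 1 + exp (- x)) at_top at_bot"
    by (intro filterlim_tendsto_add_at_top[OF tendsto_const]
        filterlim_compose[OF exp_at_top filterlim_uminus_at_top_at_bot])
  from tendsto_divide_0[OF tendsto_const filterlim_at_top_imp_at_infinity[OF this], of 1]
  show "(logistic \<longlongrightarrow> 0) at_bot" by (simp add: logistic_def[abs_def])
qed

lemma approx_halfspace:
  assumes I: "finite I" "i \<in> I"
  shows "approx I {z. z i \<bullet> v < r}"
  unfolding approx_def
proof (intro conjI allI impI)
  have "Measurable.pred gam (\<lambda>z. z i \<bullet> v < r)" by measurable
  then show S: "{z. z i \<bullet> v < r} \<in> sets gam" by (simp add: pred_def)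
  fix \<epsilon> :: real assume e: "\<epsilon> > 0"
  \<comment> \<open>The argument of \<open>logistic\<close> is k^2 s - k with s = r - z_i . v. It
    tends to infinity for s > 0 and is at most - k for s \<le> 0: the shift by - k decides the
    boundary s = 0 in favour of the open half-space.\<close>
  define \<phi> where "\<phi> k z = logistic ((real k)\<^sup>2 * r - real k + (- (real k)\<^sup>2) * (z i \<bullet> v))" for k :: nat and z :: "nat \<Rightarrow> real^3"
  have n: "\<exists>C X. nice I 0 1 C (\<phi> k) X" for k
    unfolding \<phi>_def using nice_logistic[OF I] by blast
  have m: "\<phi> k \<in> borel_measurable gam" for k using n[of k] niceD(3) by blast
  have "(\<lambda>k. \<integral>z. \<bar>\<phi> k z - indicator {z. z i \<bullet> v < r} z\<bar> \<partial>gam) \<longlonglongrightarrow> (\<integral>z. 0 \<partial>gam)"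
  proof (rule integral_dominated_convergence[where w = "\<lambda>_. 1"])
    show "AE z in gam. (\<lambda>k. \<bar>\<phi> k z - indicator {z. z i \<bullet> v < r} z\<bar>) \<longlonglongrightarrow> 0"
    proof (rule AE_I2)
      fix z
      define s where "s = r - z i \<bullet> v"
      have p: "\<phi> k z = logistic ((real k)\<^sup>2 * s - real k)" for k by (simp add: \<phi>_def s_def algebra_simps)
      have "(\<lambda>k. \<phi> k z) \<longlonglongrightarrow> indicator {z. z i \<bullet> v < r} z"
      proof (cases "s > 0")
        case True
        have "\<forall>\<^sub>F k in sequentially. 2 / s \<le> real k"
          using filterlim_real_sequentially by (simp add: filterlim_at_top)
        then have "\<forall>\<^sub>F k in sequentially. real k \<le> (real k)\<^sup>2 * s - real k"
        proof eventually_elim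
          case (elim k)
          then have "real k * 2 \<le> real k * (real k * s)" using True by (intro mult_left_mono) (auto simp: field_simps)
          then show ?case by (simp add: power2_eq_square mult.assoc)
        qed
        then have "filterlim (\<lambda>k. (real k)\<^sup>2 * s - real k) at_top sequentially"
          by (rule filterlim_at_top_mono[OF filterlim_real_sequentially])
        from filterlim_compose[OF logistic_at_top this] show ?thesis using True by (simp add: p s_def)
      next
        case False
        have "filterlim (\<lambda>k. (real k)\<^sup>2 * s - real k) at_bot sequentially"
        proof (rule filterlim_at_bot_mono)
          show "filterlim (\<lambda>k::nat. - real k) at_bot sequentially"
            using filterlim_real_sequentially by (simp add: filterlim_uminus_at_bot)
          show "\<forall>\<^sub>F k in sequentially. (real k)\<^sup>2 * s - real k \<le> - real k"
            using False by (intro always_eventually) (auto simp: mult_nonneg_nonpos)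
        qed
        from filterlim_compose[OF logistic_at_bot this] show ?thesis using False by (simp add: p s_def)
      qed
      from tendsto_rabs[OF tendsto_diff[OF this tendsto_const[of "indicator {z. z i \<bullet> v < r} z"]]]
      show "(\<lambda>k. \<bar>\<phi> k z - indicator {z. z i \<bullet> v < r} z\<bar>) \<longlonglongrightarrow> 0" by simp
    qed
    show "AE z in gam. norm \<bar>\<phi> k z - indicator {z. z i \<bullet> v < r} z\<bar> \<le> 1" for k
    proof (rule AE_I2)
      fix z
      have "0 < \<phi> k z" "\<phi> k z < 1" unfolding \<phi>_def by (rule logistic_bounds)+
      then show "norm \<bar>\<phi> k z - indicator {z. z i \<bullet> v < r} z\<bar> \<le> 1" by (auto simp: indicator_def)
    qed
  qed (use m S in auto)
  then have "(\<lambda>k. \<integral>z. \<bar>\<phi> k z - indicator {z. z i \<bullet> v < r} z\<bar> \<partial>gam) \<longlonglongrightarrow> 0" by simp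
  then obtain k where "(\<integral>z. \<bar>\<phi> k z - indicator {z. z i \<bullet> v < r} z\<bar> \<partial>gam) < \<epsilon>"
    using order_tendstoD(2)[of _ 0 sequentially \<epsilon>] e by (auto simp: eventually_sequentially)
  then show "\<exists>\<phi> C X. nice I 0 1 C \<phi> X \<and> (\<integral>z. \<bar>\<phi> z - indicator {z. z i \<bullet> v < r} z\<bar> \<partial>gam) < \<epsilon>"
    using n[of k] by blast
qed

lemma approx_component:
  assumes I: "finite I" "i \<in> I" and A: "A \<in> sets (borel :: (real^3) measure)"
  shows "approx I {z. z i \<in> A}"
proof -
  have "A \<in> sigma_sets UNIV ((\<lambda>(a, i). {x::real^3. x \<bullet> i < a}) ` (UNIV \<times> Basis))"
    using A unfolding borel_eq_halfspace_less by simp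
  then show ?thesis
  proof (induction rule: sigma_sets.induct)
    case (Basic a) then show ?case using approx_halfspace[OF I] by auto
  next
    case Empty then show ?case using approx_empty[OF I(1)] by simp
  next
    case (Compl a)
    have "{z. z i \<in> UNIV - a} = - {z. z i \<in> a}" by auto
    then show ?case using approx_compl[OF Compl.IH] by simp
  next
    case (Union a)
    have "{z. z i \<in> \<Union> (range a)} = (\<Union>k. {z. z i \<in> a k})" by auto
    then show ?case using approx_UN[OF I(1) Union.IH] by simp
  qed
qed

lemma approx_PiM:
  assumes I: "finite I" and S: "S \<in> sets (PiM I (\<lambda>_. borel :: (real^3) measure))"
  shows "approx I {z. restrict z I \<in> S}"
proof -
  have "S \<in> sigma_sets (\<Pi>\<^sub>E i\<in>I. UNIV) {{f\<in>\<Pi>\<^sub>E i\<in>I. UNIV. f i \<in> A} | i A. i \<in> I \<and> A \<in> sets (borel :: (real^3) measure)}"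
    using S by (simp add: sets_PiM_single)
  then show ?thesis
  proof (induction rule: sigma_sets.induct)
    case (Basic a)
    then obtain i A where i: "i \<in> I" and A: "A \<in> sets borel" and a: "a = {f\<in>\<Pi>\<^sub>E i\<in>I. UNIV. f i \<in> A}" by blast
    have e: "{z. restrict z I \<in> a} = {z. z i \<in> A}" using i by (auto simp: a)
    show ?case unfolding e by (rule approx_component[OF I i A])
  next
    case Empty then show ?case using approx_empty[OF I] by simp
  next
    case (Compl a)
    have e: "{z. restrict z I \<in> (\<Pi>\<^sub>E i\<in>I. UNIV) - a} = - {z. restrict z I \<in> a}" by auto
    show ?case unfolding e by (rule approx_compl[OF Compl.IH])
  next
    case (Union a)
    have e: "{z. restrict z I \<in> \<Union> (range a)} = (\<Union>k. {z. restrict z I \<in> a k})" by auto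
    show ?case unfolding e by (rule approx_UN[OF I Union.IH])
  qed
qed

section \<open>Approximation of functions and densities\<close>

lemma level_count:
  fixes y :: real
  assumes "0 \<le> y" "y \<le> real K"
  shows "\<bar>y - (\<Sum>j\<in>{1..K}. if real j < y then 1 else 0)\<bar> \<le> 1"
proof (cases "y = 0")
  case False
  define n where "n = nat \<lceil>y\<rceil>"
  have n: "real n - 1 < y" "y \<le> real n" "n \<ge> 1"
    using assms False by (auto simp: n_def) linarith+
  have eq: "{j \<in> {1..K}. real j < y} = {1..<n}"
  proof (intro set_eqI iffI)
    fix j assume "j \<in> {j \<in> {1..K}. real j < y}"
    then show "j \<in> {1..<n}" using n by auto
  next
    fix j assume j: "j \<in> {1..<n}"
    then have "real j \<le> real n - 1" by auto
    then show "j \<in> {j \<in> {1..K}. real j < y}" using n j assms by auto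
  qed
  have "(\<Sum>j\<in>{1..K}. if real j < y then 1 else 0 :: real) = (\<Sum>j\<in>{j \<in> {1..K}. real j < y}. 1)"
    by (rule sum.inter_filter[symmetric]) simp
  also have "\<dots> = real (n - 1)" unfolding eq by simp
  finally show ?thesis using n by (simp add: of_nat_diff)
qed (auto intro!: sum.neutral)

lemma nice_choice:
  assumes "\<forall>k. \<exists>u C X. nice I (A k) (B k) C u X \<and> P k u"
  obtains u C X where "\<And>k. nice I (A k) (B k) (C k) (u k) (X k)" "\<And>k. P k (u k)"
proof -
  from assms have "\<exists>u. \<forall>k. \<exists>C X. nice I (A k) (B k) C (u k) X \<and> P k (u k)" by (rule choice)
  then obtain u where "\<forall>k. \<exists>C X. nice I (A k) (B k) C (u k) X \<and> P k (u k)" by (rule exE)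
  then have "\<exists>C. \<forall>k. \<exists>X. nice I (A k) (B k) (C k) (u k) X \<and> P k (u k)" by (rule choice)
  then obtain C where "\<forall>k. \<exists>X. nice I (A k) (B k) (C k) (u k) X \<and> P k (u k)" by (rule exE)
  then have "\<exists>X. \<forall>k. nice I (A k) (B k) (C k) (u k) (X k) \<and> P k (u k)" by (rule choice)
  then obtain X where "\<forall>k. nice I (A k) (B k) (C k) (u k) (X k) \<and> P k (u k)" by (rule exE)
  then show thesis by (intro that[of C u X]) simp_all
qed

text \<open>A layer-cake sum: g is within h of A plus h times the number of levels A + j h, with j
  from 1 to K, that lie below it. Replacing the indicators of the level sets by nice functions costs
  at most K h \<delta> = \<epsilon> / 2, and h < \<epsilon> / 2. As A + K h = B, the approximant
  keeps the exact bounds A and B, between which \<open>Psi\<close> is Lipschitz.\<close>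

lemma approx_function:
  assumes I: "finite I" and g: "\<And>z. g z = g' (restrict z I)"
    and m: "g' \<in> borel_measurable (PiM I (\<lambda>_. borel :: (real^3) measure))"
    and b: "\<And>z. A \<le> g z" "\<And>z. g z \<le> B" and AB: "A < B" and e: "\<epsilon> > 0"
  shows "\<exists>u C X. nice I A B C u X \<and> (\<integral>z. \<bar>u z - g z\<bar> \<partial>gam) < \<epsilon>"
proof -
  obtain K :: nat where K: "(B - A) / (\<epsilon> / 2) < real K" using reals_Archimedean2 by blast
  have K0: "K > 0"
  proof (rule ccontr)
    assume "\<not> K > 0"
    then have "(B - A) / (\<epsilon> / 2) < 0" using K by simp
    moreover have "(B - A) / (\<epsilon> / 2) > 0" using AB e by simp
    ultimately show False by simp
  qed
  define h where "h = (B - A) / real K"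
  have h: "h > 0" "h < \<epsilon> / 2" using K0 K AB e by (auto simp: h_def field_simps)
  have hK: "real K * h = B - A" using K0 by (simp add: h_def)
  define S where "S j = {z. A + real j * h < g z}" for j :: nat
  have S: "approx I (S j)" for j
  proof -
    have "{x \<in> space (PiM I (\<lambda>_. borel)). A + real j * h < g' x} \<in> sets (PiM I (\<lambda>_. borel :: (real^3) measure))"
      using m by measurable
    from approx_PiM[OF I this]
    have "approx I {z. restrict z I \<in> {x \<in> space (PiM I (\<lambda>_. borel)). A + real j * h < g' x}}" .
    moreover have "{z. restrict z I \<in> {x \<in> space (PiM I (\<lambda>_. borel :: (real^3) measure)). A + real j * h < g' x}} = S j"
      by (auto simp: S_def g space_PiM)
    ultimately show ?thesis by simp
  qed
  have mS: "S j \<in> sets gam" for j using S by (auto simp: approx_def)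
  have mg: "g \<in> borel_measurable gam"
  proof -
    have "(\<lambda>z. restrict z I) \<in> measurable gam (PiM I (\<lambda>_. borel :: (real^3) measure))"
      by (rule measurable_restrict) measurable
    from measurable_compose[OF this m] show ?thesis unfolding g[abs_def] .
  qed
  define \<delta> where "\<delta> = \<epsilon> / (2 * (B - A))"
  have d: "\<delta> > 0" using e AB by (simp add: \<delta>_def)
  have "\<forall>j. \<exists>\<phi> C X. nice I 0 1 C \<phi> X \<and> (\<integral>z. \<bar>\<phi> z - indicator (S j) z\<bar> \<partial>gam) < \<delta>"
  proof
    fix j
    from S[of j] d show "\<exists>\<phi> C X. nice I 0 1 C \<phi> X \<and> (\<integral>z. \<bar>\<phi> z - indicator (S j) z\<bar> \<partial>gam) < \<delta>"
      unfolding approx_def by simp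
  qed
  note choice = this
  obtain \<phi> C X where n: "\<And>j. nice I 0 1 (C j) (\<phi> j) (X j)"
    "\<And>j. (\<integral>z. \<bar>\<phi> j z - indicator (S j) z\<bar> \<partial>gam) < \<delta>"
    by (rule nice_choice[OF choice]) (rule that)
  define u where "u z = A + (\<Sum>j\<in>{1..K}. h * \<phi> j z)" for z
  have nu: "nice I A B (\<Sum>j\<in>{1..K}. h * C j) u (\<lambda>z i. \<Sum>j\<in>{1..K}. h *\<^sub>R X j z i)"
    using nice_affine[of "{1..K}" I C \<phi> X "\<lambda>_. h" A, OF _ I n(1)] h hK unfolding u_def[abs_def] by simp
  have st: "\<bar>(A + (\<Sum>j\<in>{1..K}. h * indicator (S j) z)) - g z\<bar> \<le> h" for z
  proof -
    define y where "y = (g z - A) / h"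
    have y: "0 \<le> y" "y \<le> real K" "g z = A + h * y" using b h hK by (auto simp: y_def field_simps)
    have ind: "indicator (S j) z = (if real j < y then 1 else 0 :: real)" for j
      using h by (auto simp: S_def indicator_def y(3) mult.commute)
    have "(A + (\<Sum>j\<in>{1..K}. h * indicator (S j) z)) - g z
        = - (h * (y - (\<Sum>j\<in>{1..K}. if real j < y then 1 else 0)))"
      unfolding ind y(3) sum_distrib_left[symmetric] by (simp add: algebra_simps)
    also have "\<bar>\<dots>\<bar> \<le> h * 1"
      unfolding abs_minus_cancel abs_mult using level_count[OF y(1,2)] h by (intro mult_mono) auto
    finally show ?thesis by simp
  qed
  note ii = nice_ind_integrable[OF n(1) mS]
  have iug: "integrable gam (\<lambda>z. \<bar>u z - g z\<bar>)"
  proof (intro integrable_abs Bochner_Integration.integrable_diff nice_integrable[OF nu])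
    show "integrable gam g"
      using mg b by (intro GP.P.integrable_const_bound[of _ "max \<bar>A\<bar> \<bar>B\<bar>"] AE_I2)
        (auto simp: abs_le_iff le_max_iff_disj, (smt (verit, best))+)
  qed
  have "(\<integral>z. \<bar>u z - g z\<bar> \<partial>gam) \<le> (\<integral>z. (\<Sum>j\<in>{1..K}. h * \<bar>\<phi> j z - indicator (S j) z\<bar>) + h \<partial>gam)"
  proof (rule integral_mono[OF iug])
    show "integrable gam (\<lambda>z. (\<Sum>j\<in>{1..K}. h * \<bar>\<phi> j z - indicator (S j) z\<bar>) + h)"
      by (intro Bochner_Integration.integrable_add Bochner_Integration.integrable_sum integrable_mult_right ii GP.P.integrable_const)
    fix z
    have "u z - (A + (\<Sum>j\<in>{1..K}. h * indicator (S j) z)) = (\<Sum>j\<in>{1..K}. h * (\<phi> j z - indicator (S j) z))"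
      unfolding u_def by (simp add: sum_subtractf right_diff_distrib)
    also have "\<bar>\<dots>\<bar> \<le> (\<Sum>j\<in>{1..K}. h * \<bar>\<phi> j z - indicator (S j) z\<bar>)"
      using h by (intro order_trans[OF sum_abs] sum_mono) (auto simp: abs_mult)
    finally show "\<bar>u z - g z\<bar> \<le> (\<Sum>j\<in>{1..K}. h * \<bar>\<phi> j z - indicator (S j) z\<bar>) + h"
      using st[of z] by linarith
  qed
  also have "\<dots> = (\<Sum>j\<in>{1..K}. h * (\<integral>z. \<bar>\<phi> j z - indicator (S j) z\<bar> \<partial>gam)) + h"
  proof -
    have "(\<integral>z. (\<Sum>j\<in>{1..K}. h * \<bar>\<phi> j z - indicator (S j) z\<bar>) + h \<partial>gam)
       = (\<integral>z. (\<Sum>j\<in>{1..K}. h * \<bar>\<phi> j z - indicator (S j) z\<bar>) \<partial>gam) + (\<integral>z. h \<partial>gam)"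
      by (rule Bochner_Integration.integral_add)
         (intro Bochner_Integration.integrable_sum integrable_mult_right ii GP.P.integrable_const)+
    then show ?thesis unfolding integral_lin_comb[OF ii] using GP.P.prob_space by simp
  qed
  also have "\<dots> \<le> (\<Sum>j\<in>{1..K}. h * \<delta>) + h"
    using n(2) h by (intro add_right_mono sum_mono mult_left_mono) (auto intro: less_imp_le)
  also have "(\<Sum>j\<in>{1..K}. h * \<delta>) = (B - A) * \<delta>" using hK by (simp add: mult.assoc[symmetric])
  also have "(B - A) * \<delta> = \<epsilon> / 2"
  proof -
    have "D * (\<epsilon> / (2 * D)) = \<epsilon> / 2" if "D > 0" for D using that by simp
    from this[of "B - A"] show ?thesis using AB by (simp only: \<delta>_def diff_gt_0_iff_gt)
  qed
  also have "\<epsilon> / 2 + h < \<epsilon>" using h by simp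
  finally show ?thesis using nu by blast
qed

lemma nice_scale:
  assumes n: "nice I A B C u X" and s: "s \<ge> 0"
  shows "nice I (s * A) (s * B) (s * C) (\<lambda>z. s * u z) (\<lambda>z i. s *\<^sub>R X z i)"
  unfolding nice_def
proof (intro conjI allI)
  note [measurable] = niceD(3,4)[OF n]
  show "(\<lambda>z. s * u z) \<in> borel_measurable gam" "(\<lambda>z. s *\<^sub>R X z i) \<in> borel_measurable gam" for i by measurable
  fix z e
  have "ip I (\<lambda>i. s *\<^sub>R X z i) e = s * ip I (X z) e" by (simp add: ip_def sum_distrib_left)
  then have "s * u (\<lambda>i. z i + e i) - s * u z - ip I (\<lambda>i. s *\<^sub>R X z i) e = s * (u (\<lambda>i. z i + e i) - u z - ip I (X z) e)"
    by (simp add: right_diff_distrib)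
  then show "\<bar>s * u (\<lambda>i. z i + e i) - s * u z - ip I (\<lambda>i. s *\<^sub>R X z i) e\<bar> \<le> s * C * nsq I e"
    using mult_left_mono[OF niceD(8)[OF n, of z e] s] s by (simp add: abs_mult mult.assoc)
qed (use niceD[OF n] s in \<open>auto intro: mult_left_mono\<close>)

text \<open>For x > 1 monotonicity allows comparison with Psi (h + 1), and the step from h to h + 1
  costs at most ln h + 2 \<le> h + 1 when h > 1. The bound dominates the entropy densities of all
  truncations of h at once.\<close>

lemma Psi_truncate_bound:
  assumes h: "0 \<le> h" and x: "0 < x" "x \<le> h + 1"
  shows "\<bar>Psi x\<bar> \<le> \<bar>Psi h\<bar> + h + 3"
proof -
  have "Psi x \<ge> - 1" using Psi_nonneg_lower[of x] x by simp
  moreover have "Psi x \<le> \<bar>Psi h\<bar> + h + 3"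
  proof (cases "x \<le> 1")
    case True
    then have "Psi x \<le> 0" unfolding Psi_def using x by (simp add: mult_nonneg_nonpos)
    then show ?thesis using h by simp
  next
    case False
    then have "Psi x \<le> Psi (h + 1)" unfolding Psi_def using x by (intro mult_mono) auto
    also have "Psi (h + 1) \<le> \<bar>Psi h\<bar> + h + 3"
    proof (cases "h \<le> 1")
      case True
      have "Psi (h + 1) \<le> (h + 1) * h"
        unfolding Psi_def using h ln_add_one_self_le_self[of h] by (intro mult_left_mono) (auto simp: add.commute)
      also have "\<dots> \<le> 2 * 1" using h True by (intro mult_mono) auto
      finally show ?thesis using h by simp
    next
      case False
      then have h1: "h > 1" by simp
      have "Psi (h + 1) - Psi h - (ln h + 1) \<le> 1 / h"
        using Psi_tangent(2)[of "h + 1" h] h1 by simp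
      moreover have "1 / h \<le> 1" using h1 by simp
      moreover have "ln h \<le> h - 1" using h1 by (intro ln_le_minus_one) simp
      moreover have "Psi h \<le> \<bar>Psi h\<bar>" by simp
      ultimately show ?thesis by linarith
    qed
    finally show ?thesis .
  qed
  ultimately show ?thesis using h by (simp add: abs_le_iff)
qed

text \<open>The density is cut at height k and raised by \<open>a k\<close>, which bounds it away
  from 0. The result is approximated in L1 to within \<open>a k / L k\<close>, where
  \<open>L k\<close> is a Lipschitz constant of \<open>Psi\<close> on its range, so that the entropy
  changes by at most \<open>a k\<close>. Division by the mean, which tends to 1, restores a
  probability density.\<close>

lemma nice_density_sequence:
  assumes I: "finite I" and h: "\<And>z. h z = h' (restrict z I)"
    and m': "h' \<in> borel_measurable (PiM I (\<lambda>_. borel :: (real^3) measure))"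
    and h0: "\<And>z. 0 \<le> h z" and ih: "integrable gam h" and h1: "(\<integral>z. h z \<partial>gam) = 1"
    and iP: "integrable gam (\<lambda>z. Psi (h z))"
  shows "\<exists>u. (\<forall>k. \<exists>A B C X. A > 0 \<and> nice I A B C (u k) X) \<and> (\<forall>k. (\<integral>z. u k z \<partial>gam) = 1) \<and>
    (\<lambda>k. \<integral>z. \<bar>u k z - h z\<bar> \<partial>gam) \<longlonglongrightarrow> 0 \<and> (\<lambda>k. Ent (u k)) \<longlonglongrightarrow> Ent h"
proof -
  define a where "a k = 1 / (real k + 2)" for k :: nat
  define b where "b k = real k + 2" for k :: nat
  define g where "g k z = min (h z) (real k) + a k" for k z
  define L where "L k = 1 + \<bar>ln (a k)\<bar> + \<bar>ln (b k)\<bar>" for k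
  have a: "0 < a k" "a k < b k" "a k < 1" for k
  proof -
    have "a k < 1" by (simp add: a_def)
    moreover have "1 < b k" by (simp add: b_def)
    ultimately show "a k < b k" "a k < 1" by auto
    show "0 < a k" by (simp add: a_def)
  qed
  have L1: "L k \<ge> 1" for k by (simp add: L_def)
  have mh [measurable]: "h \<in> borel_measurable gam" using ih by auto
  have gb: "a k \<le> g k z" "g k z \<le> b k" for k z
    using h0[of z] a[of k] by (auto simp: g_def b_def min_def)
  have "\<exists>u C X. nice I (a k) (b k) C u X \<and> (\<integral>z. \<bar>u z - g k z\<bar> \<partial>gam) < a k / L k" for k
  proof (rule approx_function[OF I _ _ gb a(2)])
    show "g k z = (\<lambda>x. min (h' x) (real k) + a k) (restrict z I)" for z by (simp add: g_def h)
    show "(\<lambda>x. min (h' x) (real k) + a k) \<in> borel_measurable (PiM I (\<lambda>_. borel))" using m' by measurable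
    show "0 < a k / L k" using a[of k] L1[of k] by simp
  qed
  then have "\<forall>k. \<exists>u C X. nice I (a k) (b k) C u X \<and> (\<integral>z. \<bar>u z - g k z\<bar> \<partial>gam) < a k / L k" by simp
  note choice = this
  obtain v C X where v: "\<And>k. nice I (a k) (b k) (C k) (v k) (X k)"
    "\<And>k. (\<integral>z. \<bar>v k z - g k z\<bar> \<partial>gam) < a k / L k"
    by (rule nice_choice[OF choice]) (rule that)
  have mg [measurable]: "g k \<in> borel_measurable gam" for k unfolding g_def by measurable
  have ig: "integrable gam (g k)" for k
    using gb a(1) by (intro GP.P.integrable_const_bound[of _ "b k"] AE_I2) (auto simp: abs_of_pos less_le_trans[OF a(1) gb(1)])
  have iv: "integrable gam (v k)" for k by (rule nice_integrable[OF v(1)])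
  have mv [measurable]: "v k \<in> borel_measurable gam" for k by (rule niceD(3)[OF v(1)])
  have alim: "a \<longlonglongrightarrow> 0"
  proof -
    have "(\<lambda>k. 1 / real (k + 2)) \<longlonglongrightarrow> 0" using LIMSEQ_ignore_initial_segment[OF lim_1_over_n, of 2] .
    then show ?thesis by (simp add: a_def[abs_def] add.commute)
  qed
  have gpt: "(\<lambda>k. g k z) \<longlonglongrightarrow> h z" for z
  proof -
    obtain k0 :: nat where "h z \<le> real k0" using real_arch_simple by blast
    then have "eventually (\<lambda>k. min (h z) (real k) = h z) sequentially"
      by (intro eventually_sequentiallyI[of k0]) auto
    then have "(\<lambda>k. min (h z) (real k)) \<longlonglongrightarrow> h z" by (rule tendsto_eventually)
    from tendsto_add[OF this alim] show ?thesis by (simp add: g_def)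
  qed
  have gh: "\<bar>g k z - h z\<bar> \<le> h z + 1" for k z using h0[of z] a[of k] by (auto simp: g_def min_def)
  have dgh: "(\<lambda>k. \<integral>z. \<bar>g k z - h z\<bar> \<partial>gam) \<longlonglongrightarrow> 0"
  proof -
    have "(\<lambda>k. \<integral>z. \<bar>g k z - h z\<bar> \<partial>gam) \<longlonglongrightarrow> (\<integral>z. 0 \<partial>gam)"
    proof (rule integral_dominated_convergence[where w = "\<lambda>z. h z + 1"])
      show "integrable gam (\<lambda>z. h z + 1)" using ih by simp
      show "AE z in gam. (\<lambda>k. \<bar>g k z - h z\<bar>) \<longlonglongrightarrow> 0"
        using tendsto_rabs[OF tendsto_diff[OF gpt tendsto_const]] by (intro AE_I2) (metis (no_types) abs_zero diff_self)
      show "AE z in gam. norm \<bar>g k z - h z\<bar> \<le> h z + 1" for k using gh by (intro AE_I2) simp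
    qed measurable
    then show ?thesis by simp
  qed
  have Egh: "(\<lambda>k. Ent (g k)) \<longlonglongrightarrow> Ent h"
    unfolding Ent_def
  proof (rule integral_dominated_convergence[where w = "\<lambda>z. \<bar>Psi (h z)\<bar> + h z + 3"])
    show "integrable gam (\<lambda>z. \<bar>Psi (h z)\<bar> + h z + 3)"
      using iP ih by (intro Bochner_Integration.integrable_add integrable_abs GP.P.integrable_const)
    show "AE z in gam. (\<lambda>k. Psi (g k z)) \<longlonglongrightarrow> Psi (h z)"
      using order_trans[OF less_imp_le[OF a(1)] gb(1)] by (intro AE_I2 Psi_tendsto gpt always_eventually h0) auto
    show "AE z in gam. norm (Psi (g k z)) \<le> \<bar>Psi (h z)\<bar> + h z + 3" for k
    proof (rule AE_I2)
      fix z
      have "0 < g k z" using gb(1)[of k z] a(1)[of k] by linarith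
      moreover have "g k z \<le> h z + 1" using a[of k] by (auto simp: g_def min_def)
      ultimately show "norm (Psi (g k z)) \<le> \<bar>Psi (h z)\<bar> + h z + 3"
        using Psi_truncate_bound[OF h0] by simp
    qed
  qed measurable
  have ivg: "integrable gam (\<lambda>z. \<bar>v k z - g k z\<bar>)" for k
    by (intro integrable_abs Bochner_Integration.integrable_diff iv ig)
  have iPv: "integrable gam (\<lambda>z. Psi (v k z))" for k
    by (rule GP.P.integrable_const_bound[OF AE_I2])
       (use abs_Psi_le[OF a(1) niceD(5)[OF v(1)] niceD(6)[OF v(1)]]
            measurable_compose[OF mv Psi_measurable] in auto)
  have iPg: "integrable gam (\<lambda>z. Psi (g k z))" for k
    by (rule GP.P.integrable_const_bound[OF AE_I2])
       (use abs_Psi_le[OF a(1) gb] measurable_compose[OF mg Psi_measurable] in auto)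
  have Evg: "\<bar>Ent (v k) - Ent (g k)\<bar> \<le> a k" for k
  proof -
    have "Ent (v k) - Ent (g k) = (\<integral>z. Psi (v k z) - Psi (g k z) \<partial>gam)"
      unfolding Ent_def by (rule Bochner_Integration.integral_diff[OF iPv iPg, symmetric])
    also have "\<bar>\<dots>\<bar> \<le> (\<integral>z. \<bar>Psi (v k z) - Psi (g k z)\<bar> \<partial>gam)" by (rule integral_abs_bound)
    also have "\<dots> \<le> (\<integral>z. L k * \<bar>v k z - g k z\<bar> \<partial>gam)"
      by (rule integral_mono[OF integrable_abs[OF Bochner_Integration.integrable_diff[OF iPv iPg]]
            integrable_mult_right[OF ivg]])
         (use Psi_lipschitz[OF a(1) niceD(5,6)[OF v(1)] gb] in \<open>simp add: L_def\<close>)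
    also have "\<dots> = L k * (\<integral>z. \<bar>v k z - g k z\<bar> \<partial>gam)" by (rule integral_mult_right_zero)
    also have "\<dots> \<le> L k * (a k / L k)" using v(2)[of k] L1[of k] by (intro mult_left_mono) auto
    also have "\<dots> = a k" using L1[of k] by simp
    finally show ?thesis .
  qed
  have Ev: "(\<lambda>k. Ent (v k)) \<longlonglongrightarrow> Ent h"
  proof -
    have "(\<lambda>k. Ent (v k) - Ent (g k)) \<longlonglongrightarrow> 0"
      by (rule Lim_null_comparison[OF _ alim]) (use Evg in \<open>auto intro: always_eventually\<close>)
    from tendsto_add[OF this Egh] show ?thesis by simp
  qed
  have dvh: "(\<lambda>k. \<integral>z. \<bar>v k z - h z\<bar> \<partial>gam) \<longlonglongrightarrow> 0"
  proof (rule Lim_null_comparison)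
    have "(\<lambda>k. a k + (\<integral>z. \<bar>g k z - h z\<bar> \<partial>gam)) \<longlonglongrightarrow> 0 + 0" by (intro tendsto_add alim dgh)
    then show "(\<lambda>k. a k + (\<integral>z. \<bar>g k z - h z\<bar> \<partial>gam)) \<longlonglongrightarrow> 0" by simp
    show "\<forall>\<^sub>F k in sequentially. norm (\<integral>z. \<bar>v k z - h z\<bar> \<partial>gam) \<le> a k + (\<integral>z. \<bar>g k z - h z\<bar> \<partial>gam)"
    proof (intro always_eventually allI)
      fix k
      have i1: "integrable gam (\<lambda>z. \<bar>v k z - h z\<bar>)" and i2: "integrable gam (\<lambda>z. \<bar>g k z - h z\<bar>)"
        using iv ig ih by auto
      have "(\<integral>z. \<bar>v k z - h z\<bar> \<partial>gam) \<le> (\<integral>z. \<bar>v k z - g k z\<bar> + \<bar>g k z - h z\<bar> \<partial>gam)"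
        by (rule integral_mono[OF i1 Bochner_Integration.integrable_add[OF ivg i2]]) linarith
      also have "\<dots> = (\<integral>z. \<bar>v k z - g k z\<bar> \<partial>gam) + (\<integral>z. \<bar>g k z - h z\<bar> \<partial>gam)"
        by (rule Bochner_Integration.integral_add[OF ivg i2])
      also have "(\<integral>z. \<bar>v k z - g k z\<bar> \<partial>gam) \<le> a k"
      proof -
        have "a k / L k \<le> a k / 1" using L1[of k] a[of k] by (intro divide_left_mono) auto
        then show ?thesis using v(2)[of k] by simp
      qed
      finally show "norm (\<integral>z. \<bar>v k z - h z\<bar> \<partial>gam) \<le> a k + (\<integral>z. \<bar>g k z - h z\<bar> \<partial>gam)" by simp
    qed
  qed
  define \<mu> where "\<mu> k = (\<integral>z. v k z \<partial>gam)" for k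
  have \<mu>lim: "\<mu> \<longlonglongrightarrow> 1"
  proof -
    have "(\<lambda>k. \<mu> k - 1) \<longlonglongrightarrow> 0"
    proof (rule Lim_null_comparison[OF _ dvh], intro always_eventually allI)
      fix k
      have "\<mu> k - 1 = (\<integral>z. v k z - h z \<partial>gam)"
        unfolding \<mu>_def h1[symmetric] by (rule Bochner_Integration.integral_diff[OF iv ih, symmetric])
      then show "norm (\<mu> k - 1) \<le> (\<integral>z. \<bar>v k z - h z\<bar> \<partial>gam)" using integral_abs_bound[of gam "\<lambda>z. v k z - h z"] by simp
    qed
    from tendsto_add[OF this tendsto_const[of 1]] show ?thesis by simp
  qed
  have \<mu>0: "\<mu> k > 0" for k
  proof -
    have "a k \<le> \<mu> k" unfolding \<mu>_def by (rule GP.P.integral_ge_const[OF iv]) (use niceD(5)[OF v(1)] in auto)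
    then show ?thesis using a(1)[of k] by linarith
  qed
  define u where "u k z = (1 / \<mu> k) * v k z" for k z
  have nu: "\<exists>A B C X. A > 0 \<and> nice I A B C (u k) X" for k
  proof -
    have "nice I (1 / \<mu> k * a k) (1 / \<mu> k * b k) (1 / \<mu> k * C k) (u k) (\<lambda>z i. (1 / \<mu> k) *\<^sub>R X k z i)"
      unfolding u_def[abs_def] by (rule nice_scale[OF v(1)]) (use \<mu>0[of k] in simp)
    moreover have "1 / \<mu> k * a k > 0" using \<mu>0[of k] a(1)[of k] by simp
    ultimately show ?thesis by blast
  qed
  have u1: "(\<integral>z. u k z \<partial>gam) = 1" for k
    unfolding u_def integral_mult_right_zero using \<mu>0[of k] by (simp add: \<mu>_def)
  \<comment> \<open>The scaling rule for a function v of mean m: the entropy of v / m is that of v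
    divided by m, minus ln m.\<close>
  have EU: "Ent (u k) = Ent (v k) / \<mu> k - ln (\<mu> k)" for k
  proof -
    have "Psi (u k z) = (1 / \<mu> k) * Psi (v k z) - (ln (\<mu> k) / \<mu> k) * v k z" for z
    proof -
      have "v k z > 0" using niceD(5)[OF v(1), of k z] a(1)[of k] by linarith
      then show ?thesis using \<mu>0[of k] by (simp add: u_def Psi_def ln_div diff_divide_distrib right_diff_distrib)
    qed
    then have "Ent (u k) = (\<integral>z. (1 / \<mu> k) * Psi (v k z) - (ln (\<mu> k) / \<mu> k) * v k z \<partial>gam)"
      unfolding Ent_def by simp
    also have "\<dots> = (1 / \<mu> k) * Ent (v k) - (ln (\<mu> k) / \<mu> k) * \<mu> k"
      unfolding Ent_def \<mu>_def
      by (subst Bochner_Integration.integral_diff[OF integrable_mult_right[OF iPv] integrable_mult_right[OF iv]])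
         (simp only: integral_mult_right_zero)
    finally show ?thesis using \<mu>0[of k] by simp
  qed
  have "(\<lambda>k. Ent (v k) / \<mu> k - ln (\<mu> k)) \<longlonglongrightarrow> Ent h / 1 - ln 1"
    by (intro tendsto_diff tendsto_divide tendsto_ln Ev \<mu>lim) auto
  then have EUl: "(\<lambda>k. Ent (u k)) \<longlonglongrightarrow> Ent h" by (simp add: EU)
  have "(\<lambda>k. \<integral>z. \<bar>u k z - h z\<bar> \<partial>gam) \<longlonglongrightarrow> 0"
  proof (rule Lim_null_comparison)
    have "(\<lambda>k. \<bar>1 - \<mu> k\<bar> + (\<integral>z. \<bar>v k z - h z\<bar> \<partial>gam)) \<longlonglongrightarrow> \<bar>1 - 1\<bar> + 0"
      by (intro tendsto_add tendsto_rabs tendsto_diff tendsto_const \<mu>lim dvh)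
    then show "(\<lambda>k. \<bar>1 - \<mu> k\<bar> + (\<integral>z. \<bar>v k z - h z\<bar> \<partial>gam)) \<longlonglongrightarrow> 0" by simp
    show "\<forall>\<^sub>F k in sequentially. norm (\<integral>z. \<bar>u k z - h z\<bar> \<partial>gam) \<le> \<bar>1 - \<mu> k\<bar> + (\<integral>z. \<bar>v k z - h z\<bar> \<partial>gam)"
    proof (intro always_eventually allI)
      fix k
      have i1: "integrable gam (\<lambda>z. \<bar>u k z - h z\<bar>)" and i2: "integrable gam (\<lambda>z. \<bar>v k z - h z\<bar>)"
        unfolding u_def by (intro integrable_abs Bochner_Integration.integrable_diff integrable_mult_right iv ih)+
      have "(\<integral>z. \<bar>u k z - h z\<bar> \<partial>gam) \<le> (\<integral>z. \<bar>1 / \<mu> k - 1\<bar> * v k z + \<bar>v k z - h z\<bar> \<partial>gam)"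
      proof (rule integral_mono[OF i1 Bochner_Integration.integrable_add[OF integrable_mult_right[OF iv] i2]])
        fix z
        have v0: "v k z \<ge> 0" using niceD(5)[OF v(1), of k z] a(1)[of k] by linarith
        have "u k z - h z = (1 / \<mu> k - 1) * v k z + (v k z - h z)" by (simp add: u_def algebra_simps)
        also have "\<bar>\<dots>\<bar> \<le> \<bar>(1 / \<mu> k - 1) * v k z\<bar> + \<bar>v k z - h z\<bar>" by (rule abs_triangle_ineq)
        finally show "\<bar>u k z - h z\<bar> \<le> \<bar>1 / \<mu> k - 1\<bar> * v k z + \<bar>v k z - h z\<bar>" using v0 by (simp add: abs_mult)
      qed
      also have "\<dots> = \<bar>1 / \<mu> k - 1\<bar> * \<mu> k + (\<integral>z. \<bar>v k z - h z\<bar> \<partial>gam)"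
        unfolding \<mu>_def Bochner_Integration.integral_add[OF integrable_mult_right[OF iv] i2] integral_mult_right_zero ..
      also have "\<bar>1 / \<mu> k - 1\<bar> * \<mu> k = \<bar>1 - \<mu> k\<bar>"
      proof -
        have "\<bar>1 / \<mu> k - 1\<bar> * \<mu> k = \<bar>(1 / \<mu> k - 1) * \<mu> k\<bar>" using \<mu>0[of k] by (simp only: abs_mult abs_of_pos)
        also have "(1 / \<mu> k - 1) * \<mu> k = 1 - \<mu> k" using \<mu>0[of k] by (simp add: left_diff_distrib)
        finally show ?thesis .
      qed
      finally show "norm (\<integral>z. \<bar>u k z - h z\<bar> \<partial>gam) \<le> \<bar>1 - \<mu> k\<bar> + (\<integral>z. \<bar>v k z - h z\<bar> \<partial>gam)" by simp
    qed
  qed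
  then show ?thesis using nu u1 EUl by blast
qed

section \<open>The exponential series of the generator\<close>

lemma AE_sphere_rmap_nn:
  fixes F :: "(nat \<Rightarrow> real^3) \<Rightarrow> ennreal"
  assumes ij: "i \<noteq> j" and m: "F \<in> borel_measurable gam"
  shows "(\<integral>\<^sup>+\<omega>. (\<integral>\<^sup>+z. F (rmap i j \<omega> z) \<partial>gam) \<partial>sphere_measure) = (\<integral>\<^sup>+z. F z \<partial>gam)"
proof -
  have "(\<integral>\<^sup>+\<omega>. (\<integral>\<^sup>+z. F (rmap i j \<omega> z) \<partial>gam) \<partial>sphere_measure) = (\<integral>\<^sup>+\<omega>. (\<integral>\<^sup>+z. F z \<partial>gam) \<partial>sphere_measure)"
  proof (rule nn_integral_cong_AE)
    show "AE \<omega> in sphere_measure. (\<integral>\<^sup>+z. F (rmap i j \<omega> z) \<partial>gam) = (\<integral>\<^sup>+z. F z \<partial>gam)"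
      using AE_sphere by eventually_elim (rule nn_integral_rmap[OF ij _ m])
  qed
  then show ?thesis using SP.emeasure_space_1 by simp
qed

lemma Rop_joint_integrable:
  fixes H :: "(nat \<Rightarrow> real^3) \<Rightarrow> real"
  assumes ij: "i \<noteq> j" and H: "integrable gam H"
  shows "integrable (sphere_measure \<Otimes>\<^sub>M gam) (\<lambda>(\<omega>, z). H (rmap i j \<omega> z))"
proof (rule integrableI_bounded)
  have mr: "(\<lambda>(\<omega>, z). rmap i j \<omega> z) \<in> measurable (sphere_measure \<Otimes>\<^sub>M gam) gam"
  proof -
    have "(\<lambda>p. rmap i j (fst p) (snd p)) \<in> measurable (sphere_measure \<Otimes>\<^sub>M gam) gam"
      by (rule rmap_measurable[OF _ measurable_snd]) (rule measurable_compose[OF measurable_fst], simp)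
    then show ?thesis by (simp add: split_beta')
  qed
  have mH: "H \<in> borel_measurable gam" using H by auto
  show m: "(\<lambda>(\<omega>, z). H (rmap i j \<omega> z)) \<in> borel_measurable (sphere_measure \<Otimes>\<^sub>M gam)"
    using measurable_compose[OF mr mH] by (simp add: split_beta')
  have mn: "(\<lambda>z. ennreal (norm (H z))) \<in> borel_measurable gam" using mH by measurable
  have "(\<integral>\<^sup>+p. ennreal (norm (case p of (\<omega>, z) \<Rightarrow> H (rmap i j \<omega> z))) \<partial>(sphere_measure \<Otimes>\<^sub>M gam))
     = (\<integral>\<^sup>+\<omega>. (\<integral>\<^sup>+z. ennreal (norm (H (rmap i j \<omega> z))) \<partial>gam) \<partial>sphere_measure)"
    using measurable_compose[OF mr mn] by (subst GP.P.nn_integral_fst[symmetric]) (auto simp: split_beta')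
  also have "\<dots> = (\<integral>\<^sup>+z. ennreal (norm (H z)) \<partial>gam)" by (rule AE_sphere_rmap_nn[OF ij mn])
  also have "\<dots> < \<infinity>" using H by (simp add: integrable_iff_bounded)
  finally show "(\<integral>\<^sup>+p. ennreal (norm (case p of (\<omega>, z) \<Rightarrow> H (rmap i j \<omega> z))) \<partial>(sphere_measure \<Otimes>\<^sub>M gam)) < \<infinity>" .
qed

text \<open>The triangle inequality under the sphere integral and the invariance of
  \<open>gam\<close>. For functions that are merely integrable, the sphere average is a genuine
  integral only for almost every z, so the comparison is made almost everywhere.\<close>

lemma Rop_L1:
  fixes H H' :: "(nat \<Rightarrow> real^3) \<Rightarrow> real"
  assumes ij: "i \<noteq> j" and H: "integrable gam H" and H': "integrable gam H'"
  shows "integrable gam (Rop i j H)" "(\<integral>z. \<bar>Rop i j H z - Rop i j H' z\<bar> \<partial>gam) \<le> (\<integral>z. \<bar>H z - H' z\<bar> \<partial>gam)"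
proof -
  interpret P: pair_sigma_finite sphere_measure gam
    by (intro pair_sigma_finite.intro prob_space_imp_sigma_finite prob_space_sphere prob_space_gam)
  have iR: "integrable gam (Rop i j H)" if H: "integrable gam H" for H
    using P.integrable_snd[OF Rop_joint_integrable[OF ij H]] by (simp add: Rop_def[abs_def])
  show "integrable gam (Rop i j H)" by (rule iR[OF H])
  define D where "D z = \<bar>H z - H' z\<bar>" for z
  have D: "integrable gam D" unfolding D_def using H H' by simp
  note jD = Rop_joint_integrable[OF ij D]
  have "(\<integral>z. \<bar>Rop i j H z - Rop i j H' z\<bar> \<partial>gam) \<le> (\<integral>z. Rop i j D z \<partial>gam)"
  proof (rule integral_mono_AE)
    show "integrable gam (\<lambda>z. \<bar>Rop i j H z - Rop i j H' z\<bar>)" using iR[OF H] iR[OF H'] by simp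
    show "integrable gam (Rop i j D)" by (rule iR[OF D])
    show "AE z in gam. \<bar>Rop i j H z - Rop i j H' z\<bar> \<le> Rop i j D z"
      using P.AE_integrable_snd[OF Rop_joint_integrable[OF ij H]] P.AE_integrable_snd[OF Rop_joint_integrable[OF ij H']]
    proof eventually_elim
      case (elim z)
      have "Rop i j H z - Rop i j H' z = (\<integral>\<omega>. H (rmap i j \<omega> z) - H' (rmap i j \<omega> z) \<partial>sphere_measure)"
        unfolding Rop_def by (rule Bochner_Integration.integral_diff[OF elim, symmetric])
      then show ?case unfolding Rop_def D_def using integral_abs_bound by simp
    qed
  qed
  also have "\<dots> = (\<integral>z. D z \<partial>gam)"
  proof -
    have mD: "(\<lambda>z. ennreal (D z)) \<in> borel_measurable gam" using D by measurable
    have "(\<integral>z. Rop i j D z \<partial>gam) = (\<integral>\<omega>. (\<integral>z. D (rmap i j \<omega> z) \<partial>gam) \<partial>sphere_measure)"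
      unfolding Rop_def using P.Fubini_integral[OF jD] by simp
    also have "\<dots> = (\<integral>\<omega>. (\<integral>z. D z \<partial>gam) \<partial>sphere_measure)"
    proof (rule integral_cong_AE)
      show "(\<lambda>\<omega>. \<integral>z. D (rmap i j \<omega> z) \<partial>gam) \<in> borel_measurable sphere_measure"
        using P.integrable_fst[OF jD] by auto
      show "AE \<omega> in sphere_measure. (\<integral>z. D (rmap i j \<omega> z) \<partial>gam) = (\<integral>z. D z \<partial>gam)"
        using AE_sphere
      proof eventually_elim
        fix \<omega> :: "real^3" assume "norm \<omega> = 1"
        then show "(\<integral>z. D (rmap i j \<omega> z) \<partial>gam) = (\<integral>z. D z \<partial>gam)"
          using integral_rmap[OF ij, of D \<omega>] D by (simp add: rw_def borel_measurable_integrable)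
      qed
    qed simp
    finally show ?thesis using SP.prob_space by simp
  qed
  finally show "(\<integral>z. \<bar>Rop i j H z - Rop i j H' z\<bar> \<partial>gam) \<le> (\<integral>z. \<bar>H z - H' z\<bar> \<partial>gam)" by (simp add: D_def)
qed

lemma Eop_L1:
  fixes H H' :: "(nat \<Rightarrow> real^3) \<Rightarrow> real"
  assumes H: "integrable gam H" and H': "integrable gam H'"
  shows "integrable gam (Eop M H)" "(\<integral>z. \<bar>Eop M H z - Eop M H' z\<bar> \<partial>gam) \<le> (\<integral>z. \<bar>H z - H' z\<bar> \<partial>gam)"
proof -
  interpret P: pair_sigma_finite gam gam
    by (intro pair_sigma_finite.intro prob_space_imp_sigma_finite prob_space_gam)
  have m: "(\<lambda>(w, z) i. if i < M then z i else w i) \<in> measurable (gam \<Otimes>\<^sub>M gam) gam" by (rule splice_measurable)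
  have j: "integrable (gam \<Otimes>\<^sub>M gam) (\<lambda>(w, z). H (\<lambda>i. if i < M then z i else w i))"
    and je: "(\<integral>p. (case p of (w, z) \<Rightarrow> H (\<lambda>i. if i < M then z i else w i)) \<partial>(gam \<Otimes>\<^sub>M gam)) = (\<integral>z. H z \<partial>gam)"
    if H: "integrable gam H" for H :: "_ \<Rightarrow> real"
  proof -
    have mH: "H \<in> borel_measurable gam" using H by auto
    have "integrable (distr (gam \<Otimes>\<^sub>M gam) gam (\<lambda>(w, z) i. if i < M then z i else w i)) H"
      using H by (simp only: distr_splice')
    then show "integrable (gam \<Otimes>\<^sub>M gam) (\<lambda>(w, z). H (\<lambda>i. if i < M then z i else w i))"
      by (subst (asm) integrable_distr_eq[OF m mH]) (simp add: split_beta')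
    have "(\<integral>z. H z \<partial>gam) = (\<integral>z. H z \<partial>distr (gam \<Otimes>\<^sub>M gam) gam (\<lambda>(w, z) i. if i < M then z i else w i))"
      by (simp only: distr_splice')
    also have "\<dots> = (\<integral>p. (case p of (w, z) \<Rightarrow> H (\<lambda>i. if i < M then z i else w i)) \<partial>(gam \<Otimes>\<^sub>M gam))"
      by (subst integral_distr[OF m mH]) (simp add: split_beta')
    finally show "(\<integral>p. (case p of (w, z) \<Rightarrow> H (\<lambda>i. if i < M then z i else w i)) \<partial>(gam \<Otimes>\<^sub>M gam)) = (\<integral>z. H z \<partial>gam)" by simp
  qed
  have iE: "integrable gam (Eop M H)" if H: "integrable gam H" for H
    using P.integrable_snd[OF j[OF H]] by (simp add: Eop_def[abs_def])
  show "integrable gam (Eop M H)" by (rule iE[OF H])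
  define D where "D z = \<bar>H z - H' z\<bar>" for z
  have D: "integrable gam D" unfolding D_def using H H' by simp
  have "(\<integral>z. \<bar>Eop M H z - Eop M H' z\<bar> \<partial>gam) \<le> (\<integral>z. Eop M D z \<partial>gam)"
  proof (rule integral_mono_AE)
    show "integrable gam (\<lambda>z. \<bar>Eop M H z - Eop M H' z\<bar>)" using iE[OF H] iE[OF H'] by simp
    show "integrable gam (Eop M D)" by (rule iE[OF D])
    show "AE z in gam. \<bar>Eop M H z - Eop M H' z\<bar> \<le> Eop M D z"
      using P.AE_integrable_snd[OF j[OF H]] P.AE_integrable_snd[OF j[OF H']]
    proof eventually_elim
      case (elim z)
      have "Eop M H z - Eop M H' z = (\<integral>w. H (\<lambda>i. if i < M then z i else w i) - H' (\<lambda>i. if i < M then z i else w i) \<partial>gam)"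
        unfolding Eop_def by (rule Bochner_Integration.integral_diff[OF elim, symmetric])
      then show ?case unfolding Eop_def D_def using integral_abs_bound by simp
    qed
  qed
  also have "\<dots> = (\<integral>z. D z \<partial>gam)"
    unfolding Eop_def using P.integral_snd[OF j[OF D]] je[OF D] by simp
  finally show "(\<integral>z. \<bar>Eop M H z - Eop M H' z\<bar> \<partial>gam) \<le> (\<integral>z. \<bar>H z - H' z\<bar> \<partial>gam)" by (simp add: D_def)
qed

text \<open>The n-th forward difference of q at k. For q k = (Q ^^ k) u it expresses the powers of Q
  - I, and thus of the generator, through powers of \<open>Q\<close>.\<close>

definition fdiff :: "nat \<Rightarrow> (nat \<Rightarrow> real) \<Rightarrow> nat \<Rightarrow> real" where
  "fdiff n q k = (\<Sum>j\<le>n. real (n choose j) * (- 1) ^ (n - j) * q (k + j))"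

lemma fdiff_Suc: "fdiff (Suc n) q k = fdiff n q (Suc k) - fdiff n q k"
proof -
  have "fdiff (Suc n) q k = (- 1) ^ Suc n * q k
      + (\<Sum>j\<le>n. real (Suc n choose Suc j) * (- 1) ^ (n - j) * q (k + Suc j))"
    unfolding fdiff_def by (subst sum.atMost_Suc_shift) simp
  also have "(\<Sum>j\<le>n. real (Suc n choose Suc j) * (- 1) ^ (n - j) * q (k + Suc j))
     = fdiff n q (Suc k) + (\<Sum>j\<le>n. real (n choose Suc j) * (- 1) ^ (n - j) * q (k + Suc j))"
    unfolding fdiff_def sum.distrib[symmetric] by (rule sum.cong) (simp_all add: algebra_simps)
  also have "(- 1) ^ Suc n * q k + (fdiff n q (Suc k) + (\<Sum>j\<le>n. real (n choose Suc j) * (- 1) ^ (n - j) * q (k + Suc j)))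
     = fdiff n q (Suc k) + ((- 1) ^ Suc n * q k + (\<Sum>j\<le>n. real (n choose Suc j) * (- 1) ^ (n - j) * q (k + Suc j)))"
    by simp
  also have "(- 1) ^ Suc n * q k + (\<Sum>j\<le>n. real (n choose Suc j) * (- 1) ^ (n - j) * q (k + Suc j))
     = (\<Sum>j\<le>Suc n. real (n choose j) * (- 1) ^ (Suc n - j) * q (k + j))"
    by (subst sum.atMost_Suc_shift) simp
  also have "\<dots> = (\<Sum>j\<le>n. real (n choose j) * (- 1) ^ (Suc n - j) * q (k + j))" by simp
  also have "\<dots> = (\<Sum>j\<le>n. - (real (n choose j) * (- 1) ^ (n - j) * q (k + j)))"
    by (rule sum.cong) (simp_all add: Suc_diff_le)
  also have "\<dots> = - fdiff n q k" unfolding fdiff_def sum_negf ..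
  finally show ?thesis by simp
qed

text \<open>The scalar form of exp (s (Q - I)) = exp (- s) exp (s Q): by the binomial formula, the
  Cauchy product of the series on the right with that of exp (- s) has forward differences as
  coefficients.\<close>

lemma exp_fdiff_sums:
  assumes b: "\<And>k. \<bar>q k\<bar> \<le> D"
  shows "(\<lambda>n. s ^ n / fact n * fdiff n q 0) sums (exp (- s) * (\<Sum>k. s ^ k / fact k * q k))"
proof -
  define a where "a k = s ^ k / fact k * q k" for k
  define c where "c k = (- s) ^ k / fact k" for k :: nat
  have sa: "summable (\<lambda>k. norm (a k))"
  proof (rule summable_comparison_test'[of "\<lambda>k. \<bar>s\<bar> ^ k / fact k * D" 0])
    have "summable (\<lambda>k. \<bar>s\<bar> ^ k / fact k)"
      using summable_exp[of "\<bar>s\<bar>"] by (simp add: divide_inverse mult.commute)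
    then show "summable (\<lambda>k. \<bar>s\<bar> ^ k / fact k * D)" by (rule summable_mult2)
    show "norm (norm (a k)) \<le> \<bar>s\<bar> ^ k / fact k * D" for k
      unfolding a_def using mult_left_mono[OF b[of k], of "\<bar>s\<bar> ^ k / fact k"] by (simp add: abs_mult power_abs)
  qed
  have sc: "summable (\<lambda>k. norm (c k))"
    using summable_norm_exp[of "- s"] by (simp add: c_def divide_inverse mult.commute abs_mult)
  have c: "(\<Sum>k. c k) = exp (- s)" by (simp add: c_def[abs_def] exp_def divide_inverse mult.commute)
  have "(\<Sum>i\<le>n. a i * c (n - i)) = s ^ n / fact n * fdiff n q 0" for n
  proof -
    have "a i * c (n - i) = s ^ n / fact n * (real (n choose i) * (- 1) ^ (n - i) * q (0 + i))" if "i \<le> n" for i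
    proof -
      have "(- s) ^ (n - i) = (- 1) ^ (n - i) * s ^ (n - i)" by (rule power_minus)
      moreover have "s ^ i * s ^ (n - i) = s ^ n" using that by (simp add: power_add[symmetric])
      moreover have "real (n choose i) = fact n / (fact i * fact (n - i))" using that by (rule binomial_fact)
      ultimately show ?thesis by (simp add: a_def c_def field_simps)
    qed
    then show ?thesis unfolding fdiff_def sum_distrib_left by (intro sum.cong) auto
  qed
  with Cauchy_product_sums[OF sa sc] show ?thesis
    by (simp add: c a_def mult.commute)
qed

lemma exp_partial_sum_le:
  fixes x :: real
  assumes "0 \<le> x" shows "(\<Sum>n<K. x ^ n / fact n) \<le> exp x"
proof -
  have e: "x ^ n /\<^sub>R fact n = x ^ n / fact n" for n
    by (simp add: divide_inverse)
  have s: "(\<lambda>n. x ^ n / fact n) sums exp x"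
    using exp_converges[of x] unfolding e .
  have "(\<Sum>n<K. x ^ n / fact n) \<le> (\<Sum>n. x ^ n / fact n)"
    using assms by (intro sum_le_suminf[OF sums_summable[OF s]]) auto
  then show ?thesis unfolding sums_unique[OF s, symmetric] .
qed

section \<open>The generator and its partial exponential sums\<close>

context kac
begin

abbreviation "L \<equiv> Lgen M N lS lR mu"

text \<open>The rates add up to \<open>Lam\<close>, and each Rop - I expands distances by at most 2.
  The bound is stated for differences rather than derived from linearity, because on integrable
  functions \<open>Rop\<close> is additive only almost everywhere.\<close>

lemma L_L1:
  assumes H: "integrable gam H" and H': "integrable gam H'"
  shows "integrable gam (L H)" "(\<integral>z. \<bar>L H z - L H' z\<bar> \<partial>gam) \<le> 2 * Lam * (\<integral>z. \<bar>H z - H' z\<bar> \<partial>gam)"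
proof -
  have ne: "fst p \<noteq> snd p" if "p \<in> PS" for p using that by (auto simp: PS_def)
  have e: "L H z = (\<Sum>p\<in>PS. rate p * (Rop (fst p) (snd p) H z - H z))" for H z
    unfolding sum_PS Lgen_def by simp
  have i: "integrable gam (Rop (fst p) (snd p) H)" if "p \<in> PS" "integrable gam H" for H p
    by (rule Rop_L1(1)[OF ne[OF that(1)] that(2) that(2)])
  have iL: "integrable gam (L H)" if "integrable gam H" for H
    unfolding e[abs_def] using i that
    by (intro Bochner_Integration.integrable_sum integrable_mult_right Bochner_Integration.integrable_diff) auto
  show "integrable gam (L H)" by (rule iL[OF H])
  let ?d = "\<lambda>p z. \<bar>Rop (fst p) (snd p) H z - Rop (fst p) (snd p) H' z\<bar> + \<bar>H z - H' z\<bar>"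
  have id: "integrable gam (?d p)" if "p \<in> PS" for p
    using i[OF that H] i[OF that H'] H H' by simp
  have "(\<integral>z. \<bar>L H z - L H' z\<bar> \<partial>gam) \<le> (\<integral>z. (\<Sum>p\<in>PS. rate p * ?d p z) \<partial>gam)"
  proof (rule integral_mono)
    show "integrable gam (\<lambda>z. \<bar>L H z - L H' z\<bar>)" using iL[OF H] iL[OF H'] by simp
    show "integrable gam (\<lambda>z. \<Sum>p\<in>PS. rate p * ?d p z)"
      by (intro Bochner_Integration.integrable_sum integrable_mult_right id)
    fix z
    have "L H z - L H' z = (\<Sum>p\<in>PS. rate p * ((Rop (fst p) (snd p) H z - Rop (fst p) (snd p) H' z) - (H z - H' z)))"
      unfolding e sum_subtractf[symmetric] by (rule sum.cong) (simp_all add: algebra_simps)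
    also have "\<bar>\<dots>\<bar> \<le> (\<Sum>p\<in>PS. rate p * ?d p z)"
      by (rule order_trans[OF sum_abs], rule sum_mono)
         (auto simp: abs_mult rate_nonneg intro!: mult_left_mono order_trans[OF abs_triangle_ineq4])
    finally show "\<bar>L H z - L H' z\<bar> \<le> (\<Sum>p\<in>PS. rate p * ?d p z)" .
  qed
  also have "\<dots> = (\<Sum>p\<in>PS. rate p * (\<integral>z. ?d p z \<partial>gam))" by (rule integral_lin_comb[OF id])
  also have "\<dots> \<le> (\<Sum>p\<in>PS. rate p * (2 * (\<integral>z. \<bar>H z - H' z\<bar> \<partial>gam)))"
  proof (rule sum_mono, rule mult_left_mono[OF _ rate_nonneg])
    fix p assume p: "p \<in> PS"
    have "(\<integral>z. ?d p z \<partial>gam) = (\<integral>z. \<bar>Rop (fst p) (snd p) H z - Rop (fst p) (snd p) H' z\<bar> \<partial>gam) + (\<integral>z. \<bar>H z - H' z\<bar> \<partial>gam)"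
      using i[OF p H] i[OF p H'] H H' by (intro Bochner_Integration.integral_add) auto
    then show "(\<integral>z. ?d p z \<partial>gam) \<le> 2 * (\<integral>z. \<bar>H z - H' z\<bar> \<partial>gam)"
      using Rop_L1(2)[OF ne[OF p] H H'] by simp
  qed
  also have "\<dots> = 2 * Lam * (\<integral>z. \<bar>H z - H' z\<bar> \<partial>gam)" by (simp add: sum_distrib_right[symmetric])
  finally show "(\<integral>z. \<bar>L H z - L H' z\<bar> \<partial>gam) \<le> 2 * Lam * (\<integral>z. \<bar>H z - H' z\<bar> \<partial>gam)" .
qed

lemma Ln_L1:
  assumes H: "integrable gam H" and H': "integrable gam H'"
  shows "integrable gam ((L ^^ n) H) \<and> integrable gam ((L ^^ n) H') \<and>
    (\<integral>z. \<bar>(L ^^ n) H z - (L ^^ n) H' z\<bar> \<partial>gam) \<le> (2 * Lam) ^ n * (\<integral>z. \<bar>H z - H' z\<bar> \<partial>gam)"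
proof (induction n)
  case 0 then show ?case using H H' by simp
next
  case (Suc n)
  have "(\<integral>z. \<bar>L ((L ^^ n) H) z - L ((L ^^ n) H') z\<bar> \<partial>gam) \<le> 2 * Lam * (\<integral>z. \<bar>(L ^^ n) H z - (L ^^ n) H' z\<bar> \<partial>gam)"
    using Suc by (intro L_L1) auto
  also have "\<dots> \<le> 2 * Lam * ((2 * Lam) ^ n * (\<integral>z. \<bar>H z - H' z\<bar> \<partial>gam))"
    using Suc sum_rate_pos by (intro mult_left_mono) auto
  finally show ?case using Suc L_L1(1)[of "(L ^^ n) H" "(L ^^ n) H"] L_L1(1)[of "(L ^^ n) H'" "(L ^^ n) H'"]
    by (simp add: mult.assoc)
qed

abbreviation "EP t K H \<equiv> exp_partial M N lS lR mu t K H"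

lemma EP_integrable: "integrable gam H \<Longrightarrow> integrable gam (EP t K H)"
  unfolding exp_partial_def[abs_def] using Ln_L1[of H H]
  by (intro Bochner_Integration.integrable_sum integrable_mult_right) auto

text \<open>The constant is independent of K, so the bound survives the limit of the exponential
  series.\<close>

lemma EP_L1:
  assumes H: "integrable gam H" and H': "integrable gam H'" and t: "t \<ge> 0"
  shows "(\<integral>z. \<bar>EP t K H z - EP t K H' z\<bar> \<partial>gam) \<le> exp (2 * Lam * t) * (\<integral>z. \<bar>H z - H' z\<bar> \<partial>gam)"
proof -
  let ?d = "\<lambda>n z. \<bar>(L ^^ n) H z - (L ^^ n) H' z\<bar>"
  let ?D = "\<integral>z. \<bar>H z - H' z\<bar> \<partial>gam"
  have tn: "0 \<le> t ^ n / fact n" for n using t by simp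
  have "integrable gam (\<lambda>z. (L ^^ n) H z - (L ^^ n) H' z)" for n
    by (rule Bochner_Integration.integrable_diff) (use Ln_L1[OF H H', of n] in blast)+
  then have id: "integrable gam (?d n)" for n by (rule integrable_abs)
  have "(\<integral>z. \<bar>EP t K H z - EP t K H' z\<bar> \<partial>gam) \<le> (\<integral>z. (\<Sum>n<K. t ^ n / fact n * ?d n z) \<partial>gam)"
  proof (rule integral_mono)
    show "integrable gam (\<lambda>z. \<bar>EP t K H z - EP t K H' z\<bar>)"
      by (intro integrable_abs Bochner_Integration.integrable_diff EP_integrable H H')
    show "integrable gam (\<lambda>z. \<Sum>n<K. t ^ n / fact n * ?d n z)"
      by (intro Bochner_Integration.integrable_sum integrable_mult_right id)
    fix z
    have e: "EP t K H z - EP t K H' z = (\<Sum>n<K. t ^ n / fact n * ((L ^^ n) H z - (L ^^ n) H' z))"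
      unfolding exp_partial_def right_diff_distrib by (rule sum_subtractf[symmetric])
    show "\<bar>EP t K H z - EP t K H' z\<bar> \<le> (\<Sum>n<K. t ^ n / fact n * ?d n z)"
      unfolding e by (rule order_trans[OF sum_abs]) (simp only: abs_mult abs_of_nonneg[OF tn] order_refl)
  qed
  also have "\<dots> = (\<Sum>n<K. t ^ n / fact n * (\<integral>z. ?d n z \<partial>gam))" by (rule integral_lin_comb[OF id])
  also have "\<dots> \<le> (\<Sum>n<K. t ^ n / fact n * ((2 * Lam) ^ n * ?D))"
    by (rule sum_mono, rule mult_left_mono[OF _ tn]) (use Ln_L1[OF H H'] in blast)
  also have "\<dots> = (\<Sum>n<K. (2 * Lam * t) ^ n / fact n) * ?D"
    unfolding sum_distrib_right[of "\<lambda>n. (2 * Lam * t) ^ n / fact n" "{..<K}"]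
      by (rule sum.cong) (simp_all add: power_mult_distrib)
  also have "\<dots> \<le> exp (2 * Lam * t) * ?D"
  proof (rule mult_right_mono)
    show "(\<Sum>n<K. (2 * Lam * t) ^ n / fact n) \<le> exp (2 * Lam * t)"
      using t sum_rate_pos by (intro exp_partial_sum_le) simp
  qed simp
  finally show ?thesis .
qed

lemma Rop_bounded_diff:
  assumes u: "u \<in> borel_measurable gam" "\<And>z. \<bar>u z\<bar> \<le> D" and v: "v \<in> borel_measurable gam" "\<And>z. \<bar>v z\<bar> \<le> D'"
  shows "Rop i j (\<lambda>z. c * (u z - v z)) z = c * (Rop i j u z - Rop i j v z)"
proof -
  have m: "(\<lambda>\<omega>. rmap i j \<omega> z) \<in> measurable sphere_measure gam"
    unfolding rmap_def by (rule measurable_gamI) simp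
  have "integrable sphere_measure (\<lambda>\<omega>. u (rmap i j \<omega> z))"
    using u(2) measurable_compose[OF m u(1)] by (intro SP.integrable_const_bound AE_I2) auto
  moreover have "integrable sphere_measure (\<lambda>\<omega>. v (rmap i j \<omega> z))"
    using v(2) measurable_compose[OF m v(1)] by (intro SP.integrable_const_bound AE_I2) auto
  ultimately show ?thesis unfolding Rop_def by simp
qed

lemma Q_diff:
  assumes u: "u \<in> borel_measurable gam" "\<And>z. \<bar>u z\<bar> \<le> D" and v: "v \<in> borel_measurable gam" "\<And>z. \<bar>v z\<bar> \<le> D'"
  shows "Q (\<lambda>z. c * (u z - v z)) = (\<lambda>z. c * (Q u z - Q v z))"
  unfolding Qop_def[abs_def] Rop_bounded_diff[OF u v] sum_subtractf[symmetric] sum_distrib_left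
  by (intro ext sum.cong refl) (simp add: algebra_simps)

lemma Qk_diff:
  assumes u: "u \<in> borel_measurable gam" "\<And>z. \<bar>u z\<bar> \<le> D" and v: "v \<in> borel_measurable gam" "\<And>z. \<bar>v z\<bar> \<le> D'"
  shows "(Q ^^ k) (\<lambda>z. c * (u z - v z)) = (\<lambda>z. c * ((Q ^^ k) u z - (Q ^^ k) v z))"
proof (induction k)
  case (Suc k)
  show ?case
    using Suc Q_diff[of "(Q ^^ k) u" D "(Q ^^ k) v" D' c] Qk_bounded_measurable[OF u, of k] Qk_bounded_measurable[OF v, of k]
    by simp
qed simp

text \<open>On bounded functions \<open>Q\<close> is linear at every point, so L = Lam (Q - I) can
  be iterated pointwise. The extra power \<open>Q ^^ k\<close> makes the induction go through, by
  the recursion of forward differences.\<close>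

lemma Ln_fdiff:
  assumes u: "u \<in> borel_measurable gam" "\<And>z. \<bar>u z\<bar> \<le> D"
  shows "(L ^^ n) u \<in> borel_measurable gam \<and> (\<forall>z. \<bar>(L ^^ n) u z\<bar> \<le> (2 * Lam) ^ n * D) \<and>
    (\<forall>k z. (Q ^^ k) ((L ^^ n) u) z = Lam ^ n * fdiff n (\<lambda>k. (Q ^^ k) u z) k)"
proof (induction n)
  case 0 then show ?case using u by (simp add: fdiff_def)
next
  case (Suc n)
  let ?v = "(L ^^ n) u"
  have v: "?v \<in> borel_measurable gam" "\<And>z. \<bar>?v z\<bar> \<le> (2 * Lam) ^ n * D"
    and f: "\<And>k z. (Q ^^ k) ?v z = Lam ^ n * fdiff n (\<lambda>k. (Q ^^ k) u z) k" using Suc by auto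
  note Qv = Q_bounded_measurable[OF v]
  have e: "(L ^^ Suc n) u = (\<lambda>z. Lam * (Q ?v z - ?v z))" by (simp add: fun_eq_iff Lgen_eq)
  have "(\<lambda>z. Lam * (Q ?v z - ?v z)) \<in> borel_measurable gam" using Qv(1) v(1) by measurable
  moreover have "\<bar>Lam * (Q ?v z - ?v z)\<bar> \<le> (2 * Lam) ^ Suc n * D" for z
  proof -
    have "\<bar>Q ?v z - ?v z\<bar> \<le> 2 * ((2 * Lam) ^ n * D)" using Qv(2)[of z] v(2)[of z] by linarith
    then have "Lam * \<bar>Q ?v z - ?v z\<bar> \<le> Lam * (2 * ((2 * Lam) ^ n * D))"
      using sum_rate_pos by (intro mult_left_mono) auto
    then show ?thesis using sum_rate_pos by (simp add: abs_mult mult_ac)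
  qed
  moreover have "(Q ^^ k) (\<lambda>z. Lam * (Q ?v z - ?v z)) z = Lam ^ Suc n * fdiff (Suc n) (\<lambda>k. (Q ^^ k) u z) k" for k z
  proof -
    have "(Q ^^ k) (\<lambda>z. Lam * (Q ?v z - ?v z)) z = Lam * ((Q ^^ Suc k) ?v z - (Q ^^ k) ?v z)"
      unfolding Qk_diff[OF Qv v] by (simp add: funpow_swap1)
    then show ?thesis unfolding f fdiff_Suc by (simp add: algebra_simps)
  qed
  ultimately show ?case unfolding e by blast
qed

text \<open>At each point the partial sums are those of \<open>exp_fdiff_sums\<close>, whose limit
  is the Poisson average. The bound exp (2 Lam t) D, uniform in K, permits dominated
  convergence.\<close>

lemma EP_tendsto_S:
  assumes u: "u \<in> borel_measurable gam" "\<And>z. \<bar>u z\<bar> \<le> D" and t: "t \<ge> 0"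
  shows "(\<lambda>K. \<integral>z. \<bar>EP t K u z - S (Lam * t) u z\<bar> \<partial>gam) \<longlonglongrightarrow> 0"
proof -
  let ?s = "Lam * t"
  have tn: "0 \<le> t ^ n / fact n" for n using t by simp
  have s: "?s \<ge> 0" using t sum_rate_pos by simp
  have bq: "\<bar>(Q ^^ k) u z\<bar> \<le> D" for k z using Qk_bounded_measurable[OF u] by blast
  have D0: "D \<ge> 0" using u(2)[of undefined] by linarith
  have pt: "(\<lambda>K. EP t K u z) \<longlonglongrightarrow> S ?s u z" for z
  proof -
    have "(\<lambda>k. pois ?s k * (Q ^^ k) u z) sums S ?s u z"
      unfolding Sop_def by (rule integral_pois_sums[OF s bq])
    then have 1: "(\<lambda>k. exp ?s * (pois ?s k * (Q ^^ k) u z)) sums (exp ?s * S ?s u z)" by (rule sums_mult)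
    have 2: "exp ?s * (pois ?s k * (Q ^^ k) u z) = ?s ^ k / fact k * (Q ^^ k) u z" for k
      by (simp add: pois_def exp_minus)
    have 3: "(\<Sum>k. ?s ^ k / fact k * (Q ^^ k) u z) = exp ?s * S ?s u z"
      using sums_unique[OF 1] unfolding 2 by (rule sym)
    have 4: "exp (- ?s) * (\<Sum>k. ?s ^ k / fact k * (Q ^^ k) u z) = S ?s u z"
      unfolding 3 by (simp add: exp_minus)
    have "(\<lambda>n. ?s ^ n / fact n * fdiff n (\<lambda>k. (Q ^^ k) u z) 0) sums S ?s u z"
      using exp_fdiff_sums[of "\<lambda>k. (Q ^^ k) u z" D ?s, OF bq] unfolding 4 .
    moreover have "?s ^ n / fact n * fdiff n (\<lambda>k. (Q ^^ k) u z) 0 = t ^ n / fact n * (L ^^ n) u z" for n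
    proof -
      have "(Q ^^ 0) ((L ^^ n) u) z = Lam ^ n * fdiff n (\<lambda>k. (Q ^^ k) u z) 0"
        using Ln_fdiff[OF u, of n] by blast
      then have "(L ^^ n) u z = Lam ^ n * fdiff n (\<lambda>k. (Q ^^ k) u z) 0" by simp
      then show ?thesis by (simp add: power_mult_distrib)
    qed
    ultimately show ?thesis unfolding exp_partial_def sums_def by simp
  qed
  have bE: "\<bar>EP t K u z\<bar> \<le> exp (2 * Lam * t) * D" for K z
  proof -
    have "\<bar>EP t K u z\<bar> \<le> (\<Sum>n<K. t ^ n / fact n * \<bar>(L ^^ n) u z\<bar>)"
      unfolding exp_partial_def
      by (rule order_trans[OF sum_abs]) (simp only: abs_mult abs_of_nonneg[OF tn] order_refl)
    also have "\<dots> \<le> (\<Sum>n<K. t ^ n / fact n * ((2 * Lam) ^ n * D))"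
      by (rule sum_mono, rule mult_left_mono[OF _ tn]) (use Ln_fdiff[OF u] in blast)
    also have "\<dots> = (\<Sum>n<K. (2 * Lam * t) ^ n / fact n) * D"
      unfolding sum_distrib_right[of "\<lambda>n. (2 * Lam * t) ^ n / fact n" "{..<K}"]
      by (rule sum.cong) (simp_all add: power_mult_distrib)
    also have "\<dots> \<le> exp (2 * Lam * t) * D"
    proof (rule mult_right_mono[OF _ D0])
      show "(\<Sum>n<K. (2 * Lam * t) ^ n / fact n) \<le> exp (2 * Lam * t)"
        using t sum_rate_pos by (intro exp_partial_sum_le) simp
    qed
    finally show ?thesis .
  qed
  note Sb = S_bounded_measurable[OF u s]
  have mE: "EP t K u \<in> borel_measurable gam" for K
  proof (rule borel_measurable_integrable, rule EP_integrable)
    show "integrable gam u" using u by (intro GP.P.integrable_const_bound[of _ D] AE_I2) auto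
  qed
  have "(\<lambda>K. \<integral>z. \<bar>EP t K u z - S ?s u z\<bar> \<partial>gam) \<longlonglongrightarrow> (\<integral>z. 0 \<partial>gam)"
  proof (rule integral_dominated_convergence[where w = "\<lambda>_. exp (2 * Lam * t) * D + D"])
    show "AE z in gam. (\<lambda>K. \<bar>EP t K u z - S ?s u z\<bar>) \<longlonglongrightarrow> 0"
    proof (rule AE_I2)
      fix z
      from tendsto_rabs[OF tendsto_diff[OF pt[of z] tendsto_const[of "S ?s u z"]]]
      show "(\<lambda>K. \<bar>EP t K u z - S ?s u z\<bar>) \<longlonglongrightarrow> 0" by simp
    qed
    show "AE z in gam. norm \<bar>EP t K u z - S ?s u z\<bar> \<le> exp (2 * Lam * t) * D + D" for K
    proof (rule AE_I2)
      fix z show "norm \<bar>EP t K u z - S ?s u z\<bar> \<le> exp (2 * Lam * t) * D + D"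
        using bE[of K z] Sb(2)[of z] by simp
    qed
    show "(\<lambda>z. \<bar>EP t K u z - S ?s u z\<bar>) \<in> borel_measurable gam" for K using mE[of K] Sb(1) by measurable
  qed auto
  then show ?thesis by simp
qed

end

section \<open>Lebesgue densities relative to the Gaussian\<close>

interpretation LB: product_sigma_finite "\<lambda>_::nat. lborel :: (real^3) measure"
  by unfold_locales

lemma sets_config: "sets (config_space I) = sets (PiM I (\<lambda>_. borel :: (real^3) measure))"
  unfolding config_space_def by (rule sets_PiM_cong) auto

lemma sets_config_gamma: "sets (config_space I) = sets (PiM I (\<lambda>_. gamma3))"
  unfolding config_space_def by (rule sets_PiM_cong) auto

lemma space_config: "space (config_space I) = (\<Pi>\<^sub>E i\<in>I. UNIV)"
  by (simp add: config_space_def space_PiM)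

lemma gauss_nsq: "gauss I z = exp (- pi * nsq I z)"
  by (simp add: gauss_def nsq_def)

lemma gauss_pos: "gauss I z > 0"
  by (simp add: gauss_def)

lemma gauss_restrict: "gauss I (restrict z I) = gauss I z"
  by (simp add: gauss_def)

lemma gauss_prod: "finite I \<Longrightarrow> gauss I z = (\<Prod>i\<in>I. exp (- pi * (norm (z i))\<^sup>2))"
  by (simp add: gauss_def exp_sum[symmetric] sum_distrib_left sum_negf)

text \<open>Configurations in \<open>config_space\<close> are \<open>undefined\<close> off I but
  still functions on all naturals, so the inclusion allows functions on \<open>gam\<close> to be
  evaluated at them.\<close>

lemma incl_measurable: "(\<lambda>x. x) \<in> measurable (config_space I) gam"
proof (rule measurable_gamI)
  fix n
  show "(\<lambda>x. x n) \<in> borel_measurable (config_space I)"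
  proof (cases "n \<in> I")
    case True
    then have "(\<lambda>x. x n) \<in> measurable (config_space I) lborel"
      unfolding config_space_def by (rule measurable_component_singleton)
    then show ?thesis by simp
  next
    case False
    have "(\<lambda>x. x n) \<in> borel_measurable (config_space I) \<longleftrightarrow> (\<lambda>x. undefined :: real^3) \<in> borel_measurable (config_space I)"
      by (rule measurable_cong) (use False in \<open>auto simp: space_config PiE_def extensional_def\<close>)
    then show ?thesis by simp
  qed
qed

lemma gauss_measurable_gam: "gauss I \<in> borel_measurable gam"
  unfolding gauss_nsq[abs_def] by measurable

lemma gauss_measurable: "gauss I' \<in> borel_measurable (config_space I)"
  using measurable_compose[OF incl_measurable gauss_measurable_gam] .

lemma PiM_gamma3_density:
  assumes I: "finite I"
  shows "density (config_space I) (\<lambda>x. ennreal (gauss I x)) = PiM I (\<lambda>_. gamma3)"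
proof (rule GP.PiM_eqI[OF I])
  show "sets (density (config_space I) (\<lambda>x. ennreal (gauss I x))) = sets (PiM I (\<lambda>_. gamma3))"
    by (simp add: sets_config_gamma)
  fix A :: "nat \<Rightarrow> (real^3) set" assume "\<And>i. i \<in> I \<Longrightarrow> A i \<in> sets gamma3"
  then have A: "\<And>i. i \<in> I \<Longrightarrow> A i \<in> sets borel" by simp
  have E: "Pi\<^sub>E I A \<in> sets (config_space I)"
    unfolding config_space_def using A I by (intro sets_PiM_I_finite) auto
  have mg: "(\<lambda>x. ennreal (gauss I x)) \<in> borel_measurable (config_space I)"
    using gauss_measurable by measurable
  have "emeasure (density (config_space I) (\<lambda>x. ennreal (gauss I x))) (Pi\<^sub>E I A)
      = (\<integral>\<^sup>+x. ennreal (gauss I x) * indicator (Pi\<^sub>E I A) x \<partial>config_space I)"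
    by (rule emeasure_density[OF mg E])
  also have "\<dots> = (\<integral>\<^sup>+x. (\<Prod>i\<in>I. ennreal (exp (- pi * (norm (x i))\<^sup>2)) * indicator (A i) (x i)) \<partial>config_space I)"
  proof (rule nn_integral_cong)
    fix x assume x: "x \<in> space (config_space I)"
    have "(indicator (Pi\<^sub>E I A) x :: ennreal) = (\<Prod>i\<in>I. indicator (A i) (x i))"
    proof (cases "\<forall>i\<in>I. x i \<in> A i")
      case True then show ?thesis using x by (auto simp: indicator_def space_config PiE_def)
    next
      case False then show ?thesis using I by (auto simp: indicator_def PiE_def Pi_def prod_zero_iff)
    qed
    then show "ennreal (gauss I x) * indicator (Pi\<^sub>E I A) x
        = (\<Prod>i\<in>I. ennreal (exp (- pi * (norm (x i))\<^sup>2)) * indicator (A i) (x i))"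
      by (simp add: gauss_prod[OF I] prod.distrib prod_ennreal)
  qed
  also have "\<dots> = (\<Prod>i\<in>I. \<integral>\<^sup>+x. ennreal (exp (- pi * (norm x)\<^sup>2)) * indicator (A i) x \<partial>lborel)"
    unfolding config_space_def using A by (intro LB.product_nn_integral_prod[OF I]) auto
  also have "\<dots> = (\<Prod>i\<in>I. emeasure gamma3 (A i))"
    using A by (intro prod.cong refl) (simp add: gamma3_def emeasure_density)
  finally show "emeasure (density (config_space I) (\<lambda>x. ennreal (gauss I x))) (Pi\<^sub>E I A) = (\<Prod>i\<in>I. emeasure gamma3 (A i))" .
qed

lemma restrict_measurable: "(\<lambda>z. restrict z I) \<in> measurable gam (config_space I)"
proof -
  have "(\<lambda>z. restrict z I) \<in> measurable gam (PiM I (\<lambda>_. gamma3))"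
    by (rule measurable_restrict) measurable
  then show ?thesis by (simp cong: measurable_cong_sets add: sets_config_gamma)
qed

lemma distr_restrict:
  assumes I: "finite I"
  shows "distr gam (config_space I) (\<lambda>z. restrict z I) = density (config_space I) (\<lambda>x. ennreal (gauss I x))"
proof -
  have "distr gam (config_space I) (\<lambda>z. restrict z I) = distr gam (PiM I (\<lambda>_. gamma3)) (\<lambda>z. restrict z I)"
    by (rule distr_cong) (simp_all add: sets_config_gamma)
  also have "\<dots> = PiM I (\<lambda>_. gamma3)" by (rule GP.distr_PiM_restrict_finite[OF I]) simp
  finally show ?thesis by (simp only: PiM_gamma3_density[OF I])
qed

lemma nn_integral_config:
  assumes I: "finite I" and F: "F \<in> borel_measurable (config_space I)"
  shows "(\<integral>\<^sup>+x. ennreal (gauss I x) * F x \<partial>config_space I) = (\<integral>\<^sup>+z. F (restrict z I) \<partial>gam)"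
proof -
  have mg: "(\<lambda>x. ennreal (gauss I x)) \<in> borel_measurable (config_space I)"
    using gauss_measurable by measurable
  have "(\<integral>\<^sup>+x. ennreal (gauss I x) * F x \<partial>config_space I) = (\<integral>\<^sup>+x. F x \<partial>density (config_space I) (\<lambda>x. ennreal (gauss I x)))"
    by (rule nn_integral_density[OF mg F, symmetric])
  also have "\<dots> = (\<integral>\<^sup>+x. F x \<partial>distr gam (config_space I) (\<lambda>z. restrict z I))" by (simp only: distr_restrict[OF I])
  also have "\<dots> = (\<integral>\<^sup>+z. F (restrict z I) \<partial>gam)"
    by (rule nn_integral_distr[OF restrict_measurable]) (use F in simp)
  finally show ?thesis .
qed

lemma integral_config:
  fixes F :: "_ \<Rightarrow> real"
  assumes I: "finite I" and F: "F \<in> borel_measurable (config_space I)"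
  shows "(\<integral>x. gauss I x * F x \<partial>config_space I) = (\<integral>z. F (restrict z I) \<partial>gam)"
    and "integrable (config_space I) (\<lambda>x. gauss I x * F x) \<longleftrightarrow> integrable gam (\<lambda>z. F (restrict z I))"
proof -
  have p: "AE x in config_space I. 0 \<le> gauss I x" using gauss_pos by (intro AE_I2 less_imp_le)
  have "(\<integral>x. gauss I x * F x \<partial>config_space I) = (\<integral>x. F x \<partial>density (config_space I) (\<lambda>x. ennreal (gauss I x)))"
    using integral_density[OF F gauss_measurable p] by simp
  also have "\<dots> = (\<integral>x. F x \<partial>distr gam (config_space I) (\<lambda>z. restrict z I))" by (simp only: distr_restrict[OF I])
  also have "\<dots> = (\<integral>z. F (restrict z I) \<partial>gam)" by (rule integral_distr[OF restrict_measurable F])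
  finally show "(\<integral>x. gauss I x * F x \<partial>config_space I) = (\<integral>z. F (restrict z I) \<partial>gam)" .
  have "integrable (config_space I) (\<lambda>x. gauss I x * F x) \<longleftrightarrow> integrable (density (config_space I) (\<lambda>x. ennreal (gauss I x))) F"
    using integrable_density[OF F gauss_measurable p] by simp
  also have "\<dots> \<longleftrightarrow> integrable (distr gam (config_space I) (\<lambda>z. restrict z I)) F" by (simp only: distr_restrict[OF I])
  also have "\<dots> \<longleftrightarrow> integrable gam (\<lambda>z. F (restrict z I))" by (rule integrable_distr_eq[OF restrict_measurable F])
  finally show "integrable (config_space I) (\<lambda>x. gauss I x * F x) \<longleftrightarrow> integrable gam (\<lambda>z. F (restrict z I))" .
qed

text \<open>Division by the Gaussian turns \<open>ent_density\<close> into the Gaussian weight times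
  \<open>Psi\<close> of the relative density. A factor s, equal to 1 or -1, treats the positive and
  the negative part together.\<close>

lemma entropyS_gam:
  assumes f: "f \<in> borel_measurable (config_space {..<M})"
  shows "entropyS M f = enn2ereal (\<integral>\<^sup>+z. ennreal (Psi (f (restrict z {..<M}) / gauss {..<M} z)) \<partial>gam)
    - enn2ereal (\<integral>\<^sup>+z. ennreal (- Psi (f (restrict z {..<M}) / gauss {..<M} z)) \<partial>gam)"
proof -
  let ?k = "\<lambda>x. f x / gauss {..<M} x"
  have mk: "?k \<in> borel_measurable (config_space {..<M})" using f gauss_measurable by measurable
  have e: "ent_density M f x = gauss {..<M} x * Psi (?k x)" for x
    using gauss_pos[of "{..<M}" x] by (simp add: ent_density_def Psi_def)
  have 1: "(\<integral>\<^sup>+x. ennreal (s * ent_density M f x) \<partial>config_space {..<M}) = (\<integral>\<^sup>+z. ennreal (s * Psi (f (restrict z {..<M}) / gauss {..<M} z)) \<partial>gam)" for s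
  proof -
    have m: "(\<lambda>x. ennreal (s * Psi (?k x))) \<in> borel_measurable (config_space {..<M})" using mk by measurable
    have "(\<integral>\<^sup>+x. ennreal (s * ent_density M f x) \<partial>config_space {..<M})
        = (\<integral>\<^sup>+x. ennreal (gauss {..<M} x) * ennreal (s * Psi (?k x)) \<partial>config_space {..<M})"
      using gauss_pos by (intro nn_integral_cong) (simp add: e ennreal_mult'[symmetric] less_imp_le mult.left_commute)
    also have "\<dots> = (\<integral>\<^sup>+z. ennreal (s * Psi (?k (restrict z {..<M}))) \<partial>gam)"
      by (rule nn_integral_config[OF _ m]) simp
    finally show ?thesis by (simp add: gauss_restrict)
  qed
  show ?thesis unfolding entropyS_def using 1[of 1] 1[of "-1"] by simp
qed

lemma ereal_integral:
  fixes f :: "'a \<Rightarrow> real"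
  assumes f: "integrable K f"
  shows "enn2ereal (\<integral>\<^sup>+x. ennreal (f x) \<partial>K) - enn2ereal (\<integral>\<^sup>+x. ennreal (- f x) \<partial>K) = ereal (\<integral>x. f x \<partial>K)"
proof -
  have a: "(\<integral>\<^sup>+x. ennreal (f x) \<partial>K) < \<infinity>"
    using f by (simp add: real_integrable_def less_top[symmetric])
  have b: "(\<integral>\<^sup>+x. ennreal (- f x) \<partial>K) < \<infinity>" using f by (simp add: real_integrable_def less_top[symmetric])
  obtain x where x: "x \<ge> 0" "(\<integral>\<^sup>+x. ennreal (f x) \<partial>K) = ennreal x" using a by (metis ennreal_cases infinity_ennreal_def less_irrefl)
  obtain y where y: "y \<ge> 0" "(\<integral>\<^sup>+x. ennreal (- f x) \<partial>K) = ennreal y" using b by (metis ennreal_cases infinity_ennreal_def less_irrefl)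
  show ?thesis using real_lebesgue_integral_def[OF f] x y by (simp add: enn2ereal_ennreal)
qed

section \<open>The evolution of relative densities\<close>

context kac
begin

text \<open>A collision preserves |z|^2, so the Gaussian factor comes out of the average. The
  generator therefore acts on a density and on its quotient by the Gaussian in the same way.\<close>

lemma Rop_gauss:
  assumes H: "H \<in> borel_measurable gam" and p: "p \<in> PS"
  shows "Rop (fst p) (snd p) (\<lambda>z. H z * gauss {..<M+N} z) z = Rop (fst p) (snd p) H z * gauss {..<M+N} z"
proof -
  have ij: "finite {..<M+N}" "fst p \<in> {..<M+N}" "snd p \<in> {..<M+N}" "fst p \<noteq> snd p" using p by (auto simp: PS_def)
  have m: "(\<lambda>\<omega>. rmap (fst p) (snd p) \<omega> z) \<in> measurable sphere_measure gam"
    unfolding rmap_def by (rule measurable_gamI) simp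
  note mH = measurable_compose[OF m H] and mG = measurable_compose[OF m gauss_measurable_gam[of "{..<M+N}"]]
  have "Rop (fst p) (snd p) (\<lambda>z. H z * gauss {..<M+N} z) z
      = (\<integral>\<omega>. H (rmap (fst p) (snd p) \<omega> z) * gauss {..<M+N} z \<partial>sphere_measure)"
    unfolding Rop_def
  proof (rule integral_cong_AE)
    show "(\<lambda>\<omega>. H (rmap (fst p) (snd p) \<omega> z) * gauss {..<M+N} (rmap (fst p) (snd p) \<omega> z)) \<in> borel_measurable sphere_measure"
      using mH mG by measurable
    show "(\<lambda>\<omega>. H (rmap (fst p) (snd p) \<omega> z) * gauss {..<M+N} z) \<in> borel_measurable sphere_measure"
      using mH by measurable
    show "AE \<omega> in sphere_measure. H (rmap (fst p) (snd p) \<omega> z) * gauss {..<M+N} (rmap (fst p) (snd p) \<omega> z)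
        = H (rmap (fst p) (snd p) \<omega> z) * gauss {..<M+N} z"
      using AE_sphere
    proof eventually_elim
      fix \<omega> :: "real^3" assume "norm \<omega> = 1"
      then have "nsq {..<M+N} (rmap (fst p) (snd p) \<omega> z) = nsq {..<M+N} z"
        using nsq_rmap[OF ij, of \<omega> z] by (simp add: rw_def)
      then show "H (rmap (fst p) (snd p) \<omega> z) * gauss {..<M+N} (rmap (fst p) (snd p) \<omega> z)
        = H (rmap (fst p) (snd p) \<omega> z) * gauss {..<M+N} z" by (simp add: gauss_nsq)
    qed
  qed
  then show ?thesis unfolding Rop_def by simp
qed

lemma L_sum: "L H z = (\<Sum>p\<in>PS. rate p * (Rop (fst p) (snd p) H z - H z))"
  unfolding sum_PS Lgen_def by simp

lemma Ln_gauss: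
  assumes H: "integrable gam H"
  shows "(L ^^ n) (\<lambda>z. H z * gauss {..<M+N} z) = (\<lambda>z. (L ^^ n) H z * gauss {..<M+N} z)"
proof (induction n)
  case (Suc n)
  have m: "(L ^^ n) H \<in> borel_measurable gam" using Ln_L1[OF H H, of n] by auto
  have "L (\<lambda>z. (L ^^ n) H z * gauss {..<M+N} z) z = L ((L ^^ n) H) z * gauss {..<M+N} z" for z
    unfolding L_sum[of "\<lambda>z. (L ^^ n) H z * gauss {..<M+N} z" z] L_sum[of "(L ^^ n) H" z]
      sum_distrib_right[of _ _ "gauss {..<M+N} z"]
    by (rule sum.cong[OF refl]) (simp add: Rop_gauss[OF m] left_diff_distrib mult.assoc)
  then show ?case unfolding funpow.simps comp_apply Suc.IH by (rule ext)
qed simp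

lemma EP_gauss:
  assumes H: "integrable gam H"
  shows "EP t K (\<lambda>z. H z * gauss {..<M+N} z) z = EP t K H z * gauss {..<M+N} z"
  unfolding exp_partial_def Ln_gauss[OF H] sum_distrib_right[of _ _ "gauss {..<M+N} z"]
  by (simp add: mult.assoc)

text \<open>Collisions involve only the first M + N coordinates, so the two representations of a
  configuration, extensional and on all naturals, give the same values.\<close>

lemma Ln_restrict:
  assumes H: "\<And>z. H (restrict z {..<M+N}) = H z"
  shows "(L ^^ n) H (restrict z {..<M+N}) = (L ^^ n) H z"
proof (induction n arbitrary: z)
  case (Suc n)
  let ?v = "(L ^^ n) H"
  have "Rop (fst p) (snd p) ?v (restrict z {..<M+N}) = Rop (fst p) (snd p) ?v z" if p: "p \<in> PS" for p
  proof -
    have "restrict (rmap (fst p) (snd p) \<omega> (restrict z {..<M+N})) {..<M+N} = restrict (rmap (fst p) (snd p) \<omega> z) {..<M+N}" for \<omega>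
      using p by (auto simp: rmap_def PS_def fun_eq_iff)
    then have "?v (rmap (fst p) (snd p) \<omega> (restrict z {..<M+N})) = ?v (rmap (fst p) (snd p) \<omega> z)" for \<omega>
      using Suc.IH[of "rmap (fst p) (snd p) \<omega> (restrict z {..<M+N})"] Suc.IH[of "rmap (fst p) (snd p) \<omega> z"] by simp
    then show ?thesis unfolding Rop_def by simp
  qed
  then have "L ?v (restrict z {..<M+N}) = L ?v z"
    unfolding L_sum[of ?v z] L_sum[of ?v "restrict z {..<M+N}"] using Suc.IH[of z]
    by (intro sum.cong refl) (simp only:)
  then show ?case by (simp only: funpow.simps comp_apply)
qed (simp add: H)

lemma EP_restrict:
  assumes H: "\<And>z. H (restrict z {..<M+N}) = H z"
  shows "EP t K H (restrict z {..<M+N}) = EP t K H z"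
  unfolding exp_partial_def by (simp only: Ln_restrict[of H, OF H])

text \<open>The distance is estimated through the partial sums for u and for h: the distance between
  these is bounded uniformly in K by \<open>EP_L1\<close>, and the two outer distances tend to 0.
  The Poisson average is thus compared with k while being used on bounded functions only.\<close>

lemma S_L1_limit:
  assumes h: "integrable gam h" and k: "integrable gam k" and t: "t \<ge> 0"
    and lim: "(\<lambda>K. \<integral>z. \<bar>EP t K h z - k z\<bar> \<partial>gam) \<longlonglongrightarrow> 0"
    and u: "u \<in> borel_measurable gam" "\<And>z. \<bar>u z\<bar> \<le> D"
  shows "(\<integral>z. \<bar>S (Lam * t) u z - k z\<bar> \<partial>gam) \<le> exp (2 * Lam * t) * (\<integral>z. \<bar>u z - h z\<bar> \<partial>gam)"
proof (rule LIMSEQ_le_const)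
  let ?c = "exp (2 * Lam * t) * (\<integral>z. \<bar>u z - h z\<bar> \<partial>gam)"
  have s: "Lam * t \<ge> 0" using t sum_rate_pos by simp
  have iu: "integrable gam u" using u by (intro GP.P.integrable_const_bound[of _ D] AE_I2) auto
  have iS: "integrable gam (S (Lam * t) u)"
    using S_bounded_measurable[OF u s] by (intro GP.P.integrable_const_bound[of _ D] AE_I2) auto
  have "(\<lambda>K. (\<integral>z. \<bar>EP t K u z - S (Lam * t) u z\<bar> \<partial>gam) + ?c + (\<integral>z. \<bar>EP t K h z - k z\<bar> \<partial>gam)) \<longlonglongrightarrow> 0 + ?c + 0"
    by (intro tendsto_add EP_tendsto_S[OF u t] tendsto_const lim)
  then show "(\<lambda>K. (\<integral>z. \<bar>EP t K u z - S (Lam * t) u z\<bar> \<partial>gam) + ?c + (\<integral>z. \<bar>EP t K h z - k z\<bar> \<partial>gam)) \<longlonglongrightarrow> ?c"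
    by simp
  have "(\<integral>z. \<bar>S (Lam * t) u z - k z\<bar> \<partial>gam)
      \<le> (\<integral>z. \<bar>EP t K u z - S (Lam * t) u z\<bar> \<partial>gam) + ?c + (\<integral>z. \<bar>EP t K h z - k z\<bar> \<partial>gam)" for K
  proof -
    have i1: "integrable gam (\<lambda>z. \<bar>S (Lam * t) u z - k z\<bar>)"
      by (rule integrable_abs[OF Bochner_Integration.integrable_diff[OF iS k]])
    have i2: "integrable gam (\<lambda>z. \<bar>EP t K u z - S (Lam * t) u z\<bar>)"
      by (rule integrable_abs[OF Bochner_Integration.integrable_diff[OF EP_integrable[OF iu] iS]])
    have i3: "integrable gam (\<lambda>z. \<bar>EP t K u z - EP t K h z\<bar>)"
      by (rule integrable_abs[OF Bochner_Integration.integrable_diff[OF EP_integrable[OF iu] EP_integrable[OF h]]])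
    have i4: "integrable gam (\<lambda>z. \<bar>EP t K h z - k z\<bar>)"
      by (rule integrable_abs[OF Bochner_Integration.integrable_diff[OF EP_integrable[OF h] k]])
    have "(\<integral>z. \<bar>S (Lam * t) u z - k z\<bar> \<partial>gam)
        \<le> (\<integral>z. (\<bar>EP t K u z - S (Lam * t) u z\<bar> + \<bar>EP t K u z - EP t K h z\<bar>) + \<bar>EP t K h z - k z\<bar> \<partial>gam)"
      by (rule integral_mono[OF i1 Bochner_Integration.integrable_add[OF Bochner_Integration.integrable_add[OF i2 i3] i4]])
         linarith
    also have "\<dots> = (\<integral>z. \<bar>EP t K u z - S (Lam * t) u z\<bar> \<partial>gam) + (\<integral>z. \<bar>EP t K u z - EP t K h z\<bar> \<partial>gam) + (\<integral>z. \<bar>EP t K h z - k z\<bar> \<partial>gam)"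
      unfolding Bochner_Integration.integral_add[OF Bochner_Integration.integrable_add[OF i2 i3] i4]
        Bochner_Integration.integral_add[OF i2 i3] ..
    finally show ?thesis using EP_L1[OF iu h t, of K] by linarith
  qed
  then show "\<exists>n0. \<forall>K\<ge>n0. (\<integral>z. \<bar>S (Lam * t) u z - k z\<bar> \<partial>gam)
      \<le> (\<integral>z. \<bar>EP t K u z - S (Lam * t) u z\<bar> \<partial>gam) + ?c + (\<integral>z. \<bar>EP t K h z - k z\<bar> \<partial>gam)" by blast
qed

text \<open>Passage from nice initial data to general ones by lower semicontinuity of the entropy.\<close>

lemma entropy_limit:
  assumes hr: "\<And>z. h z = h' (restrict z {..<M})"
    and mh': "h' \<in> borel_measurable (PiM {..<M} (\<lambda>_. borel :: (real^3) measure))"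
    and h0: "\<And>z. 0 \<le> h z" and ih: "integrable gam h" and h1: "(\<integral>z. h z \<partial>gam) = 1"
    and iP: "integrable gam (\<lambda>z. Psi (h z))" and k: "integrable gam k" and t: "t \<ge> 0"
    and lim: "(\<lambda>K. \<integral>z. \<bar>EP t K h z - k z\<bar> \<partial>gam) \<longlonglongrightarrow> 0"
  shows "integrable gam (\<lambda>z. Psi (Eop M k z))" "(\<integral>z. Psi (Eop M k z) \<partial>gam) \<le> decay t * Ent h"
proof -
  have s: "Lam * t \<ge> 0" using t sum_rate_pos by simp
  obtain u where u: "\<And>j. \<exists>A B C X. A > 0 \<and> nice {..<M} A B C (u j) X" "\<And>j. (\<integral>z. u j z \<partial>gam) = 1"
    "(\<lambda>j. \<integral>z. \<bar>u j z - h z\<bar> \<partial>gam) \<longlonglongrightarrow> 0" "(\<lambda>j. Ent (u j)) \<longlonglongrightarrow> Ent h"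
    using nice_density_sequence[OF finite_lessThan hr mh' h0 ih h1 iP] by blast
  have U: "\<exists>A D. A > 0 \<and> u j \<in> borel_measurable gam \<and> (\<forall>z. \<bar>u j z\<bar> \<le> D) \<and> 0 \<le> Ent (u j) \<and>
      integrable gam (Top t (u j)) \<and> (\<forall>z. A \<le> Top t (u j) z) \<and> integrable gam (\<lambda>z. Psi (Top t (u j) z)) \<and>
      Ent (Top t (u j)) \<le> decay t * Ent (u j)" for j
  proof -
    obtain A B C X where A: "A > 0" and n: "nice {..<M} A B C (u j) X" using u(1)[of j] by blast
    obtain Y where Y: "nice {..<M+N} A B C (Top t (u j)) Y" using Top_fisher[OF n A t] by blast
    have "integrable gam (\<lambda>z. Psi (Top t (u j) z))"
      by (rule GP.P.integrable_const_bound[OF AE_I2])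
         (use abs_Psi_le[OF A niceD(5)[OF Y] niceD(6)[OF Y]]
              measurable_compose[OF niceD(3)[OF Y] Psi_measurable] in auto)
    then show ?thesis
      using A niceD(3)[OF n] nice_bounded[OF n] Ent_nonneg[OF n A u(2)] nice_integrable[OF Y] niceD(5)[OF Y]
        Top_entropy[OF n A t u(2)] by blast
  qed
  have iTop: "integrable gam (Top t (u j))" for j using U[of j] by blast
  have mTop: "Top t (u j) \<in> borel_measurable gam" for j using iTop by auto
  have iE: "integrable gam (Eop M k)" by (rule Eop_L1(1)[OF k k])
  have d: "(\<integral>z. \<bar>Top t (u j) z - Eop M k z\<bar> \<partial>gam) \<le> exp (2 * Lam * t) * (\<integral>z. \<bar>u j z - h z\<bar> \<partial>gam)" for j
  proof -
    obtain D where D: "u j \<in> borel_measurable gam" "\<And>z. \<bar>u j z\<bar> \<le> D" using U[of j] by blast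
    have iS: "integrable gam (S (Lam * t) (u j))"
      using S_bounded_measurable[OF D s] by (intro GP.P.integrable_const_bound[of _ D] AE_I2) auto
    show ?thesis unfolding Top_def
      by (rule order_trans[OF Eop_L1(2)[OF iS k] S_L1_limit[OF ih k t lim D]])
  qed
  have dl: "(\<lambda>j. \<integral>z. norm (Top t (u j) z - Eop M k z) \<partial>gam) \<longlonglongrightarrow> 0"
  proof (rule Lim_null_comparison)
    show "\<forall>\<^sub>F j in sequentially. norm (\<integral>z. norm (Top t (u j) z - Eop M k z) \<partial>gam) \<le> exp (2 * Lam * t) * (\<integral>z. \<bar>u j z - h z\<bar> \<partial>gam)"
      using d by (intro always_eventually allI) simp
    show "(\<lambda>j. exp (2 * Lam * t) * (\<integral>z. \<bar>u j z - h z\<bar> \<partial>gam)) \<longlonglongrightarrow> 0"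
      using tendsto_mult[OF tendsto_const u(3), of "exp (2 * Lam * t)"] by simp
  qed
  \<comment> \<open>Convergence in L1 yields convergence almost everywhere along a subsequence,
    which is enough since the entropies of u converge along the whole sequence.\<close>
  have "\<exists>r. strict_mono r \<and> (AE z in gam. (\<lambda>n. Top t (u (r n)) z - Eop M k z) \<longlonglongrightarrow> 0)"
    by (rule tendsto_L1_AE_subseq[OF _ dl]) (rule Bochner_Integration.integrable_diff[OF iTop iE])
  then obtain r where r: "strict_mono r" "AE z in gam. (\<lambda>n. Top t (u (r n)) z - Eop M k z) \<longlonglongrightarrow> 0" by blast
  have AEl: "AE z in gam. (\<lambda>n. Top t (u (r n)) z) \<longlonglongrightarrow> Eop M k z \<and> 0 \<le> Eop M k z"
    using r(2)
  proof eventually_elim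
    case (elim z)
    have l: "(\<lambda>n. Top t (u (r n)) z) \<longlonglongrightarrow> Eop M k z"
      using tendsto_add[OF elim tendsto_const[of "Eop M k z"]] by simp
    moreover have "0 \<le> Top t (u (r n)) z" for n using U[of "r n"] by (meson less_imp_le order_trans)
    ultimately show ?case using LIMSEQ_le_const[OF l, of 0] by blast
  qed
  \<comment> \<open>The shift by 1 makes the integrand nonnegative, as Psi x \<ge> x - 1 \<ge> - 1
    for x \<ge> 0, so that Fatou's lemma applies.\<close>
  let ?f = "\<lambda>n z. ennreal (Psi (Top t (u (r n)) z) + 1)"
  let ?b = "decay t * Ent h + 1"
  have Enh: "0 \<le> Ent h" by (rule LIMSEQ_le_const[OF u(4)]) (use U in blast)
  have b0: "?b \<ge> 0" using Enh decay_pos[of t] by simp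
  have fn: "(\<integral>\<^sup>+z. ?f n z \<partial>gam) \<le> ennreal (decay t * Ent (u (r n)) + 1)" for n
  proof -
    obtain A where A: "A > 0" "\<And>z. A \<le> Top t (u (r n)) z" and i: "integrable gam (\<lambda>z. Psi (Top t (u (r n)) z))"
      and e: "Ent (Top t (u (r n))) \<le> decay t * Ent (u (r n))" using U[of "r n"] by blast
    have p: "0 \<le> Psi (Top t (u (r n)) z) + 1" for z
    proof -
      have "0 \<le> Top t (u (r n)) z" using A(1) A(2)[of z] by linarith
      from Psi_nonneg_lower[OF this] show ?thesis using \<open>0 \<le> Top t (u (r n)) z\<close> by linarith
    qed
    have i1: "integrable gam (\<lambda>z. Psi (Top t (u (r n)) z) + 1)" using i by simp
    have "(\<integral>\<^sup>+z. ?f n z \<partial>gam) = ennreal (\<integral>z. Psi (Top t (u (r n)) z) + 1 \<partial>gam)"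
      by (rule nn_integral_eq_integral[OF i1]) (use p in auto)
    also have "(\<integral>z. Psi (Top t (u (r n)) z) + 1 \<partial>gam) = Ent (Top t (u (r n))) + 1"
      unfolding Ent_def using i GP.P.prob_space by simp
    finally show ?thesis using e by (simp add: ennreal_leI)
  qed
  have mE: "Eop M k \<in> borel_measurable gam" using iE by auto
  have "(\<integral>\<^sup>+z. ennreal (Psi (Eop M k z) + 1) \<partial>gam) = (\<integral>\<^sup>+z. liminf (\<lambda>n. ?f n z) \<partial>gam)"
  proof (rule nn_integral_cong_AE)
    show "AE z in gam. ennreal (Psi (Eop M k z) + 1) = liminf (\<lambda>n. ?f n z)"
      using AEl
    proof eventually_elim
      case (elim z)
      have "eventually (\<lambda>n. 0 \<le> Top t (u (r n)) z) sequentially"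
      proof (intro always_eventually allI)
        fix n show "0 \<le> Top t (u (r n)) z" using U[of "r n"] by (meson less_imp_le order_trans)
      qed
      then have "(\<lambda>n. Psi (Top t (u (r n)) z)) \<longlonglongrightarrow> Psi (Eop M k z)" using elim by (intro Psi_tendsto) auto
      then have "(\<lambda>n. ?f n z) \<longlonglongrightarrow> ennreal (Psi (Eop M k z) + 1)" by (intro tendsto_ennrealI tendsto_add tendsto_const)
      from lim_imp_Liminf[OF _ this] show ?case by simp
    qed
  qed
  also have "\<dots> \<le> liminf (\<lambda>n. \<integral>\<^sup>+z. ?f n z \<partial>gam)"
  proof (rule nn_integral_liminf)
    fix n
    have "(\<lambda>z. Psi (Top t (u (r n)) z)) \<in> borel_measurable gam" by (rule measurable_compose[OF mTop Psi_measurable])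
    then show "?f n \<in> borel_measurable gam" by measurable
  qed
  also have "\<dots> \<le> liminf (\<lambda>n. ennreal (decay t * Ent (u (r n)) + 1))"
    by (rule Liminf_mono) (use fn in auto)
  also have "\<dots> = ennreal ?b"
  proof (rule lim_imp_Liminf)
    have "(\<lambda>n. Ent (u (r n))) \<longlonglongrightarrow> Ent h" using LIMSEQ_subseq_LIMSEQ[OF u(4) r(1)] by (simp add: comp_def)
    then show "(\<lambda>n. ennreal (decay t * Ent (u (r n)) + 1)) \<longlonglongrightarrow> ennreal ?b"
      by (intro tendsto_ennrealI tendsto_add tendsto_mult tendsto_const)
  qed simp
  finally have le: "(\<integral>\<^sup>+z. ennreal (Psi (Eop M k z) + 1) \<partial>gam) \<le> ennreal ?b" .
  have p1: "AE z in gam. 0 \<le> Psi (Eop M k z) + 1"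
    using AEl
  proof eventually_elim
    case (elim z) then show ?case using Psi_nonneg_lower[of "Eop M k z"] by linarith
  qed
  have m1: "(\<lambda>z. Psi (Eop M k z) + 1) \<in> borel_measurable gam" using measurable_compose[OF mE Psi_measurable] by measurable
  have i1: "integrable gam (\<lambda>z. Psi (Eop M k z) + 1)"
    by (rule integrableI_nonneg[OF m1 p1]) (use le in \<open>simp add: le_less_trans\<close>)
  from Bochner_Integration.integrable_diff[OF this GP.P.integrable_const[of 1]]
  show iPE: "integrable gam (\<lambda>z. Psi (Eop M k z))" by simp
  have "ennreal (\<integral>z. Psi (Eop M k z) + 1 \<partial>gam) \<le> ennreal ?b"
    using nn_integral_eq_integral[OF i1 p1] le by simp
  then have "(\<integral>z. Psi (Eop M k z) + 1 \<partial>gam) \<le> ?b" using b0 by (simp add: ennreal_le_iff)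
  then show "(\<integral>z. Psi (Eop M k z) \<partial>gam) \<le> decay t * Ent h" using iPE GP.P.prob_space by simp
qed

end

section \<open>Marginals and the final estimate\<close>

lemma gauss_un:
  assumes "finite I" "finite I'" "I \<inter> I' = {}"
  shows "gauss (I \<union> I') z = gauss I z * gauss I' z"
  using assms by (simp add: gauss_def sum.union_disjoint exp_add[symmetric] distrib_left)

lemma gauss_split: "gauss {..<M+N} z = gauss {..<M} z * gauss {M..<M+N} z"
proof -
  have "{..<M+N} = {..<M} \<union> {M..<M+N}" "{..<M} \<inter> {M..<M+N} = {}" by auto
  then show ?thesis using gauss_un[of "{..<M}" "{M..<M+N}" z] by simp
qed

lemma restrict_splice:
  fixes M N :: nat
  shows "restrict (\<lambda>i. if i < M then z i else w i) {..<M+N}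
    = merge {..<M} {M..<M+N} (restrict z {..<M}, restrict w {M..<M+N})"
  by (rule ext) (auto simp: merge_def)

lemma merge_config_measurable:
  "merge {..<M} {M..<M+N} \<in> measurable (config_space {..<M} \<Otimes>\<^sub>M config_space {M..<M+N}) (config_space {..<M+N})"
proof -
  have "{..<M} \<union> {M..<M+N} = {..<M+N}" by auto
  then show ?thesis unfolding config_space_def
    using measurable_merge[of "{..<M}" "{M..<M+N}" "\<lambda>_. lborel :: (real^3) measure"] by simp
qed

lemma marginal_measurable:
  fixes g :: "_ \<Rightarrow> real"
  assumes g: "g \<in> borel_measurable (config_space {..<M+N})"
  shows "(\<lambda>v. \<integral>w. g (merge {..<M} {M..<M+N} (v, w)) \<partial>config_space {M..<M+N}) \<in> borel_measurable (config_space {..<M})"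
proof -
  have sf: "sigma_finite_measure (config_space {M..<M+N})"
    unfolding config_space_def by (rule LB.sigma_finite) simp
  have "(\<lambda>x. g (merge {..<M} {M..<M+N} x)) \<in> borel_measurable (config_space {..<M} \<Otimes>\<^sub>M config_space {M..<M+N})"
    by (rule measurable_compose[OF merge_config_measurable g])
  then show ?thesis
    by (rule sigma_finite_measure.borel_measurable_lebesgue_integral[OF sf, where f="\<lambda>v w. g (merge {..<M} {M..<M+N} (v, w))", unfolded case_prod_unfold prod.collapse])
qed

text \<open>The Gaussian of all particles is the product of those of system and reservoir: the first
  factor comes out of the reservoir integral, and the second turns Lebesgue measure on the reservoir
  into \<open>gam\<close>.\<close>

lemma marginal_eq_Eop:
  assumes g: "g \<in> borel_measurable (config_space {..<M+N})"
  shows "(\<integral>w. g (merge {..<M} {M..<M+N} (restrict z {..<M}, w)) \<partial>config_space {M..<M+N}) / gauss {..<M} z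
    = Eop M (\<lambda>z. g (restrict z {..<M+N}) / gauss {..<M+N} z) z"
proof -
  let ?W = "{M..<M+N}" and ?V = "{..<M}"
  let ?F = "\<lambda>x. g (merge ?V ?W (restrict z ?V, x)) / gauss ?W x"
  have sp: "restrict z ?V \<in> space (config_space ?V)" by (simp add: space_config)
  have m: "(\<lambda>x. g (merge ?V ?W (restrict z ?V, x))) \<in> borel_measurable (config_space ?W)"
    by (rule measurable_compose[OF measurable_compose[OF measurable_Pair1'[OF sp] merge_config_measurable] g])
  have F: "?F \<in> borel_measurable (config_space ?W)" using m gauss_measurable by (rule borel_measurable_divide)
  have s: "gauss {..<M+N} (\<lambda>i. if i < M then z i else w i) = gauss ?V z * gauss ?W w" for w
    unfolding gauss_split by (simp add: gauss_def)
  have "Eop M (\<lambda>z. g (restrict z {..<M+N}) / gauss {..<M+N} z) z = (\<integral>w. ?F (restrict w ?W) / gauss ?V z \<partial>gam)"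
    unfolding Eop_def s restrict_splice by (simp add: gauss_restrict mult.commute)
  also have "\<dots> = (\<integral>w. ?F (restrict w ?W) \<partial>gam) / gauss ?V z" by (rule integral_divide_zero)
  also have "(\<integral>w. ?F (restrict w ?W) \<partial>gam) = (\<integral>x. gauss ?W x * ?F x \<partial>config_space ?W)"
    by (rule integral_config(1)[OF _ F, symmetric]) simp
  also have "\<dots> = (\<integral>x. g (merge ?V ?W (restrict z ?V, x)) \<partial>config_space ?W)"
    using gauss_pos[of ?W] by (intro Bochner_Integration.integral_cong refl) (simp add: less_imp_neq[symmetric])
  finally show ?thesis ..
qed

context kac
begin

text \<open>The Gaussian factor commutes with the partial sums and is the density that links
  \<open>config_space\<close> to \<open>gam\<close>, so the given L1 limit for densities becomes one
  for relative densities.\<close>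

lemma exp_L_limit:
  assumes h: "integrable gam h" and hr: "\<And>z. h (restrict z {..<M+N}) = h z"
    and g: "is_exp_L M N lS lR mu t (\<lambda>z. h z * gauss {..<M+N} z) g"
  defines "k \<equiv> \<lambda>z. g (restrict z {..<M+N}) / gauss {..<M+N} z"
  shows "integrable gam k" "(\<lambda>K. \<integral>z. \<bar>EP t K h z - k z\<bar> \<partial>gam) \<longlonglongrightarrow> 0"
proof -
  let ?Z = "{..<M+N}"
  let ?q = "\<lambda>x. g x / gauss ?Z x"
  have gi: "integrable (config_space ?Z) g"
    and gl: "(\<lambda>K. \<integral>\<^sup>+ z. ennreal \<bar>EP t K (\<lambda>z. h z * gauss ?Z z) z - g z\<bar> \<partial>config_space ?Z) \<longlonglongrightarrow> 0"
    using g by (auto simp: is_exp_L_def)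
  have mg: "g \<in> borel_measurable (config_space ?Z)" using gi by auto
  have mq: "?q \<in> borel_measurable (config_space ?Z)" using mg gauss_measurable by (rule borel_measurable_divide)
  have gq: "gauss ?Z x * ?q x = g x" for x using gauss_pos[of ?Z x] by simp
  have kq: "k = (\<lambda>z. ?q (restrict z ?Z))" by (simp add: k_def gauss_restrict)
  have "integrable (config_space ?Z) (\<lambda>x. gauss ?Z x * ?q x)" unfolding gq by (rule gi)
  then show k: "integrable gam k" unfolding kq using integral_config(2)[OF _ mq] by simp
  have e: "(\<integral>\<^sup>+ z. ennreal \<bar>EP t K (\<lambda>z. h z * gauss ?Z z) z - g z\<bar> \<partial>config_space ?Z) = ennreal (\<integral>z. \<bar>EP t K h z - k z\<bar> \<partial>gam)" for K
  proof -
    have mE: "EP t K h \<in> borel_measurable (config_space ?Z)"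
      by (rule measurable_compose[OF incl_measurable borel_measurable_integrable[OF EP_integrable[OF h]]])
    have mF: "(\<lambda>x. ennreal \<bar>EP t K h x - ?q x\<bar>) \<in> borel_measurable (config_space ?Z)"
      using borel_measurable_diff[OF mE mq] by measurable
    have "ennreal \<bar>EP t K (\<lambda>z. h z * gauss ?Z z) z - g z\<bar> = ennreal (gauss ?Z z) * ennreal \<bar>EP t K h z - ?q z\<bar>" for z
    proof -
      have "EP t K (\<lambda>z. h z * gauss ?Z z) z - g z = gauss ?Z z * (EP t K h z - ?q z)"
        unfolding EP_gauss[OF h] right_diff_distrib gq by (simp only: mult.commute)
      then show ?thesis using gauss_pos[of ?Z z] by (simp add: abs_mult ennreal_mult')
    qed
    then have "(\<integral>\<^sup>+ z. ennreal \<bar>EP t K (\<lambda>z. h z * gauss ?Z z) z - g z\<bar> \<partial>config_space ?Z)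
        = (\<integral>\<^sup>+z. ennreal (gauss ?Z z) * ennreal \<bar>EP t K h z - ?q z\<bar> \<partial>config_space ?Z)" by simp
    also have "\<dots> = (\<integral>\<^sup>+z. ennreal \<bar>EP t K h (restrict z ?Z) - ?q (restrict z ?Z)\<bar> \<partial>gam)"
      by (rule nn_integral_config[OF _ mF]) simp
    also have "\<dots> = (\<integral>\<^sup>+z. ennreal \<bar>EP t K h z - k z\<bar> \<partial>gam)"
      unfolding EP_restrict[of h, OF hr] kq ..
    also have "\<dots> = ennreal (\<integral>z. \<bar>EP t K h z - k z\<bar> \<partial>gam)"
      by (rule nn_integral_eq_integral[OF integrable_abs[OF Bochner_Integration.integrable_diff[OF EP_integrable[OF h] k]]]) simp
    finally show ?thesis .
  qed
  show "(\<lambda>K. \<integral>z. \<bar>EP t K h z - k z\<bar> \<partial>gam) \<longlonglongrightarrow> 0"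
  proof (rule iffD1[OF ennreal_tendsto_0_iff])
    show "(\<lambda>K. ennreal (\<integral>z. \<bar>EP t K h z - k z\<bar> \<partial>gam)) \<longlonglongrightarrow> 0" using gl unfolding e .
  qed simp
qed

lemma entropy_decay:
  assumes mf: "f0 \<in> borel_measurable (config_space {..<M})" and f0: "\<And>v. 0 \<le> f0 v"
    and f1: "(\<integral>\<^sup>+ v. ennreal (f0 v) \<partial>config_space {..<M}) = 1" and t: "t \<ge> 0"
    and g: "is_exp_L M N lS lR mu t (\<lambda>z. f0 (restrict z {..<M}) * gauss {M..<M+N} z) g"
  shows "entropyS M (\<lambda>v. \<integral>w. g (merge {..<M} {M..<M+N} (v, w)) \<partial>config_space {M..<M+N})
    \<le> ereal (decay t) * entropyS M f0"
proof -
  let ?V = "{..<M}" and ?W = "{M..<M+N}" and ?Z = "{..<M+N}"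
  define h' where "h' x = f0 x / gauss ?V x" for x
  define h where "h z = f0 (restrict z ?V) / gauss ?V z" for z
  define k where "k = (\<lambda>z. g (restrict z ?Z) / gauss ?Z z)"
  have hr: "h z = h' (restrict z ?V)" for z by (simp add: h_def h'_def gauss_restrict)
  have mh0: "h' \<in> borel_measurable (config_space ?V)"
    unfolding h'_def[abs_def] using mf gauss_measurable by (rule borel_measurable_divide)
  then have mh': "h' \<in> borel_measurable (PiM ?V (\<lambda>_. borel :: (real^3) measure))"
    by (simp only: measurable_cong_sets[OF sets_config refl])
  have mh: "h \<in> borel_measurable gam"
    unfolding hr[abs_def] by (rule measurable_compose[OF restrict_measurable mh0])
  have h0: "0 \<le> h z" for z using f0[of "restrict z ?V"] gauss_pos[of ?V z] by (simp add: h_def)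
  have "(\<integral>\<^sup>+z. ennreal (h z) \<partial>gam) = (\<integral>\<^sup>+x. ennreal (gauss ?V x) * ennreal (h' x) \<partial>config_space ?V)"
    unfolding hr by (rule nn_integral_config[symmetric]) (use mh0 in simp_all)
  also have "\<dots> = (\<integral>\<^sup>+ v. ennreal (f0 v) \<partial>config_space ?V)"
  proof (rule nn_integral_cong)
    fix x
    have "gauss ?V x * h' x = f0 x" using gauss_pos[of ?V x] by (simp add: h'_def)
    then show "ennreal (gauss ?V x) * ennreal (h' x) = ennreal (f0 x)"
      using gauss_pos[of ?V x] by (simp add: ennreal_mult'[symmetric])
  qed
  finally have nh: "(\<integral>\<^sup>+z. ennreal (h z) \<partial>gam) = 1" by (simp only: f1)
  have ih: "integrable gam h" by (rule integrableI_nonneg[OF mh AE_I2[OF h0]]) (simp add: nh)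
  have h1: "(\<integral>z. h z \<partial>gam) = 1"
    by (subst integral_eq_nn_integral[OF mh AE_I2[OF h0]]) (simp add: nh)
  have F0: "(\<lambda>z. f0 (restrict z ?V) * gauss ?W z) = (\<lambda>z. h z * gauss ?Z z)"
  proof
    fix z show "f0 (restrict z ?V) * gauss ?W z = h z * gauss ?Z z"
      unfolding gauss_split using gauss_pos[of ?V z] by (simp add: h_def)
  qed
  have hZ: "h (restrict z ?Z) = h z" for z
  proof -
    have "restrict (restrict z ?Z) ?V = restrict z ?V" by (auto simp: fun_eq_iff)
    then show ?thesis by (simp only: hr)
  qed
  have k: "integrable gam k" and kl: "(\<lambda>K. \<integral>z. \<bar>EP t K h z - k z\<bar> \<partial>gam) \<longlonglongrightarrow> 0"
    using exp_L_limit[OF ih hZ g[unfolded F0]] unfolding k_def .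
  have mg: "g \<in> borel_measurable (config_space ?Z)" using g unfolding is_exp_L_def by (auto dest: borel_measurable_integrable)
  let ?f = "\<lambda>v. \<integral>w. g (merge ?V ?W (v, w)) \<partial>config_space ?W"
  have Sf: "entropyS M ?f = enn2ereal (\<integral>\<^sup>+z. ennreal (Psi (Eop M k z)) \<partial>gam) - enn2ereal (\<integral>\<^sup>+z. ennreal (- Psi (Eop M k z)) \<partial>gam)"
    unfolding entropyS_gam[OF marginal_measurable[OF mg]] marginal_eq_Eop[OF mg] k_def ..
  have S0: "entropyS M f0 = enn2ereal (\<integral>\<^sup>+z. ennreal (Psi (h z)) \<partial>gam) - enn2ereal (\<integral>\<^sup>+z. ennreal (- Psi (h z)) \<partial>gam)"
    unfolding entropyS_gam[OF mf] h_def ..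
  show ?thesis
  proof (cases "integrable gam (\<lambda>z. Psi (h z))")
    case True
    note l = entropy_limit[OF hr mh' h0 ih h1 True k t kl]
    show ?thesis unfolding Sf S0 ereal_integral[OF l(1)] ereal_integral[OF True] using l(2) by (simp add: Ent_def)
  next
    \<comment> \<open>The negative part of \<open>Psi (h z)\<close> is at most 1, so failure of
      integrability means that the positive part has infinite integral. The initial entropy is then
      infinite, and so is the right side, because the factor is positive.\<close>
    case False
    have m: "(\<lambda>z. Psi (h z)) \<in> borel_measurable gam" by (rule measurable_compose[OF mh Psi_measurable])
    have "(\<integral>\<^sup>+z. ennreal (- Psi (h z)) \<partial>gam) \<le> (\<integral>\<^sup>+z. 1 \<partial>gam)"
    proof (rule nn_integral_mono)
      fix z have "- Psi (h z) \<le> 1" using Psi_nonneg_lower[OF h0[of z]] h0[of z] by linarith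
      then show "ennreal (- Psi (h z)) \<le> 1" using ennreal_leI by fastforce
    qed
    also have "\<dots> = 1" by (simp only: nn_integral_const GP.P.emeasure_space_1 mult_1)
    finally have n: "(\<integral>\<^sup>+z. ennreal (- Psi (h z)) \<partial>gam) \<le> 1" .
    then have n': "(\<integral>\<^sup>+z. ennreal (- Psi (h z)) \<partial>gam) \<noteq> \<infinity>" by (auto simp: top_unique)
    then have p: "(\<integral>\<^sup>+z. ennreal (Psi (h z)) \<partial>gam) = \<infinity>" using False m by (auto simp: real_integrable_def)
    have "entropyS M f0 = \<infinity>" unfolding S0 p using n by (cases "\<integral>\<^sup>+z. ennreal (- Psi (h z)) \<partial>gam") (auto simp: top_unique)
    then show ?thesis using decay_pos[of t] by simp
  qed
qed

end

theorem theorem7p1: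
  fixes M N :: nat and lS lR mu :: real
    and f0 :: "(nat \<Rightarrow> real^3) \<Rightarrow> real"
    and G :: "real \<Rightarrow> (nat \<Rightarrow> real^3) \<Rightarrow> real"
  assumes "M \<ge> 1" and "N \<ge> M"
    and "lS > 0" and "lR > 0" and "mu > 0"
    and "f0 \<in> borel_measurable (config_space {..<M})"
    and "\<And>v. f0 v \<ge> 0"
    and "(\<integral>\<^sup>+ v. ennreal (f0 v) \<partial>config_space {..<M}) = 1"
    and "\<And>t. t \<ge> 0 \<Longrightarrow> is_exp_L M N lS lR mu t
            (\<lambda>z. f0 (restrict z {..<M}) * gauss {M..<M+N} z) (G t)"
  shows "\<forall>t\<ge>0.
    entropyS M (\<lambda>v. \<integral>w. G t (merge {..<M} {M..<M+N} (v, w)) \<partial>config_space {M..<M+N})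
    \<le> ereal (real M / real (N + M) + real N / real (N + M) * exp (- mu / 3 * (real (N + M) / real N) * t))
       * entropyS M f0"
proof -
  interpret kac M N lS lR mu using assms(1-5) by unfold_locales auto
  show ?thesis
    using entropy_decay[OF assms(6,7,8) _ assms(9)] by (simp only: decay_def) blast
qed

end
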